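(* Consider the planar system $$\begin{aligned}\frac{dx}{dt}&=-\delta_0\sigma^8x-\sigma^6y+\tfrac12(5a_{50}+b_{41}+4\delta_1+8\delta_2)\sigma^2xy^2-2y^3+x^2(a_{50}x^3+a_{22}y^2),\\ \frac{dy}{dt}&=\sigma^8x-\delta_0\sigma^8y-\tfrac12(5a_{50}+b_{41}-4\delta_1+8\delta_2)\sigma^4x^2y+3x^5+xy(b_{41}x^3+b_{13}y^2),\end{aligned}$$ where $\delta_0,\delta_1,\delta_2,\sigma$ are small real parameters and $$b_{41}=1,\quad a_{50}=-\tfrac15(1-\varepsilon_1),\quad a_{22}=\tfrac1{35}(5+7\varepsilon_2),\quad b_{13}=\tfrac5{21}.$$ When $$0<|\sigma|\ll1,\qquad 0<\delta_0\ll\delta_1\ll\delta_2\ll\varepsilon_1\ll\varepsilon_2\ll1,$$ there exist five limit cycles of the system in a neighborhood of the origin.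
   Context: A limit cycle is an isolated periodic orbit. The notation $0<c_1\ll c_2\ll\cdots\ll c_n\ll1$ means: $c_n>0$ is sufficiently small, then $c_{n-1}>0$ is sufficiently small depending on $c_n$, and so on down to $c_1$. The condition $0<|\sigma|\ll1$ means that $\sigma\ne0$ and $|\sigma|$ is sufficiently small (given the other parameters). The limit cycles lie in any prescribed neighborhood of the origin once the parameters are chosen small enough in this sense. *)

theory Defs
  imports "HOL-Analysis.Analysis"
begin

text \<open>The trajectory is a solution on the whole time line; it is required to be
  non-constant, so that equilibria do not count as periodic orbits.\<close>

definition periodic_orbit :: "('a::real_normed_vector \<Rightarrow> 'a) \<Rightarrow> 'a set \<Rightarrow> bool" where
  "periodic_orbit f \<Gamma> \<longleftrightarrow>
     (\<exists>\<phi> T. (\<forall>t::real. (\<phi> has_vector_derivative f (\<phi> t)) (at t)) \<and>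
            T > 0 \<and> (\<forall>t. \<phi> (t + T) = \<phi> t) \<and>
            (\<exists>t. \<phi> t \<noteq> \<phi> 0) \<and> \<Gamma> = range \<phi>)"

text \<open>Isolated means that no trajectory through a point near \<open>\<Gamma>\<close> is a periodic orbit,
  except \<open>\<Gamma>\<close> itself: another periodic orbit must avoid the neighbourhood \<open>V\<close>,
  rather than merely not be contained in it.\<close>

definition limit_cycle :: "('a::real_normed_vector \<Rightarrow> 'a) \<Rightarrow> 'a set \<Rightarrow> bool" where
  "limit_cycle f \<Gamma> \<longleftrightarrow>
     periodic_orbit f \<Gamma> \<and>
     (\<exists>V. open V \<and> \<Gamma> \<subseteq> V \<and>
          (\<forall>\<Gamma>'. periodic_orbit f \<Gamma>' \<and> \<Gamma>' \<inter> V \<noteq> {} \<longrightarrow> \<Gamma>' = \<Gamma>))"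

definition planar_field ::
  "real \<Rightarrow> real \<Rightarrow> real \<Rightarrow> real \<Rightarrow> real \<Rightarrow> real \<Rightarrow> real \<Rightarrow> real \<Rightarrow> real \<times> real \<Rightarrow> real \<times> real" where
  "planar_field a50 a22 b41 b13 \<delta>0 \<delta>1 \<delta>2 \<sigma> = (\<lambda>(x, y).
     (- \<delta>0 * \<sigma>^8 * x - \<sigma>^6 * y
        + 1/2 * (5 * a50 + b41 + 4 * \<delta>1 + 8 * \<delta>2) * \<sigma>^2 * x * y^2
        - 2 * y^3 + x^2 * (a50 * x^3 + a22 * y^2),
      \<sigma>^8 * x - \<delta>0 * \<sigma>^8 * y
        - 1/2 * (5 * a50 + b41 - 4 * \<delta>1 + 8 * \<delta>2) * \<sigma>^4 * x^2 * y
        + 3 * x^5 + x * y * (b41 * x^3 + b13 * y^2)))"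

end

theory Submission
  imports Defs "HOL-Complex_Analysis.Complex_Analysis"
begin

text \<open>
  In generalized polar coordinates \<open>x = \<rho>\<^sup>2 C(\<theta>)\<close>, \<open>y = \<rho>\<^sup>3 S(\<theta>)\<close> with \<open>C\<^sup>6 + S\<^sup>4 = 1\<close> the system becomes a scalar
  periodic equation \<open>d\<rho>/d\<theta> = F(\<theta>, \<rho>)\<close>. A closed curve \<open>\<rho> = a(\<theta>)\<close> is crossed outwards if \<open>a' < F\<close> along it and
  inwards if \<open>a' > F\<close>. Between two curves crossed in opposite directions the return map has a fixed point, and
  its fixed points are isolated because it is analytic. Six nested curves, crossed alternately inwards and
  outwards, therefore enclose five limit cycles.

  The two outermost curves come from the degenerate system \<open>\<sigma> = 0\<close>: the first terms of its Lyapunov expansion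
  are proportional to \<open>\<epsilon>\<^sub>2\<close> (negative) and to a positive constant, and the curves persist for small parameters. The other
  four live at the scale \<open>x = \<sigma>\<^sup>2 X\<close>, \<open>y = \<sigma>\<^sup>3 Y\<close>, where the system is a small perturbation of a Hamiltonian system with a
  centre. They are level curves of corrected energies, whose derivatives along the flow are to leading order
  \<open>- \<delta>\<^sub>0 r\<^sup>2\<close>, \<open>\<delta>\<^sub>1 r\<^sup>4 / 2\<close>, \<open>- \<delta>\<^sub>2 r\<^sup>6 / 2\<close> and \<open>47 \<epsilon>\<^sub>1 r\<^sup>8 / 256\<close>.
\<close>

section \<open>Ordinary differential equations\<close>


text \<open>The return map is never expanded uniformly in the parameters: four of the curves shrink
  with \<sigma> while the other two keep their size, so one expansion would have to cover two
  scales. A crossing condition, in contrast, is a strict inequality on a compact circle and hence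
  open in the parameters. This fits the order of the quantifiers: a curve is fixed as soon as the
  parameter that gives it its sign is known (the outermost one needs none), and every parameter
  chosen later only has to be too small to spoil it. The values 5/21 and 1/7 of the
  quasi-homogeneous part make the third-order coefficient of the degenerate system vanish at
  \<epsilon>2 = 0, so that a small \<epsilon>2 can give it the sign opposite to that of the
  fifth-order one. The latter involves the primitives \<open>gM\<close> and \<open>gJ\<close>; only
  its sign matters, and it is certified by one exact identity and one polynomial bound on
  \<open>gM\<close>. Barriers alone would allow infinitely many periodic orbits between two curves,
  and excluding this is the only purpose of the complex variable.\<close>

lemma has_integral_power_fact:
  fixes L :: real
  assumes "a \<le> t"
  shows "((\<lambda>s. L * (K * (L * (s - a)) ^ n / fact n)) has_integral
           (K * (L * (t - a)) ^ Suc n / fact (Suc n))) {a..t}"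
proof -
  have "((\<lambda>s. K * (L * (s - a)) ^ Suc n / fact (Suc n)) has_vector_derivative
          L * (K * (L * (s - a)) ^ n / fact n)) (at s within {a..t})" for s
    by (rule has_vector_derivative_eq_rhs)
      (auto intro!: derivative_eq_intros
        simp flip: has_real_derivative_iff_has_vector_derivative simp del: power_Suc)
  from fundamental_theorem_of_calculus[OF assms this] show ?thesis by simp
qed

text \<open>Iterated integration of a constant produces the terms of the exponential series. A
  constant sequence \<open>e\<close> gives Gronwall's inequality, the differences of successive
  Picard iterates give their convergence.\<close>

lemma iterated_integral_bound:
  fixes e :: "nat \<Rightarrow> real \<Rightarrow> real"
  assumes L: "L \<ge> 0"
    and cont: "\<And>n. continuous_on {a..b} (e n)"
    and step: "\<And>n t. t \<in> {a..b} \<Longrightarrow> e (Suc n) t \<le> L * integral {a..t} (e n)"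
    and start: "\<And>t. t \<in> {a..b} \<Longrightarrow> e 0 t \<le> K"
    and t: "t \<in> {a..b}"
  shows "e n t \<le> K * (L * (t - a)) ^ n / fact n"
  using t
proof (induction n arbitrary: t)
  case 0
  then show ?case using start by simp
next
  case (Suc n)
  have int: "e n integrable_on {a..t}"
    using Suc.prems by (intro integrable_continuous_real continuous_on_subset[OF cont]) auto
  have "integral {a..t} (\<lambda>s. L * e n s) \<le> integral {a..t} (\<lambda>s. L * (K * (L * (s - a)) ^ n / fact n))"
  proof (rule integral_le)
    show "(\<lambda>s. L * e n s) integrable_on {a..t}"
      using integrable_on_cmult_left[OF int, of L] by simp
    show "(\<lambda>s. L * (K * (L * (s - a)) ^ n / fact n)) integrable_on {a..t}"
      using has_integral_power_fact Suc.prems by (metis atLeastAtMost_iff has_integral_integrable)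
    show "L * e n s \<le> L * (K * (L * (s - a)) ^ n / fact n)" if "s \<in> {a..t}" for s
      using Suc.IH[of s] Suc.prems that L by (intro mult_left_mono) auto
  qed
  moreover have "integral {a..t} (\<lambda>s. L * e n s) = L * integral {a..t} (e n)" by simp
  moreover have "integral {a..t} (\<lambda>s. L * (K * (L * (s - a)) ^ n / fact n))
      = K * (L * (t - a)) ^ Suc n / fact (Suc n)"
    using has_integral_power_fact Suc.prems by (intro integral_unique) auto
  ultimately show ?case using step[OF Suc.prems, of n] by linarith
qed

text \<open>For the constant sequence the factorial bound holds for every \<open>n\<close>, and its
  limit is 0.\<close>

lemma gronwall_zero:
  fixes e :: "real \<Rightarrow> real"
  assumes L: "L \<ge> 0" and cont: "continuous_on {a..b} e"
    and step: "\<And>t. t \<in> {a..b} \<Longrightarrow> e t \<le> L * integral {a..t} e"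
    and t: "t \<in> {a..b}"
  shows "e t \<le> 0"
proof -
  have "bounded (e ` {a..b})"
    by (intro compact_imp_bounded compact_continuous_image cont compact_Icc)
  then obtain K where K: "\<And>t. t \<in> {a..b} \<Longrightarrow> e t \<le> K"
    unfolding bounded_real by (metis abs_le_D1 image_eqI)
  have "e t \<le> K * ((L * (t - a)) ^ n / fact n)" for n
    using iterated_integral_bound[where e = "\<lambda>_. e", OF L cont step K t] by (simp add: mult.commute)
  moreover have "(\<lambda>n. K * ((L * (t - a)) ^ n / fact n)) \<longlonglongrightarrow> K * 0"
    by (intro tendsto_mult tendsto_const)
      (use summable_LIMSEQ_zero[OF summable_exp_generic[of "L * (t - a)"]] in
        \<open>simp add: divide_inverse_commute scaleR_conv_of_real\<close>)
  ultimately show ?thesis by (simp add: LIMSEQ_le_const)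
qed

text \<open>The function \<open>h\<close> solves the integral inequality with equality, so
  \<open>e - h\<close> satisfies the homogeneous one.\<close>

lemma gronwall_exp:
  fixes e :: "real \<Rightarrow> real"
  assumes L: "L \<ge> 0" and cont: "continuous_on {a..b} e"
    and step: "\<And>t. t \<in> {a..b} \<Longrightarrow> e t \<le> c + L * integral {a..t} e"
    and t: "t \<in> {a..b}"
  shows "e t \<le> c * exp (L * (t - a))"
proof -
  define h where "h t = c * exp (L * (t - a))" for t
  have conth: "continuous_on A h" for A unfolding h_def by (intro continuous_intros)
  have "e t - h t \<le> 0"
  proof (rule gronwall_zero[OF L _ _ t])
    show "continuous_on {a..b} (\<lambda>t. e t - h t)" by (intro continuous_intros cont conth)
    fix t assume t: "t \<in> {a..b}"
    have "((\<lambda>s. L * h s) has_integral h t - h a) {a..t}"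
      using t unfolding h_def
      by (intro fundamental_theorem_of_calculus)
        (auto intro!: derivative_eq_intros simp flip: has_real_derivative_iff_has_vector_derivative)
    from integral_unique[OF this] have "L * integral {a..t} h = h t - c"
      by (simp add: h_def[of a])
    moreover have "integral {a..t} (\<lambda>t. e t - h t) = integral {a..t} e - integral {a..t} h"
      using t by (intro integral_diff integrable_continuous_real conth continuous_on_subset[OF cont]) auto
    ultimately have "L * integral {a..t} (\<lambda>t. e t - h t) = L * integral {a..t} e - (h t - c)"
      by (simp add: right_diff_distrib)
    then show "e t - h t \<le> L * integral {a..t} (\<lambda>t. e t - h t)"
      using step[OF t] by linarith
  qed
  then show ?thesis by (simp add: h_def)
qed

section \<open>Dependence on initial values and Picard iteration\<close>

lemma ode_dist_bound:
  fixes u v :: "real \<Rightarrow> 'a::banach"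
  assumes u: "\<And>t. t \<in> {a..b} \<Longrightarrow> (u has_vector_derivative F t (u t)) (at t within {a..b})"
    and v: "\<And>t. t \<in> {a..b} \<Longrightarrow> (v has_vector_derivative F t (v t)) (at t within {a..b})"
    and L: "L \<ge> 0"
    and lip: "\<And>t. t \<in> {a..b} \<Longrightarrow> norm (F t (u t) - F t (v t)) \<le> L * norm (u t - v t)"
    and t: "t \<in> {a..b}"
  shows "norm (u t - v t) \<le> norm (u a - v a) * exp (L * (t - a))"
proof -
  have contu: "continuous_on {a..b} u" and contv: "continuous_on {a..b} v"
    using has_vector_derivative_continuous[OF u] has_vector_derivative_continuous[OF v]
    by (auto simp: continuous_on_eq_continuous_within)
  show ?thesis
  proof (rule gronwall_exp[OF L _ _ t])
    show "continuous_on {a..b} (\<lambda>t. norm (u t - v t))" by (intro continuous_intros contu contv)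
    fix t assume t: "t \<in> {a..b}"
    have at: "{a..t} \<subseteq> {a..b}" using t by auto
    have fu: "((\<lambda>s. F s (u s)) has_integral u t - u a) {a..t}"
      using t by (intro fundamental_theorem_of_calculus)
        (auto intro: has_vector_derivative_within_subset[OF u at])
    have fv: "((\<lambda>s. F s (v s)) has_integral v t - v a) {a..t}"
      using t by (intro fundamental_theorem_of_calculus)
        (auto intro: has_vector_derivative_within_subset[OF v at])
    have eq: "integral {a..t} (\<lambda>s. F s (u s) - F s (v s)) = (u t - v t) - (u a - v a)"
      using has_integral_diff[OF fu fv] by (simp add: integral_unique algebra_simps)
    have "norm (integral {a..t} (\<lambda>s. F s (u s) - F s (v s)))
        \<le> integral {a..t} (\<lambda>s. L * norm (u s - v s))"
    proof (rule integral_norm_bound_integral)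
      show "(\<lambda>s. F s (u s) - F s (v s)) integrable_on {a..t}"
        using has_integral_diff[OF fu fv] by blast
      show "(\<lambda>s. L * norm (u s - v s)) integrable_on {a..t}"
        by (intro integrable_continuous_real continuous_intros
            continuous_on_subset[OF contu at] continuous_on_subset[OF contv at])
    qed (use lip t in auto)
    then have "norm ((u t - v t) - (u a - v a)) \<le> L * integral {a..t} (\<lambda>s. norm (u s - v s))"
      by (simp add: eq)
    then show "norm (u t - v t) \<le> norm (u a - v a) + L * integral {a..t} (\<lambda>s. norm (u s - v s))"
      using norm_triangle_ineq2[of "u t - v t" "u a - v a"] by linarith
  qed
qed

lemma picard_step_bound:
  fixes u :: "nat \<Rightarrow> real \<Rightarrow> 'a::banach"
  assumes L: "L \<ge> 0"
    and cont: "\<And>n. continuous_on {a..b} (u n)"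
    and contF: "\<And>n. continuous_on {a..b} (\<lambda>s. F s (u n s))"
    and step: "\<And>n t. t \<in> {a..b} \<Longrightarrow> u (Suc n) t = z + integral {a..t} (\<lambda>s. F s (u n s))"
    and lip: "\<And>n t. t \<in> {a..b} \<Longrightarrow>
        norm (F t (u (Suc n) t) - F t (u n t)) \<le> L * norm (u (Suc n) t - u n t)"
    and start: "\<And>t. t \<in> {a..b} \<Longrightarrow> norm (u 1 t - u 0 t) \<le> K"
    and t: "t \<in> {a..b}"
  shows "norm (u (Suc n) t - u n t) \<le> K * (L * (t - a)) ^ n / fact n"
proof (rule iterated_integral_bound[where e = "\<lambda>n t. norm (u (Suc n) t - u n t)", OF L _ _ _ t])
  show "continuous_on {a..b} (\<lambda>t. norm (u (Suc n) t - u n t))" for n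
    by (intro continuous_intros cont)
  show "norm (u (Suc 0) t - u 0 t) \<le> K" if "t \<in> {a..b}" for t using start[OF that] by simp
  fix n t assume t: "t \<in> {a..b}"
  then have at: "{a..t} \<subseteq> {a..b}" by auto
  have i: "(\<lambda>s. F s (u m s)) integrable_on {a..t}" for m
    by (intro integrable_continuous_real continuous_on_subset[OF contF at])
  have "norm (integral {a..t} (\<lambda>s. F s (u (Suc n) s) - F s (u n s)))
        \<le> integral {a..t} (\<lambda>s. L * norm (u (Suc n) s - u n s))"
  proof (rule integral_norm_bound_integral)
    show "(\<lambda>s. L * norm (u (Suc n) s - u n s)) integrable_on {a..t}"
      by (intro integrable_continuous_real continuous_intros continuous_on_subset[OF cont at])
  qed (use subsetD[OF at] in \<open>auto intro!: integrable_diff i lip simp del: atLeastAtMost_iff\<close>)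
  then show "norm (u (Suc (Suc n)) t - u (Suc n) t) \<le>
      L * integral {a..t} (\<lambda>t. norm (u (Suc n) t - u n t))"
    using t by (simp add: step integral_diff i del: power_Suc)
qed

lemma telescoping_uniform_limit:
  fixes u :: "nat \<Rightarrow> 'b \<Rightarrow> 'a::banach"
  assumes "\<And>n x. x \<in> A \<Longrightarrow> norm (u (Suc n) x - u n x) \<le> M n" and "summable M"
  shows "uniform_limit A u (\<lambda>x. lim (\<lambda>n. u n x)) sequentially"
proof -
  have ul: "uniform_limit A (\<lambda>n x. u 0 x + (\<Sum>i<n. u (Suc i) x - u i x))
      (\<lambda>x. u 0 x + (\<Sum>i. u (Suc i) x - u i x)) sequentially"
    by (intro uniform_limit_add uniform_limit_const Weierstrass_m_test[OF assms])
  have eq: "u 0 x + (\<Sum>i<n. u (Suc i) x - u i x) = u n x" for n x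
    by (induction n) (simp_all add: algebra_simps)
  have ul': "uniform_limit A u (\<lambda>x. u 0 x + (\<Sum>i. u (Suc i) x - u i x)) sequentially"
    using ul unfolding eq .
  have "u 0 x + (\<Sum>i. u (Suc i) x - u i x) = lim (\<lambda>n. u n x)" if "x \<in> A" for x
    using limI[OF tendsto_uniform_limitI[OF ul' that]] by simp
  then have "uniform_limit A u (\<lambda>x. u 0 x + (\<Sum>i. u (Suc i) x - u i x)) sequentially
      \<longleftrightarrow> uniform_limit A u (\<lambda>x. lim (\<lambda>n. u n x)) sequentially"
    by (intro uniform_limit_cong') auto
  with ul' show ?thesis by blast
qed

text \<open>The closed sets \<open>D t\<close> are where \<open>F\<close> is Lipschitz: everything
  for the truncated real equation, a disc around a reference solution for the complex one. The limit
  is written with \<open>lim\<close> so that it is one function for all end points \<open>b\<close>,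
  and so that the holomorphic map built later from the same iterates agrees with it by
  definition.\<close>

lemma picard_limit:
  fixes u :: "nat \<Rightarrow> real \<Rightarrow> 'a::banach"
  assumes L: "L \<ge> 0" and "a \<le> b"
    and cont: "\<And>n. continuous_on {a..b} (u n)"
    and contF: "\<And>n. continuous_on {a..b} (\<lambda>s. F s (u n s))"
    and step: "\<And>n t. t \<in> {a..b} \<Longrightarrow> u (Suc n) t = z + integral {a..t} (\<lambda>s. F s (u n s))"
    and lip: "\<And>t x y. \<lbrakk>t \<in> {a..b}; x \<in> D t; y \<in> D t\<rbrakk> \<Longrightarrow> norm (F t x - F t y) \<le> L * norm (x - y)"
    and D: "\<And>n t. t \<in> {a..b} \<Longrightarrow> u n t \<in> D t"
    and clD: "\<And>t. t \<in> {a..b} \<Longrightarrow> closed (D t)"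
  defines "v \<equiv> \<lambda>t. lim (\<lambda>n. u n t)"
  shows "\<And>t. t \<in> {a..b} \<Longrightarrow> (\<lambda>n. u n t) \<longlonglongrightarrow> v t"
    and "\<And>t. t \<in> {a..b} \<Longrightarrow> v t \<in> D t"
    and "v a = z"
    and "\<And>t. t \<in> {a..b} \<Longrightarrow> (v has_vector_derivative F t (v t)) (at t within {a..b})"
proof -
  have "bounded ((\<lambda>t. u 1 t - u 0 t) ` {a..b})"
    by (intro compact_imp_bounded compact_continuous_image continuous_intros cont compact_Icc)
  then obtain K where K: "\<And>t. t \<in> {a..b} \<Longrightarrow> norm (u 1 t - u 0 t) \<le> K"
    unfolding bounded_iff by blast
  have K0: "K \<ge> 0" using order.trans[OF norm_ge_zero K[of a]] \<open>a \<le> b\<close> by simp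
  have "norm (u (Suc n) t - u n t) \<le> K * ((L * (b - a)) ^ n / fact n)" if t: "t \<in> {a..b}" for n t
  proof -
    have "norm (u (Suc n) t - u n t) \<le> K * (L * (t - a)) ^ n / fact n"
      by (rule picard_step_bound[OF L cont contF step lip[OF _ D D] K t])
    also have "\<dots> \<le> K * (L * (b - a)) ^ n / fact n"
      using t L K0 by (intro divide_right_mono mult_left_mono power_mono) auto
    finally show ?thesis by simp
  qed
  moreover have "summable (\<lambda>n. K * ((L * (b - a)) ^ n / fact n))"
    using summable_exp_generic[of "L * (b - a)"]
    by (intro summable_mult) (simp add: divide_inverse_commute scaleR_conv_of_real)
  ultimately have ul: "uniform_limit {a..b} u v sequentially"
    unfolding v_def by (intro telescoping_uniform_limit)
  show lim: "(\<lambda>n. u n t) \<longlonglongrightarrow> v t" if "t \<in> {a..b}" for t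
    using ul that by (rule tendsto_uniform_limitI)
  show Dv: "v t \<in> D t" if "t \<in> {a..b}" for t
    by (rule Lim_in_closed_set[OF clD[OF that] _ sequentially_bot lim[OF that]])
      (simp add: D[OF that])
  have ulF: "uniform_limit {a..b} (\<lambda>n s. F s (u n s)) (\<lambda>s. F s (v s)) sequentially"
  proof (rule uniform_limitI)
    fix e :: real assume e: "e > 0"
    have "\<forall>\<^sub>F n in sequentially. \<forall>s\<in>{a..b}. dist (u n s) (v s) < e / (L + 1)"
      using uniform_limitD[OF ul, of "e / (L + 1)"] e L by simp
    then show "\<forall>\<^sub>F n in sequentially. \<forall>s\<in>{a..b}. dist (F s (u n s)) (F s (v s)) < e"
    proof eventually_elim
      case (elim n)
      show ?case
      proof
        fix s assume s: "s \<in> {a..b}"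
        have "norm (F s (u n s) - F s (v s)) \<le> L * norm (u n s - v s)"
          using lip[OF s D[OF s] Dv[OF s]] .
        also have "\<dots> \<le> L * (e / (L + 1))"
          using elim s L by (intro mult_left_mono) (auto simp: dist_norm less_imp_le)
        also have "\<dots> < e" using e L by (simp add: field_simps)
        finally show "dist (F s (u n s)) (F s (v s)) < e" by (simp add: dist_norm)
      qed
    qed
  qed
  have contv: "continuous_on {a..b} (\<lambda>s. F s (v s))"
    by (rule uniform_limit_theorem[OF always_eventually ulF]) (simp_all add: contF)
  have v_eq: "v t = z + integral {a..t} (\<lambda>s. F s (v s))" if t: "t \<in> {a..b}" for t
  proof -
    have at: "{a..t} \<subseteq> {a..b}" using t by auto
    have ulc: "uniform_limit (cbox a t) (\<lambda>n s. F s (u n s)) (\<lambda>s. F s (v s)) sequentially"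
      using uniform_limit_on_subset[OF ulF at] by simp
    have contc: "continuous_on (cbox a t) (\<lambda>s. F s (u n s))" for n
      using continuous_on_subset[OF contF at] by simp
    obtain I J where IJ: "\<And>n. ((\<lambda>s. F s (u n s)) has_integral I n) (cbox a t)"
      "((\<lambda>s. F s (v s)) has_integral J) (cbox a t)" "I \<longlonglongrightarrow> J"
      by (rule uniform_limit_integral_cbox[OF ulc contc sequentially_bot], rule that)
    have "(\<lambda>n. integral {a..t} (\<lambda>s. F s (u n s))) \<longlonglongrightarrow> integral {a..t} (\<lambda>s. F s (v s))"
      using IJ(3) unfolding integral_unique[OF IJ(1), symmetric] integral_unique[OF IJ(2), symmetric]
      by (simp only: box_real)
    then have "(\<lambda>n. z + integral {a..t} (\<lambda>s. F s (u n s))) \<longlonglongrightarrow> z + integral {a..t} (\<lambda>s. F s (v s))"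
      by (intro tendsto_add tendsto_const)
    then have "(\<lambda>n. u (Suc n) t) \<longlonglongrightarrow> z + integral {a..t} (\<lambda>s. F s (v s))"
      using step[OF t] by simp
    moreover have "(\<lambda>n. u (Suc n) t) \<longlonglongrightarrow> v t" using lim[OF t] by (rule LIMSEQ_Suc)
    ultimately show ?thesis by (rule LIMSEQ_unique[symmetric])
  qed
  show "v a = z" using \<open>a \<le> b\<close> by (subst v_eq) simp_all
  show "(v has_vector_derivative F t (v t)) (at t within {a..b})" if t: "t \<in> {a..b}" for t
  proof (rule has_vector_derivative_transform[OF t])
    show "((\<lambda>t. z + integral {a..t} (\<lambda>s. F s (v s))) has_vector_derivative F t (v t)) (at t within {a..b})"
      using integral_has_vector_derivative[OF contv t] by (auto intro!: derivative_eq_intros)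
  qed (rule v_eq)
qed

text \<open>The substitution \<open>s = a + (t - a) * \<tau>\<close> moves the variable upper limit
  into the integrand, which leaves an integral over the fixed interval from 0 to 1 with parameter
  \<open>(t, z)\<close>.\<close>

lemma continuous_on_param_indefinite_integral:
  fixes f :: "real \<Rightarrow> 'b::topological_space \<Rightarrow> 'a::banach"
  assumes f: "continuous_on ({a..b} \<times> Z) (\<lambda>(s, z). f s z)"
  shows "continuous_on ({a..b} \<times> Z) (\<lambda>(t, z). integral {a..t} (\<lambda>s. f s z))"
proof -
  have "continuous_on (({a..b} \<times> Z) \<times> cbox (0::real) 1)
      (\<lambda>(p, \<tau>). f (a + (fst p - a) * \<tau>) (snd p))"
  proof -
    have sub: "(\<lambda>q. (a + (fst (fst q) - a) * snd q, snd (fst q))) ` (({a..b} \<times> Z) \<times> cbox (0::real) 1)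
          \<subseteq> {a..b} \<times> Z"
    proof clarsimp
      fix t \<tau> :: real assume t: "a \<le> t" "t \<le> b" "0 \<le> \<tau>" "\<tau> \<le> 1"
      then have "(t - a) * \<tau> \<le> t - a" by (intro mult_left_le) auto
      then show "a + (t - a) * \<tau> \<le> b" using t by auto
    qed
    have "continuous_on (({a..b} \<times> Z) \<times> cbox (0::real) 1)
        (\<lambda>q. (\<lambda>(s, z). f s z) (a + (fst (fst q) - a) * snd q, snd (fst q)))"
      by (rule continuous_on_compose2[OF f _ sub]) (intro continuous_intros)
    then show ?thesis by (simp add: case_prod_unfold)
  qed
  then have "continuous_on ({a..b} \<times> Z) (\<lambda>p. integral (cbox (0::real) 1) (\<lambda>\<tau>. f (a + (fst p - a) * \<tau>) (snd p)))"
    by (rule integral_continuous_on_param)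
  then have "continuous_on ({a..b} \<times> Z)
      (\<lambda>p. (fst p - a) *\<^sub>R integral (cbox (0::real) 1) (\<lambda>\<tau>. f (a + (fst p - a) * \<tau>) (snd p)))"
    by (intro continuous_intros)
  moreover have "(t - a) *\<^sub>R integral (cbox (0::real) 1) (\<lambda>\<tau>. f (a + (t - a) * \<tau>) z) = integral {a..t} (\<lambda>s. f s z)"
    if t: "t \<in> {a..b}" and z: "z \<in> Z" for t z
  proof -
    let ?G = "\<lambda>t. integral {a..t} (\<lambda>s. f s z)"
    have "continuous_on {a..t} (\<lambda>s. (\<lambda>(s, z). f s z) (s, z))"
      using t z by (intro continuous_on_compose2[OF f] continuous_intros) auto
    then have G: "(?G has_vector_derivative f s z) (at s within {a..t})" if "s \<in> {a..t}" for s
      using integral_has_vector_derivative[of a t "\<lambda>s. f s z"] that by simp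
    have "((\<lambda>\<tau>. (t - a) *\<^sub>R f (a + (t - a) * \<tau>) z) has_integral
        (?G (a + (t - a) * 1) - ?G (a + (t - a) * 0))) {0..1}"
    proof (rule fundamental_theorem_of_calculus)
      fix \<tau> :: real assume \<tau>: "\<tau> \<in> {0..1}"
      have sub: "(\<lambda>\<tau>. a + (t - a) * \<tau>) ` {0..1} \<subseteq> {a..t}"
      proof clarsimp
        fix c :: real assume "0 \<le> c" "c \<le> 1"
        then show "0 \<le> (t - a) * c \<and> a + (t - a) * c \<le> t"
          using t mult_left_le[of c "t - a"] by auto
      qed
      have "(?G has_vector_derivative f (a + (t - a) * \<tau>) z)
          (at (a + (t - a) * \<tau>) within (\<lambda>\<tau>. a + (t - a) * \<tau>) ` {0..1})"
        using sub \<tau> by (intro has_vector_derivative_within_subset[OF G]) blast+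
      moreover have "((\<lambda>\<tau>. a + (t - a) * \<tau>) has_vector_derivative (t - a)) (at \<tau> within {0..1})"
        by (auto intro!: derivative_eq_intros simp flip: has_real_derivative_iff_has_vector_derivative)
      ultimately show "((\<lambda>\<tau>. ?G (a + (t - a) * \<tau>)) has_vector_derivative
          (t - a) *\<^sub>R f (a + (t - a) * \<tau>) z) (at \<tau> within {0..1})"
        using vector_diff_chain_within by (fastforce simp: o_def)
    qed simp
    from integral_unique[OF this] show ?thesis by simp
  qed
  ultimately show ?thesis
    by (subst continuous_on_cong[OF refl]) (auto simp: case_prod_unfold)
qed

text \<open>The iterates do not mention a right end point, so the solutions obtained on all
  intervals \<open>{a..b}\<close> are restrictions of a single function.\<close>

lemma ode_exists_global:
  fixes F :: "real \<Rightarrow> real \<Rightarrow> real"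
  assumes contF: "continuous_on UNIV (\<lambda>(t, x). F t x)"
    and lip: "\<And>t x y. \<bar>F t x - F t y\<bar> \<le> L * \<bar>x - y\<bar>"
  shows "\<exists>u. u a = z \<and> (\<forall>t\<ge>a. (u has_real_derivative F t (u t)) (at t within {a..}))"
proof -
  have L: "L \<ge> 0" using lip[of 0 0 1] by simp
  define u where "u n = ((\<lambda>v t. z + integral {a..t} (\<lambda>s. F s (v s))) ^^ n) (\<lambda>_. z)" for n
  have u_Suc: "u (Suc n) t = z + integral {a..t} (\<lambda>s. F s (u n s))" for n t
    by (simp add: u_def)
  have contFv: "continuous_on A (\<lambda>s. F s (v s))" if "continuous_on A v" for A v
  proof -
    have "continuous_on A (\<lambda>s. (\<lambda>(t, x). F t x) (s, v s))"
      by (intro continuous_on_compose2[OF contF] continuous_intros that) auto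
    then show ?thesis by simp
  qed
  have cont: "continuous_on {a..b} (u n)" for n b
  proof (induction n)
    case 0 show ?case by (simp add: u_def)
  next
    case (Suc n)
    have "continuous_on {a..b} (\<lambda>t. z + integral {a..t} (\<lambda>s. F s (u n s)))"
      by (intro continuous_intros indefinite_integral_continuous_1 integrable_continuous_real contFv Suc)
    then show ?case by (simp add: u_Suc[abs_def])
  qed
  define v where "v t = lim (\<lambda>n. u n t)" for t
  have deriv: "(v has_vector_derivative F t (v t)) (at t within {a..b})" if "t \<in> {a..b}" for t b
    unfolding v_def using that
    by (intro picard_limit(4)[where D = "\<lambda>_. UNIV" and z = z and u = u and L = L])
      (auto simp: L cont contFv u_Suc lip)
  have "v a = z"
    unfolding v_def
    by (intro picard_limit(3)[where D = "\<lambda>_. UNIV" and u = u and L = L and b = a and F = F])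
      (auto simp: L cont contFv u_Suc lip)
  moreover have "(v has_real_derivative F t (v t)) (at t within {a..})" if t: "t \<ge> a" for t
  proof -
    have "at t within {a..} = at t within {a..t + 1}"
      by (rule at_within_nhd[of _ "{..<t + 1}"]) auto
    then show ?thesis using deriv[of t "t + 1"] t
      by (simp add: has_real_derivative_iff_has_vector_derivative)
  qed
  ultimately show ?thesis by blast
qed

text \<open>After a first positive value, \<open>g\<close> would have to reach its next zero from
  above, whereas \<open>cross\<close> makes it increase strictly there. The start may be a zero,
  because \<open>g\<close> then leaves it upwards for the same reason; barriers use this for
  solutions that start on the curve itself.\<close>

lemma positive_crossing:
  fixes g :: "real \<Rightarrow> real"
  assumes g: "\<And>t. t \<ge> a \<Longrightarrow> (g has_real_derivative g' t) (at t within {a..})"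
    and start: "g a \<ge> 0"
    and cross: "\<And>t. t \<ge> a \<Longrightarrow> g t = 0 \<Longrightarrow> g' t > 0"
    and t: "t > a"
  shows "g t > 0"
proof (rule ccontr)
  assume neg: "\<not> g t > 0"
  have cont: "continuous_on {a..} g"
    using g by (auto simp: continuous_on_eq_continuous_within intro: DERIV_continuous)
  have "\<exists>s. a < s \<and> s < t \<and> g s > 0"
  proof (cases "g a = 0")
    case True
    then have "g' a > 0" using cross by simp
    from has_real_derivative_pos_inc_right[OF g[OF order_refl] this]
    obtain d where d: "d > 0" "\<And>h. h > 0 \<Longrightarrow> a + h \<in> {a..} \<Longrightarrow> h < d \<Longrightarrow> g a < g (a + h)" by blast
    define h where "h = min (d / 2) ((t - a) / 2)"
    have "h > 0" "h < d" "a + h < t" using d t by (auto simp: h_def min_def field_simps)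
    then show ?thesis using d(2)[of h] True by (intro exI[of _ "a + h"]) auto
  next
    case False
    then have pos: "g a > 0" using start by simp
    have "continuous (at a within {a..}) g" using cont by (simp add: continuous_on_eq_continuous_within)
    then have "\<forall>\<^sub>F s in at a within {a..}. g s > 0"
      using pos by (simp add: continuous_within order_tendsto_iff)
    then obtain d where d: "d > 0" "\<And>s. s \<in> {a..} \<Longrightarrow> s \<noteq> a \<Longrightarrow> dist s a < d \<Longrightarrow> g s > 0"
      unfolding eventually_at by blast
    define h where "h = min (d / 2) ((t - a) / 2)"
    have "h > 0" "h < d" "a + h < t" using d t by (auto simp: h_def min_def field_simps)
    then show ?thesis using d(2)[of "a + h"] by (intro exI[of _ "a + h"]) (auto simp: dist_real_def)
  qed
  then obtain s where s: "a < s" "s < t" "g s > 0" by blast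
  define Z where "Z = {x \<in> {s..t}. g x \<le> 0}"
  have "closed Z"
  proof -
    have "closed ({s..t} \<inter> g -` {..0})"
      using s by (intro continuous_closed_preimage continuous_on_subset[OF cont]) auto
    then show ?thesis by (simp add: Z_def vimage_def Int_def)
  qed
  moreover have "t \<in> Z" "bdd_below Z" using neg s by (auto simp: Z_def)
  ultimately have I: "Inf Z \<in> Z" by (intro closed_contains_Inf) auto
  define x where "x = Inf Z"
  have x: "s \<le> x" "x \<le> t" "g x \<le> 0" using I by (auto simp: Z_def x_def)
  have before: "g y > 0" if "s \<le> y" "y < x" for y
    using cInf_lower[of y Z] \<open>bdd_below Z\<close> that x by (force simp: Z_def x_def)
  have "s < x" using x s by (cases "s = x") auto
  have "g x \<ge> 0"
  proof (rule tendsto_lowerbound)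
    show "(g \<longlongrightarrow> g x) (at_left x)"
      using g[of x] \<open>s < x\<close> s
      by (metis DERIV_continuous at_within_interior atLeast_iff continuous_at_imp_continuous_at_within
          continuous_within interior_real_atLeast greaterThan_iff less_trans order_less_imp_le)
    show "\<forall>\<^sub>F y in at_left x. 0 \<le> g y"
      using before \<open>s < x\<close> by (auto simp: eventually_at_left_field intro: less_imp_le)
  qed auto
  then have gx: "g x = 0" using x by simp
  have "(g has_real_derivative g' x) (at x)"
    using g[of x] at_within_interior[of x "{a..}"] \<open>s < x\<close> s by simp
  from DERIV_pos_inc_left[OF this cross[OF _ gx]] \<open>s < x\<close> s
  obtain d where d: "d > 0" "\<And>h. h > 0 \<Longrightarrow> h < d \<Longrightarrow> g (x - h) < g x" by auto
  define h where "h = min (d / 2) (x - s)"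
  have "h > 0" "h < d" "s \<le> x - h" using d \<open>s < x\<close> by (auto simp: h_def)
  then show False using d(2)[of h] before[of "x - h"] gx by simp
qed

text \<open>The autonomous equation \<open>\<tau>' = g \<tau>\<close> is solved by inverting
  \<open>\<Psi>\<close>, the time needed to reach a given angle. The upper bound \<open>M\<close>
  forces \<open>\<Psi>\<close> to grow at least linearly, so it is onto and \<open>\<tau>\<close>
  exists for all times.\<close>

lemma time_change:
  fixes g :: "real \<Rightarrow> real"
  assumes cont: "continuous_on UNIV g" and m: "\<And>x. 0 < g x" and gM: "\<And>x. g x \<le> M"
  obtains \<Psi> \<tau> where "\<And>x. (\<Psi> has_real_derivative 1 / g x) (at x)" "\<Psi> \<theta>0 = 0"
    "\<And>x. \<tau> (\<Psi> x) = x" "\<And>t. \<Psi> (\<tau> t) = t" "strict_mono \<Psi>" "strict_mono \<tau>"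
    "\<And>t. (\<tau> has_real_derivative g (\<tau> t)) (at t)"
proof -
  have M: "M > 0" using m[of 0] gM[of 0] by linarith
  have "isCont (\<lambda>x. 1 / g x) x" for x
    using m[of x] cont by (intro continuous_intros) (auto simp: continuous_on_eq_continuous_at)
  then have "\<exists>F. \<forall>x. - \<infinity> < ereal x \<longrightarrow> ereal x < \<infinity> \<longrightarrow> (F has_vector_derivative 1 / g x) (at x)"
    by (intro einterval_antiderivative) simp_all
  then obtain \<Psi>0 where "\<And>x. (\<Psi>0 has_vector_derivative 1 / g x) (at x)" by auto
  then have \<Psi>0: "(\<Psi>0 has_real_derivative 1 / g x) (at x)" for x
    by (simp add: has_real_derivative_iff_has_vector_derivative)
  define \<Psi> where "\<Psi> x = \<Psi>0 x - \<Psi>0 \<theta>0" for x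
  have D: "(\<Psi> has_real_derivative 1 / g x) (at x)" for x
    unfolding \<Psi>_def by (auto intro!: derivative_eq_intros \<Psi>0)
  have mono: "strict_mono \<Psi>"
  proof (rule strict_monoI)
    fix x y :: real assume "x < y"
    then show "\<Psi> x < \<Psi> y" using DERIV_pos_imp_increasing[of x y \<Psi>] D m by (meson divide_pos_pos zero_less_one)
  qed
  have grow: "(y - x) / M \<le> \<Psi> y - \<Psi> x" if "x \<le> y" for x y
  proof -
    have "\<exists>d. ((\<lambda>x. \<Psi> x - x / M) has_real_derivative d) (at x) \<and> d \<ge> 0" for x
    proof (intro exI conjI)
      show "((\<lambda>x. \<Psi> x - x / M) has_real_derivative 1 / g x - 1 / M) (at x)"
        by (rule DERIV_diff[OF D DERIV_cdivide[OF DERIV_ident]])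
      have "1 / M \<le> 1 / g x" by (rule frac_le[OF _ order_refl m gM]) simp
      then show "1 / g x - 1 / M \<ge> 0" by linarith
    qed
    then have "\<Psi> x - x / M \<le> \<Psi> y - y / M"
      by (rule DERIV_nonneg_imp_nondecreasing[where f = "\<lambda>x. \<Psi> x - x / M", OF that])
    then show ?thesis by (simp add: diff_divide_distrib)
  qed
  have contP: "continuous_on A \<Psi>" for A
    using D by (intro DERIV_continuous_on[of A]) (blast intro: has_field_derivative_at_within)
  have surj: "\<exists>x. \<Psi> x = t" for t
  proof (cases "t \<ge> 0")
    case True
    have "\<exists>x\<ge>\<theta>0. x \<le> \<theta>0 + M * t \<and> \<Psi> x = t"
      using True M grow[of \<theta>0 "\<theta>0 + M * t"]
      by (intro IVT' contP) (auto simp: \<Psi>_def)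
    then show ?thesis by blast
  next
    case False
    have "\<exists>x\<ge>\<theta>0 + M * t. x \<le> \<theta>0 \<and> \<Psi> x = t"
      using False M grow[of "\<theta>0 + M * t" \<theta>0] mult_pos_neg[of M t]
      by (intro IVT' contP) (auto simp: \<Psi>_def)
    then show ?thesis by blast
  qed
  define \<tau> where "\<tau> = inv \<Psi>"
  have \<tau>1: "\<tau> (\<Psi> x) = x" for x
    unfolding \<tau>_def by (intro inv_f_f strict_mono_imp_inj_on mono)
  have \<tau>2: "\<Psi> (\<tau> t) = t" for t
    using surj[of t] \<tau>1 by auto
  have mono\<tau>: "strict_mono \<tau>"
  proof (rule strict_monoI)
    fix s t :: real assume "s < t"
    then have "\<Psi> (\<tau> s) < \<Psi> (\<tau> t)" by (simp add: \<tau>2)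
    then show "\<tau> s < \<tau> t" by (simp add: strict_mono_less[OF mono])
  qed
  have "(\<tau> has_real_derivative g (\<tau> t)) (at t)" for t
  proof -
    have "(\<tau> has_derivative (\<lambda>h. g (\<tau> t) * h)) (at (\<Psi> (\<tau> t)))"
    proof (rule has_derivative_inverse_strong[of UNIV "\<tau> t" \<Psi> \<tau> "\<lambda>h. 1 / g (\<tau> t) * h" "\<lambda>h. g (\<tau> t) * h"])
      show "(\<Psi> has_derivative (\<lambda>h. 1 / g (\<tau> t) * h)) (at (\<tau> t))"
        using D[of "\<tau> t"] unfolding has_field_derivative_def .
      show "(\<lambda>h. 1 / g (\<tau> t) * h) \<circ> (\<lambda>h. g (\<tau> t) * h) = id"
        using m[of "\<tau> t"] by (auto simp: fun_eq_iff)
    qed (auto simp: contP \<tau>1)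
    then show ?thesis by (simp add: has_field_derivative_def \<tau>2)
  qed
  note D\<tau> = this
  have "\<Psi> \<theta>0 = 0" by (simp add: \<Psi>_def)
  from that[OF D this \<tau>1 \<tau>2 mono mono\<tau> D\<tau>] show thesis .
qed

text \<open>On a compact tube around \<open>w\<close> the bound on \<open>F'\<close> is a Lipschitz
  constant, each Picard iterate is holomorphic in the initial value, and uniform limits of
  holomorphic functions are holomorphic. The conclusion speaks of every solution that stays in the
  tube, which is how embedded real solutions are recognised later.\<close>

lemma holomorphic_dependence:
  fixes F F' :: "real \<Rightarrow> complex \<Rightarrow> complex"
  assumes ab: "a \<le> b" and R: "R > 0"
    and w: "\<And>t. t \<in> {a..b} \<Longrightarrow> (w has_vector_derivative F t (w t)) (at t within {a..b})"
    and F: "\<And>t x. t \<in> {a..b} \<Longrightarrow> x \<in> cball (w t) R \<Longrightarrow> (F t has_field_derivative F' t x) (at x)"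
    and contF: "continuous_on (SIGMA t:{a..b}. cball (w t) R) (\<lambda>(t, x). F t x)"
    and contF': "continuous_on (SIGMA t:{a..b}. cball (w t) R) (\<lambda>(t, x). F' t x)"
  shows "\<exists>\<epsilon>>0. \<exists>g. g holomorphic_on ball (w a) \<epsilon> \<and> (\<forall>v. v a \<in> ball (w a) \<epsilon> \<longrightarrow>
           (\<forall>t\<in>{a..b}. v t \<in> cball (w t) R \<and> (v has_vector_derivative F t (v t)) (at t within {a..b}))
           \<longrightarrow> v b = g (v a))"
proof -
  let ?K = "SIGMA t:{a..b}. cball (w t) R"
  have contw: "continuous_on {a..b} w"
    using has_vector_derivative_continuous[OF w] by (auto simp: continuous_on_eq_continuous_within)
  have K_eq: "?K = (\<lambda>p. (fst p, w (fst p) + snd p)) ` ({a..b} \<times> cball 0 R)"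
  proof (intro set_eqI iffI)
    fix p assume "p \<in> ?K"
    then show "p \<in> (\<lambda>p. (fst p, w (fst p) + snd p)) ` ({a..b} \<times> cball 0 R)"
      by (intro image_eqI[of _ _ "(fst p, snd p - w (fst p))"]) (auto simp: dist_norm norm_minus_commute)
  qed (auto simp: dist_norm)
  have "compact ?K"
    unfolding K_eq
    by (intro compact_continuous_image continuous_intros compact_Times compact_Icc compact_cball
        continuous_on_compose2[OF contw]) auto
  then have "bounded ((\<lambda>(t, x). F' t x) ` ?K)"
    by (intro compact_imp_bounded compact_continuous_image contF')
  then obtain L0 where L0: "\<And>t x. t \<in> {a..b} \<Longrightarrow> x \<in> cball (w t) R \<Longrightarrow> norm (F' t x) \<le> L0"
    unfolding bounded_iff by fastforce
  define L where "L = max 0 L0"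
  have L: "L \<ge> 0" and LF': "\<And>t x. t \<in> {a..b} \<Longrightarrow> x \<in> cball (w t) R \<Longrightarrow> norm (F' t x) \<le> L"
    using L0 by (auto simp: L_def le_max_iff_disj)
  have lip: "norm (F t x - F t y) \<le> L * norm (x - y)"
    if "t \<in> {a..b}" "x \<in> cball (w t) R" "y \<in> cball (w t) R" for t x y
    by (rule field_differentiable_bound[of "cball (w t) R" "F t" "F' t"])
      (use that in \<open>auto intro!: has_field_derivative_at_within[OF F] LF'\<close>)
  \<comment> \<open>Initial values this close stay in the tube: growth by the factor
    \<open>exp (L * (b - a))\<close> uses up exactly the radius \<open>R\<close>.\<close>
  define \<epsilon> where "\<epsilon> = R * exp (- (L * (b - a)))"
  have \<epsilon>: "\<epsilon> > 0" using R by (simp add: \<epsilon>_def)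
  have \<epsilon>R: "\<epsilon> * exp (L * (t - a)) \<le> R" if "t \<in> {a..b}" for t
  proof -
    have "\<epsilon> * exp (L * (t - a)) = R * exp (L * (t - b))"
      by (simp add: \<epsilon>_def algebra_simps flip: exp_add)
    also have "\<dots> \<le> R * 1" using R L that by (intro mult_left_mono) (auto simp: mult_nonneg_nonpos)
    finally show ?thesis by simp
  qed
  define Z where "Z = ball (w a) \<epsilon>"
  \<comment> \<open>The iteration starts from the translate of \<open>w\<close> rather than from a
    constant, so that iterate 0 already lies in the tube.\<close>
  define u where "u n z = ((\<lambda>v t. z + integral {a..t} (\<lambda>s. F s (v s))) ^^ n) (\<lambda>t. w t + (z - w a))" for n z
  have u_0: "u 0 z t = w t + (z - w a)" for z t by (simp add: u_def)
  have u_Suc: "u (Suc n) z t = z + integral {a..t} (\<lambda>s. F s (u n z s))" for n z t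
    by (simp add: u_def)
  \<comment> \<open>These are the derivatives of the iterates in \<open>z\<close>, obtained by
    differentiating the recursion under the integral sign.\<close>
  define du where "du = rec_nat (\<lambda>z t. 1)
     (\<lambda>n d z t. 1 + integral {a..t} (\<lambda>s. F' s (u n z s) * d z s))"
  have du_0: "du 0 z t = 1" for z t by (simp add: du_def)
  have du_Suc: "du (Suc n) z t = 1 + integral {a..t} (\<lambda>s. F' s (u n z s) * du n z s)" for n z t
    by (simp add: du_def)
  \<comment> \<open>The bound reproduces itself under a Picard step, because \<epsilon> plus the
    integral of \<open>L * \<epsilon> * exp (L * (s - a))\<close> is again
    \<open>\<epsilon> * exp (L * (t - a))\<close>.\<close>
  have inv: "continuous_on ({a..b} \<times> Z) (\<lambda>(t, z). u n z t) \<and>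
      continuous_on ({a..b} \<times> Z) (\<lambda>(t, z). du n z t) \<and>
      (\<forall>t\<in>{a..b}. \<forall>z\<in>Z. norm (u n z t - w t) \<le> \<epsilon> * exp (L * (t - a)) \<and>
         ((\<lambda>z. u n z t) has_field_derivative du n z t) (at z))" for n
  proof (induction n)
    case 0
    have "norm (z - w a) \<le> \<epsilon> * exp (L * (t - a))" if "t \<in> {a..b}" "z \<in> Z" for t z
    proof -
      have "norm (z - w a) \<le> \<epsilon> * 1" using that by (auto simp: Z_def dist_norm norm_minus_commute)
      also have "\<dots> \<le> \<epsilon> * exp (L * (t - a))" using \<epsilon> L that by (intro mult_left_mono) auto
      finally show ?thesis .
    qed
    moreover have "continuous_on ({a..b} \<times> Z) (\<lambda>x. w (fst x))"
      by (intro continuous_on_compose2[OF contw] continuous_intros) auto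
    ultimately show ?case
      by (auto simp: u_0 du_0 case_prod_unfold intro!: continuous_intros derivative_eq_intros)
  next
    case (Suc n)
    then have cu: "continuous_on ({a..b} \<times> Z) (\<lambda>(t, z). u n z t)"
      and cdu: "continuous_on ({a..b} \<times> Z) (\<lambda>(t, z). du n z t)"
      and near: "\<And>t z. t \<in> {a..b} \<Longrightarrow> z \<in> Z \<Longrightarrow> norm (u n z t - w t) \<le> \<epsilon> * exp (L * (t - a))"
      and der: "\<And>t z. t \<in> {a..b} \<Longrightarrow> z \<in> Z \<Longrightarrow> ((\<lambda>z. u n z t) has_field_derivative du n z t) (at z)"
      by auto
    have tube: "u n z t \<in> cball (w t) R" if "t \<in> {a..b}" "z \<in> Z" for t z
      using near[OF that] \<epsilon>R[OF that(1)] by (simp add: dist_norm norm_minus_commute)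
    have cp: "continuous_on ({a..b} \<times> Z) (\<lambda>p. (fst p, u n (snd p) (fst p)))"
      using cu unfolding case_prod_unfold by (intro continuous_intros)
    have sp: "(\<lambda>p. (fst p, u n (snd p) (fst p))) ` ({a..b} \<times> Z) \<subseteq> ?K"
      using tube by (auto simp del: mem_cball)
    have cF: "continuous_on ({a..b} \<times> Z) (\<lambda>(s, z). F s (u n z s))"
      using continuous_on_compose2[OF contF cp sp] by (simp add: case_prod_unfold)
    have "continuous_on ({a..b} \<times> Z) (\<lambda>(s, z). F' s (u n z s))"
      using continuous_on_compose2[OF contF' cp sp] by (simp add: case_prod_unfold)
    then have cF': "continuous_on ({a..b} \<times> Z) (\<lambda>(s, z). F' s (u n z s) * du n z s)"
      using cdu unfolding case_prod_unfold by (intro continuous_intros)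
    have "continuous_on ({a..b} \<times> Z) (\<lambda>(t, z). u (Suc n) z t)"
      using continuous_on_param_indefinite_integral[OF cF]
      unfolding case_prod_unfold u_Suc by (intro continuous_intros)
    moreover have "continuous_on ({a..b} \<times> Z) (\<lambda>(t, z). du (Suc n) z t)"
      using continuous_on_param_indefinite_integral[OF cF']
      unfolding case_prod_unfold du_Suc by (intro continuous_intros)
    moreover have "norm (u (Suc n) z t - w t) \<le> \<epsilon> * exp (L * (t - a))"
      if t: "t \<in> {a..b}" and z: "z \<in> Z" for t z
    proof -
      have at: "{a..t} \<subseteq> {a..b}" using t by auto
      have iw: "((\<lambda>s. F s (w s)) has_integral w t - w a) {a..t}"
        using t by (intro fundamental_theorem_of_calculus)
          (auto intro: has_vector_derivative_within_subset[OF w at])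
      have "continuous_on {a..t} (\<lambda>s. (\<lambda>(s, z). F s (u n z s)) (s, z))"
        using t z by (intro continuous_on_compose2[OF cF] continuous_intros) auto
      then have iu: "(\<lambda>s. F s (u n z s)) integrable_on {a..t}"
        by (intro integrable_continuous_real) auto
      have ie: "((\<lambda>s. L * (\<epsilon> * exp (L * (s - a)))) has_integral
          \<epsilon> * exp (L * (t - a)) - \<epsilon> * exp (L * (a - a))) {a..t}"
        using t by (intro fundamental_theorem_of_calculus)
          (auto intro!: derivative_eq_intros simp flip: has_real_derivative_iff_has_vector_derivative)
      have "norm (integral {a..t} (\<lambda>s. F s (u n z s) - F s (w s)))
          \<le> integral {a..t} (\<lambda>s. L * (\<epsilon> * exp (L * (s - a))))"
      proof (rule integral_norm_bound_integral)
        show "(\<lambda>s. F s (u n z s) - F s (w s)) integrable_on {a..t}"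
          by (rule integrable_diff[OF iu has_integral_integrable[OF iw]])
        show "(\<lambda>s. L * (\<epsilon> * exp (L * (s - a)))) integrable_on {a..t}" using ie by blast
        fix s assume "s \<in> {a..t}"
        then have s: "s \<in> {a..b}" using at by blast
        have "norm (F s (u n z s) - F s (w s)) \<le> L * norm (u n z s - w s)"
          using lip[OF s tube[OF s z]] R by simp
        also have "\<dots> \<le> L * (\<epsilon> * exp (L * (s - a)))" using near[OF s z] L by (intro mult_left_mono)
        finally show "norm (F s (u n z s) - F s (w s)) \<le> L * (\<epsilon> * exp (L * (s - a)))" .
      qed
      also have "\<dots> = \<epsilon> * exp (L * (t - a)) - \<epsilon>" using integral_unique[OF ie] by simp
      finally have le: "norm (integral {a..t} (\<lambda>s. F s (u n z s) - F s (w s))) \<le> \<epsilon> * exp (L * (t - a)) - \<epsilon>" .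
      have "integral {a..t} (\<lambda>s. F s (u n z s) - F s (w s))
          = integral {a..t} (\<lambda>s. F s (u n z s)) - (w t - w a)"
        using integral_diff[OF iu has_integral_integrable[OF iw]] integral_unique[OF iw] by simp
      then have "u (Suc n) z t - w t = (z - w a) + integral {a..t} (\<lambda>s. F s (u n z s) - F s (w s))"
        by (simp add: u_Suc)
      then have "norm (u (Suc n) z t - w t) \<le>
          norm (z - w a) + norm (integral {a..t} (\<lambda>s. F s (u n z s) - F s (w s)))"
        by (simp only: norm_triangle_ineq)
      moreover have "norm (z - w a) \<le> \<epsilon>" using z by (simp add: Z_def dist_norm norm_minus_commute)
      ultimately show ?thesis using le by linarith
    qed
    moreover have "((\<lambda>z. u (Suc n) z t) has_field_derivative du (Suc n) z t) (at z)"
      if t: "t \<in> {a..b}" and z: "z \<in> Z" for t z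
    proof -
      have "((\<lambda>z. integral (cbox a t) (\<lambda>s. F s (u n z s))) has_field_derivative
          integral (cbox a t) (\<lambda>s. F' s (u n z s) * du n z s)) (at z within Z)"
      proof (rule leibniz_rule_field_derivative)
        fix z s assume z: "z \<in> Z" and s: "s \<in> cbox a t"
        then have s': "s \<in> {a..b}" using t by auto
        have "((\<lambda>z. F s (u n z s)) has_field_derivative F' s (u n z s) * du n z s) (at z)"
          using DERIV_chain2[OF F[OF s' tube[OF s' z]] der[OF s' z]] .
        then show "((\<lambda>z. F s (u n z s)) has_field_derivative F' s (u n z s) * du n z s) (at z within Z)"
          by (rule has_field_derivative_at_within)
      next
        fix z assume z: "z \<in> Z"
        have "continuous_on {a..t} (\<lambda>s. (\<lambda>(s, z). F s (u n z s)) (s, z))"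
          using t z by (intro continuous_on_compose2[OF cF] continuous_intros) auto
        then show "(\<lambda>s. F s (u n z s)) integrable_on cbox a t"
          by (auto intro!: integrable_continuous_real)
      next
        have "continuous_on (Z \<times> cbox a t) (\<lambda>p. (\<lambda>(s, z). F' s (u n z s) * du n z s) (snd p, fst p))"
          using t by (intro continuous_on_compose2[OF cF'] continuous_intros) auto
        then show "continuous_on (Z \<times> cbox a t) (\<lambda>(z, s). F' s (u n z s) * du n z s)"
          by (simp add: case_prod_unfold)
      qed (use z in \<open>auto simp: Z_def\<close>)
      moreover have "at z within Z = at z" using z by (intro at_within_open) (auto simp: Z_def)
      ultimately show ?thesis
        unfolding u_Suc du_Suc by (auto intro!: derivative_eq_intros)
    qed
    ultimately show ?case by blast
  qed
  have tube: "u n z t \<in> cball (w t) R" if t: "t \<in> {a..b}" and z: "z \<in> Z" for n t z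
  proof -
    have "norm (u n z t - w t) \<le> \<epsilon> * exp (L * (t - a))" using inv[of n] t z by blast
    also have "\<dots> \<le> R" by (rule \<epsilon>R[OF t])
    finally show ?thesis by (simp add: dist_norm norm_minus_commute)
  qed
  have cu: "continuous_on {a..b} (u n z)" if z: "z \<in> Z" for n z
  proof -
    have c: "continuous_on ({a..b} \<times> Z) (\<lambda>(t, z). u n z t)" using inv[of n] by blast
    have "continuous_on {a..b} (\<lambda>s. (\<lambda>(s, z). u n z s) (s, z))"
      by (rule continuous_on_compose2[OF c]) (use z in \<open>auto intro!: continuous_intros\<close>)
    then show ?thesis by simp
  qed
  have cF: "continuous_on {a..b} (\<lambda>s. F s (u n z s))" if z: "z \<in> Z" for n z
  proof -
    have "continuous_on {a..b} (\<lambda>s. (\<lambda>(s, x). F s x) (s, u n z s))"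
    proof (rule continuous_on_compose2[OF contF])
      show "continuous_on {a..b} (\<lambda>s. (s, u n z s))" by (intro continuous_intros cu z)
      show "(\<lambda>s. (s, u n z s)) ` {a..b} \<subseteq> ?K" using tube[OF _ z] by (auto simp del: mem_cball)
    qed
    then show ?thesis by simp
  qed
  define g where "g z = lim (\<lambda>n. u n z b)" for z
  have ulg: "uniform_limit Z (\<lambda>n z. u n z b) g sequentially"
    unfolding g_def
  proof (rule telescoping_uniform_limit)
    fix n z assume z: "z \<in> Z"
    have K: "norm (u 1 z t - u 0 z t) \<le> 2 * R" if "t \<in> {a..b}" for t
      using tube[OF that z, of 0] tube[OF that z, of 1] dist_triangle2[of "u 1 z t" "u 0 z t" "w t"]
      by (simp add: dist_norm norm_minus_commute)
    have "norm (u (Suc n) z b - u n z b) \<le> 2 * R * (L * (b - a)) ^ n / fact n"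
      by (rule picard_step_bound[where u = "\<lambda>n. u n z" and F = F and z = z and b = b,
            OF L cu[OF z] cF[OF z] u_Suc lip[OF _ tube[OF _ z] tube[OF _ z]] K])
        (use ab in auto)
    then show "norm (u (Suc n) z b - u n z b) \<le> 2 * R * ((L * (b - a)) ^ n / fact n)" by simp
  next
    show "summable (\<lambda>n. 2 * R * ((L * (b - a)) ^ n / fact n))"
      using summable_exp_generic[of "L * (b - a)"]
      by (intro summable_mult) (simp add: divide_inverse_commute scaleR_conv_of_real)
  qed
  have holu: "(\<lambda>z. u n z b) holomorphic_on Z" for n
  proof -
    have "b \<in> {a..b}" using ab by simp
    then have "((\<lambda>z. u n z b) has_field_derivative du n z b) (at z)" if "z \<in> Z" for z
      using inv[of n] that by blast
    then show ?thesis unfolding holomorphic_on_open[OF open_ball, of _ "w a" \<epsilon>, folded Z_def] by blast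
  qed
  have "\<exists>d>0. cball x d \<subseteq> Z \<and> uniform_limit (cball x d) (\<lambda>n z. u n z b) g sequentially"
    if x: "x \<in> Z" for x
  proof -
    have "open Z" by (simp add: Z_def)
    then obtain d where "d > 0" "cball x d \<subseteq> Z"
      using x open_contains_cball by blast
    then show ?thesis using uniform_limit_on_subset[OF ulg] by blast
  qed
  then have "g holomorphic_on Z"
    by (intro holomorphic_uniform_sequence[OF _ holu]) (simp_all add: Z_def)
  \<comment> \<open>The limit of the iterates is a solution in the tube with the same initial value,
    so Gronwall's inequality identifies it with \<open>v\<close>.\<close>
  moreover have "v b = g (v a)"
    if z: "v a \<in> Z" and v: "\<forall>t\<in>{a..b}. v t \<in> cball (w t) R \<and> (v has_vector_derivative F t (v t)) (at t within {a..b})"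
    for v
  proof -
    let ?v = "\<lambda>t. lim (\<lambda>n. u n (v a) t)"
    have pl: "?v t \<in> cball (w t) R" "(?v has_vector_derivative F t (?v t)) (at t within {a..b})" "?v a = v a"
      if t: "t \<in> {a..b}" for t
    proof -
      note pl = picard_limit[where D = "\<lambda>t. cball (w t) R" and u = "\<lambda>n. u n (v a)" and F = F and z = "v a",
          OF L ab cu[OF z] cF[OF z] u_Suc]
      show "?v t \<in> cball (w t) R"
        by (rule pl(2)[OF _ _ _ t]; (rule lip tube[OF _ z] closed_cball); assumption?)
      show "(?v has_vector_derivative F t (?v t)) (at t within {a..b})"
        by (rule pl(4)[OF _ _ _ t]; (rule lip tube[OF _ z] closed_cball); assumption?)
      show "?v a = v a"
        by (rule pl(3); (rule lip tube[OF _ z] closed_cball); assumption?)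
    qed
    have "norm (v b - ?v b) \<le> norm (v a - ?v a) * exp (L * (b - a))"
    proof (rule ode_dist_bound[where F = F and b = b])
      fix t assume t: "t \<in> {a..b}"
      show "(v has_vector_derivative F t (v t)) (at t within {a..b})" using v t by blast
      show "(?v has_vector_derivative F t (?v t)) (at t within {a..b})" by (rule pl(2)[OF t])
      show "norm (F t (v t) - F t (?v t)) \<le> L * norm (v t - ?v t)"
      proof (rule lip[OF t])
        show "v t \<in> cball (w t) R" using v t by blast
        show "?v t \<in> cball (w t) R" by (rule pl(1)[OF t])
      qed
    qed (use ab L in auto)
    moreover have "?v a = v a" using pl(3)[of a] ab by simp
    ultimately show ?thesis by (simp add: g_def)
  qed
  ultimately show ?thesis using \<epsilon> unfolding Z_def by blast
qed

section \<open>Generalized polar coordinates\<close>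


text \<open>The factor by which the weighted dilation with weights 2 and 3 moves the point
  \<open>(cos \<theta>, sin \<theta>)\<close> of the unit circle onto the curve
  \<open>C^6 + S^4 = 1\<close>. This choice of angle keeps the period \<open>2 * pi\<close> and the
  symmetries of \<open>cos\<close> and \<open>sin\<close>.\<close>

definition gR :: "real \<Rightarrow> real" where
  "gR \<theta> = (cos \<theta> ^ 6 + sin \<theta> ^ 4) powr (-1/12)"

definition gC :: "real \<Rightarrow> real" where "gC \<theta> = gR \<theta> ^ 2 * cos \<theta>"
definition gS :: "real \<Rightarrow> real" where "gS \<theta> = gR \<theta> ^ 3 * sin \<theta>"
text \<open>The speed factor that compares the angle with the natural time of
  \<open>C' = - 2 S^3\<close>, \<open>S' = 3 C^5\<close>. The formula comes from
  \<open>2 C S' - 3 S C'\<close>: with the factor it equals \<open>6 w (C^6 + S^4) = 6 w\<close>,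
  and in terms of \<open>gR\<close> the derivatives of \<open>gR\<close> cancel.\<close>

definition gw :: "real \<Rightarrow> real" where
  "gw \<theta> = gR \<theta> ^ 5 * (3 * sin \<theta> ^ 2 + 2 * cos \<theta> ^ 2) / 6"

lemma cos6_sin4_pos: "cos \<theta> ^ 6 + sin \<theta> ^ 4 > (0::real)"
proof -
  have "cos \<theta> ^ 6 \<noteq> 0 \<or> sin \<theta> ^ 4 \<noteq> 0"
    using sin_zero_norm_cos_one[of \<theta>] by auto
  moreover have "cos \<theta> ^ 6 \<ge> 0" "sin \<theta> ^ 4 \<ge> 0" by simp_all
  ultimately show ?thesis by linarith
qed

lemma gR_pos [simp]: "gR \<theta> > 0"
  using cos6_sin4_pos[of \<theta>] by (simp add: gR_def)

lemma gR_power12: "gR \<theta> ^ 12 * (cos \<theta> ^ 6 + sin \<theta> ^ 4) = 1"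
proof -
  have "gR \<theta> ^ 12 = (cos \<theta> ^ 6 + sin \<theta> ^ 4) powr -1"
    unfolding gR_def by (subst powr_power) (use cos6_sin4_pos[of \<theta>] in auto)
  then show ?thesis using cos6_sin4_pos[of \<theta>] by (simp add: powr_minus_divide)
qed

lemma gw_pos [simp]: "gw \<theta> > 0"
proof -
  have "3 * sin \<theta> ^ 2 + 2 * cos \<theta> ^ 2 = 2 * 1 + sin \<theta> ^ 2"
  proof -
    have "3 * sin \<theta> ^ 2 + 2 * cos \<theta> ^ 2 = 2 * (sin \<theta> ^ 2 + cos \<theta> ^ 2) + sin \<theta> ^ 2"
      by (simp only: distrib_left)
    then show ?thesis by (simp only: sin_cos_squared_add)
  qed
  moreover have "2 * 1 + sin \<theta> ^ 2 > 0" by (rule add_pos_nonneg) simp_all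
  ultimately have "3 * sin \<theta> ^ 2 + 2 * cos \<theta> ^ 2 > 0" by (simp only:)
  then show ?thesis by (simp add: gw_def)
qed

lemma gC_gS: "gC \<theta> ^ 6 + gS \<theta> ^ 4 = 1"
proof -
  have "gC \<theta> ^ 6 + gS \<theta> ^ 4 = gR \<theta> ^ 12 * (cos \<theta> ^ 6 + sin \<theta> ^ 4)"
    unfolding gC_def gS_def by algebra
  then show ?thesis by (simp only: gR_power12)
qed

lemma DERIV_gR:
  "(gR has_real_derivative
     - (1/12) * gR \<theta> ^ 13 * (4 * sin \<theta> ^ 3 * cos \<theta> - 6 * cos \<theta> ^ 5 * sin \<theta>)) (at \<theta>)"
proof -
  let ?h = "\<lambda>\<theta>::real. cos \<theta> ^ 6 + sin \<theta> ^ 4"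
  have "?h \<theta> powr (-1/12 - 1) = gR \<theta> ^ 13"
    unfolding gR_def by (subst powr_power) (use cos6_sin4_pos[of \<theta>] in auto)
  moreover have "((\<lambda>\<theta>. ?h \<theta> powr (-1/12)) has_real_derivative
      (-1/12) * ?h \<theta> powr (-1/12 - 1) * (4 * sin \<theta> ^ 3 * cos \<theta> - 6 * cos \<theta> ^ 5 * sin \<theta>)) (at \<theta>)"
    using cos6_sin4_pos[of \<theta>]
    by (auto intro!: derivative_eq_intros DERIV_fun_powr simp: algebra_simps)
  ultimately show ?thesis unfolding gR_def[abs_def] by simp
qed

lemma DERIV_gC: "(gC has_real_derivative - 2 * gS \<theta> ^ 3 * gw \<theta>) (at \<theta>)"
proof -
  have D: "(gC has_real_derivative
     2 * gR \<theta> * (- (1/12) * gR \<theta> ^ 13 * (4 * sin \<theta> ^ 3 * cos \<theta> - 6 * cos \<theta> ^ 5 * sin \<theta>)) * cos \<theta>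
     - gR \<theta> ^ 2 * sin \<theta>) (at \<theta>)"
    unfolding gC_def[abs_def] by (auto intro!: derivative_eq_intros DERIV_gR)
  have "2 * r * (- (1/12) * r ^ 13 * (4 * s ^ 3 * c - 6 * c ^ 5 * s)) * c - r ^ 2 * s
      = - 2 * (r ^ 3 * s) ^ 3 * (r ^ 5 * (3 * s ^ 2 + 2 * c ^ 2) / 6)"
    if "s ^ 2 + c ^ 2 = 1" "r ^ 12 * (c ^ 6 + s ^ 4) = 1" for r s c :: real
    using that by algebra
  from D[unfolded this[OF sin_cos_squared_add gR_power12]] show ?thesis
    unfolding gS_def gw_def .
qed

lemma DERIV_gS: "(gS has_real_derivative 3 * gC \<theta> ^ 5 * gw \<theta>) (at \<theta>)"
proof -
  have D: "(gS has_real_derivative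
     3 * gR \<theta> ^ 2 * (- (1/12) * gR \<theta> ^ 13 * (4 * sin \<theta> ^ 3 * cos \<theta> - 6 * cos \<theta> ^ 5 * sin \<theta>)) * sin \<theta>
     + gR \<theta> ^ 3 * cos \<theta>) (at \<theta>)"
    unfolding gS_def[abs_def] by (auto intro!: derivative_eq_intros DERIV_gR)
  have "3 * r ^ 2 * (- (1/12) * r ^ 13 * (4 * s ^ 3 * c - 6 * c ^ 5 * s)) * s + r ^ 3 * c
      = 3 * (r ^ 2 * c) ^ 5 * (r ^ 5 * (3 * s ^ 2 + 2 * c ^ 2) / 6)"
    if "s ^ 2 + c ^ 2 = 1" "r ^ 12 * (c ^ 6 + s ^ 4) = 1" for r s c :: real
    using that by algebra
  from D[unfolded this[OF sin_cos_squared_add gR_power12]] show ?thesis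
    unfolding gC_def gw_def .
qed

lemmas DERIV_gC' [derivative_intros] = DERIV_chain2[OF DERIV_gC]
lemmas DERIV_gS' [derivative_intros] = DERIV_chain2[OF DERIV_gS]

lemma continuous_on_gR: "continuous_on A gR"
  by (rule DERIV_continuous_on[OF has_field_derivative_at_within[OF DERIV_gR]])

lemma continuous_on_gC [continuous_intros]: "continuous_on A f \<Longrightarrow> continuous_on A (\<lambda>x. gC (f x))"
  by (rule continuous_on_compose2[OF DERIV_continuous_on[OF has_field_derivative_at_within[OF DERIV_gC]]]) auto

lemma continuous_on_gS [continuous_intros]: "continuous_on A f \<Longrightarrow> continuous_on A (\<lambda>x. gS (f x))"
  by (rule continuous_on_compose2[OF DERIV_continuous_on[OF has_field_derivative_at_within[OF DERIV_gS]]]) auto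

lemma continuous_on_gw [continuous_intros]: "continuous_on A f \<Longrightarrow> continuous_on A (\<lambda>x. gw (f x))"
  by (rule continuous_on_compose2[of UNIV gw])
    (auto simp: gw_def intro!: continuous_intros continuous_on_gR)

lemma g_periodic [simp]:
  "gC (\<theta> + 2 * pi) = gC \<theta>" "gS (\<theta> + 2 * pi) = gS \<theta>" "gw (\<theta> + 2 * pi) = gw \<theta>"
  by (simp_all add: gC_def gS_def gw_def gR_def)

lemma g_shift [simp]:
  "gC (\<theta> + pi) = - gC \<theta>" "gS (\<theta> + pi) = - gS \<theta>" "gw (\<theta> + pi) = gw \<theta>"
  by (simp_all add: gC_def gS_def gw_def gR_def)

lemma g_minus [simp]:
  "gC (- \<theta>) = gC \<theta>" "gS (- \<theta>) = - gS \<theta>" "gw (- \<theta>) = gw \<theta>"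
  by (simp_all add: gC_def gS_def gw_def gR_def)

lemma g_0 [simp]: "gC 0 = 1" "gS 0 = 0"
  by (simp_all add: gC_def gS_def gR_def)

lemma g_int_periodic:
  fixes n :: int
  shows "gC (\<theta> + 2 * pi * of_int n) = gC \<theta>" "gS (\<theta> + 2 * pi * of_int n) = gS \<theta>"
  using sin_cos_eq_iff[of "\<theta> + 2 * pi * of_int n" \<theta>]
  by (auto simp: gC_def gS_def gR_def)

section \<open>The polar parametrization, periodic functions and uniqueness of orbits\<close>

definition pt :: "real \<Rightarrow> real \<Rightarrow> real \<times> real" where
  "pt \<theta> \<rho> = (\<rho> ^ 2 * gC \<theta>, \<rho> ^ 3 * gS \<theta>)"

text \<open>A weighted dilation by \<open>q < 1\<close> moves the unit circle strictly inside
  itself, since \<open>q^4 cos^2 + q^6 sin^2 \<le> q^4 < 1\<close>.\<close>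

lemma weighted_circle_unique:
  fixes r r' :: real
  assumes "r > 0" "r' > 0" "r ^ 2 * cos a = r' ^ 2 * cos b" "r ^ 3 * sin a = r' ^ 3 * sin b"
  shows "r = r'"
proof -
  have less: False if "r < r'" "r > 0" "r ^ 2 * cos a = r' ^ 2 * cos b" "r ^ 3 * sin a = r' ^ 3 * sin b"
    for r r' a b :: real
  proof -
    define q where "q = r / r'"
    have q: "0 < q" "q < 1" using that by (auto simp: q_def)
    have r: "r = q * r'" using that by (simp add: q_def)
    have cb: "cos b = q ^ 2 * cos a" and sb: "sin b = q ^ 3 * sin a"
      using that(2-4) q unfolding r by (auto simp: power_mult_distrib)
    have "1 = q ^ 4 * cos a ^ 2 + q ^ 6 * sin a ^ 2"
      using sin_cos_squared_add[of b] unfolding cb sb by (simp add: power_mult_distrib flip: power_mult)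
    also have "\<dots> \<le> q ^ 4 * cos a ^ 2 + q ^ 4 * sin a ^ 2"
      using q by (intro add_left_mono mult_right_mono power_decreasing) auto
    also have "\<dots> = q ^ 4" using sin_cos_squared_add2[of a] by (simp flip: distrib_left)
    also have "\<dots> < 1" using q by (simp add: power_less_one_iff)
    finally show False by simp
  qed
  show ?thesis using less[of r r' a b] less[of r' r b a] assms by (metis linorder_neqE)
qed

lemma pt_eq:
  assumes "pt a r = pt b r'" "r > 0" "r' > 0"
  shows "r = r'" and "\<exists>n::int. a = b + 2 * pi * n"
proof -
  have e: "(r * gR a) ^ 2 * cos a = (r' * gR b) ^ 2 * cos b" "(r * gR a) ^ 3 * sin a = (r' * gR b) ^ 3 * sin b"
    using assms(1) by (simp_all add: pt_def gC_def gS_def power_mult_distrib)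
  have R: "r * gR a = r' * gR b"
    by (rule weighted_circle_unique[OF _ _ e]) (use assms in auto)
  have pos: "r' * gR b > 0" using assms by simp
  have "cos a = cos b" "sin a = sin b"
    using e pos unfolding R by auto
  then show ex: "\<exists>n::int. a = b + 2 * pi * n"
    using sin_cos_eq_iff[of a b] by auto
  have "gR a = gR b" using \<open>cos a = cos b\<close> \<open>sin a = sin b\<close> by (simp add: gR_def)
  then show "r = r'" using R gR_pos[of b] by simp
qed

lemma periodic_shift_int:
  fixes \<phi> :: "real \<Rightarrow> 'a"
  assumes "\<And>t. \<phi> (t + T) = \<phi> t"
  shows "\<phi> (t + of_int n * T) = \<phi> t"
proof -
  have nat: "\<phi> (t + of_nat k * T) = \<phi> t" for k t
  proof (induction k)
    case (Suc k)
    have "\<phi> (t + of_nat (Suc k) * T) = \<phi> ((t + of_nat k * T) + T)" by (simp add: algebra_simps)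
    then show ?case using Suc assms by simp
  qed simp
  show ?thesis
  proof (cases "n \<ge> 0")
    case True
    then show ?thesis using nat[of t "nat n"] by simp
  next
    case False
    then have "\<phi> ((t + of_int n * T) + of_nat (nat (- n)) * T) = \<phi> t" by (simp add: algebra_simps)
    then show ?thesis using nat by simp
  qed
qed

lemma periodic_representative:
  fixes T :: real
  assumes "T > 0"
  obtains n :: int where "s \<le> t + of_int n * T" "t + of_int n * T < s + T"
proof -
  define q where "q = (t - s) / T"
  have t: "t = s + q * T" using assms by (simp add: q_def)
  have "of_int \<lfloor>q\<rfloor> * T \<le> q * T" using assms by (intro mult_right_mono) auto
  then have 1: "s \<le> t + of_int (- \<lfloor>q\<rfloor>) * T" using t by simp
  have "q * T < (of_int \<lfloor>q\<rfloor> + 1) * T" using assms by (intro mult_strict_right_mono) linarith+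
  then have "t + of_int (- \<lfloor>q\<rfloor>) * T < s + T"
    using t by (simp add: distrib_right)
  with 1 show thesis by (rule that)
qed

text \<open>A periodic trajectory sweeps out its orbit on every forward half line. Hence uniqueness
  forwards in time is enough to compare whole orbits.\<close>

lemma periodic_range:
  fixes \<phi> :: "real \<Rightarrow> 'a"
  assumes "\<And>t. \<phi> (t + T) = \<phi> t" "T > 0"
  shows "range \<phi> = (\<lambda>t. \<phi> (s + t)) ` {0..}"
proof (intro equalityI subsetI)
  fix p assume "p \<in> range \<phi>"
  then obtain t where t: "p = \<phi> t" by blast
  obtain n :: int where "s \<le> t + of_int n * T" "t + of_int n * T < s + T"
    by (rule periodic_representative[OF assms(2)])
  then show "p \<in> (\<lambda>t. \<phi> (s + t)) ` {0..}"
    using periodic_shift_int[where \<phi> = \<phi>, OF assms(1), of t n] t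
    by (intro image_eqI[of _ _ "t + of_int n * T - s"]) auto
qed auto

lemma periodic_bounded_range:
  fixes \<phi> :: "real \<Rightarrow> 'a::metric_space"
  assumes "\<And>t. \<phi> (t + T) = \<phi> t" "T > 0" "continuous_on UNIV \<phi>"
  shows "compact (range \<phi>)"
proof -
  have "range \<phi> = \<phi> ` {0..T}"
  proof (intro equalityI subsetI)
    fix p assume "p \<in> range \<phi>"
    then obtain t where t: "p = \<phi> t" by blast
    obtain n :: int where "0 \<le> t + of_int n * T" "t + of_int n * T < 0 + T"
      by (rule periodic_representative[OF assms(2)])
    then show "p \<in> \<phi> ` {0..T}"
      using periodic_shift_int[where \<phi> = \<phi>, OF assms(1), of t n] t
      by (intro image_eqI[of _ _ "t + of_int n * T"]) auto
  qed auto
  then show ?thesis using assms(3) by (auto intro: compact_continuous_image continuous_on_subset)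
qed

lemma flow_unique:
  fixes f :: "'a::banach \<Rightarrow> 'a"
  assumes lip: "\<And>B. \<exists>L\<ge>0. \<forall>x\<in>cball 0 B. \<forall>y\<in>cball 0 B. norm (f x - f y) \<le> L * norm (x - y)"
    and \<phi>: "\<And>t. t \<ge> 0 \<Longrightarrow> (\<phi> has_vector_derivative f (\<phi> t)) (at t within {0..})"
    and \<psi>: "\<And>t. t \<ge> 0 \<Longrightarrow> (\<psi> has_vector_derivative f (\<psi> t)) (at t within {0..})"
    and init: "\<phi> 0 = \<psi> 0" and t: "t \<ge> 0"
  shows "\<phi> t = \<psi> t"
proof -
  have sub: "{0..t} \<subseteq> {0..}" by auto
  have cont: "continuous_on {0..t} \<phi>" "continuous_on {0..t} \<psi>"
    using has_vector_derivative_continuous[OF \<phi>] has_vector_derivative_continuous[OF \<psi>]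
    by (auto simp: continuous_on_eq_continuous_within intro: continuous_within_subset[OF _ sub])
  have "bounded (\<phi> ` {0..t} \<union> \<psi> ` {0..t})"
    by (intro compact_imp_bounded compact_Un compact_continuous_image cont compact_Icc)
  then obtain B where "\<forall>x\<in>\<phi> ` {0..t} \<union> \<psi> ` {0..t}. norm x \<le> B"
    unfolding bounded_iff by blast
  then have B: "\<And>s. s \<in> {0..t} \<Longrightarrow> \<phi> s \<in> cball 0 B" "\<And>s. s \<in> {0..t} \<Longrightarrow> \<psi> s \<in> cball 0 B"
    by auto
  obtain L where L: "L \<ge> 0" "\<And>x y. x \<in> cball 0 B \<Longrightarrow> y \<in> cball 0 B \<Longrightarrow> norm (f x - f y) \<le> L * norm (x - y)"
    using lip[of B] by blast
  have "norm (\<phi> t - \<psi> t) \<le> norm (\<phi> 0 - \<psi> 0) * exp (L * (t - 0))"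
  proof (rule ode_dist_bound[where F = "\<lambda>_. f" and b = t])
    fix s assume s: "s \<in> {0..t}"
    show "(\<phi> has_vector_derivative f (\<phi> s)) (at s within {0..t})"
      using s by (intro has_vector_derivative_within_subset[OF \<phi> sub]) auto
    show "(\<psi> has_vector_derivative f (\<psi> s)) (at s within {0..t})"
      using s by (intro has_vector_derivative_within_subset[OF \<psi> sub]) auto
    show "norm (f (\<phi> s) - f (\<psi> s)) \<le> L * norm (\<phi> s - \<psi> s)" using L(2) B s by blast
  qed (use t L in auto)
  then show ?thesis using init by simp
qed

lemma has_vector_derivative_shift:
  assumes "\<And>t. (\<phi> has_vector_derivative f (\<phi> t)) (at t)"
  shows "((\<lambda>t. \<phi> (s + t)) has_vector_derivative f (\<phi> (s + t))) (at t within S)"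
proof -
  have "((\<lambda>t. s + t) has_vector_derivative 1) (at t within S)"
    by (auto intro!: derivative_eq_intros simp flip: has_real_derivative_iff_has_vector_derivative)
  from vector_diff_chain_within[OF this has_vector_derivative_at_within[OF assms]]
  have "((\<phi> \<circ> (\<lambda>t. s + t)) has_vector_derivative 1 *\<^sub>R f (\<phi> (s + t))) (at t within S)" .
  then show ?thesis by (simp add: o_def)
qed

text \<open>From a common point on, both trajectories coincide, and these forward halves already
  fill both orbits.\<close>

lemma periodic_orbit_eq:
  fixes f :: "'a::banach \<Rightarrow> 'a"
  assumes lip: "\<And>B. \<exists>L\<ge>0. \<forall>x\<in>cball 0 B. \<forall>y\<in>cball 0 B. norm (f x - f y) \<le> L * norm (x - y)"
    and "periodic_orbit f \<Gamma>" "periodic_orbit f \<Gamma>'" "\<Gamma> \<inter> \<Gamma>' \<noteq> {}"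
  shows "\<Gamma> = \<Gamma>'"
proof -
  obtain \<phi> T where \<phi>: "\<And>t. (\<phi> has_vector_derivative f (\<phi> t)) (at t)" "T > 0" "\<And>t. \<phi> (t + T) = \<phi> t" "\<Gamma> = range \<phi>"
    using assms(2) unfolding periodic_orbit_def by blast
  obtain \<psi> S where \<psi>: "\<And>t. (\<psi> has_vector_derivative f (\<psi> t)) (at t)" "S > 0" "\<And>t. \<psi> (t + S) = \<psi> t" "\<Gamma>' = range \<psi>"
    using assms(3) unfolding periodic_orbit_def by blast
  obtain p where "p \<in> range \<phi>" "p \<in> range \<psi>" using assms(4) unfolding \<phi>(4) \<psi>(4) by blast
  then obtain r s where rs: "\<phi> r = \<psi> s" by auto
  have eq: "\<phi> (r + t) = \<psi> (s + t)" if t: "t \<ge> 0" for t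
  proof -
    have 0: "\<phi> (r + 0) = \<psi> (s + 0)" by (simp add: rs)
    note d = has_vector_derivative_shift[of \<phi> f r, OF \<phi>(1)] has_vector_derivative_shift[of \<psi> f s, OF \<psi>(1)]
    show ?thesis
      by (rule flow_unique[of f "\<lambda>t. \<phi> (r + t)" "\<lambda>t. \<psi> (s + t)" t, OF lip d(1) d(2) 0 t])
  qed
  show ?thesis
    unfolding \<phi>(4) \<psi>(4) periodic_range[where \<phi> = \<phi>, OF \<phi>(3,2), of r] periodic_range[where \<phi> = \<psi>, OF \<psi>(3,2), of s]
    by (intro image_cong) (simp_all add: eq)
qed

lemma pt_continuous [continuous_intros]:
  "continuous_on A f \<Longrightarrow> continuous_on A g \<Longrightarrow> continuous_on A (\<lambda>x. pt (f x) (g x))"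
  unfolding pt_def by (intro continuous_intros)

definition annulus :: "(real \<Rightarrow> real) \<Rightarrow> (real \<Rightarrow> real) \<Rightarrow> (real \<times> real) set" where
  "annulus a b = {pt \<theta> \<rho> |\<theta> \<rho>. a \<theta> < \<rho> \<and> \<rho> < b \<theta>}"

text \<open>On an angular strip of width \<open>2 * pi\<close> the map \<open>pt\<close> is
  injective, so invariance of domain applies; strips around all angles cover the annulus.\<close>

lemma open_annulus:
  assumes a: "continuous_on UNIV a" "\<And>\<theta>. a \<theta> > 0" and b: "continuous_on UNIV b"
  shows "open (annulus a b)"
proof -
  let ?S = "\<lambda>c. {p :: real \<times> real. c < fst p \<and> fst p < c + 2 * pi \<and> a (fst p) < snd p \<and> snd p < b (fst p)}"
  have "open ((\<lambda>p. pt (fst p) (snd p)) ` ?S c)" for c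
  proof (rule invariance_of_domain)
    show "continuous_on (?S c) (\<lambda>p. pt (fst p) (snd p))" by (intro continuous_intros)
    have "continuous_on UNIV (\<lambda>p::real \<times> real. a (fst p))" "continuous_on UNIV (\<lambda>p::real \<times> real. b (fst p))"
      by (rule continuous_on_compose2[OF a(1)] continuous_on_compose2[OF b]; auto intro!: continuous_intros)+
    then show "open (?S c)"
      by (intro open_Collect_conj open_Collect_less continuous_intros)
    show "inj_on (\<lambda>p. pt (fst p) (snd p)) (?S c)"
    proof (rule inj_onI)
      fix p q assume p: "p \<in> ?S c" and q: "q \<in> ?S c" and e: "pt (fst p) (snd p) = pt (fst q) (snd q)"
      have pos: "snd p > 0" "snd q > 0" using p q a(2)[of "fst p"] a(2)[of "fst q"] by auto
      obtain n :: int where n: "fst p = fst q + 2 * pi * n" using pt_eq(2)[OF e pos] by blast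
      have "\<bar>2 * pi * of_int n\<bar> < 2 * pi * 1" using p q n by auto
      then have "\<bar>of_int n :: real\<bar> < 1" by (simp add: abs_mult)
      then have "n = 0" by linarith
      then show "p = q" using n pt_eq(1)[OF e pos] by (simp add: prod_eq_iff)
    qed
  qed
  then have "open (\<Union>c. (\<lambda>p. pt (fst p) (snd p)) ` ?S c)" by blast
  moreover have "(\<Union>c. (\<lambda>p. pt (fst p) (snd p)) ` ?S c) = annulus a b"
  proof (intro equalityI subsetI)
    fix x assume "x \<in> annulus a b"
    then obtain \<theta> \<rho> where *: "x = pt \<theta> \<rho>" "a \<theta> < \<rho>" "\<rho> < b \<theta>" by (auto simp: annulus_def)
    then have "x \<in> (\<lambda>p. pt (fst p) (snd p)) ` ?S (\<theta> - pi)"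
      by (intro image_eqI[of _ _ "(\<theta>, \<rho>)"]) auto
    then show "x \<in> (\<Union>c. (\<lambda>p. pt (fst p) (snd p)) ` ?S c)" by blast
  qed (auto simp: annulus_def)
  ultimately show ?thesis by simp
qed

section \<open>Limit cycles between transversal curves\<close>


definition pt_rho :: "real \<Rightarrow> real \<Rightarrow> real \<times> real" where
  "pt_rho \<theta> \<rho> = (2 * \<rho> * gC \<theta>, 3 * \<rho> ^ 2 * gS \<theta>)"

definition pt_theta :: "real \<Rightarrow> real \<Rightarrow> real \<times> real" where
  "pt_theta \<theta> \<rho> = (- 2 * \<rho> ^ 2 * gS \<theta> ^ 3 * gw \<theta>, 3 * \<rho> ^ 3 * gC \<theta> ^ 5 * gw \<theta>)"

lemma pt_int_periodic: "pt (\<theta> + 2 * pi * of_int n) \<rho> = pt \<theta> \<rho>"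
  by (simp add: pt_def g_int_periodic)

lemma pt_has_vector_derivative:
  assumes \<tau>: "(\<tau> has_real_derivative \<tau>') (at t within S)" and v: "(v has_real_derivative v') (at t within S)"
  shows "((\<lambda>t. pt (\<tau> t) (v t)) has_vector_derivative \<tau>' *\<^sub>R pt_theta (\<tau> t) (v t) + v' *\<^sub>R pt_rho (\<tau> t) (v t))
    (at t within S)"
proof -
  have "((\<lambda>t. v t ^ 2 * gC (\<tau> t)) has_real_derivative
      \<tau>' * (- 2 * v t ^ 2 * gS (\<tau> t) ^ 3 * gw (\<tau> t)) + v' * (2 * v t * gC (\<tau> t))) (at t within S)"
    by (auto intro!: derivative_eq_intros \<tau> v simp: algebra_simps)
  moreover have "((\<lambda>t. v t ^ 3 * gS (\<tau> t)) has_real_derivative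
      \<tau>' * (3 * v t ^ 3 * gC (\<tau> t) ^ 5 * gw (\<tau> t)) + v' * (3 * v t ^ 2 * gS (\<tau> t))) (at t within S)"
    by (auto intro!: derivative_eq_intros \<tau> v simp: algebra_simps)
  ultimately have "((\<lambda>t. (v t ^ 2 * gC (\<tau> t), v t ^ 3 * gS (\<tau> t))) has_vector_derivative
      (\<tau>' * (- 2 * v t ^ 2 * gS (\<tau> t) ^ 3 * gw (\<tau> t)) + v' * (2 * v t * gC (\<tau> t)),
       \<tau>' * (3 * v t ^ 3 * gC (\<tau> t) ^ 5 * gw (\<tau> t)) + v' * (3 * v t ^ 2 * gS (\<tau> t)))) (at t within S)"
    by (intro has_vector_derivative_Pair) (simp_all add: has_real_derivative_iff_has_vector_derivative)
  then show ?thesis by (simp add: pt_def pt_theta_def pt_rho_def)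
qed

text \<open>Here \<open>d\<close> is the angular speed, positive so that the angle can replace time,
  and \<open>F\<close> is the slope of the orbits. \<open>G\<close> continues \<open>F\<close> to
  complex radii in an open set \<Omega>. All polar data are restricted to radii below
  \<open>R\<close>, whereas the Lipschitz condition on \<open>f\<close> is global on balls.\<close>

locale polar_system =
  fixes f :: "real \<times> real \<Rightarrow> real \<times> real" and F d :: "real \<Rightarrow> real \<Rightarrow> real"
    and G G' :: "real \<Rightarrow> complex \<Rightarrow> complex" and \<Omega> :: "(real \<times> complex) set" and R :: real
  assumes lip: "\<And>B. \<exists>L\<ge>0. \<forall>x\<in>cball 0 B. \<forall>y\<in>cball 0 B. norm (f x - f y) \<le> L * norm (x - y)"
    and field: "\<And>\<theta> \<rho>. 0 < \<rho> \<Longrightarrow> \<rho> < R \<Longrightarrow> f (pt \<theta> \<rho>) = d \<theta> \<rho> *\<^sub>R (pt_theta \<theta> \<rho> + F \<theta> \<rho> *\<^sub>R pt_rho \<theta> \<rho>)"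
    and d_pos: "\<And>\<theta> \<rho>. 0 < \<rho> \<Longrightarrow> \<rho> < R \<Longrightarrow> d \<theta> \<rho> > 0"
    and d_cont: "continuous_on (UNIV \<times> {0<..<R}) (\<lambda>(\<theta>, \<rho>). d \<theta> \<rho>)"
    and d_per: "\<And>\<theta> \<rho>. d (\<theta> + 2 * pi) \<rho> = d \<theta> \<rho>"
    and F_per: "\<And>\<theta> \<rho>. F (\<theta> + 2 * pi) \<rho> = F \<theta> \<rho>"
    and \<Omega>: "open \<Omega>" "\<And>\<theta> \<rho>. 0 < \<rho> \<Longrightarrow> \<rho> < R \<Longrightarrow> (\<theta>, of_real \<rho>) \<in> \<Omega>"
    and G_cont: "continuous_on \<Omega> (\<lambda>(\<theta>, z). G \<theta> z)"
    and G'_cont: "continuous_on \<Omega> (\<lambda>(\<theta>, z). G' \<theta> z)"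
    and G_deriv: "\<And>\<theta> z. (\<theta>, z) \<in> \<Omega> \<Longrightarrow> (G \<theta> has_field_derivative G' \<theta> z) (at z)"
    and G_F: "\<And>\<theta> \<rho>. 0 < \<rho> \<Longrightarrow> \<rho> < R \<Longrightarrow> G \<theta> (of_real \<rho>) = of_real (F \<theta> \<rho>)"
begin

lemma F_int_per: "F (\<theta> + 2 * pi * of_int n) \<rho> = F \<theta> \<rho>"
  using periodic_shift_int[where \<phi> = "\<lambda>\<theta>. F \<theta> \<rho>" and T = "2 * pi", OF F_per] by (simp add: mult.commute)

lemma d_int_per: "d (\<theta> + 2 * pi * of_int n) \<rho> = d \<theta> \<rho>"
  using periodic_shift_int[where \<phi> = "\<lambda>\<theta>. d \<theta> \<rho>" and T = "2 * pi", OF d_per] by (simp add: mult.commute)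

lemma representative: obtains n :: int where "0 \<le> \<theta> + 2 * pi * of_int n" "\<theta> + 2 * pi * of_int n \<le> 2 * pi"
proof -
  obtain n :: int where "0 \<le> \<theta> + of_int n * (2 * pi)" "\<theta> + of_int n * (2 * pi) < 0 + 2 * pi"
    by (rule periodic_representative[of "2 * pi" 0 \<theta>]) simp
  then show thesis by (intro that[of n]) (simp_all add: mult.commute)
qed

lemma F_cont: "continuous_on (UNIV \<times> {0<..<R}) (\<lambda>p. F (fst p) (snd p))"
proof -
  have "continuous_on (UNIV \<times> {0<..<R}) (\<lambda>p. Re ((\<lambda>(\<theta>, z). G \<theta> z) (fst p, of_real (snd p))))"
    by (intro continuous_on_Re continuous_on_compose2[OF G_cont] continuous_intros) (auto intro: \<Omega>)
  then show ?thesis by (rule continuous_on_eq) (auto simp: G_F)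
qed

lemma F_lipschitz:
  assumes "0 < \<alpha>" "\<beta> < R"
  shows "\<exists>L\<ge>0. \<forall>\<theta>. \<forall>x\<in>{\<alpha>..\<beta>}. \<forall>y\<in>{\<alpha>..\<beta>}. \<bar>F \<theta> x - F \<theta> y\<bar> \<le> L * \<bar>x - y\<bar>"
proof -
  have "continuous_on ({0..2 * pi} \<times> {\<alpha>..\<beta>}) (\<lambda>p. (\<lambda>(\<theta>, z). G' \<theta> z) (fst p, of_real (snd p)))"
    using assms by (intro continuous_on_compose2[OF G'_cont] continuous_intros) (auto intro: \<Omega>)
  then have "bounded ((\<lambda>p. G' (fst p) (of_real (snd p))) ` ({0..2 * pi} \<times> {\<alpha>..\<beta>}))"
    by (intro compact_imp_bounded compact_continuous_image compact_Times compact_Icc) simp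
  then obtain L where L: "\<forall>q\<in>(\<lambda>p. G' (fst p) (of_real (snd p))) ` ({0..2 * pi} \<times> {\<alpha>..\<beta>}). norm q \<le> L"
    unfolding bounded_iff by blast
  have *: "\<bar>F \<theta> x - F \<theta> y\<bar> \<le> max 0 L * \<bar>x - y\<bar>" if x: "x \<in> {\<alpha>..\<beta>}" and y: "y \<in> {\<alpha>..\<beta>}" for \<theta> x y
  proof -
    obtain n :: int where n: "0 \<le> \<theta> + 2 * pi * of_int n" "\<theta> + 2 * pi * of_int n \<le> 2 * pi"
      by (rule representative)
    define \<eta> where "\<eta> = \<theta> + 2 * pi * of_int n"
    have "norm (G \<eta> (of_real x) - G \<eta> (of_real y)) \<le> max 0 L * norm (of_real x - of_real y :: complex)"
    \<comment> \<open>Only a complex derivative is available, so the mean value estimate is made on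
      the real segment regarded as a convex set of complex numbers.\<close>
    proof (rule field_differentiable_bound[of "of_real ` {\<alpha>..\<beta>}" "G \<eta>" "G' \<eta>"])
      show "convex (complex_of_real ` {\<alpha>..\<beta>})"
        by (intro convex_linear_image bounded_linear.linear[OF bounded_linear_of_real] convex_real_interval)
      fix z :: complex assume "z \<in> of_real ` {\<alpha>..\<beta>}"
      then obtain r where r: "z = of_real r" "r \<in> {\<alpha>..\<beta>}" by blast
      then show "(G \<eta> has_field_derivative G' \<eta> z) (at z within of_real ` {\<alpha>..\<beta>})"
        using assms by (intro has_field_derivative_at_within[OF G_deriv]) (auto intro: \<Omega>)
      have "norm (G' \<eta> z) \<le> L"
        using L n r by (force simp: \<eta>_def)
      then show "norm (G' \<eta> z) \<le> max 0 L" by simp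
    qed (use x y in auto)
    moreover have "G \<eta> (of_real x) = of_real (F \<eta> x)" "G \<eta> (of_real y) = of_real (F \<eta> y)"
      using x y assms by (auto intro!: G_F)
    ultimately have "\<bar>F \<eta> x - F \<eta> y\<bar> \<le> max 0 L * \<bar>x - y\<bar>"
      by (simp only: of_real_diff[symmetric] norm_of_real)
    then show ?thesis by (simp add: \<eta>_def F_int_per)
  qed
  show ?thesis by (intro exI[of _ "max 0 L"] conjI allI ballI *) auto
qed

lemma d_bounded:
  assumes "0 < \<alpha>" "\<beta> < R"
  shows "\<exists>M. \<forall>\<theta>. \<forall>\<rho>\<in>{\<alpha>..\<beta>}. d \<theta> \<rho> \<le> M"
proof -
  have "continuous_on ({0..2 * pi} \<times> {\<alpha>..\<beta>}) (\<lambda>(\<theta>, \<rho>). d \<theta> \<rho>)"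
    by (rule continuous_on_subset[OF d_cont]) (use assms in auto)
  then have "bounded ((\<lambda>(\<theta>, \<rho>). d \<theta> \<rho>) ` ({0..2 * pi} \<times> {\<alpha>..\<beta>}))"
    by (intro compact_imp_bounded compact_continuous_image compact_Times compact_Icc)
  then obtain M where M: "\<forall>q\<in>(\<lambda>(\<theta>, \<rho>). d \<theta> \<rho>) ` ({0..2 * pi} \<times> {\<alpha>..\<beta>}). norm q \<le> M"
    unfolding bounded_iff by blast
  have "d \<theta> \<rho> \<le> M" if \<rho>: "\<rho> \<in> {\<alpha>..\<beta>}" for \<theta> \<rho>
  proof -
    obtain n :: int where n: "0 \<le> \<theta> + 2 * pi * of_int n" "\<theta> + 2 * pi * of_int n \<le> 2 * pi"
      by (rule representative)
    then have "norm (d (\<theta> + 2 * pi * of_int n) \<rho>) \<le> M" using M \<rho> by force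
    then show ?thesis by (simp add: d_int_per)
  qed
  then show ?thesis by blast
qed

end

locale attracting_annulus = polar_system +
  fixes a b :: "real \<Rightarrow> real"
  assumes a_pos: "\<And>\<theta>. 0 < a \<theta>" and ab: "\<And>\<theta>. a \<theta> < b \<theta>" and bR: "\<And>\<theta>. b \<theta> < R"
    and a_per: "\<And>\<theta>. a (\<theta> + 2 * pi) = a \<theta>" and b_per: "\<And>\<theta>. b (\<theta> + 2 * pi) = b \<theta>"
    and a_der: "\<And>\<theta>. \<exists>a'. (a has_real_derivative a') (at \<theta>) \<and> a' < F \<theta> (a \<theta>)"
    and b_der: "\<And>\<theta>. \<exists>b'. (b has_real_derivative b') (at \<theta>) \<and> b' > F \<theta> (b \<theta>)"
begin

lemma a_cont: "continuous_on A a" and b_cont: "continuous_on A b"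
  using a_der b_der by (meson DERIV_atLeastAtMost_imp_continuous_on DERIV_continuous continuous_at_imp_continuous_on)+

lemma a_int_per: "a (\<theta> + 2 * pi * of_int n) = a \<theta>"
  using periodic_shift_int[where \<phi> = a and T = "2 * pi", OF a_per] by (simp add: mult.commute)

lemma b_int_per: "b (\<theta> + 2 * pi * of_int n) = b \<theta>"
  using periodic_shift_int[where \<phi> = b and T = "2 * pi", OF b_per] by (simp add: mult.commute)

lemma bounds: obtains \<alpha> \<beta> where "0 < \<alpha>" "\<beta> < R" "\<alpha> \<le> \<beta>" "\<And>\<theta>. \<alpha> \<le> a \<theta>" "\<And>\<theta>. b \<theta> \<le> \<beta>"
proof -
  have "compact (range a)" "compact (range b)"
    by (rule periodic_bounded_range[of _ "2 * pi"]; simp add: a_per b_per a_cont b_cont)+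
  then obtain s t where st: "\<And>\<theta>. a s \<le> a \<theta>" "\<And>\<theta>. b \<theta> \<le> b t"
    using compact_attains_inf[of "range a"] compact_attains_sup[of "range b"] by auto
  show thesis
  proof (rule that)
    show "a s \<le> b t" using st(1)[of t] ab[of t] by linarith
  qed (use a_pos bR st in auto)
qed

section \<open>Solutions of the scalar equation between the two curves\<close>

definition sol :: "real \<Rightarrow> (real \<Rightarrow> real) \<Rightarrow> bool" where
  "sol s u \<longleftrightarrow> (\<forall>\<theta>\<ge>s. (u has_real_derivative F \<theta> (u \<theta>)) (at \<theta> within {s..}) \<and> a \<theta> \<le> u \<theta> \<and> u \<theta> \<le> b \<theta>)"

text \<open>The right-hand side \<open>H\<close> has to agree with \<open>F\<close> on the two
  curves only, so the trapping argument applies to the truncated equation before its solution is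
  known to solve the original one.\<close>

lemma crossing:
  assumes u: "\<And>\<theta>. \<theta> \<ge> s \<Longrightarrow> (u has_real_derivative H \<theta> (u \<theta>)) (at \<theta> within {s..})"
    and H: "\<And>\<theta>. H \<theta> (a \<theta>) = F \<theta> (a \<theta>)" "\<And>\<theta>. H \<theta> (b \<theta>) = F \<theta> (b \<theta>)"
    and init: "a s \<le> u s" "u s \<le> b s" and \<theta>: "\<theta> > s"
  shows "a \<theta> < u \<theta>" "u \<theta> < b \<theta>"
proof -
  obtain a' where a': "\<And>\<theta>. (a has_real_derivative a' \<theta>) (at \<theta>)" "\<And>\<theta>. a' \<theta> < F \<theta> (a \<theta>)"
    using a_der by metis
  obtain b' where b': "\<And>\<theta>. (b has_real_derivative b' \<theta>) (at \<theta>)" "\<And>\<theta>. b' \<theta> > F \<theta> (b \<theta>)"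
    using b_der by metis
  have "u \<theta> - a \<theta> > 0"
  proof (rule positive_crossing[where a = s and g = "\<lambda>\<theta>. u \<theta> - a \<theta>" and g' = "\<lambda>\<theta>. H \<theta> (u \<theta>) - a' \<theta>"])
    fix t assume t: "t \<ge> s"
    show "((\<lambda>\<theta>. u \<theta> - a \<theta>) has_real_derivative H t (u t) - a' t) (at t within {s..})"
      by (intro DERIV_diff u t has_field_derivative_at_within[OF a'(1)])
    assume "u t - a t = 0"
    then have "u t = a t" by simp
    then show "H t (u t) - a' t > 0" using a'(2)[of t] H(1)[of t] by simp
  qed (use init \<theta> in auto)
  then show "a \<theta> < u \<theta>" by simp
  have "b \<theta> - u \<theta> > 0"
  proof (rule positive_crossing[where a = s and g = "\<lambda>\<theta>. b \<theta> - u \<theta>" and g' = "\<lambda>\<theta>. b' \<theta> - H \<theta> (u \<theta>)"])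
    fix t assume t: "t \<ge> s"
    show "((\<lambda>\<theta>. b \<theta> - u \<theta>) has_real_derivative b' t - H t (u t)) (at t within {s..})"
      by (intro DERIV_diff u t has_field_derivative_at_within[OF b'(1)])
    assume "b t - u t = 0"
    then have "u t = b t" by simp
    then show "b' t - H t (u t) > 0" using b'(2)[of t] H(2)[of t] by simp
  qed (use init \<theta> in auto)
  then show "u \<theta> < b \<theta>" by simp
qed

lemma sol_strict: "sol s u \<Longrightarrow> \<theta> > s \<Longrightarrow> a \<theta> < u \<theta> \<and> u \<theta> < b \<theta>"
  using crossing[of s u F \<theta>] by (auto simp: sol_def)

text \<open>Clamping the radius to an interval that contains both curves makes the equation globally
  Lipschitz. The curves trap the solution, so the clamp never acts on it.\<close>

lemma sol_exists:
  assumes z: "a s \<le> z" "z \<le> b s"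
  shows "\<exists>u. sol s u \<and> u s = z"
proof -
  obtain \<alpha> \<beta> where \<alpha>\<beta>: "0 < \<alpha>" "\<beta> < R" "\<alpha> \<le> \<beta>" "\<And>\<theta>. \<alpha> \<le> a \<theta>" "\<And>\<theta>. b \<theta> \<le> \<beta>"
    using bounds by blast
  obtain L where L: "\<And>\<theta> x y. x \<in> {\<alpha>..\<beta>} \<Longrightarrow> y \<in> {\<alpha>..\<beta>} \<Longrightarrow> \<bar>F \<theta> x - F \<theta> y\<bar> \<le> L * \<bar>x - y\<bar>" "L \<ge> 0"
    using F_lipschitz[OF \<alpha>\<beta>(1,2)] by blast
  define c where "c x = max \<alpha> (min \<beta> x)" for x
  have c: "c x \<in> {\<alpha>..\<beta>}" for x using \<alpha>\<beta>(3) by (auto simp: c_def)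
  have c_id: "c x = x" if "\<alpha> \<le> x" "x \<le> \<beta>" for x using that by (auto simp: c_def)
  have c_lip: "\<bar>c x - c y\<bar> \<le> \<bar>x - y\<bar>" for x y by (auto simp: c_def max_def min_def)
  have "continuous_on UNIV (\<lambda>p. (\<lambda>p. F (fst p) (snd p)) (fst p, c (snd p)))"
    using c \<alpha>\<beta> by (intro continuous_on_compose2[OF F_cont])
      (force simp: c_def intro!: continuous_intros)+
  then have cont: "continuous_on UNIV (\<lambda>(t, x). F t (c x))" by (simp add: case_prod_unfold)
  have lip': "\<bar>F t (c x) - F t (c y)\<bar> \<le> L * \<bar>x - y\<bar>" for t x y
    using L(1)[OF c c, of t x y] mult_left_mono[OF c_lip L(2), of x y] by linarith
  obtain u where u: "u s = z" "\<And>t. t \<ge> s \<Longrightarrow> (u has_real_derivative F t (c (u t))) (at t within {s..})"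
    using ode_exists_global[of "\<lambda>t x. F t (c x)" L s z, OF cont lip'] by blast
  have c_ab: "c (a \<theta>) = a \<theta>" "c (b \<theta>) = b \<theta>" for \<theta>
    using \<alpha>\<beta>(4,5)[of \<theta>] ab[of \<theta>] by (auto intro!: c_id)
  have "a t < u t \<and> u t < b t" if "t > s" for t
    using crossing[of s u "\<lambda>\<theta> x. F \<theta> (c x)" t] u c_ab z that by simp
  then have in_ab: "a t \<le> u t \<and> u t \<le> b t" if "t \<ge> s" for t
    using that z u(1) by (cases "t = s") (auto simp: less_imp_le)
  have "c (u t) = u t" if "t \<ge> s" for t
    using in_ab[OF that] \<alpha>\<beta>(4,5)[of t] by (intro c_id) linarith+
  then show ?thesis using u in_ab unfolding sol_def by (intro exI[of _ u]) auto
qed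

lemma sol_dist:
  "\<exists>L\<ge>0. \<forall>s u v \<theta>. sol s u \<longrightarrow> sol s v \<longrightarrow> \<theta> \<ge> s \<longrightarrow> \<bar>u \<theta> - v \<theta>\<bar> \<le> \<bar>u s - v s\<bar> * exp (L * (\<theta> - s))"
proof -
  obtain \<alpha> \<beta> where \<alpha>\<beta>: "0 < \<alpha>" "\<beta> < R" "\<alpha> \<le> \<beta>" "\<And>\<theta>. \<alpha> \<le> a \<theta>" "\<And>\<theta>. b \<theta> \<le> \<beta>"
    using bounds by blast
  obtain L where L: "\<And>\<theta> x y. x \<in> {\<alpha>..\<beta>} \<Longrightarrow> y \<in> {\<alpha>..\<beta>} \<Longrightarrow> \<bar>F \<theta> x - F \<theta> y\<bar> \<le> L * \<bar>x - y\<bar>" "L \<ge> 0"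
    using F_lipschitz[OF \<alpha>\<beta>(1,2)] by blast
  have *: "\<bar>u \<theta> - v \<theta>\<bar> \<le> \<bar>u s - v s\<bar> * exp (L * (\<theta> - s))"
    if u: "sol s u" and v: "sol s v" and \<theta>: "\<theta> \<ge> s" for s u v \<theta>
  proof -
    have "norm (u \<theta> - v \<theta>) \<le> norm (u s - v s) * exp (L * (\<theta> - s))"
    proof (rule ode_dist_bound[where F = F and b = \<theta>])
      fix t assume t: "t \<in> {s..\<theta>}"
      have sub: "{s..\<theta>} \<subseteq> {s..}" by auto
      have "(u has_real_derivative F t (u t)) (at t within {s..})" "(v has_real_derivative F t (v t)) (at t within {s..})"
        using u v t by (auto simp: sol_def)
      then show "(u has_vector_derivative F t (u t)) (at t within {s..\<theta>})"
         "(v has_vector_derivative F t (v t)) (at t within {s..\<theta>})"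
        using DERIV_subset[OF _ sub] by (auto simp flip: has_real_derivative_iff_has_vector_derivative)
      have "u t \<in> {\<alpha>..\<beta>}" "v t \<in> {\<alpha>..\<beta>}"
        using u v t \<alpha>\<beta>(4,5)[of t] unfolding sol_def by fastforce+
      then show "norm (F t (u t) - F t (v t)) \<le> L * norm (u t - v t)" using L(1) by simp
    qed (use L \<theta> in auto)
    then show ?thesis by simp
  qed
  show ?thesis by (intro exI[of _ L] conjI allI impI * L(2))
qed

lemma sol_unique: "sol s u \<Longrightarrow> sol s v \<Longrightarrow> u s = v s \<Longrightarrow> \<theta> \<ge> s \<Longrightarrow> u \<theta> = v \<theta>"
  using sol_dist by fastforce

lemma sol_shift:
  assumes "sol s u" "s \<le> s' + 2 * pi * of_int n"
  shows "sol s' (\<lambda>\<theta>. u (\<theta> + 2 * pi * of_int n))"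
  unfolding sol_def
proof (intro allI impI)
  let ?c = "2 * pi * of_int n"
  fix \<theta> assume \<theta>: "\<theta> \<ge> s'"
  then have ge: "\<theta> + ?c \<ge> s" using assms(2) by linarith
  have u: "(u has_real_derivative F (\<theta> + ?c) (u (\<theta> + ?c))) (at (\<theta> + ?c) within {s..})"
    using assms(1) ge by (simp add: sol_def)
  have "((\<lambda>\<theta>. u (\<theta> + ?c)) has_real_derivative F (\<theta> + ?c) (u (\<theta> + ?c)) * 1) (at \<theta> within {s'..})"
  proof (rule DERIV_image_chain[where f = u and g = "\<lambda>\<theta>. \<theta> + ?c", unfolded o_def])
    show "(u has_real_derivative F (\<theta> + ?c) (u (\<theta> + ?c))) (at (\<theta> + ?c) within (\<lambda>\<theta>. \<theta> + ?c) ` {s'..})"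
      by (rule DERIV_subset[OF u]) (use assms(2) in auto)
  qed (auto intro!: derivative_eq_intros)
  moreover have "a (\<theta> + ?c) \<le> u (\<theta> + ?c) \<and> u (\<theta> + ?c) \<le> b (\<theta> + ?c)"
    using assms(1) ge by (simp add: sol_def)
  ultimately show "((\<lambda>\<theta>. u (\<theta> + ?c)) has_real_derivative F \<theta> (u (\<theta> + ?c))) (at \<theta> within {s'..}) \<and>
      a \<theta> \<le> u (\<theta> + ?c) \<and> u (\<theta> + ?c) \<le> b \<theta>"
    by (simp add: F_int_per a_int_per b_int_per)
qed

lemma sol_restrict: "sol s u \<Longrightarrow> s \<le> s' \<Longrightarrow> sol s' u"
  using sol_shift[of s u s' 0] by simp

lemma sol_cont: "sol s u \<Longrightarrow> continuous_on {s..} u"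
  by (auto simp: sol_def continuous_on_eq_continuous_within intro: DERIV_continuous)

lemma sol_mono:
  assumes u: "sol s u" and v: "sol s v" and le: "u s \<le> v s" and \<theta>: "\<theta> \<ge> s"
  shows "u \<theta> \<le> v \<theta>"
proof (rule ccontr)
  assume neg: "\<not> u \<theta> \<le> v \<theta>"
  have "continuous_on {s..\<theta>} (\<lambda>\<theta>. u \<theta> - v \<theta>)"
    by (intro continuous_intros continuous_on_subset[OF sol_cont[OF u]] continuous_on_subset[OF sol_cont[OF v]]) auto
  then have "\<exists>x\<ge>s. x \<le> \<theta> \<and> u x - v x = 0"
    using le neg \<theta> by (intro IVT') auto
  then obtain x where x: "s \<le> x" "x \<le> \<theta>" "u x = v x" by auto
  then have "u \<theta> = v \<theta>"
    using sol_unique[OF sol_restrict[OF u x(1)] sol_restrict[OF v x(1)]] by simp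
  then show False using neg by simp
qed

lemma sol_nat_shift: "sol 0 u \<Longrightarrow> sol 0 (\<lambda>\<theta>. u (\<theta> + 2 * pi * of_nat n))"
  using sol_shift[of 0 u 0 "int n"] by simp

text \<open>Solutions preserve order, so the values after successive turns form a monotone sequence.
  If it comes back to its first value, it was constant from the start.\<close>

lemma return_once:
  assumes u: "sol 0 u" and ret: "u (2 * pi * of_nat (Suc k)) = u 0"
  shows "u (2 * pi) = u 0"
proof -
  have v: "sol 0 (\<lambda>\<theta>. u (\<theta> + 2 * pi))" using sol_nat_shift[OF u, of 1] by simp
  have "u (2 * pi) \<le> u 0" if le: "u 0 \<le> u (2 * pi)"
  proof -
    have step: "u \<theta> \<le> u (\<theta> + 2 * pi)" if "\<theta> \<ge> 0" for \<theta>
      using sol_mono[OF u v] le that by simp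
    have "u (2 * pi) \<le> u (2 * pi * of_nat (Suc k))" for k
    proof (induction k)
      case (Suc k)
      then show ?case using step[of "2 * pi * of_nat (Suc k)"] by (simp add: algebra_simps)
    qed simp
    then show ?thesis using ret by metis
  qed
  moreover have "u (2 * pi) \<ge> u 0" if le: "u 0 \<ge> u (2 * pi)"
  proof -
    have step: "u \<theta> \<ge> u (\<theta> + 2 * pi)" if "\<theta> \<ge> 0" for \<theta>
      using sol_mono[OF v u] le that by simp
    have "u (2 * pi) \<ge> u (2 * pi * of_nat (Suc k))" for k
    proof (induction k)
      case (Suc k)
      then show ?case using step[of "2 * pi * of_nat (Suc k)"] by (simp add: algebra_simps)
    qed simp
    then show ?thesis using ret by metis
  qed
  ultimately show ?thesis by linarith
qed

end

context attracting_annulus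
begin

section \<open>From scalar solutions to trajectories and periodic orbits\<close>

definition orbit :: "(real \<Rightarrow> real) \<Rightarrow> (real \<times> real) set" where
  "orbit u = (\<lambda>\<theta>. pt \<theta> (u \<theta>)) ` {0..}"

lemma sol_range:
  assumes "sol s u" "\<theta> \<ge> s"
  shows "0 < u \<theta>" "u \<theta> < R"
  using assms a_pos[of \<theta>] bR[of \<theta>] unfolding sol_def by force+

lemma trajectory:
  assumes u: "sol s u"
  obtains \<tau> where "\<tau> 0 = s" "strict_mono \<tau>" "\<And>\<theta>. \<theta> \<ge> s \<Longrightarrow> \<exists>t\<ge>0. \<tau> t = \<theta>"
    "\<And>t. t \<ge> 0 \<Longrightarrow> ((\<lambda>t. pt (\<tau> t) (u (\<tau> t))) has_vector_derivative f (pt (\<tau> t) (u (\<tau> t)))) (at t within {0..})"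
proof -
  obtain \<alpha> \<beta> where \<alpha>\<beta>: "0 < \<alpha>" "\<beta> < R" "\<alpha> \<le> \<beta>" "\<And>\<theta>. \<alpha> \<le> a \<theta>" "\<And>\<theta>. b \<theta> \<le> \<beta>"
    using bounds by blast
  obtain M where M: "\<And>\<theta> \<rho>. \<rho> \<in> {\<alpha>..\<beta>} \<Longrightarrow> d \<theta> \<rho> \<le> M" using d_bounded[OF \<alpha>\<beta>(1,2)] by blast
  have u_in: "u \<theta> \<in> {\<alpha>..\<beta>}" if "\<theta> \<ge> s" for \<theta>
    using u that \<alpha>\<beta>(4,5)[of \<theta>] unfolding sol_def by fastforce
  \<comment> \<open>The solution is controlled for angles from \<open>s\<close> on only. Frozen
    below \<open>s\<close>, the angular speed is positive, bounded and continuous on the whole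
    line.\<close>
  define g where "g \<theta> = d (max \<theta> s) (u (max \<theta> s))" for \<theta>
  have g: "0 < g \<theta>" "g \<theta> \<le> M" for \<theta>
    using sol_range[OF u, of "max \<theta> s"] u_in[of "max \<theta> s"] M by (auto simp: g_def intro!: d_pos)
  have "continuous_on UNIV (\<lambda>\<theta>. u (max \<theta> s))"
    by (rule continuous_on_compose2[OF sol_cont[OF u]]) (auto intro!: continuous_intros)
  then have "continuous_on UNIV (\<lambda>\<theta>. (\<lambda>(\<theta>, \<rho>). d \<theta> \<rho>) (max \<theta> s, u (max \<theta> s)))"
    using sol_range[OF u max.cobounded2] by (intro continuous_on_compose2[OF d_cont] continuous_intros) auto
  then have cont: "continuous_on UNIV g" by (simp add: g_def)
  obtain \<Psi> \<tau> where \<tau>: "\<Psi> s = 0" "\<And>x. \<tau> (\<Psi> x) = x" "strict_mono \<Psi>" "strict_mono \<tau>"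
    "\<And>t. (\<tau> has_real_derivative g (\<tau> t)) (at t)"
    using time_change[of g M s, OF cont g] by metis
  have \<tau>0: "\<tau> 0 = s" using \<tau>(1) \<tau>(2)[of s] by simp
  have ge: "\<tau> t \<ge> s" if "t \<ge> 0" for t
    using that \<tau>0 \<tau>(4) by (metis strict_mono_less_eq)
  have onto: "\<exists>t\<ge>0. \<tau> t = \<theta>" if "\<theta> \<ge> s" for \<theta>
    using that \<tau>(1,2) \<tau>(3) by (metis strict_mono_less_eq)
  have "((\<lambda>t. pt (\<tau> t) (u (\<tau> t))) has_vector_derivative f (pt (\<tau> t) (u (\<tau> t)))) (at t within {0..})"
    if t: "t \<ge> 0" for t
  proof -
    have "(u has_real_derivative F (\<tau> t) (u (\<tau> t))) (at (\<tau> t) within \<tau> ` {0..})"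
      by (rule DERIV_subset[of u _ _ "{s..}"]) (use u ge t in \<open>auto simp: sol_def\<close>)
    from DERIV_image_chain[OF this has_field_derivative_at_within[OF \<tau>(5)]]
    have du: "((\<lambda>t. u (\<tau> t)) has_real_derivative F (\<tau> t) (u (\<tau> t)) * g (\<tau> t)) (at t within {0..})"
      by (simp add: o_def)
    have "g (\<tau> t) = d (\<tau> t) (u (\<tau> t))" using ge[OF t] by (simp add: g_def max_absorb1)
    moreover have "f (pt (\<tau> t) (u (\<tau> t))) = d (\<tau> t) (u (\<tau> t)) *\<^sub>R
        (pt_theta (\<tau> t) (u (\<tau> t)) + F (\<tau> t) (u (\<tau> t)) *\<^sub>R pt_rho (\<tau> t) (u (\<tau> t)))"
      by (intro field sol_range[OF u] ge t)
    ultimately show ?thesis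
      using pt_has_vector_derivative[OF has_field_derivative_at_within[OF \<tau>(5)] du]
      by (simp add: scaleR_add_right mult.commute)
  qed
  with that \<tau>0 \<tau>(4) onto show thesis by blast
qed

lemma follow:
  assumes u: "sol s u" and \<phi>: "\<And>t. (\<phi> has_vector_derivative f (\<phi> t)) (at t)"
    and init: "\<phi> t0 = pt s (u s)"
  obtains \<tau> where "\<tau> 0 = s" "strict_mono \<tau>" "\<And>\<theta>. \<theta> \<ge> s \<Longrightarrow> \<exists>t\<ge>0. \<tau> t = \<theta>"
    "\<And>t. t \<ge> 0 \<Longrightarrow> \<phi> (t0 + t) = pt (\<tau> t) (u (\<tau> t))"
proof -
  obtain \<tau> where \<tau>: "\<tau> 0 = s" "strict_mono \<tau>" "\<And>\<theta>. \<theta> \<ge> s \<Longrightarrow> \<exists>t\<ge>0. \<tau> t = \<theta>"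
    "\<And>t. t \<ge> 0 \<Longrightarrow> ((\<lambda>t. pt (\<tau> t) (u (\<tau> t))) has_vector_derivative f (pt (\<tau> t) (u (\<tau> t)))) (at t within {0..})"
    using trajectory[OF u] by blast
  have 0: "\<phi> (t0 + 0) = pt (\<tau> 0) (u (\<tau> 0))" using init \<tau>(1) by simp
  have "\<phi> (t0 + t) = pt (\<tau> t) (u (\<tau> t))" if "t \<ge> 0" for t
    by (rule flow_unique[of f "\<lambda>t. \<phi> (t0 + t)" "\<lambda>t. pt (\<tau> t) (u (\<tau> t))" t,
          OF lip has_vector_derivative_shift[of \<phi> f t0, OF \<phi>] \<tau>(4) 0 that])
  with that \<tau>(1,2,3) show thesis by blast
qed

text \<open>The solution through the common point is trapped and moves along the orbit with
  increasing angle. After one period the point recurs, so the angle has grown by a multiple of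
  \<open>2 * pi\<close> with the same radius; by \<open>return_once\<close> a single turn already
  closes up.\<close>

lemma periodic_orbit_meets:
  assumes "periodic_orbit f \<Gamma>" and meets: "pt \<theta> \<rho> \<in> \<Gamma>" "a \<theta> \<le> \<rho>" "\<rho> \<le> b \<theta>"
  shows "\<exists>u. sol 0 u \<and> u (2 * pi) = u 0 \<and> \<Gamma> = orbit u"
proof -
  obtain \<phi> T where \<phi>: "\<And>t. (\<phi> has_vector_derivative f (\<phi> t)) (at t)" "T > 0"
      "\<And>t. \<phi> (t + T) = \<phi> t" "\<Gamma> = range \<phi>"
    using assms(1) unfolding periodic_orbit_def by blast
  obtain t0 where t0: "\<phi> t0 = pt \<theta> \<rho>" using meets(1) \<phi>(4) by auto
  obtain v where v: "sol \<theta> v" "v \<theta> = \<rho>" using sol_exists[OF meets(2,3)] by blast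
  then have init: "\<phi> t0 = pt \<theta> (v \<theta>)" using t0 by simp
  obtain \<tau> where \<tau>: "\<And>\<eta>. \<eta> \<ge> \<theta> \<Longrightarrow> \<exists>t\<ge>0. \<tau> t = \<eta>" "\<And>t. t \<ge> 0 \<Longrightarrow> \<phi> (t0 + t) = pt (\<tau> t) (v (\<tau> t))"
    using follow[OF v(1) \<phi>(1) init] by blast
  \<comment> \<open>The orbit is followed up to an angle that is a multiple of
    \<open>2 * pi\<close>, because fixed points of the return map are counted at angle 0.\<close>
  obtain n :: int where n: "\<theta> \<le> 0 + of_int n * (2 * pi)" using periodic_representative[of "2 * pi" \<theta> 0] by auto
  then have n: "\<theta> \<le> 0 + 2 * pi * of_int n" by (simp add: mult.commute)
  then obtain t1 where t1: "t1 \<ge> 0" "\<tau> t1 = 2 * pi * of_int n" using \<tau>(1)[of "2 * pi * of_int n"] by auto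
  define u where "u \<eta> = v (\<eta> + 2 * pi * of_int n)" for \<eta>
  have u: "sol 0 u" unfolding u_def by (rule sol_shift[OF v(1) n])
  have init1: "\<phi> (t0 + t1) = pt 0 (u 0)"
    using \<tau>(2)[OF t1(1)] t1(2) pt_int_periodic[of 0 n] by (simp add: u_def)
  obtain \<sigma> where \<sigma>: "\<sigma> 0 = 0" "strict_mono \<sigma>" "\<And>\<eta>. \<eta> \<ge> 0 \<Longrightarrow> \<exists>t\<ge>0. \<sigma> t = \<eta>"
      "\<And>t. t \<ge> 0 \<Longrightarrow> \<phi> (t0 + t1 + t) = pt (\<sigma> t) (u (\<sigma> t))"
    using follow[OF u \<phi>(1) init1] by blast
  have \<sigma>T: "\<sigma> T > 0" using \<sigma>(1,2) \<phi>(2) by (metis strict_mono_less)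
  have eq: "pt (\<sigma> T) (u (\<sigma> T)) = pt 0 (u 0)"
    using \<sigma>(4)[of T] \<phi>(2) \<phi>(3)[of "t0 + t1"] init1 by simp
  have pos: "u (\<sigma> T) > 0" "u 0 > 0" using sol_range[OF u] \<sigma>T by auto
  obtain k :: int where k: "\<sigma> T = 0 + 2 * pi * k" using pt_eq(2)[OF eq pos] by blast
  have "k > 0" using k \<sigma>T by (simp add: zero_less_mult_iff)
  then obtain j where j: "k = int (Suc j)" by (metis gr0_implies_Suc zero_less_imp_eq_int)
  have "u (2 * pi * of_nat (Suc j)) = u 0" using pt_eq(1)[OF eq pos] k j by simp
  then have "u (2 * pi) = u 0" by (rule return_once[OF u])
  moreover have "\<Gamma> = orbit u"
  proof -
    have "\<Gamma> = (\<lambda>t. \<phi> (t0 + t1 + t)) ` {0..}"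
      unfolding \<phi>(4) by (rule periodic_range[where \<phi> = \<phi>, OF \<phi>(3,2)])
    also have "\<dots> = (\<lambda>t. pt (\<sigma> t) (u (\<sigma> t))) ` {0..}"
      by (rule image_cong) (simp_all add: \<sigma>(4))
    also have "\<dots> = (\<lambda>\<theta>. pt \<theta> (u \<theta>)) ` (\<sigma> ` {0..})" by (simp add: image_image)
    also have "\<sigma> ` {0..} = {0..}"
    proof (intro equalityI subsetI)
      fix x assume "x \<in> \<sigma> ` {0..}"
      then show "x \<in> {0..}" using \<sigma>(1,2) by (metis atLeast_iff imageE strict_mono_less_eq)
    next
      fix x :: real assume "x \<in> {0..}"
      then show "x \<in> \<sigma> ` {0..}" using \<sigma>(3)[of x] by force
    qed
    finally show ?thesis by (simp add: orbit_def)
  qed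
  ultimately show ?thesis using u by blast
qed

lemma sol_periodic:
  assumes u: "sol 0 u" and ret: "u (2 * pi) = u 0" and "\<theta> \<ge> 0"
  shows "u (\<theta> + 2 * pi * of_nat n) = u \<theta>"
  using assms(3)
proof (induction n arbitrary: \<theta>)
  case (Suc n)
  have "u (\<theta> + 2 * pi * of_nat (Suc n)) = u ((\<theta> + 2 * pi) + 2 * pi * of_nat n)"
    by (simp add: algebra_simps)
  also have "\<dots> = u (\<theta> + 2 * pi)" using Suc by simp
  also have "\<dots> = u \<theta>"
    using sol_unique[OF sol_nat_shift[OF u, of 1] u] ret Suc.prems by simp
  finally show ?case .
qed simp

text \<open>A trajectory of a periodic orbit must exist for all times and be differentiable there
  from both sides, whereas \<open>u\<close> is known on a half line with one-sided derivative at its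
  end. Periodicity supplies the rest.\<close>

lemma periodic_extension:
  assumes u: "sol 0 u" and ret: "u (2 * pi) = u 0"
  obtains v where "\<And>\<theta>. \<theta> \<ge> 0 \<Longrightarrow> v \<theta> = u \<theta>" "\<And>\<theta>. v (\<theta> + 2 * pi) = v \<theta>"
    "\<And>\<theta>. (v has_real_derivative F \<theta> (v \<theta>)) (at \<theta>)" "\<And>\<theta>. a \<theta> < v \<theta> \<and> v \<theta> < b \<theta>"
proof -
  define v where "v \<theta> = u (\<theta> + 2 * pi * of_int (- \<lfloor>\<theta> / (2 * pi)\<rfloor>))" for \<theta>
  have same: "u (\<theta> + 2 * pi * of_int m) = u (\<theta> + 2 * pi * of_int n)"
    if "\<theta> + 2 * pi * of_int m \<ge> 0" "m \<le> n" for \<theta> m n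
    using sol_periodic[OF u ret that(1), of "nat (n - m)"] that(2) by (simp add: algebra_simps)
  have nonneg: "\<theta> + 2 * pi * of_int (- \<lfloor>\<theta> / (2 * pi)\<rfloor>) \<ge> 0" for \<theta>
  proof -
    have "2 * pi * of_int \<lfloor>\<theta> / (2 * pi)\<rfloor> \<le> 2 * pi * (\<theta> / (2 * pi))"
      by (intro mult_left_mono) auto
    then show ?thesis by simp
  qed
  have v: "v \<theta> = u (\<theta> + 2 * pi * of_int m)" if "\<theta> + 2 * pi * of_int m \<ge> 0" for \<theta> m
    using same[OF that, of "- \<lfloor>\<theta> / (2 * pi)\<rfloor>"] same[OF nonneg, of \<theta> m] unfolding v_def
    by (cases "m \<le> - \<lfloor>\<theta> / (2 * pi)\<rfloor>") auto
  have v_u: "v \<theta> = u \<theta>" if "\<theta> \<ge> 0" for \<theta> using v[of \<theta> 0] that by simp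
  have big: "\<exists>m::int. \<theta> + 2 * pi * of_int m > 0" for \<theta>
  proof -
    have "\<theta> + 2 * pi * of_int (1 - \<lfloor>\<theta> / (2 * pi)\<rfloor>) =
        (\<theta> + 2 * pi * of_int (- \<lfloor>\<theta> / (2 * pi)\<rfloor>)) + 2 * pi" by (simp add: algebra_simps)
    then have "\<theta> + 2 * pi * of_int (1 - \<lfloor>\<theta> / (2 * pi)\<rfloor>) > 0"
      using nonneg[of \<theta>] pi_gt_zero by linarith
    then show ?thesis by blast
  qed
  have "v (\<theta> + 2 * pi) = v \<theta>" for \<theta>
  proof -
    obtain m :: int where m: "\<theta> + 2 * pi * of_int m > 0" using big by blast
    have "v (\<theta> + 2 * pi) = u (\<theta> + 2 * pi + 2 * pi * of_int (m - 1))"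
      using m by (intro v) (simp add: algebra_simps)
    also have "\<dots> = v \<theta>" using m by (subst v[of \<theta> m]) (simp_all add: algebra_simps)
    finally show ?thesis .
  qed
  moreover have "(v has_real_derivative F \<theta> (v \<theta>)) (at \<theta>)" "a \<theta> < v \<theta> \<and> v \<theta> < b \<theta>" for \<theta>
  proof -
    obtain m :: int where m: "\<theta> + 2 * pi * of_int m > 0" using big by blast
    let ?c = "2 * pi * of_int m"
    have vm: "v \<theta> = u (\<theta> + ?c)" using m by (intro v) simp
    have 1: "(u has_real_derivative F (\<theta> + ?c) (u (\<theta> + ?c))) (at (\<theta> + ?c) within {0..})"
      using u less_imp_le[OF m] unfolding sol_def by blast
    have 2: "at (\<theta> + ?c) within {0..} = at (\<theta> + ?c)"
      by (rule at_within_interior) (use m in simp)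
    have "(u has_real_derivative F \<theta> (v \<theta>)) (at (\<theta> + ?c))"
      using 1 unfolding 2 F_int_per vm .
    then have "((\<lambda>\<theta>. u (\<theta> + ?c)) has_real_derivative F \<theta> (v \<theta>)) (at \<theta>)"
      by (simp only: DERIV_shift)
    then show "(v has_real_derivative F \<theta> (v \<theta>)) (at \<theta>)"
    proof (rule has_field_derivative_transform_within_open)
      show "open {\<theta>. - ?c < \<theta>}" by (rule open_greaterThan[unfolded greaterThan_def])
      show "u (\<eta> + ?c) = v \<eta>" if "\<eta> \<in> {\<theta>. - ?c < \<theta>}" for \<eta>
        using that by (intro v[symmetric]) simp
    qed (use m in simp)
    show "a \<theta> < v \<theta> \<and> v \<theta> < b \<theta>"
      using sol_strict[OF u m] by (simp add: vm a_int_per b_int_per)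
  qed
  ultimately show thesis using that[of v] v_u by blast
qed

lemma orbit_of_fixed_point:
  assumes u: "sol 0 u" and ret: "u (2 * pi) = u 0"
  shows "periodic_orbit f (orbit u)" "orbit u \<subseteq> annulus a b" "compact (orbit u)"
proof -
  obtain v where v: "\<And>\<theta>. \<theta> \<ge> 0 \<Longrightarrow> v \<theta> = u \<theta>" "\<And>\<theta>. v (\<theta> + 2 * pi) = v \<theta>"
    "\<And>\<theta>. (v has_real_derivative F \<theta> (v \<theta>)) (at \<theta>)" "\<And>\<theta>. a \<theta> < v \<theta> \<and> v \<theta> < b \<theta>"
    using periodic_extension[OF u ret] by blast
  obtain \<alpha> \<beta> where \<alpha>\<beta>: "0 < \<alpha>" "\<beta> < R" "\<alpha> \<le> \<beta>" "\<And>\<theta>. \<alpha> \<le> a \<theta>" "\<And>\<theta>. b \<theta> \<le> \<beta>"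
    using bounds by blast
  obtain M where M: "\<And>\<theta> \<rho>. \<rho> \<in> {\<alpha>..\<beta>} \<Longrightarrow> d \<theta> \<rho> \<le> M" using d_bounded[OF \<alpha>\<beta>(1,2)] by blast
  have v_in: "v \<theta> \<in> {\<alpha>..\<beta>}" for \<theta> using v(4)[of \<theta>] \<alpha>\<beta>(4,5)[of \<theta>] by auto
  have v_R: "0 < v \<theta>" "v \<theta> < R" for \<theta> using v_in[of \<theta>] \<alpha>\<beta> by auto
  define g where "g \<theta> = d \<theta> (v \<theta>)" for \<theta>
  have g: "0 < g \<theta>" "g \<theta> \<le> M" for \<theta>
    using M[OF v_in] d_pos[OF v_R] by (simp_all add: g_def)
  have v_cont: "continuous_on A v" for A
    using v(3) by (meson DERIV_continuous continuous_at_imp_continuous_on)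
  have "continuous_on UNIV (\<lambda>\<theta>. (\<lambda>(\<theta>, \<rho>). d \<theta> \<rho>) (\<theta>, v \<theta>))"
    by (intro continuous_on_compose2[OF d_cont] continuous_intros v_cont) (auto intro: v_R)
  then have cont: "continuous_on UNIV g" by (simp add: g_def)
  obtain \<Psi> \<tau> where \<tau>: "\<And>x. (\<Psi> has_real_derivative 1 / g x) (at x)" "\<Psi> 0 = 0" "\<And>x. \<tau> (\<Psi> x) = x"
    "\<And>t. \<Psi> (\<tau> t) = t" "strict_mono \<Psi>" "\<And>t. (\<tau> has_real_derivative g (\<tau> t)) (at t)"
    using time_change[of g M 0, OF cont g] by metis
  define T where "T = \<Psi> (2 * pi)"
  have T: "T > 0" using \<tau>(2,5) unfolding T_def by (metis pi_gt_zero strict_mono_less mult_pos_pos zero_less_numeral)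
  have \<Psi>_per: "\<Psi> (\<theta> + 2 * pi) = \<Psi> \<theta> + T" for \<theta>
  proof -
    have "((\<lambda>\<theta>. \<Psi> (\<theta> + 2 * pi) - \<Psi> \<theta>) has_real_derivative 0) (at \<theta>)" for \<theta>
    proof -
      have "((\<lambda>\<theta>. \<Psi> (\<theta> + 2 * pi)) has_real_derivative 1 / g \<theta>) (at \<theta>)"
        using \<tau>(1)[of "\<theta> + 2 * pi"] by (simp add: DERIV_shift g_def d_per v(2))
      from DERIV_diff[OF this \<tau>(1)] show ?thesis by simp
    qed
    then have "\<Psi> (\<theta> + 2 * pi) - \<Psi> \<theta> = \<Psi> (0 + 2 * pi) - \<Psi> 0"
      by (intro DERIV_isconst_all allI)
    then show ?thesis by (simp add: T_def \<tau>(2))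
  qed
  have \<tau>_per: "\<tau> (t + T) = \<tau> t + 2 * pi" for t
    using \<Psi>_per[of "\<tau> t"] \<tau>(3)[of "\<tau> t + 2 * pi"] \<tau>(4)[of t] by simp
  let ?\<phi> = "\<lambda>t. pt (\<tau> t) (v (\<tau> t))"
  have pt_per: "pt (\<theta> + 2 * pi) \<rho> = pt \<theta> \<rho>" for \<theta> \<rho> using pt_int_periodic[of \<theta> 1 \<rho>] by simp
  have per: "?\<phi> (t + T) = ?\<phi> t" for t by (simp add: \<tau>_per v(2) pt_per)
  have der: "(?\<phi> has_vector_derivative f (?\<phi> t)) (at t)" for t
  proof -
    have "((\<lambda>t. v (\<tau> t)) has_real_derivative F (\<tau> t) (v (\<tau> t)) * g (\<tau> t)) (at t)"
      by (rule DERIV_chain2[OF v(3) \<tau>(6)])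
    moreover have "f (?\<phi> t) = d (\<tau> t) (v (\<tau> t)) *\<^sub>R
        (pt_theta (\<tau> t) (v (\<tau> t)) + F (\<tau> t) (v (\<tau> t)) *\<^sub>R pt_rho (\<tau> t) (v (\<tau> t)))"
      by (rule field[OF v_R])
    ultimately show ?thesis
      using pt_has_vector_derivative[OF \<tau>(6)] by (simp add: g_def scaleR_add_right mult.commute)
  qed
  have eq: "orbit u = range ?\<phi>"
  proof -
    have rangeT: "range \<tau> = UNIV" using \<tau>(3) by (metis surj_def)
    have "range ?\<phi> = (\<lambda>\<theta>. pt \<theta> (v \<theta>)) ` range \<tau>" by (simp add: image_image)
    also have "\<dots> = (\<lambda>\<theta>. pt (0 + \<theta>) (v (0 + \<theta>))) ` {0..}"
      unfolding rangeT by (rule periodic_range[of _ "2 * pi"]) (simp_all add: v(2) pt_per)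
    also have "\<dots> = orbit u" unfolding orbit_def by (rule image_cong) (simp_all add: v(1))
    finally show ?thesis by simp
  qed
  \<comment> \<open>This excludes an equilibrium: the two angles differ by \<open>pi\<close>, which
    is not a multiple of \<open>2 * pi\<close>.\<close>
  have "?\<phi> (\<Psi> pi) \<noteq> ?\<phi> 0"
  proof
    assume "?\<phi> (\<Psi> pi) = ?\<phi> 0"
    moreover have "\<tau> 0 = 0" using \<tau>(3)[of 0] \<tau>(2) by simp
    ultimately have "pt pi (v pi) = pt 0 (v 0)" by (simp add: \<tau>(3))
    then obtain n :: int where "pi = 0 + 2 * pi * n" using pt_eq(2) v_R by blast
    then have "2 * of_int n = (1::real)" by simp
    then have "2 * n = 1" by (metis of_int_1 of_int_eq_iff of_int_mult of_int_numeral)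
    then show False by presburger
  qed
  then show "periodic_orbit f (orbit u)"
    unfolding periodic_orbit_def eq using der T per by blast
  show "orbit u \<subseteq> annulus a b"
    unfolding eq annulus_def using v(4) by blast
  have "continuous_on UNIV ?\<phi>"
    using der by (meson continuous_at_imp_continuous_on has_vector_derivative_continuous)
  then show "compact (orbit u)"
    unfolding eq by (rule periodic_bounded_range[where \<phi> = ?\<phi>, OF per T])
qed

section \<open>The return map, its analyticity and its fixed points\<close>

definition P :: "real \<Rightarrow> real" where
  "P z = (SOME u. sol 0 u \<and> u 0 = z) (2 * pi)"

lemma P_eq: "sol 0 u \<Longrightarrow> P (u 0) = u (2 * pi)"
proof -
  assume u: "sol 0 u"
  define w where "w = (SOME w. sol 0 w \<and> w 0 = u 0)"
  have "sol 0 w \<and> w 0 = u 0" unfolding w_def by (rule someI[of _ u]) (use u in simp)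
  then have "w (2 * pi) = u (2 * pi)" using sol_unique[of 0 w u "2 * pi"] u by simp
  then show ?thesis by (simp add: P_def w_def)
qed

text \<open>Real solutions, regarded as complex ones, solve the continued equation. Near
  \<open>z0\<close> they stay for a full turn in the tube around the reference solution, so their
  end value is the holomorphic function of the initial value. End points of the interval are
  included, since agreement is asked for on the real interval only.\<close>

lemma P_analytic:
  assumes z0: "z0 \<in> {a 0..b 0}"
  shows "\<exists>\<epsilon>>0. \<exists>g. g holomorphic_on ball (of_real z0) \<epsilon> \<and>
    (\<forall>z\<in>{a 0..b 0}. \<bar>z - z0\<bar> < \<epsilon> \<longrightarrow> g (of_real z) = of_real (P z))"
proof -
  obtain w where w: "sol 0 w" "w 0 = z0" using sol_exists[of 0 z0] z0 by auto
  have contw: "continuous_on {0..2 * pi} w" using sol_cont[OF w(1)] by (rule continuous_on_subset) auto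
  have "compact ((\<lambda>\<theta>. (\<theta>, complex_of_real (w \<theta>))) ` {0..2 * pi})"
    by (intro compact_continuous_image continuous_intros contw compact_Icc)
  moreover have "(\<lambda>\<theta>. (\<theta>, complex_of_real (w \<theta>))) ` {0..2 * pi} \<subseteq> \<Omega>"
    using sol_range[OF w(1)] by (auto intro: \<Omega>(2))
  ultimately obtain e where e: "e > 0"
    "(\<Union>x\<in>(\<lambda>\<theta>. (\<theta>, complex_of_real (w \<theta>))) ` {0..2 * pi}. ball x e) \<subseteq> \<Omega>"
    using compact_subset_open_imp_ball_epsilon_subset[OF _ \<Omega>(1)] by metis
  define r where "r = e / 2"
  have r: "r > 0" using e by (simp add: r_def)
  have tube: "(t, x) \<in> \<Omega>" if "t \<in> {0..2 * pi}" "x \<in> cball (of_real (w t)) r" for t x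
  proof -
    have "(t, x) \<in> ball (t, complex_of_real (w t)) e"
      using that e(1) by (auto simp: r_def dist_Pair_Pair)
    then show ?thesis using e(2) that(1) by blast
  qed
  have sub: "(SIGMA t:{0..2 * pi}. cball (complex_of_real (w t)) r) \<subseteq> \<Omega>" using tube by auto
  have der: "((\<lambda>t. complex_of_real (u t)) has_vector_derivative G t (of_real (u t))) (at t within {0..2 * pi})"
    if "sol 0 u" "t \<in> {0..2 * pi}" for u t
  proof -
    have "(u has_real_derivative F t (u t)) (at t within {0..2 * pi})"
      by (rule DERIV_subset[of u _ _ "{0..}"]) (use that in \<open>auto simp: sol_def\<close>)
    then have "((\<lambda>t. complex_of_real (u t)) has_vector_derivative of_real (F t (u t))) (at t within {0..2 * pi})"
      by (rule has_vector_derivative_of_real)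
    then show ?thesis using that sol_range[OF that(1), of t] by (simp add: G_F)
  qed
  have "\<exists>\<epsilon>>0. \<exists>g. g holomorphic_on ball (of_real (w 0)) \<epsilon> \<and> (\<forall>v. v 0 \<in> ball (complex_of_real (w 0)) \<epsilon> \<longrightarrow>
           (\<forall>t\<in>{0..2 * pi}. v t \<in> cball (of_real (w t)) r \<and> (v has_vector_derivative G t (v t)) (at t within {0..2 * pi}))
           \<longrightarrow> v (2 * pi) = g (v 0))"
    by (rule holomorphic_dependence[where w = "\<lambda>t. complex_of_real (w t)" and F' = G'])
      (use r der[OF w(1)] tube G_deriv continuous_on_subset[OF G_cont sub] continuous_on_subset[OF G'_cont sub] in auto)
  then obtain \<epsilon> g where \<epsilon>: "\<epsilon> > 0" and g: "g holomorphic_on ball (of_real z0) \<epsilon>"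
    and gv: "\<And>v. v 0 \<in> ball (complex_of_real z0) \<epsilon> \<Longrightarrow>
           (\<And>t. t \<in> {0..2 * pi} \<Longrightarrow> v t \<in> cball (of_real (w t)) r \<and> (v has_vector_derivative G t (v t)) (at t within {0..2 * pi}))
           \<Longrightarrow> v (2 * pi) = g (v 0)"
    unfolding w(2) by blast
  obtain L where L: "L \<ge> 0" "\<And>u \<theta>. sol 0 u \<Longrightarrow> \<theta> \<ge> 0 \<Longrightarrow> \<bar>u \<theta> - w \<theta>\<bar> \<le> \<bar>u 0 - w 0\<bar> * exp (L * (\<theta> - 0))"
    using sol_dist w(1) by metis
  \<comment> \<open>The second entry keeps neighbouring solutions within distance \<open>r\<close>
    of \<open>w\<close> for a full turn.\<close>
  define \<eta> where "\<eta> = min \<epsilon> (r * exp (- (L * (2 * pi))))"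
  have "g (of_real z) = of_real (P z)" if z: "z \<in> {a 0..b 0}" "\<bar>z - z0\<bar> < \<eta>" for z
  proof -
    obtain u where u: "sol 0 u" "u 0 = z" using sol_exists[of 0 z] z by auto
    have near: "\<bar>u t - w t\<bar> \<le> r" if t: "t \<in> {0..2 * pi}" for t
    proof -
      have "\<bar>u t - w t\<bar> \<le> \<bar>z - z0\<bar> * exp (L * t)" using L(2)[OF u(1), of t] t u w by simp
      also have "\<dots> \<le> (r * exp (- (L * (2 * pi)))) * exp (L * (2 * pi))"
        using z(2) t L(1) by (intro mult_mono) (auto simp: \<eta>_def mult_left_mono)
      also have "\<dots> = r" by (simp add: exp_minus)
      finally show ?thesis .
    qed
    have "of_real (u (2 * pi)) = g (of_real (u 0))"
    proof (rule gv)
      show "complex_of_real (u 0) \<in> ball (complex_of_real z0) \<epsilon>"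
        using z(2) u(2) by (simp add: \<eta>_def dist_of_real dist_real_def abs_minus_commute)
      fix t :: real assume t: "t \<in> {0..2 * pi}"
      show "complex_of_real (u t) \<in> cball (of_real (w t)) r \<and>
          ((\<lambda>t. complex_of_real (u t)) has_vector_derivative G t (of_real (u t))) (at t within {0..2 * pi})"
        using near[OF t] der[OF u(1) t] by (simp add: dist_of_real dist_real_def abs_minus_commute)
    qed
    then show ?thesis using P_eq[OF u(1)] u(2) by simp
  qed
  moreover have "\<eta> > 0" using \<epsilon> r by (simp add: \<eta>_def)
  moreover have "g holomorphic_on ball (of_real z0) \<eta>"
    by (rule holomorphic_on_subset[OF g]) (auto simp: \<eta>_def)
  ultimately show ?thesis by blast
qed

lemma P_ends: "P (a 0) > a 0" "P (b 0) < b 0"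
proof -
  obtain u where u: "sol 0 u" "u 0 = a 0" using sol_exists[of 0 "a 0"] ab[of 0] by auto
  show "P (a 0) > a 0"
    using P_eq[OF u(1)] sol_strict[OF u(1), of "2 * pi"] a_per[of 0] u(2) by simp
  obtain u where u: "sol 0 u" "u 0 = b 0" using sol_exists[of 0 "b 0"] ab[of 0] by auto
  show "P (b 0) < b 0"
    using P_eq[OF u(1)] sol_strict[OF u(1), of "2 * pi"] b_per[of 0] u(2) by simp
qed

lemma P_cont: "continuous_on {a 0..b 0} P"
  unfolding continuous_on_iff
proof (intro ballI allI impI)
  fix z0 e :: real assume z0: "z0 \<in> {a 0..b 0}" and e: "e > 0"
  obtain L where L: "L \<ge> 0" "\<And>u v \<theta>. sol 0 u \<Longrightarrow> sol 0 v \<Longrightarrow> \<theta> \<ge> 0 \<Longrightarrow> \<bar>u \<theta> - v \<theta>\<bar> \<le> \<bar>u 0 - v 0\<bar> * exp (L * (\<theta> - 0))"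
    using sol_dist by metis
  have "dist (P z) (P z0) < e" if z: "z \<in> {a 0..b 0}" "dist z z0 < e * exp (- (L * (2 * pi)))" for z
  proof -
    obtain u where u: "sol 0 u" "u 0 = z" using sol_exists[of 0 z] z by auto
    obtain v where v: "sol 0 v" "v 0 = z0" using sol_exists[of 0 z0] z0 by auto
    have "\<bar>P z - P z0\<bar> \<le> \<bar>z - z0\<bar> * exp (L * (2 * pi))"
      using L(2)[OF u(1) v(1), of "2 * pi"] P_eq[OF u(1)] P_eq[OF v(1)] u(2) v(2) by simp
    also have "\<dots> < (e * exp (- (L * (2 * pi)))) * exp (L * (2 * pi))"
      using z(2) by (intro mult_strict_right_mono) (auto simp: dist_real_def)
    also have "\<dots> = e" by (simp add: exp_minus)
    finally show ?thesis by (simp add: dist_real_def)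
  qed
  then show "\<exists>d>0. \<forall>x'\<in>{a 0..b 0}. dist x' z0 < d \<longrightarrow> dist (P x') (P z0) < e"
    using e by (intro exI[of _ "e * exp (- (L * (2 * pi)))"]) auto
qed

text \<open>An accumulation point of fixed points would, by analyticity, spread to the whole interval.\<close>

lemma finite_fixed_points: "finite {z \<in> {a 0..b 0}. P z = z}"
proof (rule ccontr)
  define Z where "Z = {z \<in> {a 0..b 0}. P z = z}"
  define A where "A = {x \<in> {a 0..b 0}. x islimpt Z}"
  assume "\<not> finite {z \<in> {a 0..b 0}. P z = z}"
  then have inf: "infinite Z" by (simp add: Z_def)
  have Zsub: "Z \<subseteq> {a 0..b 0}" by (auto simp: Z_def)
  have "\<exists>x\<in>{a 0..b 0}. x islimpt Z"
    using compact_Icc[of "a 0" "b 0"] inf Zsub unfolding compact_eq_Bolzano_Weierstrass by blast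
  then have "A \<noteq> {}" by (auto simp: A_def)
  moreover have "closed A"
  proof -
    have "A = {a 0..b 0} \<inter> {x. x islimpt Z}" by (auto simp: A_def)
    then show ?thesis using closed_limpts[of Z] by (simp add: closed_Int)
  qed
  moreover have bdd: "bdd_below A" by (intro bdd_belowI[of _ "a 0"]) (auto simp: A_def)
  ultimately have m: "Inf A \<in> A" by (intro closed_contains_Inf)
  \<comment> \<open>At the leftmost accumulation point \<open>m\<close> the return map equals the
    identity on a whole neighbourhood, so points slightly to the left of \<open>m\<close> are
    accumulation points too, unless \<open>m\<close> is the left end.\<close>
  define m where "m = Inf A"
  have mA: "m \<in> {a 0..b 0}" "m islimpt Z" using m by (auto simp: A_def m_def)
  obtain \<epsilon> g where \<epsilon>: "\<epsilon> > 0" and g: "g holomorphic_on ball (of_real m) \<epsilon>"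
    and gP: "\<And>z. z \<in> {a 0..b 0} \<Longrightarrow> \<bar>z - m\<bar> < \<epsilon> \<Longrightarrow> g (of_real z) = of_real (P z)"
    using P_analytic[OF mA(1)] by blast
  have zero: "g z - z = 0" if "z \<in> ball (of_real m) \<epsilon>" for z
  proof (rule analytic_continuation[where f = "\<lambda>z. g z - z" and S = "ball (of_real m) \<epsilon>"
        and U = "of_real ` (Z \<inter> ball m \<epsilon>)" and \<xi> = "of_real m"])
    show "(\<lambda>z. g z - z) holomorphic_on ball (of_real m) \<epsilon>" by (intro holomorphic_intros g)
    show "complex_of_real ` (Z \<inter> ball m \<epsilon>) \<subseteq> ball (of_real m) \<epsilon>" by (auto simp: dist_of_real)
    have "m islimpt (Z \<inter> ball m \<epsilon>)"
    proof (rule islimptI)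
      fix T assume "m \<in> T" "open T"
      then have "m \<in> T \<inter> ball m \<epsilon>" "open (T \<inter> ball m \<epsilon>)" using \<epsilon> by auto
      then obtain y where "y \<in> Z" "y \<in> T \<inter> ball m \<epsilon>" "y \<noteq> m" using islimptE[OF mA(2)] by metis
      then show "\<exists>y\<in>Z \<inter> ball m \<epsilon>. y \<in> T \<and> y \<noteq> m" by blast
    qed
    then show "complex_of_real m islimpt of_real ` (Z \<inter> ball m \<epsilon>)"
      unfolding islimpt_approachable by (force simp: dist_of_real)
    show "g z - z = 0" if "z \<in> complex_of_real ` (Z \<inter> ball m \<epsilon>)" for z
      using that gP by (auto simp: Z_def dist_real_def abs_minus_commute)
  qed (use that \<epsilon> in auto)
  have fixed: "P z = z" if "z \<in> {a 0..b 0}" "\<bar>z - m\<bar> < \<epsilon>" for z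
    using zero[of "of_real z"] gP[OF that] that
    by (simp add: dist_of_real dist_real_def abs_minus_commute)
  \<comment> \<open>The left end moves strictly inwards and cannot be fixed.\<close>
  have "m \<noteq> a 0" using fixed[of m] mA(1) \<epsilon> P_ends(1) by auto
  then have am: "a 0 < m" using mA(1) by simp
  define y where "y = max ((a 0 + m) / 2) (m - \<epsilon> / 2)"
  have y: "a 0 < y" "y < m" "m - \<epsilon> < y" using am \<epsilon> by (auto simp: y_def max_def field_simps)
  have "{y<..<m} \<subseteq> Z" using fixed y mA(1) by (auto simp: Z_def)
  moreover have "y islimpt {y<..<m}" using y(2) by (simp add: islimpt_greaterThanLessThan1)
  ultimately have "y islimpt Z" by (rule islimpt_subset[rotated])
  then have "y \<in> A" using y mA(1) by (auto simp: A_def)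
  then show False using cInf_lower[OF _ bdd, of y] y(2) by (simp add: m_def)
qed

text \<open>The two boundary curves make \<open>P z - z\<close> change sign. Every periodic orbit
  that touches the annulus belongs to the finite family \<open>Orb\<close> of pairwise disjoint
  compact orbits, and this yields the isolating neighbourhood.\<close>

theorem limit_cycle_in_annulus: "\<exists>\<Gamma>. limit_cycle f \<Gamma> \<and> \<Gamma> \<subseteq> annulus a b"
proof -
  have "\<exists>z\<ge>a 0. z \<le> b 0 \<and> z - P z = 0"
    using P_ends ab[of 0] by (intro IVT') (auto intro!: continuous_intros P_cont)
  then obtain z where z: "z \<in> {a 0..b 0}" "P z = z" by auto
  obtain u where u: "sol 0 u" "u 0 = z" using sol_exists[of 0 z] z by auto
  have ret: "u (2 * pi) = u 0" using P_eq[OF u(1)] u(2) z(2) by simp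
  define Orb where "Orb = {orbit v |v. sol 0 v \<and> v (2 * pi) = v 0}"
  have "Orb \<subseteq> (\<lambda>z. orbit (SOME v. sol 0 v \<and> v 0 = z)) ` {z \<in> {a 0..b 0}. P z = z}"
  proof
    fix \<Gamma> assume "\<Gamma> \<in> Orb"
    then obtain v where v: "\<Gamma> = orbit v" "sol 0 v" "v (2 * pi) = v 0" by (auto simp: Orb_def)
    define w where "w = (SOME w. sol 0 w \<and> w 0 = v 0)"
    have w: "sol 0 w \<and> w 0 = v 0" unfolding w_def by (rule someI[of _ v]) (use v in simp)
    have "orbit w = orbit v"
      unfolding orbit_def using sol_unique[of 0 w v] w v(2) by (intro image_cong) auto
    moreover have "v 0 \<in> {a 0..b 0}" using v(2) by (auto simp: sol_def)
    moreover have "P (v 0) = v 0" using P_eq[OF v(2)] v(3) by simp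
    ultimately show "\<Gamma> \<in> (\<lambda>z. orbit (SOME v. sol 0 v \<and> v 0 = z)) ` {z \<in> {a 0..b 0}. P z = z}"
      using v(1) w_def by (intro image_eqI[of _ _ "v 0"]) auto
  qed
  then have finOrb: "finite Orb" using finite_fixed_points finite_surj by blast
  have Orb: "periodic_orbit f \<Gamma>" "\<Gamma> \<subseteq> annulus a b" "compact \<Gamma>" if "\<Gamma> \<in> Orb" for \<Gamma>
    using that orbit_of_fixed_point by (auto simp: Orb_def)
  have uO: "orbit u \<in> Orb" using u ret by (auto simp: Orb_def)
  \<comment> \<open>Removing the other members of the finite family leaves an open set, in which a
    trajectory cannot even touch another periodic orbit.\<close>
  define V where "V = annulus a b - \<Union>(Orb - {orbit u})"
  have "open V"
    unfolding V_def using finOrb Orb(3)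
    by (intro open_Diff open_annulus a_cont b_cont a_pos closed_Union) (auto intro: compact_imp_closed)
  moreover have "orbit u \<subseteq> V"
  proof -
    have "orbit u \<inter> \<Gamma> = {}" if "\<Gamma> \<in> Orb - {orbit u}" for \<Gamma>
      using periodic_orbit_eq[OF lip Orb(1)[OF uO], of \<Gamma>] Orb(1)[of \<Gamma>] that by auto
    then show ?thesis using Orb(2)[OF uO] by (auto simp: V_def)
  qed
  moreover have "\<Gamma> = orbit u" if \<Gamma>: "periodic_orbit f \<Gamma>" "\<Gamma> \<inter> V \<noteq> {}" for \<Gamma>
  proof -
    obtain p where p: "p \<in> \<Gamma>" "p \<in> V" using \<Gamma>(2) by blast
    then obtain \<theta> \<rho> where "p = pt \<theta> \<rho>" "a \<theta> < \<rho>" "\<rho> < b \<theta>" by (auto simp: V_def annulus_def)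
    then have "\<exists>v. sol 0 v \<and> v (2 * pi) = v 0 \<and> \<Gamma> = orbit v"
      using periodic_orbit_meets[OF \<Gamma>(1), of \<theta> \<rho>] p(1) by simp
    then have "\<Gamma> \<in> Orb" by (auto simp: Orb_def)
    then show ?thesis using p by (auto simp: V_def)
  qed
  ultimately have "limit_cycle f (orbit u)"
    unfolding limit_cycle_def using Orb(1)[OF uO] by blast
  then show ?thesis using Orb(2)[OF uO] by blast
qed

end

section \<open>Time reversal and repelling annuli\<close>

definition mirror :: "real \<times> real \<Rightarrow> real \<times> real" where "mirror p = (fst p, - snd p)"

lemma mirror_mirror [simp]: "mirror (mirror p) = p" by (simp add: mirror_def)
lemma mirror_minus: "mirror (- p) = - mirror p" by (simp add: mirror_def)
lemma norm_mirror [simp]: "norm (mirror p) = norm p" by (simp add: mirror_def norm_prod_def)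
lemma mirror_diff: "mirror p - mirror q = mirror (p - q)" by (simp add: mirror_def)
lemma bounded_linear_mirror: "bounded_linear mirror"
  unfolding mirror_def[abs_def]
  by (intro bounded_linear_Pair bounded_linear_minus bounded_linear_fst bounded_linear_snd)

text \<open>Time reversal combined with the reflection \<open>y \<mapsto> -y\<close> preserves the shape of a polar system, so repelling
  annuli reduce to attracting ones.\<close>

definition revf :: "(real \<times> real \<Rightarrow> real \<times> real) \<Rightarrow> real \<times> real \<Rightarrow> real \<times> real" where
  "revf f p = - mirror (f (mirror p))"

lemma revf_revf [simp]: "revf (revf f) = f"
  by (rule ext) (simp add: revf_def mirror_minus)

lemma periodic_orbit_revf:
  assumes "periodic_orbit (revf f) \<Gamma>"
  shows "periodic_orbit f (mirror ` \<Gamma>)"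
proof -
  obtain \<phi> T where \<phi>: "\<And>t. (\<phi> has_vector_derivative revf f (\<phi> t)) (at t)" "T > 0"
      "\<And>t. \<phi> (t + T) = \<phi> t" "\<Gamma> = range \<phi>" "\<exists>t. \<phi> t \<noteq> \<phi> 0"
    using assms unfolding periodic_orbit_def by blast
  define \<psi> where "\<psi> t = mirror (\<phi> (- t))" for t
  have "(\<psi> has_vector_derivative f (\<psi> t)) (at t)" for t
  proof -
    have "((\<lambda>t::real. - t) has_vector_derivative -1) (at t)"
      by (auto intro!: derivative_eq_intros)
    from vector_diff_chain_at[OF this \<phi>(1)]
    have "((\<lambda>t. \<phi> (- t)) has_vector_derivative - revf f (\<phi> (- t))) (at t)" by (simp add: o_def)
    from bounded_linear.has_vector_derivative[OF bounded_linear_mirror this]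
    show ?thesis by (simp add: \<psi>_def[abs_def] revf_def)
  qed
  moreover have "\<psi> (t + T) = \<psi> t" for t
    using \<phi>(3)[of "- t - T"] by (simp add: \<psi>_def)
  moreover have "\<exists>t. \<psi> t \<noteq> \<psi> 0"
  proof -
    obtain t where "\<phi> t \<noteq> \<phi> 0" using \<phi>(5) by blast
    then have "\<psi> (- t) \<noteq> \<psi> 0" unfolding \<psi>_def by (metis minus_minus minus_zero mirror_mirror)
    then show ?thesis by blast
  qed
  moreover have "mirror ` \<Gamma> = range \<psi>"
  proof (intro equalityI subsetI)
    fix p assume "p \<in> mirror ` \<Gamma>"
    then obtain t where "p = mirror (\<phi> t)" unfolding \<phi>(4) by auto
    then show "p \<in> range \<psi>" by (intro image_eqI[of _ _ "- t"]) (simp_all add: \<psi>_def)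
  qed (auto simp: \<psi>_def \<phi>(4))
  ultimately show ?thesis unfolding periodic_orbit_def using \<phi>(2) by blast
qed

lemma limit_cycle_revf:
  assumes "limit_cycle (revf f) \<Gamma>"
  shows "limit_cycle f (mirror ` \<Gamma>)"
proof -
  obtain V where V: "open V" "\<Gamma> \<subseteq> V" "\<And>\<Gamma>'. periodic_orbit (revf f) \<Gamma>' \<Longrightarrow> \<Gamma>' \<inter> V \<noteq> {} \<Longrightarrow> \<Gamma>' = \<Gamma>"
    using assms unfolding limit_cycle_def by blast
  have mirror_image: "mirror ` A = mirror -` A" for A
  proof (intro equalityI subsetI)
    fix p assume "p \<in> mirror -` A"
    then show "p \<in> mirror ` A" by (intro image_eqI[of _ mirror "mirror p"]) simp_all
  qed auto
  have 1: "open (mirror ` V)"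
    unfolding mirror_image by (intro open_vimage V(1) linear_continuous_on bounded_linear_mirror)
  have 2: "mirror ` \<Gamma> \<subseteq> mirror ` V" using V(2) by blast
  have 3: "\<Gamma>' = mirror ` \<Gamma>" if \<Gamma>': "periodic_orbit f \<Gamma>'" "\<Gamma>' \<inter> mirror ` V \<noteq> {}" for \<Gamma>'
  proof -
    have "periodic_orbit (revf f) (mirror ` \<Gamma>')" using periodic_orbit_revf[of "revf f" \<Gamma>'] \<Gamma>'(1) by simp
    moreover have "mirror ` \<Gamma>' \<inter> V \<noteq> {}"
    proof -
      obtain q where "q \<in> V" "mirror q \<in> \<Gamma>'" using \<Gamma>'(2) by blast
      then have "q \<in> mirror ` \<Gamma>'" by (intro image_eqI[of _ mirror "mirror q"]) simp_all
      then show ?thesis using \<open>q \<in> V\<close> by blast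
    qed
    ultimately have "mirror ` \<Gamma>' = \<Gamma>" by (rule V(3))
    then have "mirror ` \<Gamma> = mirror ` mirror ` \<Gamma>'" by simp
    then show ?thesis by (simp add: image_image)
  qed
  have 4: "periodic_orbit f (mirror ` \<Gamma>)"
    using assms by (intro periodic_orbit_revf) (simp add: limit_cycle_def)
  show ?thesis
    unfolding limit_cycle_def by (intro conjI exI[of _ "mirror ` V"] allI impI 1 2 4) (erule conjE, rule 3)
qed

lemma mirror_pt: "mirror (pt \<theta> \<rho>) = pt (- \<theta>) \<rho>" by (simp add: mirror_def pt_def)

definition lower_barrier :: "(real \<Rightarrow> real \<Rightarrow> real) \<Rightarrow> (real \<Rightarrow> real) \<Rightarrow> bool" where
  "lower_barrier F a \<longleftrightarrow> (\<forall>\<theta>. a (\<theta> + 2 * pi) = a \<theta> \<and> (\<exists>a'. (a has_real_derivative a') (at \<theta>) \<and> a' < F \<theta> (a \<theta>)))"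

definition upper_barrier :: "(real \<Rightarrow> real \<Rightarrow> real) \<Rightarrow> (real \<Rightarrow> real) \<Rightarrow> bool" where
  "upper_barrier F a \<longleftrightarrow> (\<forall>\<theta>. a (\<theta> + 2 * pi) = a \<theta> \<and> (\<exists>a'. (a has_real_derivative a') (at \<theta>) \<and> a' > F \<theta> (a \<theta>)))"

lemma upper_barrier_reflect:
  assumes "upper_barrier F a"
  shows "lower_barrier (\<lambda>\<theta> \<rho>. - F (- \<theta>) \<rho>) (\<lambda>\<theta>. a (- \<theta>))"
  unfolding lower_barrier_def
proof (intro allI conjI)
  fix \<theta>
  show "a (- (\<theta> + 2 * pi)) = a (- \<theta>)"
    using assms[unfolded upper_barrier_def, rule_format, of "- (\<theta> + 2 * pi)"] by simp
  obtain a' where "(a has_real_derivative a') (at (- \<theta>))" "a' > F (- \<theta>) (a (- \<theta>))"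
    using assms unfolding upper_barrier_def by blast
  then show "\<exists>a'. ((\<lambda>\<theta>. a (- \<theta>)) has_real_derivative a') (at \<theta>) \<and> a' < - F (- \<theta>) (a (- \<theta>))"
    by (intro exI[of _ "- a'"]) (simp add: DERIV_mirror)
qed

lemma lower_barrier_reflect:
  assumes "lower_barrier F a"
  shows "upper_barrier (\<lambda>\<theta> \<rho>. - F (- \<theta>) \<rho>) (\<lambda>\<theta>. a (- \<theta>))"
  unfolding upper_barrier_def
proof (intro allI conjI)
  fix \<theta>
  show "a (- (\<theta> + 2 * pi)) = a (- \<theta>)"
    using assms[unfolded lower_barrier_def, rule_format, of "- (\<theta> + 2 * pi)"] by simp
  obtain a' where "(a has_real_derivative a') (at (- \<theta>))" "a' < F (- \<theta>) (a (- \<theta>))"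
    using assms unfolding lower_barrier_def by blast
  then show "\<exists>a'. ((\<lambda>\<theta>. a (- \<theta>)) has_real_derivative a') (at \<theta>) \<and> a' > - F (- \<theta>) (a (- \<theta>))"
    by (intro exI[of _ "- a'"]) (simp add: DERIV_mirror)
qed

context polar_system
begin

lemma limit_cycle_attracting:
  assumes "\<And>\<theta>. 0 < a \<theta> \<and> a \<theta> < b \<theta> \<and> b \<theta> < R" "lower_barrier F a" "upper_barrier F b"
  shows "\<exists>\<Gamma>. limit_cycle f \<Gamma> \<and> \<Gamma> \<subseteq> annulus a b"
proof -
  interpret attracting_annulus f F d G G' \<Omega> R a b
    by unfold_locales (use assms in \<open>auto simp: lower_barrier_def upper_barrier_def\<close>)
  show ?thesis by (rule limit_cycle_in_annulus)
qed

text \<open>The reflection turns \<theta> into \<open>- \<theta>\<close>. Together with the reversal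
  of time the angular speed stays positive, while the slope changes sign, so that the roles of the
  two kinds of barriers are exchanged.\<close>

lemma reflected_polar_system:
  "polar_system (revf f) (\<lambda>\<theta> \<rho>. - F (- \<theta>) \<rho>) (\<lambda>\<theta>. d (- \<theta>)) (\<lambda>\<theta> z. - G (- \<theta>) z) (\<lambda>\<theta> z. - G' (- \<theta>) z)
     {p. (- fst p, snd p) \<in> \<Omega>} R"
proof
  show "\<exists>L\<ge>0. \<forall>x\<in>cball 0 B. \<forall>y\<in>cball 0 B. norm (revf f x - revf f y) \<le> L * norm (x - y)" for B
  proof -
    obtain L where L: "L \<ge> 0" "\<And>x y. x \<in> cball 0 B \<Longrightarrow> y \<in> cball 0 B \<Longrightarrow> norm (f x - f y) \<le> L * norm (x - y)"
      using lip[of B] by blast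
    have "norm (revf f x - revf f y) \<le> L * norm (x - y)" if "x \<in> cball 0 B" "y \<in> cball 0 B" for x y
    proof -
      have "norm (revf f x - revf f y) = norm (f (mirror x) - f (mirror y))"
        by (simp add: revf_def norm_minus_commute mirror_diff)
      also have "\<dots> \<le> L * norm (mirror x - mirror y)" using that by (intro L(2)) auto
      finally show ?thesis by (simp add: mirror_diff)
    qed
    then show ?thesis using L(1) by blast
  qed
  show "revf f (pt \<theta> \<rho>) = d (- \<theta>) \<rho> *\<^sub>R (pt_theta \<theta> \<rho> + (- F (- \<theta>) \<rho>) *\<^sub>R pt_rho \<theta> \<rho>)" if "0 < \<rho>" "\<rho> < R" for \<theta> \<rho>
    using field[OF that, of "- \<theta>"] by (simp add: revf_def mirror_pt) (simp add: mirror_def pt_theta_def pt_rho_def algebra_simps)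
  show "continuous_on (UNIV \<times> {0<..<R}) (\<lambda>(\<theta>, \<rho>). d (- \<theta>) \<rho>)"
  proof -
    have "continuous_on (UNIV \<times> {0<..<R}) (\<lambda>p. (\<lambda>(\<theta>, \<rho>). d \<theta> \<rho>) (- fst p, snd p))"
      by (intro continuous_on_compose2[OF d_cont] continuous_intros) auto
    then show ?thesis by (simp add: case_prod_unfold)
  qed
  show "d (- (\<theta> + 2 * pi)) \<rho> = d (- \<theta>) \<rho>" for \<theta> \<rho> using d_per[of "- (\<theta> + 2 * pi)" \<rho>] by simp
  show "- F (- (\<theta> + 2 * pi)) \<rho> = - F (- \<theta>) \<rho>" for \<theta> \<rho> using F_per[of "- (\<theta> + 2 * pi)" \<rho>] by simp
  have "open ((\<lambda>p. (- fst p, snd p)) -` \<Omega>)"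
    by (intro open_vimage \<Omega>(1) continuous_intros)
  then show "open {p. (- fst p, snd p) \<in> \<Omega>}" by (simp add: vimage_def)
  have "continuous_on {p. (- fst p, snd p) \<in> \<Omega>} (\<lambda>p. (\<lambda>(\<theta>, z). G \<theta> z) (- fst p, snd p))"
    by (intro continuous_on_compose2[OF G_cont] continuous_intros) auto
  then show "continuous_on {p. (- fst p, snd p) \<in> \<Omega>} (\<lambda>(\<theta>, z). - G (- \<theta>) z)"
    unfolding case_prod_unfold by (intro continuous_intros) simp
  have "continuous_on {p. (- fst p, snd p) \<in> \<Omega>} (\<lambda>p. (\<lambda>(\<theta>, z). G' \<theta> z) (- fst p, snd p))"
    by (intro continuous_on_compose2[OF G'_cont] continuous_intros) auto
  then show "continuous_on {p. (- fst p, snd p) \<in> \<Omega>} (\<lambda>(\<theta>, z). - G' (- \<theta>) z)"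
    unfolding case_prod_unfold by (intro continuous_intros) simp
qed (auto intro: d_pos \<Omega>(2) DERIV_minus G_deriv simp: G_F)

lemma limit_cycle_repelling:
  assumes ab: "\<And>\<theta>. 0 < a \<theta> \<and> a \<theta> < b \<theta> \<and> b \<theta> < R" and "upper_barrier F a" "lower_barrier F b"
  shows "\<exists>\<Gamma>. limit_cycle f \<Gamma> \<and> \<Gamma> \<subseteq> annulus a b"
proof -
  interpret r: polar_system "revf f" "\<lambda>\<theta> \<rho>. - F (- \<theta>) \<rho>" "\<lambda>\<theta>. d (- \<theta>)" "\<lambda>\<theta> z. - G (- \<theta>) z" "\<lambda>\<theta> z. - G' (- \<theta>) z"
     "{p. (- fst p, snd p) \<in> \<Omega>}" R
    by (rule reflected_polar_system)
  obtain \<Gamma> where \<Gamma>: "limit_cycle (revf f) \<Gamma>" "\<Gamma> \<subseteq> annulus (\<lambda>\<theta>. a (- \<theta>)) (\<lambda>\<theta>. b (- \<theta>))"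
    using r.limit_cycle_attracting[OF _ upper_barrier_reflect[OF assms(2)] lower_barrier_reflect[OF assms(3)]] ab
    by blast
  have "mirror ` \<Gamma> \<subseteq> annulus a b"
    using \<Gamma>(2) by (force simp: annulus_def mirror_pt)
  then show ?thesis using limit_cycle_revf[OF \<Gamma>(1)] by blast
qed

end

section \<open>Local Lipschitz continuity of the polynomial field\<close>

definition locally_lipschitz :: "(real \<times> real \<Rightarrow> 'a::real_normed_vector) \<Rightarrow> bool" where
  "locally_lipschitz g \<longleftrightarrow> (\<forall>B. \<exists>L\<ge>0. \<forall>x\<in>cball 0 B. \<forall>y\<in>cball 0 B. norm (g x - g y) \<le> L * norm (x - y))"

lemma locally_lipschitz_const: "locally_lipschitz (\<lambda>_. c)"
  unfolding locally_lipschitz_def by (auto intro!: exI[of _ 0])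

lemma locally_lipschitz_fst: "locally_lipschitz fst"
  unfolding locally_lipschitz_def
proof (intro allI exI[of _ 1] conjI ballI)
  show "norm (fst x - fst y) \<le> 1 * norm (x - y)" for x y :: "real \<times> real"
    using dist_fst_le[of x y] by (simp add: dist_norm)
qed simp

lemma locally_lipschitz_snd: "locally_lipschitz snd"
  unfolding locally_lipschitz_def
proof (intro allI exI[of _ 1] conjI ballI)
  show "norm (snd x - snd y) \<le> 1 * norm (x - y)" for x y :: "real \<times> real"
    using dist_snd_le[of x y] by (simp add: dist_norm)
qed simp

lemma locally_lipschitz_add:
  assumes "locally_lipschitz g" "locally_lipschitz h"
  shows "locally_lipschitz (\<lambda>x. g x + h x)"
  unfolding locally_lipschitz_def
proof
  fix B
  obtain K where K: "K \<ge> 0" "\<And>x y. x \<in> cball 0 B \<Longrightarrow> y \<in> cball 0 B \<Longrightarrow> norm (g x - g y) \<le> K * norm (x - y)"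
    using assms(1) unfolding locally_lipschitz_def by blast
  obtain L where L: "L \<ge> 0" "\<And>x y. x \<in> cball 0 B \<Longrightarrow> y \<in> cball 0 B \<Longrightarrow> norm (h x - h y) \<le> L * norm (x - y)"
    using assms(2) unfolding locally_lipschitz_def by blast
  have "norm (g x + h x - (g y + h y)) \<le> (K + L) * norm (x - y)" if "x \<in> cball 0 B" "y \<in> cball 0 B" for x y
  proof -
    have "norm (g x + h x - (g y + h y)) = norm ((g x - g y) + (h x - h y))" by (simp add: algebra_simps)
    also have "\<dots> \<le> norm (g x - g y) + norm (h x - h y)" by (rule norm_triangle_ineq)
    also have "\<dots> \<le> K * norm (x - y) + L * norm (x - y)" using K(2)[OF that] L(2)[OF that] by linarith
    finally show ?thesis by (simp add: distrib_right)
  qed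
  then show "\<exists>L\<ge>0. \<forall>x\<in>cball 0 B. \<forall>y\<in>cball 0 B. norm (g x + h x - (g y + h y)) \<le> L * norm (x - y)"
    using K(1) L(1) by (intro exI[of _ "K + L"]) auto
qed

lemma locally_lipschitz_mult:
  fixes g h :: "real \<times> real \<Rightarrow> real"
  assumes "locally_lipschitz g" "locally_lipschitz h"
  shows "locally_lipschitz (\<lambda>x. g x * h x)"
  unfolding locally_lipschitz_def
proof
  fix B
  obtain K where K: "K \<ge> 0" "\<And>x y. x \<in> cball 0 B \<Longrightarrow> y \<in> cball 0 B \<Longrightarrow> norm (g x - g y) \<le> K * norm (x - y)"
    using assms(1) unfolding locally_lipschitz_def by blast
  obtain L where L: "L \<ge> 0" "\<And>x y. x \<in> cball 0 B \<Longrightarrow> y \<in> cball 0 B \<Longrightarrow> norm (h x - h y) \<le> L * norm (x - y)"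
    using assms(2) unfolding locally_lipschitz_def by blast
  define M where "M = \<bar>g 0\<bar> + K * \<bar>B\<bar>"
  define N where "N = \<bar>h 0\<bar> + L * \<bar>B\<bar>"
  have gM: "\<bar>g x\<bar> \<le> M" if "x \<in> cball 0 B" for x
  proof -
    have "norm (g x - g 0) \<le> K * norm (x - 0)" using that by (intro K(2)) (auto intro: order_trans[OF norm_ge_zero])
    also have "\<dots> \<le> K * \<bar>B\<bar>" using that K(1) by (intro mult_left_mono) auto
    finally show ?thesis unfolding M_def by simp
  qed
  have hN: "\<bar>h x\<bar> \<le> N" if "x \<in> cball 0 B" for x
  proof -
    have "norm (h x - h 0) \<le> L * norm (x - 0)" using that by (intro L(2)) (auto intro: order_trans[OF norm_ge_zero])
    also have "\<dots> \<le> L * \<bar>B\<bar>" using that L(1) by (intro mult_left_mono) auto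
    finally show ?thesis unfolding N_def by simp
  qed
  have MN: "M \<ge> 0" "N \<ge> 0" using K(1) L(1) by (simp_all add: M_def N_def)
  have "norm (g x * h x - g y * h y) \<le> (M * L + K * N) * norm (x - y)" if "x \<in> cball 0 B" "y \<in> cball 0 B" for x y
  proof -
    have "g x * h x - g y * h y = g x * (h x - h y) + (g x - g y) * h y" by (simp add: algebra_simps)
    then have "norm (g x * h x - g y * h y) \<le> \<bar>g x\<bar> * \<bar>h x - h y\<bar> + \<bar>g x - g y\<bar> * \<bar>h y\<bar>"
      by (simp only: abs_triangle_ineq real_norm_def flip: abs_mult)
    also have "\<dots> \<le> M * (L * norm (x - y)) + (K * norm (x - y)) * N"
      using gM[OF that(1)] hN[OF that(2)] L(2)[OF that] K(2)[OF that] MN K(1)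
      by (intro add_mono mult_mono) auto
    finally show ?thesis by (simp add: algebra_simps)
  qed
  then show "\<exists>L\<ge>0. \<forall>x\<in>cball 0 B. \<forall>y\<in>cball 0 B. norm (g x * h x - g y * h y) \<le> L * norm (x - y)"
    using K(1) L(1) MN by (intro exI[of _ "M * L + K * N"]) auto
qed

lemma locally_lipschitz_power:
  "locally_lipschitz (g :: _ \<Rightarrow> real) \<Longrightarrow> locally_lipschitz (\<lambda>x. g x ^ n)"
  by (induction n) (auto intro: locally_lipschitz_const locally_lipschitz_mult)

lemma locally_lipschitz_minus: "locally_lipschitz g \<Longrightarrow> locally_lipschitz (\<lambda>x. - g x)"
  unfolding locally_lipschitz_def by (simp add: norm_minus_commute)

lemma locally_lipschitz_Pair:
  assumes "locally_lipschitz g" "locally_lipschitz h"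
  shows "locally_lipschitz (\<lambda>x. (g x, h x))"
  unfolding locally_lipschitz_def
proof
  fix B
  obtain K where K: "K \<ge> 0" "\<And>x y. x \<in> cball 0 B \<Longrightarrow> y \<in> cball 0 B \<Longrightarrow> norm (g x - g y) \<le> K * norm (x - y)"
    using assms(1) unfolding locally_lipschitz_def by blast
  obtain L where L: "L \<ge> 0" "\<And>x y. x \<in> cball 0 B \<Longrightarrow> y \<in> cball 0 B \<Longrightarrow> norm (h x - h y) \<le> L * norm (x - y)"
    using assms(2) unfolding locally_lipschitz_def by blast
  have "norm ((g x, h x) - (g y, h y)) \<le> (K + L) * norm (x - y)" if "x \<in> cball 0 B" "y \<in> cball 0 B" for x y
    using norm_Pair_le[of "g x - g y" "h x - h y"] K(2)[OF that] L(2)[OF that] by (simp add: distrib_right)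
  then show "\<exists>L\<ge>0. \<forall>x\<in>cball 0 B. \<forall>y\<in>cball 0 B. norm ((g x, h x) - (g y, h y)) \<le> L * norm (x - y)"
    using K(1) L(1) by (intro exI[of _ "K + L"]) auto
qed

lemma locally_lipschitz_planar_field: "locally_lipschitz (planar_field a50 a22 b41 b13 \<delta>0 \<delta>1 \<delta>2 \<sigma>)"
proof -
  note ll = locally_lipschitz_Pair locally_lipschitz_add locally_lipschitz_minus locally_lipschitz_mult
    locally_lipschitz_power locally_lipschitz_const locally_lipschitz_fst locally_lipschitz_snd
  show ?thesis
    unfolding planar_field_def case_prod_unfold diff_conv_add_uminus by (intro ll)
qed

section \<open>The system in generalized polar coordinates\<close>


text \<open>With the given coefficients \<open>5 a50 + b41\<close> equals \<epsilon>1, so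
  \<open>fA\<close> and \<open>fB\<close> are the bracketed coefficients of the two middle terms of
  the field, including the factor 1/2.\<close>

definition fA :: "real \<Rightarrow> real \<Rightarrow> real \<Rightarrow> real" where "fA e1 d2 d1 = (e1 + 4 * d1 + 8 * d2) / 2"
definition fB :: "real \<Rightarrow> real \<Rightarrow> real \<Rightarrow> real" where "fB e1 d2 d1 = (e1 - 4 * d1 + 8 * d2) / 2"
text \<open>The contribution of the quintic and quartic terms one weighted degree above the leading
  part \<open>(- 2 y^3, 3 x^5)\<close>, projected to the radial direction; \<open>k9\<close> is its
  angular counterpart.\<close>

definition n9 :: "real \<Rightarrow> real \<Rightarrow> real \<Rightarrow> real" where
  "n9 e2 e1 \<theta> = - (3/5) * (1 - e1) * gC \<theta> ^ 10 + 3/35 * (5 + 7 * e2) * gC \<theta> ^ 7 * gS \<theta> ^ 2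
     + 2 * gC \<theta> ^ 4 * gS \<theta> ^ 4 + 10/21 * gC \<theta> * gS \<theta> ^ 6"
definition k9 :: "real \<Rightarrow> real \<Rightarrow> real \<Rightarrow> real" where
  "k9 e2 e1 \<theta> = (2 + 3/5 * (1 - e1)) * gC \<theta> ^ 5 * gS \<theta> + (10/21 - 3/35 * (5 + 7 * e2)) * gC \<theta> ^ 2 * gS \<theta> ^ 3"

text \<open>\<open>fF\<close> is the slope \<open>d\<rho>/d\<theta>\<close> of the orbits. Numerator and denominator are polynomials in \<open>\<rho>\<close>, stated over any normed field
  because the return map is analysed for complex \<open>\<rho>\<close>.\<close>

definition fnum :: "real \<Rightarrow> real \<Rightarrow> real \<Rightarrow> real \<Rightarrow> real \<Rightarrow> real \<Rightarrow> real \<Rightarrow> 'a::real_normed_field \<Rightarrow> 'a" where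
  "fnum e2 e1 d2 d1 d0 s \<theta> z =
     of_real (2 * s ^ 8 * gC \<theta> * gS \<theta> ^ 3) + of_real (- d0 * s ^ 8 * (3 * gC \<theta> ^ 6 + 2 * gS \<theta> ^ 4)) * z
     + of_real (- 3 * s ^ 6 * gC \<theta> ^ 5 * gS \<theta>) * z ^ 2
     + of_real (- 2 * fB e1 d2 d1 * s ^ 4 * gC \<theta> ^ 2 * gS \<theta> ^ 4) * z ^ 5
     + of_real (3 * fA e1 d2 d1 * s ^ 2 * gC \<theta> ^ 6 * gS \<theta> ^ 2) * z ^ 7
     + of_real (n9 e2 e1 \<theta>) * z ^ 9"

definition fden :: "real \<Rightarrow> real \<Rightarrow> real \<Rightarrow> real \<Rightarrow> real \<Rightarrow> real \<Rightarrow> real \<Rightarrow> 'a::real_normed_field \<Rightarrow> 'a" where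
  "fden e2 e1 d2 d1 d0 s \<theta> z =
     of_real (2 * s ^ 8 * gC \<theta> ^ 2) + of_real (d0 * s ^ 8 * gC \<theta> * gS \<theta>) * z
     + of_real (3 * s ^ 6 * gS \<theta> ^ 2) * z ^ 2
     + of_real (- 2 * fB e1 d2 d1 * s ^ 4 * gC \<theta> ^ 3 * gS \<theta>) * z ^ 5
     + of_real (- 3 * fA e1 d2 d1 * s ^ 2 * gC \<theta> * gS \<theta> ^ 3) * z ^ 7
     + 6 * z ^ 8 + of_real (k9 e2 e1 \<theta>) * z ^ 9"

definition fF :: "real \<Rightarrow> real \<Rightarrow> real \<Rightarrow> real \<Rightarrow> real \<Rightarrow> real \<Rightarrow> real \<Rightarrow> real \<Rightarrow> real" where
  "fF e2 e1 d2 d1 d0 s \<theta> \<rho> = gw \<theta> * \<rho> * fnum e2 e1 d2 d1 d0 s \<theta> \<rho> / fden e2 e1 d2 d1 d0 s \<theta> \<rho>"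

text \<open>A fixed box on which the angular speed is positive for all radii below 1/10. Every later
  smallness condition stays inside it.\<close>

definition small_parameters :: "real \<Rightarrow> real \<Rightarrow> real \<Rightarrow> real \<Rightarrow> real \<Rightarrow> real \<Rightarrow> bool" where
  "small_parameters e2 e1 d2 d1 d0 s \<longleftrightarrow>
     \<bar>e2\<bar> \<le> 1/20 \<and> \<bar>e1\<bar> \<le> 1/20 \<and> \<bar>d2\<bar> \<le> 1/20 \<and> \<bar>d1\<bar> \<le> 1/20 \<and> \<bar>d0\<bar> \<le> 1/20 \<and> \<bar>s\<bar> \<le> 1"

abbreviation (input) pfield :: "real \<Rightarrow> real \<Rightarrow> real \<Rightarrow> real \<Rightarrow> real \<Rightarrow> real \<Rightarrow> real \<times> real \<Rightarrow> real \<times> real" where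
  "pfield e2 e1 d2 d1 d0 s \<equiv> planar_field (- (1/5) * (1 - e1)) (1/35 * (5 + 7 * e2)) 1 (5/21) d0 d1 d2 s"

text \<open>Up to powers of the radius, the radial and angular components are
  \<open>3 C^5 x' / \<rho> + 2 S^3 y' / \<rho>^2\<close> and
  \<open>2 C y' / \<rho>^2 - 3 S x' / \<rho>\<close>. Written in the solved form, the claim becomes
  a pair of polynomial identities modulo \<open>C^6 + S^4 = 1\<close>.\<close>

lemma pfield_polar:
  assumes "\<rho> \<noteq> 0"
  shows "pfield e2 e1 d2 d1 d0 s (pt \<theta> \<rho>) =
     (\<rho> / 3 * (gC \<theta> * fnum e2 e1 d2 d1 d0 s \<theta> \<rho> - gS \<theta> ^ 3 * fden e2 e1 d2 d1 d0 s \<theta> \<rho>),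
      \<rho> ^ 2 / 2 * (gS \<theta> * fnum e2 e1 d2 d1 d0 s \<theta> \<rho> + gC \<theta> ^ 5 * fden e2 e1 d2 d1 d0 s \<theta> \<rho>))"
proof -
  have 1: "- d0 * s^8 * (r^2*c) - s^6 * (r^3*t) + 1/2 * (5 * (- (1/5) * (1 - e1)) + 1 + 4 * d1 + 8 * d2) * s^2 * (r^2*c) * (r^3*t)^2
        - 2 * (r^3*t)^3 + (r^2*c)^2 * (- (1/5) * (1 - e1) * (r^2*c)^3 + 1/35 * (5 + 7 * e2) * (r^3*t)^2)
      = r / 3 * (c * (2 * s^8 * c * t^3 + (- d0 * s^8 * (3 * c^6 + 2 * t^4)) * r + (- 3 * s^6 * c^5 * t) * r^2
            + (- 2 * ((e1 - 4 * d1 + 8 * d2) / 2) * s^4 * c^2 * t^4) * r^5 + (3 * ((e1 + 4 * d1 + 8 * d2) / 2) * s^2 * c^6 * t^2) * r^7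
            + (- (3/5) * (1 - e1) * c^10 + 3/35 * (5 + 7 * e2) * c^7 * t^2 + 2 * c^4 * t^4 + 10/21 * c * t^6) * r^9)
         - t^3 * (2 * s^8 * c^2 + (d0 * s^8 * c * t) * r + (3 * s^6 * t^2) * r^2
            + (- 2 * ((e1 - 4 * d1 + 8 * d2) / 2) * s^4 * c^3 * t) * r^5 + (- 3 * ((e1 + 4 * d1 + 8 * d2) / 2) * s^2 * c * t^3) * r^7
            + 6 * r^8 + ((2 + 3/5 * (1 - e1)) * c^5 * t + (10/21 - 3/35 * (5 + 7 * e2)) * c^2 * t^3) * r^9))"
    if "c^6 + t^4 = 1" for c t r :: real
    using that by algebra
  have 2: "s^8 * (r^2*c) - d0 * s^8 * (r^3*t) - 1/2 * (5 * (- (1/5) * (1 - e1)) + 1 - 4 * d1 + 8 * d2) * s^4 * (r^2*c)^2 * (r^3*t)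
        + 3 * (r^2*c)^5 + (r^2*c) * (r^3*t) * (1 * (r^2*c)^3 + 5/21 * (r^3*t)^2)
      = r^2 / 2 * (t * (2 * s^8 * c * t^3 + (- d0 * s^8 * (3 * c^6 + 2 * t^4)) * r + (- 3 * s^6 * c^5 * t) * r^2
            + (- 2 * ((e1 - 4 * d1 + 8 * d2) / 2) * s^4 * c^2 * t^4) * r^5 + (3 * ((e1 + 4 * d1 + 8 * d2) / 2) * s^2 * c^6 * t^2) * r^7
            + (- (3/5) * (1 - e1) * c^10 + 3/35 * (5 + 7 * e2) * c^7 * t^2 + 2 * c^4 * t^4 + 10/21 * c * t^6) * r^9)
         + c^5 * (2 * s^8 * c^2 + (d0 * s^8 * c * t) * r + (3 * s^6 * t^2) * r^2
            + (- 2 * ((e1 - 4 * d1 + 8 * d2) / 2) * s^4 * c^3 * t) * r^5 + (- 3 * ((e1 + 4 * d1 + 8 * d2) / 2) * s^2 * c * t^3) * r^7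
            + 6 * r^8 + ((2 + 3/5 * (1 - e1)) * c^5 * t + (10/21 - 3/35 * (5 + 7 * e2)) * c^2 * t^3) * r^9))"
    if "c^6 + t^4 = 1" for c t r :: real
    using that by algebra
  show ?thesis
    unfolding planar_field_def pt_def prod.case fnum_def fden_def fA_def fB_def n9_def k9_def of_real_eq_id id_apply prod.inject
    by (intro conjI 1 2 gC_gS)
qed

lemma gC_le: "\<bar>gC \<theta>\<bar> \<le> 1" and gS_le: "\<bar>gS \<theta>\<bar> \<le> 1"
proof -
  have "gC \<theta> ^ 6 \<le> 1" "gS \<theta> ^ 4 \<le> 1"
  proof -
    have "gC \<theta> ^ 6 \<ge> 0" "gS \<theta> ^ 4 \<ge> 0" by simp_all
    then show "gC \<theta> ^ 6 \<le> 1" "gS \<theta> ^ 4 \<le> 1" using gC_gS[of \<theta>] by linarith+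
  qed
  then have "\<bar>gC \<theta>\<bar> ^ 6 \<le> 1" "\<bar>gS \<theta>\<bar> ^ 4 \<le> 1" by simp_all
  then show "\<bar>gC \<theta>\<bar> \<le> 1" "\<bar>gS \<theta>\<bar> \<le> 1"
    using power_le_one_iff[of "\<bar>gC \<theta>\<bar>" 6] power_le_one_iff[of "\<bar>gS \<theta>\<bar>" 4] by simp_all
qed

lemma prod_le_1:
  fixes x y :: real
  assumes "\<bar>x\<bar> \<le> 1" "\<bar>y\<bar> \<le> 1"
  shows "\<bar>x * y\<bar> \<le> 1"
  using mult_mono[of "\<bar>x\<bar>" 1 "\<bar>y\<bar>" 1] assms by (simp add: abs_mult)

lemma power_le_1: "\<bar>x :: real\<bar> \<le> 1 \<Longrightarrow> \<bar>x ^ n\<bar> \<le> 1"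
  by (simp add: power_abs power_le_one)

text \<open>The terms \<open>2 s^8 C^2\<close>, \<open>3 s^6 S^2 \<rho>^2\<close> and
  \<open>6 \<rho>^8\<close> are nonnegative, and all others are absorbed by the inequality of the
  two means. The parts charged to \<open>P = s^8 C^2\<close> are 1/2, 1/2 and 1/4 out of 2; those
  charged to \<open>\<rho>^8\<close> are 1/2, 3/4 and 4/10 out of 6. The last one uses that the
  radius is below 1/10.\<close>

lemma fden_pos:
  assumes sp: "small_parameters e2 e1 d2 d1 d0 s" and \<rho>: "0 < \<rho>" "\<rho> < 1/10"
  shows "(fden e2 e1 d2 d1 d0 s \<theta> \<rho> :: real) > 0"
proof -
  define c t where "c = gC \<theta>" and "t = gS \<theta>"
  have ct: "\<bar>c\<bar> \<le> 1" "\<bar>t\<bar> \<le> 1" using gC_le gS_le by (simp_all add: c_def t_def)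
  have AB: "\<bar>fA e1 d2 d1\<bar> \<le> 1/2" "\<bar>fB e1 d2 d1\<bar> \<le> 1/2"
    using sp by (auto simp: small_parameters_def fA_def fB_def)
  have d0: "\<bar>d0\<bar> \<le> 1" and s1: "\<bar>s\<bar> \<le> 1" using sp by (auto simp: small_parameters_def)
  have amgm: "\<bar>x * y\<bar> \<le> (x ^ 2 + y ^ 2) / 2" for x y :: real
  proof -
    have "0 \<le> (\<bar>x\<bar> - \<bar>y\<bar>) ^ 2" by simp
    then show ?thesis by (simp add: power2_diff abs_mult power2_abs)
  qed
  have bnd: "\<bar>x * y\<bar> \<le> k * \<bar>y\<bar>" if "\<bar>x\<bar> \<le> k" for x y k :: real
    using that by (simp add: abs_mult mult_right_mono)
  define P where "P = s ^ 8 * c ^ 2"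
  have P0: "P \<ge> 0" by (simp add: P_def)
  have "\<bar>d0 * s ^ 8 * c * t * \<rho>\<bar> \<le> (P + 3 * s ^ 6 * t ^ 2 * \<rho> ^ 2) / 2"
  proof -
    have "\<bar>(s ^ 4 * c) * (s ^ 4 * t * \<rho>)\<bar> \<le> ((s ^ 4 * c) ^ 2 + (s ^ 4 * t * \<rho>) ^ 2) / 2" by (rule amgm)
    moreover have "(s ^ 4 * t * \<rho>) ^ 2 \<le> 1 * (s ^ 6 * t ^ 2 * \<rho> ^ 2)"
    proof -
      have "s ^ 2 \<le> 1" using s1 by (simp add: abs_square_le_1)
      then have "s ^ 2 * (s ^ 6 * t ^ 2 * \<rho> ^ 2) \<le> 1 * (s ^ 6 * t ^ 2 * \<rho> ^ 2)" by (intro mult_right_mono) auto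
      moreover have "(s ^ 4 * t * \<rho>) ^ 2 = s ^ 2 * (s ^ 6 * t ^ 2 * \<rho> ^ 2)" by algebra
      ultimately show ?thesis by simp
    qed
    moreover have "(s ^ 4 * c) ^ 2 = P" by (simp add: P_def power_mult_distrib flip: power_mult)
    moreover have "\<bar>d0 * ((s ^ 4 * c) * (s ^ 4 * t * \<rho>))\<bar> \<le> 1 * \<bar>(s ^ 4 * c) * (s ^ 4 * t * \<rho>)\<bar>"
      by (rule bnd[OF d0])
    moreover have "d0 * s ^ 8 * c * t * \<rho> = d0 * ((s ^ 4 * c) * (s ^ 4 * t * \<rho>))"
      by (simp add: algebra_simps flip: power_add)
    moreover have "0 \<le> s ^ 6 * t ^ 2 * \<rho> ^ 2" by simp
    ultimately show ?thesis by argo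
  qed
  moreover have "\<bar>(2 * fB e1 d2 d1 * s ^ 4 * c ^ 3 * t) * \<rho> ^ 5\<bar> \<le> (P + \<rho> ^ 8) / 2"
  proof -
    have "\<bar>(s ^ 4 * c) * \<rho> ^ 4\<bar> \<le> ((s ^ 4 * c) ^ 2 + (\<rho> ^ 4) ^ 2) / 2" by (rule amgm)
    moreover have "\<bar>(2 * fB e1 d2 d1 * (c ^ 2 * t) * \<rho>) * ((s ^ 4 * c) * \<rho> ^ 4)\<bar> \<le> 1 * \<bar>(s ^ 4 * c) * \<rho> ^ 4\<bar>"
    proof -
      obtain q where q: "q = 2 * fB e1 d2 d1" by blast
      then have "\<bar>q\<bar> \<le> 1" "\<bar>\<rho>\<bar> \<le> 1" using AB(2) \<rho> by auto
      then show ?thesis unfolding q[symmetric] by (intro bnd prod_le_1 power_le_1 ct)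
    qed
    moreover have "(2 * fB e1 d2 d1 * s ^ 4 * c ^ 3 * t) * \<rho> ^ 5 = (2 * fB e1 d2 d1 * (c ^ 2 * t) * \<rho>) * ((s ^ 4 * c) * \<rho> ^ 4)"
      by algebra
    moreover have "(s ^ 4 * c) ^ 2 = P" "(\<rho> ^ 4) ^ 2 = \<rho> ^ 8"
      by (simp_all add: P_def power_mult_distrib flip: power_mult)
    ultimately show ?thesis by argo
  qed
  moreover have "\<bar>(3 * fA e1 d2 d1 * s ^ 2 * c * t ^ 3) * \<rho> ^ 7\<bar> \<le> (P + 3 * \<rho> ^ 8) / 4"
  proof -
    have "\<bar>(s ^ 2 * c * \<rho> ^ 2) * \<rho> ^ 4\<bar> \<le> ((s ^ 2 * c * \<rho> ^ 2) ^ 2 + (\<rho> ^ 4) ^ 2) / 2" by (rule amgm)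
    moreover have "\<bar>(s ^ 4 * c) * (c * \<rho> ^ 4)\<bar> \<le> ((s ^ 4 * c) ^ 2 + (c * \<rho> ^ 4) ^ 2) / 2" by (rule amgm)
    moreover have "(s ^ 2 * c * \<rho> ^ 2) ^ 2 = (s ^ 4 * c) * (c * \<rho> ^ 4)" by algebra
    moreover have "(c * \<rho> ^ 4) ^ 2 \<le> (\<rho> ^ 4) ^ 2"
    proof -
      have "c ^ 2 \<le> 1" using ct by (simp add: abs_square_le_1)
      then have "c ^ 2 * (\<rho> ^ 4) ^ 2 \<le> 1 * (\<rho> ^ 4) ^ 2" by (intro mult_right_mono) auto
      then show ?thesis by (simp add: power_mult_distrib)
    qed
    moreover have "\<bar>(2 * fA e1 d2 d1 * t ^ 3 * (3 / 2 * \<rho>)) * ((s ^ 2 * c * \<rho> ^ 2) * \<rho> ^ 4)\<bar> \<le> 1 * \<bar>(s ^ 2 * c * \<rho> ^ 2) * \<rho> ^ 4\<bar>"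
    proof -
      obtain q r where q: "q = 2 * fA e1 d2 d1" and r: "r = 3 / 2 * \<rho>" by blast
      then have "\<bar>q\<bar> \<le> 1" "\<bar>r\<bar> \<le> 1" using AB(1) \<rho> by auto
      then show ?thesis unfolding q[symmetric] r[symmetric] by (intro bnd prod_le_1 power_le_1 ct)
    qed
    moreover have "(3 * fA e1 d2 d1 * s ^ 2 * c * t ^ 3) * \<rho> ^ 7 =
        (2 * fA e1 d2 d1 * t ^ 3 * (3 / 2 * \<rho>)) * ((s ^ 2 * c * \<rho> ^ 2) * \<rho> ^ 4)"
      by algebra
    moreover have "(s ^ 4 * c) ^ 2 = P" "(\<rho> ^ 4) ^ 2 = \<rho> ^ 8"
      by (simp_all add: P_def power_mult_distrib flip: power_mult)
    ultimately show ?thesis using abs_ge_self[of "(s ^ 4 * c) * (c * \<rho> ^ 4)"] by argo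
  qed
  moreover have "\<bar>k9 e2 e1 \<theta> * \<rho> ^ 9\<bar> \<le> 4/10 * \<rho> ^ 8"
  proof -
    have ee: "\<bar>e1\<bar> \<le> 1/20" "\<bar>e2\<bar> \<le> 1/20" using sp by (auto simp: small_parameters_def)
    have coeffs: "\<bar>2 + 3/5 * (1 - e1)\<bar> \<le> 3" "\<bar>10/21 - 3/35 * (5 + 7 * e2)\<bar> \<le> 1"
      using ee unfolding abs_le_iff by argo+
    have "\<bar>(c ^ 5 * t)\<bar> \<le> 1" "\<bar>(c ^ 2 * t ^ 3)\<bar> \<le> 1" by (intro prod_le_1 power_le_1 ct)+
    with coeffs have "\<bar>(2 + 3/5 * (1 - e1)) * (c ^ 5 * t)\<bar> \<le> 3 * 1" "\<bar>(10/21 - 3/35 * (5 + 7 * e2)) * (c ^ 2 * t ^ 3)\<bar> \<le> 1 * 1"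
      unfolding abs_mult[of "2 + 3/5 * (1 - e1)"] abs_mult[of "10/21 - 3/35 * (5 + 7 * e2)"]
      by (intro mult_mono; simp)+
    then have "\<bar>k9 e2 e1 \<theta>\<bar> \<le> 4" unfolding k9_def c_def[symmetric] t_def[symmetric] mult.assoc by linarith
    then have "\<bar>k9 e2 e1 \<theta> * \<rho>\<bar> \<le> 4 * (1/10)" unfolding abs_mult using \<rho> by (intro mult_mono) auto
    then have "\<bar>(k9 e2 e1 \<theta> * \<rho>) * \<rho> ^ 8\<bar> \<le> 4/10 * \<bar>\<rho> ^ 8\<bar>" by (intro bnd) simp
    then show ?thesis using \<rho> by (simp add: algebra_simps power_numeral_reduce)
  qed
  moreover have "fden e2 e1 d2 d1 d0 s \<theta> \<rho> = 2 * P + d0 * s ^ 8 * c * t * \<rho> + 3 * s ^ 6 * t ^ 2 * \<rho> ^ 2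
      - (2 * fB e1 d2 d1 * s ^ 4 * c ^ 3 * t) * \<rho> ^ 5 - (3 * fA e1 d2 d1 * s ^ 2 * c * t ^ 3) * \<rho> ^ 7
      + 6 * \<rho> ^ 8 + k9 e2 e1 \<theta> * \<rho> ^ 9"
    by (simp add: fden_def P_def c_def t_def)
  moreover have "\<rho> ^ 8 > 0" using \<rho> by simp
  moreover have "3 * s ^ 6 * t ^ 2 * \<rho> ^ 2 \<ge> 0" by simp
  ultimately show ?thesis using P0 unfolding abs_le_iff by argo
qed

section \<open>Derivatives in the radius and the complexified slope\<close>

definition fnum' :: "real \<Rightarrow> real \<Rightarrow> real \<Rightarrow> real \<Rightarrow> real \<Rightarrow> real \<Rightarrow> real \<Rightarrow> 'a::real_normed_field \<Rightarrow> 'a" where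
  "fnum' e2 e1 d2 d1 d0 s \<theta> z =
     of_real (- d0 * s ^ 8 * (3 * gC \<theta> ^ 6 + 2 * gS \<theta> ^ 4))
     + of_real (- 3 * s ^ 6 * gC \<theta> ^ 5 * gS \<theta>) * (2 * z)
     + of_real (- 2 * fB e1 d2 d1 * s ^ 4 * gC \<theta> ^ 2 * gS \<theta> ^ 4) * (5 * z ^ 4)
     + of_real (3 * fA e1 d2 d1 * s ^ 2 * gC \<theta> ^ 6 * gS \<theta> ^ 2) * (7 * z ^ 6)
     + of_real (n9 e2 e1 \<theta>) * (9 * z ^ 8)"

definition fden' :: "real \<Rightarrow> real \<Rightarrow> real \<Rightarrow> real \<Rightarrow> real \<Rightarrow> real \<Rightarrow> real \<Rightarrow> 'a::real_normed_field \<Rightarrow> 'a" where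
  "fden' e2 e1 d2 d1 d0 s \<theta> z =
     of_real (d0 * s ^ 8 * gC \<theta> * gS \<theta>)
     + of_real (3 * s ^ 6 * gS \<theta> ^ 2) * (2 * z)
     + of_real (- 2 * fB e1 d2 d1 * s ^ 4 * gC \<theta> ^ 3 * gS \<theta>) * (5 * z ^ 4)
     + of_real (- 3 * fA e1 d2 d1 * s ^ 2 * gC \<theta> * gS \<theta> ^ 3) * (7 * z ^ 6)
     + 6 * (8 * z ^ 7) + of_real (k9 e2 e1 \<theta>) * (9 * z ^ 8)"

lemma DERIV_fnum: "(fnum e2 e1 d2 d1 d0 s \<theta> has_field_derivative fnum' e2 e1 d2 d1 d0 s \<theta> z) (at z)"
  unfolding fnum_def[abs_def] fnum'_def by (rule derivative_eq_intros refl | simp)+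

lemma DERIV_fden: "(fden e2 e1 d2 d1 d0 s \<theta> has_field_derivative fden' e2 e1 d2 d1 d0 s \<theta> z) (at z)"
  unfolding fden_def[abs_def] fden'_def by (rule derivative_eq_intros refl | simp)+

lemma continuous_on_n9 [continuous_intros]:
  assumes "continuous_on A f" "continuous_on A g" "continuous_on A h"
  shows "continuous_on A (\<lambda>x. n9 (f x) (g x) (h x))" "continuous_on A (\<lambda>x. k9 (f x) (g x) (h x))"
  unfolding n9_def k9_def by (intro continuous_intros assms)+

lemma continuous_on_fA [continuous_intros]:
  assumes "continuous_on A f" "continuous_on A g" "continuous_on A h"
  shows "continuous_on A (\<lambda>x. fA (f x) (g x) (h x))" "continuous_on A (\<lambda>x. fB (f x) (g x) (h x))"
  unfolding fA_def fB_def by (intro continuous_intros assms; simp)+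

lemma continuous_on_fnum [continuous_intros]:
  assumes "continuous_on A a1" "continuous_on A a2" "continuous_on A a3" "continuous_on A a4"
    "continuous_on A a5" "continuous_on A a6" "continuous_on A h" "continuous_on A g"
  shows "continuous_on A (\<lambda>x. fnum (a1 x) (a2 x) (a3 x) (a4 x) (a5 x) (a6 x) (h x) (g x))"
    "continuous_on A (\<lambda>x. fden (a1 x) (a2 x) (a3 x) (a4 x) (a5 x) (a6 x) (h x) (g x))"
    "continuous_on A (\<lambda>x. fnum' (a1 x) (a2 x) (a3 x) (a4 x) (a5 x) (a6 x) (h x) (g x))"
    "continuous_on A (\<lambda>x. fden' (a1 x) (a2 x) (a3 x) (a4 x) (a5 x) (a6 x) (h x) (g x))"
  unfolding fnum_def fden_def fnum'_def fden'_def by (intro continuous_intros assms)+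

lemma fnum_of_real:
  "fnum e2 e1 d2 d1 d0 s \<theta> (of_real \<rho>) = of_real (fnum e2 e1 d2 d1 d0 s \<theta> \<rho>)"
  "fden e2 e1 d2 d1 d0 s \<theta> (of_real \<rho>) = of_real (fden e2 e1 d2 d1 d0 s \<theta> \<rho>)"
  by (simp_all add: fnum_def fden_def)

lemma fnum_periodic:
  "fnum e2 e1 d2 d1 d0 s (\<theta> + 2 * pi) \<rho> = fnum e2 e1 d2 d1 d0 s \<theta> \<rho>"
  "fden e2 e1 d2 d1 d0 s (\<theta> + 2 * pi) \<rho> = fden e2 e1 d2 d1 d0 s \<theta> \<rho>"
  by (simp_all add: fnum_def fden_def n9_def k9_def)

text \<open>The slope is rational in the radius, so its complex continuation lives where the
  denominator does not vanish. This set is open and contains the real radii by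
  \<open>fden_pos\<close>.\<close>

lemma planar_polar_system:
  assumes sp: "small_parameters e2 e1 d2 d1 d0 s"
  shows "polar_system (pfield e2 e1 d2 d1 d0 s) (fF e2 e1 d2 d1 d0 s)
    (\<lambda>\<theta> \<rho>. fden e2 e1 d2 d1 d0 s \<theta> \<rho> / (6 * \<rho> * gw \<theta>))
    (\<lambda>\<theta> z. of_real (gw \<theta>) * z * fnum e2 e1 d2 d1 d0 s \<theta> z / fden e2 e1 d2 d1 d0 s \<theta> z)
    (\<lambda>\<theta> z. of_real (gw \<theta>) * ((fnum e2 e1 d2 d1 d0 s \<theta> z + z * fnum' e2 e1 d2 d1 d0 s \<theta> z) * fden e2 e1 d2 d1 d0 s \<theta> z
       - z * fnum e2 e1 d2 d1 d0 s \<theta> z * fden' e2 e1 d2 d1 d0 s \<theta> z) / fden e2 e1 d2 d1 d0 s \<theta> z ^ 2)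
    {p. fden e2 e1 d2 d1 d0 s (fst p) (snd p) \<noteq> 0} (1/10)"
proof
  show "\<exists>L\<ge>0. \<forall>x\<in>cball 0 B. \<forall>y\<in>cball 0 B. norm (pfield e2 e1 d2 d1 d0 s x - pfield e2 e1 d2 d1 d0 s y) \<le> L * norm (x - y)" for B
    using locally_lipschitz_planar_field unfolding locally_lipschitz_def by blast
  fix \<theta> \<rho> :: real assume \<rho>: "0 < \<rho>" "\<rho> < 1/10"
  note pos = fden_pos[OF sp \<rho>, of \<theta>]
  show "pfield e2 e1 d2 d1 d0 s (pt \<theta> \<rho>) = (fden e2 e1 d2 d1 d0 s \<theta> \<rho> / (6 * \<rho> * gw \<theta>)) *\<^sub>R
      (pt_theta \<theta> \<rho> + fF e2 e1 d2 d1 d0 s \<theta> \<rho> *\<^sub>R pt_rho \<theta> \<rho>)"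
  proof -
    define n m w where "n = fnum e2 e1 d2 d1 d0 s \<theta> \<rho>" and "m = fden e2 e1 d2 d1 d0 s \<theta> \<rho>" and "w = gw \<theta>"
    have nz: "m \<noteq> 0" "w \<noteq> 0" "\<rho> \<noteq> 0" using pos less_imp_neq[OF gw_pos[of \<theta>]] \<rho> by (auto simp: m_def w_def)
    have "\<rho> / 3 * (gC \<theta> * n - gS \<theta> ^ 3 * m) =
        m / (6 * \<rho> * w) * (- 2 * \<rho> ^ 2 * gS \<theta> ^ 3 * w + w * \<rho> * n / m * (2 * \<rho> * gC \<theta>))"
      using nz by (simp add: field_simps power_numeral_reduce)
    moreover have "\<rho> ^ 2 / 2 * (gS \<theta> * n + gC \<theta> ^ 5 * m) =
        m / (6 * \<rho> * w) * (3 * \<rho> ^ 3 * gC \<theta> ^ 5 * w + w * \<rho> * n / m * (3 * \<rho> ^ 2 * gS \<theta>))"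
      using nz by (simp add: field_simps power_numeral_reduce)
    ultimately show ?thesis
      unfolding pfield_polar[OF nz(3)] pt_theta_def pt_rho_def fF_def n_def m_def w_def by simp
  qed
  show "fden e2 e1 d2 d1 d0 s \<theta> \<rho> / (6 * \<rho> * gw \<theta>) > 0" using pos \<rho> by simp
  show "(\<theta>, complex_of_real \<rho>) \<in> {p. fden e2 e1 d2 d1 d0 s (fst p) (snd p) \<noteq> 0}"
    using pos by (simp add: fnum_of_real)
  show "of_real (gw \<theta>) * of_real \<rho> * fnum e2 e1 d2 d1 d0 s \<theta> (of_real \<rho>) / fden e2 e1 d2 d1 d0 s \<theta> (of_real \<rho>)
      = complex_of_real (fF e2 e1 d2 d1 d0 s \<theta> \<rho>)"
    by (simp add: fF_def fnum_of_real)
next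
  show "continuous_on (UNIV \<times> {0<..<1/10}) (\<lambda>(\<theta>, \<rho>). fden e2 e1 d2 d1 d0 s \<theta> \<rho> / (6 * \<rho> * gw \<theta>))"
    unfolding case_prod_unfold
    by (intro continuous_intros) (use gw_pos in \<open>force simp: less_imp_neq[symmetric]\<close>)
  show "open {p. fden e2 e1 d2 d1 d0 s (fst p) (snd p :: complex) \<noteq> 0}"
    by (intro open_Collect_neq continuous_intros)
  show "continuous_on {p. fden e2 e1 d2 d1 d0 s (fst p) (snd p :: complex) \<noteq> 0}
     (\<lambda>(\<theta>, z). of_real (gw \<theta>) * z * fnum e2 e1 d2 d1 d0 s \<theta> z / fden e2 e1 d2 d1 d0 s \<theta> z)"
    unfolding case_prod_unfold by (intro continuous_intros) auto
  show "continuous_on {p. fden e2 e1 d2 d1 d0 s (fst p) (snd p :: complex) \<noteq> 0}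
     (\<lambda>(\<theta>, z). of_real (gw \<theta>) * ((fnum e2 e1 d2 d1 d0 s \<theta> z + z * fnum' e2 e1 d2 d1 d0 s \<theta> z) * fden e2 e1 d2 d1 d0 s \<theta> z
       - z * fnum e2 e1 d2 d1 d0 s \<theta> z * fden' e2 e1 d2 d1 d0 s \<theta> z) / fden e2 e1 d2 d1 d0 s \<theta> z ^ 2)"
    unfolding case_prod_unfold by (intro continuous_intros) auto
next
  fix \<theta> :: real and z :: complex assume "(\<theta>, z) \<in> {p. fden e2 e1 d2 d1 d0 s (fst p) (snd p) \<noteq> 0}"
  then have nz: "fden e2 e1 d2 d1 d0 s \<theta> z \<noteq> 0" by simp
  have "((\<lambda>z. of_real (gw \<theta>) * z * fnum e2 e1 d2 d1 d0 s \<theta> z / fden e2 e1 d2 d1 d0 s \<theta> z) has_field_derivative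
     ((of_real (gw \<theta>) * fnum e2 e1 d2 d1 d0 s \<theta> z + fnum' e2 e1 d2 d1 d0 s \<theta> z * (of_real (gw \<theta>) * z)) * fden e2 e1 d2 d1 d0 s \<theta> z
       - of_real (gw \<theta>) * z * fnum e2 e1 d2 d1 d0 s \<theta> z * fden' e2 e1 d2 d1 d0 s \<theta> z)
       / (fden e2 e1 d2 d1 d0 s \<theta> z * fden e2 e1 d2 d1 d0 s \<theta> z)) (at z)"
    by (intro DERIV_divide DERIV_mult DERIV_fnum DERIV_fden nz DERIV_cmult_Id)
  then show "((\<lambda>z. of_real (gw \<theta>) * z * fnum e2 e1 d2 d1 d0 s \<theta> z / fden e2 e1 d2 d1 d0 s \<theta> z) has_field_derivative
     of_real (gw \<theta>) * ((fnum e2 e1 d2 d1 d0 s \<theta> z + z * fnum' e2 e1 d2 d1 d0 s \<theta> z) * fden e2 e1 d2 d1 d0 s \<theta> z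
       - z * fnum e2 e1 d2 d1 d0 s \<theta> z * fden' e2 e1 d2 d1 d0 s \<theta> z) / fden e2 e1 d2 d1 d0 s \<theta> z ^ 2) (at z)"
    by (rule DERIV_cong) (simp add: power2_eq_square algebra_simps)
qed (simp_all add: fnum_periodic fF_def)

lemma limit_cycle_between:
  assumes sp: "small_parameters e2 e1 d2 d1 d0 s"
    and ab: "\<And>\<theta>. 0 < a \<theta> \<and> a \<theta> < b \<theta> \<and> b \<theta> < 1/10"
    and "lower_barrier (fF e2 e1 d2 d1 d0 s) a \<and> upper_barrier (fF e2 e1 d2 d1 d0 s) b \<or>
         upper_barrier (fF e2 e1 d2 d1 d0 s) a \<and> lower_barrier (fF e2 e1 d2 d1 d0 s) b"
  shows "\<exists>\<Gamma>. limit_cycle (pfield e2 e1 d2 d1 d0 s) \<Gamma> \<and> \<Gamma> \<subseteq> annulus a b"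
proof -
  note ps = planar_polar_system[OF sp]
  show ?thesis
    using polar_system.limit_cycle_attracting[where a = a and b = b, OF ps ab]
      polar_system.limit_cycle_repelling[where a = a and b = b, OF ps ab] assms(3) by blast
qed

section \<open>The outer curves\<close>


definition primitive :: "(real \<Rightarrow> real) \<Rightarrow> real \<Rightarrow> real" where
  "primitive g = (SOME G. G 0 = 0 \<and> (\<forall>\<theta>. (G has_real_derivative g \<theta>) (at \<theta>)))"

definition circ :: "(real \<Rightarrow> real) \<Rightarrow> real" where "circ g = primitive g (2 * pi)"

lemma primitive:
  assumes "continuous_on UNIV g"
  shows "primitive g 0 = 0" "(primitive g has_real_derivative g \<theta>) (at \<theta>)"
proof -
  have "\<exists>F. \<forall>x. - \<infinity> < ereal x \<longrightarrow> ereal x < \<infinity> \<longrightarrow> (F has_vector_derivative g x) (at x)"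
    by (intro einterval_antiderivative) (use assms in \<open>simp_all add: continuous_on_eq_continuous_at\<close>)
  then obtain F where F: "\<And>x. (F has_real_derivative g x) (at x)"
    by (auto simp: has_real_derivative_iff_has_vector_derivative)
  have "((\<lambda>x. F x - F 0) has_real_derivative g x) (at x)" for x
    using DERIV_diff[OF F DERIV_const] by simp
  then have "\<exists>G. G 0 = 0 \<and> (\<forall>\<theta>. (G has_real_derivative g \<theta>) (at \<theta>))"
    by (intro exI[of _ "\<lambda>x. F x - F 0"]) simp
  from someI_ex[OF this] show "primitive g 0 = 0" "(primitive g has_real_derivative g \<theta>) (at \<theta>)"
    by (simp_all add: primitive_def)
qed

lemma derivative_zero_const:
  fixes f :: "real \<Rightarrow> real"
  assumes "\<And>x. (f has_real_derivative 0) (at x)"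
  shows "f x = f y"
  using DERIV_isconst_all[of f x y] assms by blast

lemma primitive_unique:
  assumes g: "continuous_on UNIV g" and H: "\<And>\<theta>. (H has_real_derivative g \<theta>) (at \<theta>)"
  shows "primitive g \<theta> = H \<theta> - H 0"
proof -
  have "((\<lambda>\<theta>. primitive g \<theta> - H \<theta>) has_real_derivative 0) (at \<theta>)" for \<theta>
    using DERIV_diff[OF primitive(2)[OF g] H] by simp
  from derivative_zero_const[of "\<lambda>\<theta>. primitive g \<theta> - H \<theta>" \<theta> 0, OF this] show ?thesis
    using primitive(1)[OF g] by simp
qed

lemma circ_eq:
  assumes "continuous_on UNIV g" "\<And>\<theta>. (H has_real_derivative g \<theta>) (at \<theta>)"
  shows "circ g = H (2 * pi) - H 0"
  unfolding circ_def by (rule primitive_unique[OF assms])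

lemma circ_exact:
  assumes "continuous_on UNIV g" "\<And>\<theta>. (H has_real_derivative g \<theta>) (at \<theta>)" "\<And>\<theta>. H (\<theta> + 2 * pi) = H \<theta>"
  shows "circ g = 0"
  using circ_eq[OF assms(1,2)] assms(3)[of 0] by simp

lemma circ_add:
  assumes "continuous_on UNIV g" "continuous_on UNIV h"
  shows "circ (\<lambda>\<theta>. g \<theta> + h \<theta>) = circ g + circ h"
  using circ_eq[of "\<lambda>\<theta>. g \<theta> + h \<theta>" "\<lambda>\<theta>. primitive g \<theta> + primitive h \<theta>"] assms
  by (simp add: continuous_on_add DERIV_add primitive circ_def)

lemma circ_cmult:
  assumes "continuous_on UNIV g"
  shows "circ (\<lambda>\<theta>. c * g \<theta>) = c * circ g"
  using circ_eq[of "\<lambda>\<theta>. c * g \<theta>" "\<lambda>\<theta>. c * primitive g \<theta>"] assms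
  by (simp add: continuous_on_mult_left DERIV_cmult primitive circ_def)

lemma circ_pos:
  assumes "continuous_on UNIV g" "\<And>\<theta>. g \<theta> > 0"
  shows "circ g > 0"
proof -
  have "primitive g 0 < primitive g (2 * pi)"
  proof (rule DERIV_pos_imp_increasing[of 0 "2 * pi" "primitive g"])
    show "\<exists>y. (primitive g has_real_derivative y) (at x) \<and> 0 < y" for x
      using primitive(2)[OF assms(1), of x] assms(2)[of x] by blast
  qed simp
  then show ?thesis using primitive(1)[OF assms(1)] by (simp add: circ_def)
qed

text \<open>The difference has derivative zero. The factor \<open>c = 1\<close> serves periodic
  integrands and \<open>c = - 1\<close> those that change sign after half a turn.\<close>

lemma primitive_shift:
  assumes g: "continuous_on UNIV g" and per: "\<And>\<theta>. g (\<theta> + p) = c * g \<theta>"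
  shows "primitive g (\<theta> + p) - c * primitive g \<theta> = primitive g (\<eta> + p) - c * primitive g \<eta>"
proof -
  have "((\<lambda>\<theta>. primitive g (\<theta> + p) - c * primitive g \<theta>) has_real_derivative 0) (at \<theta>)" for \<theta>
  proof -
    have "((\<lambda>\<theta>. primitive g (\<theta> + p)) has_real_derivative c * g \<theta>) (at \<theta>)"
      using primitive(2)[OF g, of "\<theta> + p"] unfolding DERIV_shift per .
    from DERIV_diff[OF this DERIV_cmult[OF primitive(2)[OF g], of c \<theta>]] show ?thesis by simp
  qed
  then show ?thesis by (rule derivative_zero_const[of "\<lambda>\<theta>. primitive g (\<theta> + p) - c * primitive g \<theta>"])
qed

lemma primitive_minus:
  assumes g: "continuous_on UNIV g" and par: "\<And>\<theta>. g (- \<theta>) = c * g \<theta>"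
  shows "primitive g (- \<theta>) = - c * primitive g \<theta>"
proof -
  have "((\<lambda>\<theta>. primitive g (- \<theta>) + c * primitive g \<theta>) has_real_derivative 0) (at \<theta>)" for \<theta>
  proof -
    have "((\<lambda>\<theta>. primitive g (- \<theta>)) has_real_derivative - (c * g \<theta>)) (at \<theta>)"
      using primitive(2)[OF g, of "- \<theta>"] unfolding DERIV_mirror par by simp
    from DERIV_add[OF this DERIV_cmult[OF primitive(2)[OF g], of c \<theta>]] show ?thesis by simp
  qed
  from derivative_zero_const[of "\<lambda>\<theta>. primitive g (- \<theta>) + c * primitive g \<theta>" \<theta> 0, OF this]
  show ?thesis using primitive(1)[OF g] by simp
qed

lemma primitive_periodic:
  assumes g: "continuous_on UNIV g" and per: "\<And>\<theta>. g (\<theta> + 2 * pi) = g \<theta>" and "circ g = 0"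
  shows "primitive g (\<theta> + 2 * pi) = primitive g \<theta>"
  using primitive_shift[of g "2 * pi" 1 \<theta> 0] assms primitive(1)[OF g] by (simp add: circ_def)

lemma circ_odd:
  assumes g: "continuous_on UNIV g" and per: "\<And>\<theta>. g (\<theta> + 2 * pi) = g \<theta>" and odd: "\<And>\<theta>. g (- \<theta>) = - g \<theta>"
  shows "circ g = 0"
  using primitive_shift[of g "2 * pi" 1 0 "- pi"] primitive_minus[of g "- 1" pi] assms primitive(1)[OF g]
  by (simp add: circ_def)

lemma circ_antiperiodic:
  assumes g: "continuous_on UNIV g" and per: "\<And>\<theta>. g (\<theta> + pi) = - g \<theta>"
  shows "circ g = 0"
  using primitive_shift[of g pi "- 1" pi 0] assms primitive(1)[OF g] by (simp add: circ_def)

section \<open>The two primitives \<open>gM\<close> and \<open>gJ\<close> and their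
  symmetries\<close>

definition gM :: "real \<Rightarrow> real" where "gM = primitive (\<lambda>\<theta>. gw \<theta> * (gC \<theta> * gS \<theta> ^ 2))"
definition gJ :: "real \<Rightarrow> real" where "gJ = primitive (\<lambda>\<theta>. gw \<theta> * (gC \<theta> ^ 3 * gS \<theta> ^ 5))"

lemma DERIV_gM: "(gM has_real_derivative gw \<theta> * (gC \<theta> * gS \<theta> ^ 2)) (at \<theta>)"
  and gM_0 [simp]: "gM 0 = 0"
  unfolding gM_def by (intro primitive continuous_intros)+

lemma DERIV_gJ: "(gJ has_real_derivative gw \<theta> * (gC \<theta> ^ 3 * gS \<theta> ^ 5)) (at \<theta>)"
  unfolding gJ_def by (intro primitive continuous_intros)

lemma gM_minus [simp]: "gM (- \<theta>) = - gM \<theta>"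
  unfolding gM_def by (subst primitive_minus[where c = 1]) (auto intro!: continuous_intros)

lemma gJ_minus [simp]: "gJ (- \<theta>) = gJ \<theta>"
  unfolding gJ_def by (subst primitive_minus[where c = "- 1"]) (auto intro!: continuous_intros)

lemma gM_shift [simp]: "gM (\<theta> + pi) = - gM \<theta>"
proof -
  \<comment> \<open>The constant is evaluated at \<open>- pi/2\<close>, where the half turn
    coincides with the reflection and oddness makes it vanish.\<close>
  have "gM (\<theta> + pi) - (- 1) * gM \<theta> = gM (- (pi/2) + pi) - (- 1) * gM (- (pi/2))"
    unfolding gM_def by (rule primitive_shift) (auto intro!: continuous_intros)
  then show ?thesis using gM_minus[of "pi/2"] by (simp add: field_simps)
qed

lemma gJ_shift [simp]: "gJ (\<theta> + pi) = gJ \<theta>"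
proof -
  have "gJ (\<theta> + pi) - 1 * gJ \<theta> = gJ (- (pi/2) + pi) - 1 * gJ (- (pi/2))"
    unfolding gJ_def by (rule primitive_shift) (auto intro!: continuous_intros)
  then show ?thesis using gJ_minus[of "pi/2"] by (simp add: field_simps)
qed

lemma gM_gJ_periodic [simp]: "gM (\<theta> + 2 * pi) = gM \<theta>" "gJ (\<theta> + 2 * pi) = gJ \<theta>"
  using gM_shift[of "\<theta> + pi"] gJ_shift[of "\<theta> + pi"] by (simp_all add: add.assoc)

lemmas DERIV_gM' [derivative_intros] = DERIV_chain2[OF DERIV_gM]
lemmas DERIV_gJ' [derivative_intros] = DERIV_chain2[OF DERIV_gJ]

lemma continuous_on_gM [continuous_intros]: "continuous_on A f \<Longrightarrow> continuous_on A (\<lambda>x. gM (f x))"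
  by (rule continuous_on_compose2[OF DERIV_continuous_on[OF has_field_derivative_at_within[OF DERIV_gM]]]) auto

lemma continuous_on_gJ [continuous_intros]: "continuous_on A f \<Longrightarrow> continuous_on A (\<lambda>x. gJ (f x))"
  by (rule continuous_on_compose2[OF DERIV_continuous_on[OF has_field_derivative_at_within[OF DERIV_gJ]]]) auto

text \<open>At \<open>\<sigma> = 0\<close>, \<open>\<epsilon>\<^sub>1 = 0\<close> the quasi-homogeneous part of degree one splits as
  \<open>X\<^sub>K + \<mu> E\<close> with \<open>K = x\<^sup>5 y / 5 + \<beta> x\<^sup>2 y\<^sup>3\<close>, \<open>\<mu> = \<kappa> x y\<^sup>2\<close> and \<open>E\<close> the weighted Euler field;
  \<open>ok\<close>, \<open>okd\<close> and \<open>om\<close> are the restrictions of \<open>K\<close>, its derivative along the flow, and \<open>\<mu>\<close> to the unit curve.\<close>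

definition kap :: "real \<Rightarrow> real" where "kap e = 1/13 + 2 * e / 65"
definition bet :: "real \<Rightarrow> real" where "bet e = 1/273 - 3 * e / 65"
definition ok :: "real \<Rightarrow> real \<Rightarrow> real" where
  "ok e \<theta> = gC \<theta> ^ 5 * gS \<theta> / 5 + bet e * gC \<theta> ^ 2 * gS \<theta> ^ 3"
definition okd :: "real \<Rightarrow> real \<Rightarrow> real" where
  "okd e \<theta> = - 2 * gC \<theta> ^ 4 * gS \<theta> ^ 4 + 3/5 * gC \<theta> ^ 10 + bet e * (9 * gC \<theta> ^ 7 * gS \<theta> ^ 2 - 4 * gC \<theta> * gS \<theta> ^ 6)"
definition om :: "real \<Rightarrow> real \<Rightarrow> real" where "om e \<theta> = kap e * gC \<theta> * gS \<theta> ^ 2"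
definition oB :: "real \<Rightarrow> real \<Rightarrow> real" where "oB e \<theta> = - (13/6) * ok e \<theta> * (om e \<theta> - okd e \<theta> / 6)"
definition oA :: "real \<Rightarrow> real \<Rightarrow> real" where "oA e \<theta> = kap e * gM \<theta> - 7/3 * ok e \<theta>"

lemma DERIV_ok: "(ok e has_real_derivative gw \<theta> * okd e \<theta>) (at \<theta>)"
proof -
  have "(ok e has_real_derivative
      ((5 * gC \<theta> ^ 4 * (- 2 * gS \<theta> ^ 3 * gw \<theta>)) * gS \<theta> + gC \<theta> ^ 5 * (3 * gC \<theta> ^ 5 * gw \<theta>)) / 5
      + bet e * ((2 * gC \<theta> * (- 2 * gS \<theta> ^ 3 * gw \<theta>)) * gS \<theta> ^ 3
                 + gC \<theta> ^ 2 * (3 * gS \<theta> ^ 2 * (3 * gC \<theta> ^ 5 * gw \<theta>)))) (at \<theta>)"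
    unfolding ok_def[abs_def] by (auto intro!: derivative_eq_intros) (simp add: field_simps)
  then show ?thesis
    by (rule DERIV_cong) (unfold okd_def, algebra)
qed

lemma continuous_on_o [continuous_intros]:
  "continuous_on A f \<Longrightarrow> continuous_on A (\<lambda>x. ok e (f x))"
  "continuous_on A f \<Longrightarrow> continuous_on A (\<lambda>x. okd e (f x))"
  "continuous_on A f \<Longrightarrow> continuous_on A (\<lambda>x. om e (f x))"
  "continuous_on A f \<Longrightarrow> continuous_on A (\<lambda>x. oA e (f x))"
  "continuous_on A f \<Longrightarrow> continuous_on A (\<lambda>x. oB e (f x))"
  unfolding ok_def okd_def om_def oA_def oB_def by (intro continuous_intros; simp)+

lemma o_periodic [simp]:
  "ok e (\<theta> + 2 * pi) = ok e \<theta>" "okd e (\<theta> + 2 * pi) = okd e \<theta>" "om e (\<theta> + 2 * pi) = om e \<theta>"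
  "oA e (\<theta> + 2 * pi) = oA e \<theta>" "oB e (\<theta> + 2 * pi) = oB e \<theta>"
  by (simp_all add: ok_def okd_def om_def oA_def oB_def)

lemma ok_minus [simp]: "ok e (- \<theta>) = - ok e \<theta>" "okd e (- \<theta>) = okd e \<theta>" "om e (- \<theta>) = om e \<theta>"
  by (simp_all add: ok_def okd_def om_def)

lemma oA_minus [simp]: "oA e (- \<theta>) = - oA e \<theta>" "oB e (- \<theta>) = - oB e \<theta>"
  by (simp_all add: oA_def oB_def)

text \<open>The Euler field \<open>(2 x, 3 y)\<close> has radial part 6 on the unit curve, so \<mu>
  enters with the factor 6. A Hamiltonian field has as radial part minus the derivative of its
  Hamiltonian along the unit curve.\<close>

lemma n9_eq: "n9 e 0 \<theta> = 6 * om e \<theta> - okd e \<theta>"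
proof -
  have "- (3/5) * (1 - 0) * c ^ 10 + 3/35 * (5 + 7 * e) * c ^ 7 * t ^ 2 + 2 * c ^ 4 * t ^ 4 + 10/21 * c * t ^ 6
     = 6 * ((1/13 + 2 * e / 65) * c * t ^ 2) - (- 2 * c ^ 4 * t ^ 4 + 3/5 * c ^ 10 + (1/273 - 3 * e / 65) * (9 * c ^ 7 * t ^ 2 - 4 * c * t ^ 6))"
    if "c ^ 6 + t ^ 4 = 1" for c t :: real
    using that by algebra
  from this[OF gC_gS[of \<theta>]] show ?thesis unfolding n9_def om_def okd_def kap_def bet_def .
qed

text \<open>The Euler field has no angular part, and that of the Hamiltonian field is the weighted
  Euler derivative of \<open>K\<close>, which multiplies \<open>K\<close> by its weighted degree
  13.\<close>

lemma k9_eq: "k9 e 0 \<theta> = 13 * ok e \<theta>"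
  unfolding k9_def ok_def bet_def by (simp add: field_simps)

text \<open>The sign \<sigma> is 1 for curves crossed outwards and -1 for curves crossed inwards. A
  continuous derivative is recorded because persistence under small changes of the parameters is
  proved by compactness.\<close>

definition barrier_data :: "real \<Rightarrow> (real \<Rightarrow> real \<Rightarrow> real) \<Rightarrow> (real \<Rightarrow> real) \<Rightarrow> bool" where
  "barrier_data \<sigma> F a \<longleftrightarrow> (\<exists>a'. (\<forall>\<theta>. (a has_real_derivative a' \<theta>) (at \<theta>)) \<and> continuous_on UNIV a' \<and>
     (\<forall>\<theta>. a (\<theta> + 2 * pi) = a \<theta> \<and> a' (\<theta> + 2 * pi) = a' \<theta> \<and> \<sigma> * (F \<theta> (a \<theta>) - a' \<theta>) > 0))"

text \<open>In the coordinate \<open>1/\<rho> - k/6 + M\<close> the equation becomes \<open>s' = - B / (s - A)\<close>;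
  the barrier is the curve \<open>s = 1/t + v t \<theta>\<close>.\<close>

lemma outer_barrier:
  fixes v v' E :: "real \<Rightarrow> real \<Rightarrow> real"
  assumes e: "\<bar>e\<bar> \<le> 1/20"
    and v: "\<And>t \<theta>. (v t has_real_derivative v' t \<theta>) (at \<theta>)"
    and per: "\<And>t \<theta>. v t (\<theta> + 2 * pi) = v t \<theta>" "\<And>t \<theta>. v' t (\<theta> + 2 * pi) = v' t \<theta>"
    and cont: "continuous_on ({0..1} \<times> UNIV) (\<lambda>p. v (fst p) (snd p))"
      "\<And>t. continuous_on UNIV (v' t)" "continuous_on ({0..1} \<times> UNIV) (\<lambda>p. E (fst p) (snd p))"
    and Eper: "\<And>t \<theta>. E t (\<theta> + 2 * pi) = E t \<theta>"
    and E: "\<And>t \<theta>. t > 0 \<Longrightarrow> v' t \<theta> * (1 / t + v t \<theta> - oA e \<theta>) + gw \<theta> * oB e \<theta> = t ^ j * E t \<theta>"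
    and E0: "\<And>\<theta>. \<sigma> * E 0 \<theta> > 0"
    and \<eta>: "\<eta> > 0"
  shows "\<exists>a. barrier_data \<sigma> (fF e 0 0 0 0 0) a \<and> (\<forall>\<theta>. 0 < a \<theta> \<and> a \<theta> < \<eta>)"
proof -
  \<comment> \<open>On the curve \<open>1/\<rho>\<close> equals \<open>T t \<theta> / t\<close>; the
    factor \<open>t\<close> removes the singularity at \<open>t = 0\<close>, where \<open>T\<close>
    is 1.\<close>
  define T where "T t \<theta> = 1 + t * (v t \<theta> + ok e \<theta> / 6 - kap e * gM \<theta>)" for t \<theta>
  have red: "\<exists>\<phi>\<in>{0..2 * pi}. \<forall>t. T t \<theta> = T t \<phi> \<and> E t \<theta> = E t \<phi>" for \<theta>
  proof -
    obtain n :: int where n: "0 \<le> \<theta> + of_int n * (2 * pi)" "\<theta> + of_int n * (2 * pi) < 0 + 2 * pi"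
      by (rule periodic_representative[of "2 * pi" 0 \<theta>]) simp
    have "T t (\<theta> + of_int n * (2 * pi)) = T t \<theta>" "E t (\<theta> + of_int n * (2 * pi)) = E t \<theta>" for t
      by (rule periodic_shift_int; simp add: T_def per Eper)+
    then show ?thesis using n by (intro bexI[of _ "\<theta> + of_int n * (2 * pi)"]) auto
  qed
  have contT: "continuous_on ({0..1} \<times> {0..2 * pi}) (\<lambda>p. T (fst p) (snd p))"
    unfolding T_def by (intro continuous_intros continuous_on_subset[OF cont(1)]) auto
  have contE: "continuous_on ({0..1} \<times> {0..2 * pi}) (\<lambda>p. E (fst p) (snd p))"
    by (rule continuous_on_subset[OF cont(3)]) auto
  have cE0: "continuous_on {0..2 * pi} (E 0)"
  proof -
    have "continuous_on {0..2 * pi} (\<lambda>\<theta>. E (fst (0::real, \<theta>)) (snd (0::real, \<theta>)))"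
      by (rule continuous_on_compose2[OF cont(3)]) (auto intro!: continuous_intros)
    then show ?thesis by simp
  qed
  then have "continuous_on {0..2 * pi} (\<lambda>\<theta>. \<sigma> * E 0 \<theta>)" by (intro continuous_intros)
  then obtain \<theta>1 where \<theta>1: "\<theta>1 \<in> {0..2 * pi}" "\<And>\<theta>. \<theta> \<in> {0..2 * pi} \<Longrightarrow> \<sigma> * E 0 \<theta>1 \<le> \<sigma> * E 0 \<theta>"
    using continuous_attains_inf[of "{0..2 * pi}" "\<lambda>\<theta>. \<sigma> * E 0 \<theta>"] by (auto simp: less_imp_le)
  have contsE: "continuous_on ({0..1} \<times> {0..2 * pi}) (\<lambda>p. \<sigma> * E (fst p) (snd p))"
    by (intro continuous_intros contE)
  obtain X where X: "0 \<in> X" "open X" "\<And>t \<theta>. t \<in> X \<inter> {0..1} \<Longrightarrow> \<theta> \<in> {0..2 * pi} \<Longrightarrow> dist (\<sigma> * E t \<theta>) (\<sigma> * E 0 \<theta>) \<le> \<sigma> * E 0 \<theta>1 / 2"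
    by (rule continuous_on_prod_compactE[OF contsE, of 0 "\<sigma> * E 0 \<theta>1 / 2"]) (use E0[of \<theta>1] in auto)
  obtain Y where Y: "0 \<in> Y" "open Y" "\<And>t \<theta>. t \<in> Y \<inter> {0..1} \<Longrightarrow> \<theta> \<in> {0..2 * pi} \<Longrightarrow> dist (T t \<theta>) (T 0 \<theta>) \<le> 1 / 2"
    by (rule continuous_on_prod_compactE[OF contT, of 0 "1/2"]) auto
  have "open (X \<inter> Y)" "0 \<in> X \<inter> Y" using X Y by auto
  then obtain r where r: "r > 0" "ball 0 r \<subseteq> X \<inter> Y" by (meson openE)
  \<comment> \<open>Along the curve \<open>a \<theta> \<le> 2 * t\<close>, so the last two entries
    put it below \<eta> and below 1/10, the range in which the denominator is positive.\<close>
  define t where "t = Min {r / 2, 1, \<eta> / 4, 1 / 40}"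
  have t: "t > 0" "t \<le> r / 2" "t \<le> 1" "t \<le> \<eta> / 4" "t \<le> 1 / 40" using r \<eta> by (auto simp: t_def)
  have tX: "t \<in> X \<inter> {0..1}" "t \<in> Y \<inter> {0..1}" using t r by (auto intro!: subsetD[OF r(2)] simp: subset_iff)
  have Epos: "\<sigma> * E t \<theta> > 0" for \<theta>
  proof -
    obtain \<phi> where \<phi>: "\<phi> \<in> {0..2 * pi}" "E t \<theta> = E t \<phi>" using red by blast
    have "dist (\<sigma> * E t \<phi>) (\<sigma> * E 0 \<phi>) \<le> \<sigma> * E 0 \<theta>1 / 2" using X(3)[OF tX(1) \<phi>(1)] .
    then show ?thesis using \<theta>1(2)[OF \<phi>(1)] E0[of \<theta>1] unfolding \<phi>(2) dist_real_def by linarith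
  qed
  have Tpos: "1/2 \<le> T t \<theta>" for \<theta>
  proof -
    obtain \<phi> where \<phi>: "\<phi> \<in> {0..2 * pi}" "T t \<theta> = T t \<phi>" using red by blast
    have "dist (T t \<phi>) 1 \<le> 1 / 2" using Y(3)[OF tX(2) \<phi>(1)] by (simp add: T_def[of 0])
    then show ?thesis unfolding \<phi>(2) dist_real_def by linarith
  qed
  define Q where "Q \<theta> = 1 / t + v t \<theta> + ok e \<theta> / 6 - kap e * gM \<theta>" for \<theta>
  have QT: "Q \<theta> = T t \<theta> / t" for \<theta> using t(1) by (simp add: Q_def T_def field_simps)
  have Q: "Q \<theta> \<ge> 1 / (2 * t)" for \<theta> using Tpos[of \<theta>] t(1) by (simp add: QT field_simps)
  have Qpos: "Q \<theta> > 0" for \<theta> using Q[of \<theta>] t(1) by (smt (verit) divide_pos_pos)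
  define a where "a \<theta> = 1 / Q \<theta>" for \<theta>
  define a' where "a' \<theta> = - (v' t \<theta> + gw \<theta> * okd e \<theta> / 6 - gw \<theta> * om e \<theta>) / (Q \<theta>) ^ 2" for \<theta>
  have a_pos: "a \<theta> > 0" for \<theta> using Qpos by (simp add: a_def)
  have a_le: "a \<theta> \<le> 2 * t" for \<theta>
    using Q[of \<theta>] Qpos[of \<theta>] t(1) by (simp add: a_def field_simps)
  have contQ: "continuous_on UNIV Q"
  proof -
    have "continuous_on UNIV (\<lambda>\<theta>. v t \<theta>)" using v by (meson DERIV_continuous continuous_at_imp_continuous_on)
    then show ?thesis unfolding Q_def[abs_def] by (intro continuous_intros) simp_all
  qed
  have "(a has_real_derivative a' \<theta>) (at \<theta>)" for \<theta>
  proof -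
    have "(Q has_real_derivative v' t \<theta> + gw \<theta> * okd e \<theta> / 6 - gw \<theta> * om e \<theta>) (at \<theta>)"
      unfolding Q_def[abs_def]
      by (auto intro!: derivative_eq_intros v DERIV_ok simp: om_def)
    from DERIV_inverse_fun[OF this] Qpos[of \<theta>]
    have "(a has_real_derivative - ((v' t \<theta> + gw \<theta> * okd e \<theta> / 6 - gw \<theta> * om e \<theta>) / (Q \<theta> * Q \<theta>))) (at \<theta>)"
      by (simp add: a_def[abs_def] inverse_eq_divide)
    then show ?thesis unfolding a'_def power2_eq_square minus_divide_left .
  qed
  moreover have "continuous_on UNIV a'"
    unfolding a'_def[abs_def]
    by (intro continuous_intros cont(2) contQ) (simp_all add: less_imp_neq[OF Qpos, symmetric])
  moreover have "a (\<theta> + 2 * pi) = a \<theta>" "a' (\<theta> + 2 * pi) = a' \<theta>" for \<theta>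
    by (simp_all add: a_def a'_def Q_def per)
  moreover have "\<sigma> * (fF e 0 0 0 0 0 \<theta> (a \<theta>) - a' \<theta>) > 0" for \<theta>
  proof -
    have sp: "small_parameters e 0 0 0 0 0" using e by (simp add: small_parameters_def)
    have lt: "a \<theta> < 1/10" using a_le[of \<theta>] t by linarith
    have den: "fden e 0 0 0 0 0 \<theta> (a \<theta>) > (0::real)" by (rule fden_pos[OF sp a_pos lt])
    have fden_eq: "fden e 0 0 0 0 0 \<theta> (a \<theta>) = a \<theta> ^ 9 * (6 * Q \<theta> + 13 * ok e \<theta>)"
      using Qpos[of \<theta>] by (simp add: fden_def k9_eq a_def field_simps power_numeral_reduce)
    \<comment> \<open>This is \<open>s - A\<close> of the reduced equation. The denominator of the
      slope is \<open>6 * W\<close> times a power of the radius, which gives the sign of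
      \<open>W\<close>.\<close>
    define W where "W = 1 / t + v t \<theta> - oA e \<theta>"
    have W_eq: "6 * W = 6 * Q \<theta> + 13 * ok e \<theta>" by (simp add: W_def Q_def oA_def algebra_simps)
    have Wpos: "W > 0" using den a_pos[of \<theta>] unfolding fden_eq W_eq[symmetric] by (simp add: zero_less_mult_iff)
    have "fF e 0 0 0 0 0 \<theta> (a \<theta>) = gw \<theta> * a \<theta> * (n9 e 0 \<theta> * a \<theta> ^ 9) / (a \<theta> ^ 9 * (6 * W))"
      unfolding fF_def fden_eq W_eq by (simp add: fnum_def)
    also have "\<dots> = gw \<theta> * (6 * om e \<theta> - okd e \<theta>) / (Q \<theta> * (6 * W))"
      using a_pos[of \<theta>] by (simp add: n9_eq a_def)
    finally have F_eq: "fF e 0 0 0 0 0 \<theta> (a \<theta>) = gw \<theta> * (6 * om e \<theta> - okd e \<theta>) / (Q \<theta> * (6 * W))" .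
    have B_eq: "oB e \<theta> = - (W - Q \<theta>) * (om e \<theta> - okd e \<theta> / 6)"
    proof -
      have "W - Q \<theta> = 13/6 * ok e \<theta>" using W_eq by simp
      then show ?thesis unfolding oB_def by (simp only:)
    qed
    have "fF e 0 0 0 0 0 \<theta> (a \<theta>) - a' \<theta> = (v' t \<theta> * W + gw \<theta> * oB e \<theta>) / (Q \<theta> ^ 2 * W)"
      unfolding F_eq a'_def B_eq using Qpos[of \<theta>] Wpos by (simp add: field_simps power2_eq_square)
    also have "\<dots> = t ^ j * E t \<theta> / (Q \<theta> ^ 2 * W)" using E[OF t(1), of \<theta>] by (simp add: W_def)
    finally have "\<sigma> * (fF e 0 0 0 0 0 \<theta> (a \<theta>) - a' \<theta>) = t ^ j * (\<sigma> * E t \<theta>) / (Q \<theta> ^ 2 * W)" by simp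
    then show ?thesis using Epos[of \<theta>] Qpos[of \<theta>] Wpos t(1) by simp
  qed
  ultimately have "barrier_data \<sigma> (fF e 0 0 0 0 0) a" unfolding barrier_data_def by blast
  moreover have "0 < a \<theta> \<and> a \<theta> < \<eta>" for \<theta> using a_pos[of \<theta>] a_le[of \<theta>] t \<eta> by auto
  ultimately show ?thesis by blast
qed

section \<open>Polynomials in C, S, M, J and the bound on \<open>gM\<close>\<close>

definition gmono :: "nat \<Rightarrow> nat \<Rightarrow> nat \<Rightarrow> nat \<Rightarrow> real \<Rightarrow> real" where
  "gmono i j l n \<theta> = gC \<theta> ^ i * gS \<theta> ^ j * gM \<theta> ^ l * gJ \<theta> ^ n"

text \<open>The derivation with \<open>C' = - 2 S^3\<close>, \<open>S' = 3 C^5\<close>,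
  \<open>M' = C S^2\<close>, \<open>J' = C^3 S^5\<close>, that is, the derivative without the common
  factor \<open>gw\<close>. A truncated exponent \<open>i - 1\<close> at \<open>i = 0\<close> is
  harmless because its coefficient is 0.\<close>

definition dmono :: "nat \<Rightarrow> nat \<Rightarrow> nat \<Rightarrow> nat \<Rightarrow> real \<Rightarrow> real \<Rightarrow> real \<Rightarrow> real \<Rightarrow> real" where
  "dmono i j l n c t M J =
     - (2 * real i * (c ^ (i - 1) * t ^ (j + 3) * M ^ l * J ^ n))
     + 3 * real j * (c ^ (i + 5) * t ^ (j - 1) * M ^ l * J ^ n)
     + real l * (c ^ (i + 1) * t ^ (j + 2) * M ^ (l - 1) * J ^ n)
     + real n * (c ^ (i + 3) * t ^ (j + 5) * M ^ l * J ^ (n - 1))"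

lemma DERIV_gmono:
  "(gmono i j l n has_real_derivative gw \<theta> * dmono i j l n (gC \<theta>) (gS \<theta>) (gM \<theta>) (gJ \<theta>)) (at \<theta>)"
proof -
  have "(gmono i j l n has_real_derivative
     (((real i * (- 2 * gS \<theta> ^ 3 * gw \<theta> * gC \<theta> ^ (i - 1))) * gS \<theta> ^ j
       + real j * (3 * gC \<theta> ^ 5 * gw \<theta> * gS \<theta> ^ (j - 1)) * gC \<theta> ^ i) * gM \<theta> ^ l
     + real l * (gw \<theta> * (gC \<theta> * gS \<theta> ^ 2) * gM \<theta> ^ (l - 1)) * (gC \<theta> ^ i * gS \<theta> ^ j)) * gJ \<theta> ^ n
     + real n * (gw \<theta> * (gC \<theta> ^ 3 * gS \<theta> ^ 5) * gJ \<theta> ^ (n - 1)) * (gC \<theta> ^ i * gS \<theta> ^ j * gM \<theta> ^ l)) (at \<theta>)"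
    unfolding gmono_def[abs_def]
    by (intro DERIV_mult DERIV_power[unfolded One_nat_def[symmetric]] DERIV_gC DERIV_gS DERIV_gM DERIV_gJ)
  then show ?thesis
    by (rule DERIV_cong) (simp add: dmono_def power_add algebra_simps power_numeral_reduce)
qed

definition gpoly :: "(real \<times> nat \<times> nat \<times> nat \<times> nat) list \<Rightarrow> real \<Rightarrow> real" where
  "gpoly xs \<theta> = (\<Sum>(x, i, j, l, n)\<leftarrow>xs. x * gmono i j l n \<theta>)"

definition dpoly :: "(real \<times> nat \<times> nat \<times> nat \<times> nat) list \<Rightarrow> real \<Rightarrow> real \<Rightarrow> real \<Rightarrow> real \<Rightarrow> real" where
  "dpoly xs c t M J = (\<Sum>(x, i, j, l, n)\<leftarrow>xs. x * dmono i j l n c t M J)"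

text \<open>The multiples of \<open>c^6 + t^4 - 1\<close> with the listed cofactor, kept expanded;
  with this as an explicit summand \<open>qeven_eq\<close> is an identity of polynomials in free
  variables.\<close>

definition rpoly :: "(real \<times> nat \<times> nat \<times> nat \<times> nat) list \<Rightarrow> real \<Rightarrow> real \<Rightarrow> real \<Rightarrow> real \<Rightarrow> real" where
  "rpoly xs c t M J = (\<Sum>(x, i, j, l, n)\<leftarrow>xs. x * (c ^ (i + 6) * t ^ j * M ^ l * J ^ n
      + c ^ i * t ^ (j + 4) * M ^ l * J ^ n - c ^ i * t ^ j * M ^ l * J ^ n))"

lemma DERIV_gpoly:
  "(gpoly xs has_real_derivative gw \<theta> * dpoly xs (gC \<theta>) (gS \<theta>) (gM \<theta>) (gJ \<theta>)) (at \<theta>)"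
proof (induction xs)
  case (Cons y xs)
  obtain x i j l n where y: "y = (x, i, j, l, n)" by (cases y) auto
  have "((\<lambda>\<theta>. x * gmono i j l n \<theta> + gpoly xs \<theta>) has_real_derivative
      x * (gw \<theta> * dmono i j l n (gC \<theta>) (gS \<theta>) (gM \<theta>) (gJ \<theta>)) + gw \<theta> * dpoly xs (gC \<theta>) (gS \<theta>) (gM \<theta>) (gJ \<theta>)) (at \<theta>)"
    by (intro DERIV_add DERIV_cmult DERIV_gmono Cons.IH)
  then show ?case by (simp add: gpoly_def[abs_def] dpoly_def y algebra_simps)
qed (simp add: gpoly_def[abs_def] dpoly_def)

lemma gpoly_periodic: "gpoly xs (\<theta> + 2 * pi) = gpoly xs \<theta>"
  by (simp add: gpoly_def gmono_def)

lemma continuous_on_dpoly: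
  "continuous_on A (\<lambda>\<theta>. dpoly xs (gC \<theta>) (gS \<theta>) (gM \<theta>) (gJ \<theta>))"
proof (induction xs)
  case (Cons y xs)
  obtain x i j l n where y: "y = (x, i, j, l, n)" by (cases y) auto
  have "continuous_on A (\<lambda>\<theta>. x * dmono i j l n (gC \<theta>) (gS \<theta>) (gM \<theta>) (gJ \<theta>) + dpoly xs (gC \<theta>) (gS \<theta>) (gM \<theta>) (gJ \<theta>))"
    unfolding dmono_def by (intro continuous_intros Cons.IH)
  then show ?case by (simp add: dpoly_def y)
qed (simp add: dpoly_def)

lemma circ_dpoly: "circ (\<lambda>\<theta>. gw \<theta> * dpoly xs (gC \<theta>) (gS \<theta>) (gM \<theta>) (gJ \<theta>)) = 0"
  by (rule circ_exact[OF _ DERIV_gpoly gpoly_periodic]) (intro continuous_intros continuous_on_dpoly)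

lemma rpoly_zero:
  assumes "c ^ 6 + t ^ 4 = 1"
  shows "rpoly xs c t M J = 0"
proof (induction xs)
  case (Cons y xs)
  obtain x i j l n where y: "y = (x, i, j, l, n)" by (cases y) auto
  have "c ^ (i + 6) * t ^ j * M ^ l * J ^ n + c ^ i * t ^ (j + 4) * M ^ l * J ^ n - c ^ i * t ^ j * M ^ l * J ^ n
     = (c ^ 6 + t ^ 4 - 1) * (c ^ i * t ^ j * M ^ l * J ^ n)"
    by (simp add: power_add algebra_simps)
  then show ?case using Cons assms by (simp add: rpoly_def y)
qed (simp add: rpoly_def)

text \<open>\<open>qG\<close> is a numerically fitted polynomial; the differential inequality that makes it a bound for \<open>M\<close> is certified by
  its nonnegative coefficients in the Bernstein basis.\<close>

definition qG :: "real \<Rightarrow> real" where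
  "qG u = 15/1000 + 346/1000 * u - 1125/1000 * u ^ 2 + 3046/1000 * u ^ 3 - 5369/1000 * u ^ 4 + 5699/1000 * u ^ 5
     - 3293/1000 * u ^ 6 + 793/1000 * u ^ 7"

definition qG' :: "real \<Rightarrow> real" where
  "qG' u = 346/1000 - 2250/1000 * u + 9138/1000 * u ^ 2 - 21476/1000 * u ^ 3 + 28495/1000 * u ^ 4
     - 19758/1000 * u ^ 5 + 5551/1000 * u ^ 6"

lemma DERIV_qG: "(qG has_real_derivative qG' u) (at u)"
  unfolding qG_def[abs_def] qG'_def by (auto intro!: derivative_eq_intros)

lemma qG_bernstein:
  "9 * u * qG u + 8 * (1 - u) * qG u - 12 * (1 - u) * u * qG' u - u =
     3/25 * (u ^ 0 * (1 - u) ^ 20) + 31/1000 * (u ^ 1 * (1 - u) ^ 19) + 287/1000 * (u ^ 2 * (1 - u) ^ 18) + 5813/250 * (u ^ 3 * (1 - u) ^ 17) + 63737/500 * (u ^ 4 * (1 - u) ^ 16) + 292399/1000 * (u ^ 5 * (1 - u) ^ 15) + 36238/125 * (u ^ 6 * (1 - u) ^ 14) + 5527/250 * (u ^ 7 * (1 - u) ^ 13) + 6773/500 * (u ^ 8 * (1 - u) ^ 12) + 6591/8 * (u ^ 9 * (1 - u) ^ 11) + 949663/500 * (u ^ 10 * (1 - u) ^ 10) + 207571/100 * (u ^ 11 * (1 - u) ^ 9) + 123851/100 * (u ^ 12 * (1 - u) ^ 8) + 348481/1000 * (u ^ 13 * (1 - u) ^ 7) + 701/125 * (u ^ 14 * (1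 - u) ^ 6) + 92/25 * (u ^ 15 * (1 - u) ^ 5) + 12731/500 * (u ^ 16 * (1 - u) ^ 4) + 6407/500 * (u ^ 17 * (1 - u) ^ 3) + 2187/1000 * (u ^ 18 * (1 - u) ^ 2) + 41/500 * (u ^ 19 * (1 - u) ^ 1) + 1/125 * (u ^ 20 * (1 - u) ^ 0)"
  unfolding qG_def qG'_def by algebra

lemma qG_nonneg:
  assumes "0 \<le> u" "u \<le> 1"
  shows "9 * u * qG u + 8 * (1 - u) * qG u - 12 * (1 - u) * u * qG' u - u \<ge> 0"
  unfolding qG_bernstein using assms by (intro add_nonneg_nonneg mult_nonneg_nonneg zero_le_power) auto

text \<open>Both sides vanish at angle 0. For this shape of bound the derivative of the difference
  is \<open>w S^2 / C^5\<close> times a polynomial in \<open>u = C^6\<close> alone, the one shown to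
  be nonnegative in \<open>qG_nonneg\<close>.\<close>

lemma gM_le:
  assumes "0 \<le> \<theta>" "\<theta> < pi / 2"
  shows "gM \<theta> \<le> gS \<theta> ^ 3 * qG (gC \<theta> ^ 6) / gC \<theta> ^ 4"
proof -
  have Cpos: "gC x > 0" if "0 \<le> x" "x \<le> \<theta>" for x
    using that assms cos_gt_zero_pi[of x] unfolding gC_def by (intro mult_pos_pos zero_less_power gR_pos) auto
  let ?X = "\<lambda>x. gS x ^ 3 * qG (gC x ^ 6) / gC x ^ 4 - gM x"
  have "\<exists>y. (?X has_real_derivative y) (at x) \<and> 0 \<le> y" if x: "0 \<le> x" "x \<le> \<theta>" for x
  proof (intro exI conjI)
    define c t w where "c = gC x" and "t = gS x" and "w = gw x"
    have c: "c > 0" using Cpos[OF x] by (simp add: c_def)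
    have ct: "c ^ 6 + t ^ 4 = 1" unfolding c_def t_def by (rule gC_gS)
    have "((\<lambda>x. gS x ^ 3 * qG (gC x ^ 6)) has_real_derivative
        (3 * t ^ 2 * (3 * c ^ 5 * w)) * qG (c ^ 6) + t ^ 3 * (qG' (c ^ 6) * (6 * c ^ 5 * (- 2 * t ^ 3 * w)))) (at x)"
      unfolding c_def t_def w_def
      by (auto intro!: derivative_eq_intros DERIV_chain2[OF DERIV_qG])
    moreover have "((\<lambda>x. gC x ^ 4) has_real_derivative 4 * c ^ 3 * (- 2 * t ^ 3 * w)) (at x)"
      unfolding c_def t_def w_def by (auto intro!: derivative_eq_intros)
    ultimately have D: "((\<lambda>x. gS x ^ 3 * qG (gC x ^ 6) / gC x ^ 4 - gM x) has_real_derivative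
        (((3 * t ^ 2 * (3 * c ^ 5 * w)) * qG (c ^ 6) + t ^ 3 * (qG' (c ^ 6) * (6 * c ^ 5 * (- 2 * t ^ 3 * w)))) * gC x ^ 4
          - gS x ^ 3 * qG (gC x ^ 6) * (4 * c ^ 3 * (- 2 * t ^ 3 * w))) / (gC x ^ 4 * gC x ^ 4) - w * (c * t ^ 2)) (at x)"
      using c unfolding c_def t_def w_def by (intro DERIV_diff DERIV_divide DERIV_gM) auto
    have t4: "t ^ 4 = 1 - c ^ 6" using ct by simp
    have eq: "(((3 * t ^ 2 * (3 * c ^ 5 * w)) * g + t ^ 3 * (g' * (6 * c ^ 5 * (- 2 * t ^ 3 * w)))) * c ^ 4
          - t ^ 3 * g * (4 * c ^ 3 * (- 2 * t ^ 3 * w))) / (c ^ 4 * c ^ 4) - w * (c * t ^ 2)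
        = w * t ^ 2 / c ^ 5 * (9 * c ^ 6 * g + 8 * t ^ 4 * g - 12 * t ^ 4 * c ^ 6 * g' - c ^ 6)" for g g'
      using c by (simp add: field_simps power_numeral_reduce)
    show "(?X has_real_derivative w * t ^ 2 / c ^ 5 * (9 * c ^ 6 * qG (c ^ 6) + 8 * (1 - c ^ 6) * qG (c ^ 6)
        - 12 * (1 - c ^ 6) * c ^ 6 * qG' (c ^ 6) - c ^ 6)) (at x)"
      using D unfolding c_def[symmetric] t_def[symmetric] eq t4 .
    have "c ^ 6 \<le> 1" using ct zero_le_even_power'[of t 2] by (simp add: power_numeral_reduce)
    then have "0 \<le> 9 * c ^ 6 * qG (c ^ 6) + 8 * (1 - c ^ 6) * qG (c ^ 6) - 12 * (1 - c ^ 6) * c ^ 6 * qG' (c ^ 6) - c ^ 6"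
      by (intro qG_nonneg) auto
    then show "0 \<le> w * t ^ 2 / c ^ 5 * (9 * c ^ 6 * qG (c ^ 6) + 8 * (1 - c ^ 6) * qG (c ^ 6)
        - 12 * (1 - c ^ 6) * c ^ 6 * qG' (c ^ 6) - c ^ 6)"
      using c by (intro mult_nonneg_nonneg divide_nonneg_nonneg) (auto simp: w_def less_imp_le)
  qed
  from DERIV_nonneg_imp_nondecreasing[of 0 \<theta> ?X, OF assms(1) this] show ?thesis by simp
qed

text \<open>Multiplied by \<open>C^4 S\<close>, the bound has no denominator and is invariant under
  reflection and under the half turn, so a quarter of the period suffices. At its end
  \<open>C\<close> is 0 and the claim reduces to \<open>qG 0 > 0\<close>.\<close>

lemma gM_bound: "gM \<theta> * gC \<theta> ^ 4 * gS \<theta> \<le> gS \<theta> ^ 4 * qG (gC \<theta> ^ 6)"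
proof -
  let ?h = "\<lambda>\<theta>. gS \<theta> ^ 4 * qG (gC \<theta> ^ 6) - gM \<theta> * gC \<theta> ^ 4 * gS \<theta>"
  have main: "?h \<theta> \<ge> 0" if \<theta>: "0 \<le> \<theta>" "\<theta> \<le> pi / 2" for \<theta>
  proof (cases "\<theta> = pi / 2")
    case True
    then have "gC \<theta> = 0" unfolding True gC_def by simp
    then show ?thesis by (simp add: qG_def)
  next
    case False
    then have lt: "\<theta> < pi / 2" using \<theta> by simp
    then have C: "gC \<theta> > 0" using \<theta> lt cos_gt_zero_pi[of \<theta>]
      unfolding gC_def by (intro mult_pos_pos zero_less_power gR_pos) auto
    have S: "gS \<theta> \<ge> 0" using \<theta> unfolding gS_def by (intro mult_nonneg_nonneg zero_le_power less_imp_le[OF gR_pos] sin_ge_zero) auto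
    have "gM \<theta> * gC \<theta> ^ 4 \<le> gS \<theta> ^ 3 * qG (gC \<theta> ^ 6)"
      using gM_le[OF \<theta>(1) lt] C by (simp add: pos_le_divide_eq)
    then have "gM \<theta> * gC \<theta> ^ 4 * gS \<theta> \<le> gS \<theta> ^ 3 * qG (gC \<theta> ^ 6) * gS \<theta>"
      using S by (rule mult_right_mono)
    then show ?thesis by (simp add: algebra_simps power_numeral_reduce)
  qed
  have per: "?h (\<theta> + pi) = ?h \<theta>" and mir: "?h (- \<theta>) = ?h \<theta>" for \<theta> by simp_all
  obtain n :: int where n: "- (pi/2) \<le> \<theta> + of_int n * pi" "\<theta> + of_int n * pi < - (pi/2) + pi"
    by (rule periodic_representative[of pi "- (pi/2)" \<theta>]) simp
  have "?h (\<theta> + of_int n * pi) = ?h \<theta>" by (rule periodic_shift_int[where \<phi> = ?h, OF per])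
  moreover have "?h (\<theta> + of_int n * pi) \<ge> 0"
  proof (cases "\<theta> + of_int n * pi \<ge> 0")
    case True
    then show ?thesis using n by (intro main) auto
  next
    case False
    then have "?h (- (\<theta> + of_int n * pi)) \<ge> 0" using n by (intro main) auto
    then show ?thesis by (simp only: mir)
  qed
  ultimately show ?thesis by simp
qed

text \<open>The non-exact even part \<open>qeven\<close> of the fifth-order coefficient is an exact derivative (\<open>qlist\<close>), plus a multiple of
  \<open>C\<^sup>6 + S\<^sup>4 - 1\<close> (\<open>rlist\<close>), plus a positive function; the lists come from solving a linear system for their coefficients.\<close>

definition qlist :: "(real \<times> nat \<times> nat \<times> nat \<times> nat) list" where
  "qlist = [(371817298357/401591964852000000, 1, 1, 0, 0), (-11/936000, 5, 2, 1, 0), (1/922740, 7, 0, 3, 0), (1276127861453/562228750792800000, 7, 1, 0, 0), (1/80491320, 9, 3, 0, 1), (-1/2768220, 9, 3, 2, 0), (-10597/1245699000, 11, 2, 1, 0), (-111875160291572921/22183595241795842400000, 13, 1, 0, 0), (12409/311424750, 17, 2, 1, 0), (480413476746667/152990312012385120000, 19, 1, 0, 0), (-181724560478887/23321693904327000000, 25, 1, 0, 0), (177493/16921125000, 31, 1, 0, 0), (-1319/260325000, 37, 1, 0, 0), (671/640800000, 43, 1, 0, 0)]"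

definition rlist :: "(real \<times> nat \<times> nat \<times> nat \<times> nat) list" where
  "rlist = [(35700043289/401591964852000000, 0, 0, 0, 0), (-11/93600, 4, 1, 1, 0), (28778798459/10039799121300000, 6, 0, 0, 0), (-1/8943480, 8, 2, 0, 1), (1/307580, 8, 2, 2, 0), (-11/58500, 10, 1, 1, 0), (-2/1245699, 10, 5, 1, 0), (319999782239/33072279458400000, 12, 0, 0, 0), (31333/395534346480, 12, 4, 0, 0), (63017/791068692960, 12, 8, 0, 0), (-12409/51904125, 16, 1, 1, 0), (-347649732587083/63745963338493800000, 18, 0, 0, 0), (586877321/2472089665500, 18, 4, 0, 0), (24669962277683/6219118374487200000, 24, 0, 0, 0), (-3503251/180492000000, 30, 0, 0, 0), (6697/555360000, 36, 0, 0, 0), (-671/213600000, 42, 0, 0, 0)]"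

definition qeven :: "real \<Rightarrow> real \<Rightarrow> real \<Rightarrow> real \<Rightarrow> real" where
  "qeven c t M J = (-1/65910) * c ^ 6 * t ^ 3 * M ^ 3 + (1/8943480) * c ^ 8 * t ^ 2 * J + (-1/2981160) * c ^ 8 * t ^ 6 * J + (3/307580) * c ^ 8 * t ^ 6 * M ^ 2 + (-2/1245699) * c ^ 10 * t ^ 9 * M + (1/83472480) * c ^ 12 * t ^ 8 + (63017/791068692960) * c ^ 12 * t ^ 12 + (-14/8775) * c ^ 16 * t ^ 5 * M + (1/28000) * c ^ 18 * t ^ 4 + (63017/265356000) * c ^ 18 * t ^ 8"

lemma qeven_eq:
  "qeven c t M J = dpoly qlist c t M J + rpoly rlist c t M J + 11/93600 * (t ^ 4 * qG (c ^ 6) - M * c ^ 4 * t) + 35700043289/401591964852000000"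
  unfolding qeven_def dpoly_def rpoly_def qlist_def rlist_def dmono_def qG_def
  by (simp add: algebra_simps flip: power_mult) algebra

text \<open>The first correction of the curve \<open>s = 1/t\<close>. It is written out because its
  periodicity, visible from the formula, is the vanishing of the lowest averaged coefficient, and
  because the fifth-order computation needs its terms.\<close>

definition oq1 :: "real \<Rightarrow> real \<Rightarrow> real" where
  "oq1 e \<theta> = - (13/420) * kap e * gC \<theta> ^ 7 + 13/6 * bet e * kap e * gJ \<theta> - 169/936 * ok e \<theta> ^ 2"

lemma DERIV_oq1: "(oq1 e has_real_derivative - (gw \<theta> * oB e \<theta>)) (at \<theta>)"
proof -
  have "(oq1 e has_real_derivative - (13/420) * kap e * (7 * gC \<theta> ^ 6 * (- 2 * gS \<theta> ^ 3 * gw \<theta>))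
      + 13/6 * bet e * kap e * (gw \<theta> * (gC \<theta> ^ 3 * gS \<theta> ^ 5)) - 169/936 * (2 * ok e \<theta> * (gw \<theta> * okd e \<theta>))) (at \<theta>)"
    unfolding oq1_def[abs_def] by (auto intro!: derivative_eq_intros DERIV_ok)
  then show ?thesis
    by (rule DERIV_cong) (simp add: oB_def om_def ok_def[of e \<theta>] field_simps power_numeral_reduce)
qed

lemma oq1_simps [simp]: "oq1 e (\<theta> + 2 * pi) = oq1 e \<theta>" "oq1 e (- \<theta>) = oq1 e \<theta>"
  by (simp_all add: oq1_def)

lemma continuous_on_oq1 [continuous_intros]:
  "continuous_on A f \<Longrightarrow> continuous_on A (\<lambda>x. oq1 e (f x))"
  unfolding oq1_def by (intro continuous_intros)

text \<open>The integrand splits into the derivative of the periodic function \<open>?H\<close>, a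
  part \<open>?o\<close> that changes sign under the half turn, and a multiple of
  \<open>C^8 S^6\<close>. Only the last contributes.\<close>

lemma cubic_coefficient:
  "circ (\<lambda>\<theta>. gw \<theta> * (oB e \<theta> * oA e \<theta>)) = - (13/140) * e * kap e * circ (\<lambda>\<theta>. gw \<theta> * (gC \<theta> ^ 8 * gS \<theta> ^ 6))"
proof -
  let ?H = "\<lambda>\<theta>. 169/936 * kap e * ok e \<theta> ^ 2 * gM \<theta> - 91/324 * ok e \<theta> ^ 3
     + 13/420 * kap e ^ 2 * gC \<theta> ^ 7 * gM \<theta> - 13/3780 * kap e ^ 2 * gC \<theta> ^ 9 * gS \<theta> ^ 3"
  let ?h = "\<lambda>\<theta>. 169/936 * kap e * (2 * ok e \<theta> * okd e \<theta> * gM \<theta> + ok e \<theta> ^ 2 * (gC \<theta> * gS \<theta> ^ 2))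
     - 91/108 * ok e \<theta> ^ 2 * okd e \<theta>
     + 13/420 * kap e ^ 2 * (- 14 * gC \<theta> ^ 6 * gS \<theta> ^ 3 * gM \<theta> + gC \<theta> ^ 8 * gS \<theta> ^ 2)
     - 13/3780 * kap e ^ 2 * (9 * (gC \<theta> ^ 14 * gS \<theta> ^ 2) - 18 * gC \<theta> ^ 8 * gS \<theta> ^ 6)"
  let ?o = "\<lambda>\<theta>. - (13/6) * bet e * kap e ^ 2 * gC \<theta> ^ 3 * gS \<theta> ^ 5 * gM \<theta>
     + 27/26 * kap e * (169/900 * gC \<theta> ^ 10 * gS \<theta> ^ 2 + 169/36 * bet e ^ 2 * gC \<theta> ^ 4 * gS \<theta> ^ 6) * (gC \<theta> * gS \<theta> ^ 2)"
  have DH: "(?H has_real_derivative gw \<theta> * ?h \<theta>) (at \<theta>)" for \<theta>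
  proof -
    have "(?H has_real_derivative
       (169/936 * kap e * (2 * ok e \<theta> * (gw \<theta> * okd e \<theta>))) * gM \<theta> + (169/936 * kap e * ok e \<theta> ^ 2) * (gw \<theta> * (gC \<theta> * gS \<theta> ^ 2))
       - 91/324 * (3 * ok e \<theta> ^ 2 * (gw \<theta> * okd e \<theta>))
       + ((13/420 * kap e ^ 2 * (7 * gC \<theta> ^ 6 * (- 2 * gS \<theta> ^ 3 * gw \<theta>))) * gM \<theta>
          + (13/420 * kap e ^ 2 * gC \<theta> ^ 7) * (gw \<theta> * (gC \<theta> * gS \<theta> ^ 2)))
       - ((13/3780 * kap e ^ 2 * (9 * gC \<theta> ^ 8 * (- 2 * gS \<theta> ^ 3 * gw \<theta>))) * gS \<theta> ^ 3
          + (13/3780 * kap e ^ 2 * gC \<theta> ^ 9) * (3 * gS \<theta> ^ 2 * (3 * gC \<theta> ^ 5 * gw \<theta>)))) (at \<theta>)"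
      by (auto intro!: derivative_eq_intros DERIV_ok) algebra
    then show ?thesis by (rule DERIV_cong) (simp add: field_simps power_numeral_reduce)
  qed
  have eq: "oB e \<theta> * oA e \<theta> = ?h \<theta> + (- (13/140) * e * kap e * (gC \<theta> ^ 8 * gS \<theta> ^ 6) + ?o \<theta>)" for \<theta>
  proof -
    have "- (13/6) * k * (p * c * t ^ 2 - kd / 6) * (p * M - 7/3 * k) =
      169/936 * p * (2 * k * kd * M + k ^ 2 * (c * t ^ 2)) - 91/108 * k ^ 2 * kd
     + 13/420 * p ^ 2 * (- 14 * c ^ 6 * t ^ 3 * M + c ^ 8 * t ^ 2) - 13/3780 * p ^ 2 * (9 * (c ^ 14 * t ^ 2) - 18 * c ^ 8 * t ^ 6)
     + ((39/20 * b - 13/140 * p) * p * (c ^ 8 * t ^ 6) + (- (13/6) * b * p ^ 2 * c ^ 3 * t ^ 5 * M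
     + 27/26 * p * (169/900 * c ^ 10 * t ^ 2 + 169/36 * b ^ 2 * c ^ 4 * t ^ 6) * (c * t ^ 2)))"
      if k: "k = c ^ 5 * t / 5 + b * c ^ 2 * t ^ 3" and "c ^ 6 + t ^ 4 = 1" for c t M b p k kd :: real
    proof -
      have 1: "- (13/6) * k * (p * c * t ^ 2 - kd / 6) * (p * M - 7/3 * k) =
          169/936 * p * (2 * k * kd * M + k ^ 2 * (c * t ^ 2)) - 91/108 * k ^ 2 * kd
          + (- (13/6) * k * p ^ 2 * c * t ^ 2 * M + (91/18 - 169/936) * p * k ^ 2 * c * t ^ 2)" by algebra
      have 2: "c ^ 14 * t ^ 2 = c ^ 8 * t ^ 2 - c ^ 8 * t ^ 6" using that(2) by algebra
      show ?thesis unfolding 1 2 unfolding k by (simp add: field_simps power_numeral_reduce)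
    qed
    note this[of "ok e \<theta>" "gC \<theta>" "gS \<theta>" "bet e" "kap e" "okd e \<theta>" "gM \<theta>", OF ok_def gC_gS]
    \<comment> \<open>At \<open>e = 0\<close> the two contributions to the surviving monomial
      cancel. This is where the special values of the coefficients a22 and b13 take effect.\<close>
    moreover have "39/20 * bet e - 13/140 * kap e = - (13/140) * e" by (simp add: bet_def kap_def field_simps)
    ultimately show ?thesis by (simp only: oB_def oA_def om_def)
  qed
  have ch: "continuous_on UNIV (\<lambda>\<theta>. gw \<theta> * ?h \<theta>)" and co: "continuous_on UNIV (\<lambda>\<theta>. gw \<theta> * ?o \<theta>)"
    and cm: "continuous_on UNIV (\<lambda>\<theta>. gw \<theta> * (gC \<theta> ^ 8 * gS \<theta> ^ 6))"
    by (intro continuous_intros)+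
  have zh: "circ (\<lambda>\<theta>. gw \<theta> * ?h \<theta>) = 0" by (rule circ_exact[OF ch DH]) simp
  have zo: "circ (\<lambda>\<theta>. gw \<theta> * ?o \<theta>) = 0" by (rule circ_antiperiodic[OF co]) (simp add: algebra_simps)
  have "circ (\<lambda>\<theta>. gw \<theta> * (oB e \<theta> * oA e \<theta>)) =
      circ (\<lambda>\<theta>. gw \<theta> * ?h \<theta> + ((- (13/140) * e * kap e) * (gw \<theta> * (gC \<theta> ^ 8 * gS \<theta> ^ 6)) + gw \<theta> * ?o \<theta>))"
    unfolding eq by (simp add: algebra_simps)
  also have "\<dots> = circ (\<lambda>\<theta>. gw \<theta> * ?h \<theta>) + (- (13/140) * e * kap e * circ (\<lambda>\<theta>. gw \<theta> * (gC \<theta> ^ 8 * gS \<theta> ^ 6))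
      + circ (\<lambda>\<theta>. gw \<theta> * ?o \<theta>))"
    by (simp only: circ_add[OF ch continuous_on_add[OF continuous_on_mult_left[OF cm] co]]
        circ_add[OF continuous_on_mult_left[OF cm] co] circ_cmult[OF cm])
  finally show ?thesis using zh zo by simp
qed

text \<open>Removing the square of \<open>ok\<close> leaves a function whose derivative is a
  multiple of \<open>om\<close>, so that \<open>k'\<close> can be eliminated below.\<close>

definition oN :: "real \<Rightarrow> real" where "oN \<theta> = oq1 0 \<theta> + 169/936 * ok 0 \<theta> ^ 2"

lemma oN_eq: "oN \<theta> = - (1/420) * gC \<theta> ^ 7 + 1/1638 * gJ \<theta>"
  by (simp add: oN_def oq1_def kap_def bet_def)

lemma DERIV_oN: "(oN has_real_derivative gw \<theta> * (13/6 * ok 0 \<theta> * om 0 \<theta>)) (at \<theta>)"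
proof -
  have "(oN has_real_derivative - (gw \<theta> * oB 0 \<theta>) + 169/936 * (2 * ok 0 \<theta> * (gw \<theta> * okd 0 \<theta>))) (at \<theta>)"
    unfolding oN_def[abs_def] by (auto intro!: derivative_eq_intros DERIV_ok DERIV_oq1)
  then show ?thesis by (rule DERIV_cong) (simp add: oB_def field_simps power2_eq_square)
qed

lemma continuous_on_oN [continuous_intros]:
  "continuous_on A f \<Longrightarrow> continuous_on A (\<lambda>x. oN (f x))"
  unfolding oN_def by (intro continuous_intros)

text \<open>Up to exact terms the fifth-order coefficient is the mean of \<open>m S\<close>, where \<open>S\<close> is a polynomial in \<open>k\<close>, \<open>M\<close>
  and \<open>N\<close> with \<open>M' = m\<close>, \<open>N' = (13/6) k m\<close>.\<close>

definition qS :: "real \<Rightarrow> real \<Rightarrow> real \<Rightarrow> real" where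
  "qS k M N = - (13/6) * k * M ^ 3 + 117/8 * M ^ 2 * k ^ 2 - 910/27 * M * k ^ 3
     + 819221/31104 * k ^ 4
     + (-39/8) * N * k ^ 2 - N ^ 2 / 2"

text \<open>A primitive that collects all terms containing \<open>k'\<close>, found by integrating
  by parts with \<open>M' = m\<close> and \<open>N' = (13/6) k m\<close>. It is evaluated on
  periodic functions, so its derivative has mean zero.\<close>

definition qexact :: "real \<Rightarrow> real \<Rightarrow> real \<Rightarrow> real" where
  "qexact k M N = (M - 7/3 * k) * (N - 169/936 * k ^ 2) ^ 2 / 2
     + 13/36 * (M ^ 3 * k ^ 2 / 2 - 7/3 * M ^ 2 * k ^ 3 + 49/12 * M * k ^ 4 - 343/135 * k ^ 5)
     + 7/6 * (N ^ 2 * k - 169/1404 * N * k ^ 3 + 28561/4380480 * k ^ 5)"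

definition qexact' :: "real \<Rightarrow> real \<Rightarrow> real \<Rightarrow> real \<Rightarrow> real \<Rightarrow> real" where
  "qexact' k kd m M N = (m - 7/3 * kd) * (N - 169/936 * k ^ 2) ^ 2 / 2
     + (M - 7/3 * k) * (N - 169/936 * k ^ 2) * (13/6 * k * m - 13/36 * k * kd)
     + 13/36 * (k * kd * (M - 7/3 * k) ^ 3 + m * (3/2 * M ^ 2 * k ^ 2 - 14/3 * M * k ^ 3 + 49/12 * k ^ 4))
     + 7/6 * ((N - 169/936 * k ^ 2) ^ 2 * kd + (2 * N * k - 169/1404 * k ^ 3) * (13/6 * k * m))"

lemma DERIV_qexact:
  assumes k: "(k has_real_derivative w * kd) (at x)" and M: "(M has_real_derivative w * m) (at x)"
    and N: "(N has_real_derivative w * (13/6 * k x * m)) (at x)"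
  shows "((\<lambda>x. qexact (k x) (M x) (N x)) has_real_derivative w * qexact' (k x) kd m (M x) (N x)) (at x)"
proof -
  note D = DERIV_add DERIV_diff DERIV_mult DERIV_cmult DERIV_power DERIV_const DERIV_cdivide k M N
  have 1: "((\<lambda>x. (M x - 7/3 * k x) * (N x - 169/936 * k x ^ 2) ^ 2 / 2) has_real_derivative
      w * ((m - 7/3 * kd) * (N x - 169/936 * k x ^ 2) ^ 2 / 2
     + (M x - 7/3 * k x) * (N x - 169/936 * k x ^ 2) * (13/6 * k x * m - 13/36 * k x * kd))) (at x)"
    by (rule DERIV_cong, (rule D)+) (simp add: field_simps power2_eq_square)
  have 2: "((\<lambda>x. 13/36 * (M x ^ 3 * k x ^ 2 / 2 - 7/3 * M x ^ 2 * k x ^ 3 + 49/12 * M x * k x ^ 4 - 343/135 * k x ^ 5))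
      has_real_derivative w * (13/36 * (k x * kd * (M x - 7/3 * k x) ^ 3
        + m * (3/2 * M x ^ 2 * k x ^ 2 - 14/3 * M x * k x ^ 3 + 49/12 * k x ^ 4)))) (at x)"
    by (rule DERIV_cong, (rule D)+) (simp add: field_simps power_numeral_reduce)
  have 3: "((\<lambda>x. 7/6 * (N x ^ 2 * k x - 169/1404 * N x * k x ^ 3 + 28561/4380480 * k x ^ 5)) has_real_derivative
      w * (7/6 * ((N x - 169/936 * k x ^ 2) ^ 2 * kd + (2 * N x * k x - 169/1404 * k x ^ 3) * (13/6 * k x * m)))) (at x)"
    by (rule DERIV_cong, (rule D)+) (simp add: field_simps power_numeral_reduce)
  show ?thesis
    unfolding qexact_def qexact'_def
    by (rule DERIV_cong[OF DERIV_add[OF DERIV_add[OF 1 2] 3]]) (simp only: distrib_left add.assoc)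
qed

text \<open>The left side is the fifth-order integrand without \<open>gw\<close>, with
  \<open>A = M - 7/3 k\<close> and the first correction written through \<open>N\<close>. Modulo
  exact terms it becomes divisible by \<open>m\<close>.\<close>

lemma quintic_decomposition:
  "- (13/6) * k * (m - kd / 6) * ((M - 7/3 * k) ^ 3 - (M - 7/3 * k) * (N - 169/936 * k ^ 2))
     = qexact' k kd m M N + m * qS k M N"
  unfolding qexact'_def qS_def by (simp add: field_simps power_numeral_reduce)

text \<open>Here \<open>k = k1 + k2\<close> and \<open>N = N1 + N2\<close> are split by their
  behaviour under the half turn: \<open>k1\<close> and \<open>N2\<close> are invariant, while
  \<open>k2\<close>, \<open>M\<close> and \<open>N1\<close> change sign. The terms of
  \<open>qS\<close> collected here are the invariant ones; since \<open>C S^2\<close> changes sign,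
  their product with it has mean zero.\<close>

definition qSodd :: "real \<Rightarrow> real \<Rightarrow> real \<Rightarrow> real \<Rightarrow> real \<Rightarrow> real" where
  "qSodd k1 k2 M N1 N2 = - (13/6) * k2 * M ^ 3 + 117/8 * M ^ 2 * (k1 ^ 2 + k2 ^ 2) - 910/27 * M * (k2 ^ 3 + 3 * k1 ^ 2 * k2)
     + 819221/31104 * (k1 ^ 4 + 6 * k1 ^ 2 * k2 ^ 2 + k2 ^ 4)
     + (-39/8) * (N2 * (k1 ^ 2 + k2 ^ 2) + 2 * N1 * k1 * k2) - (N1 ^ 2 + N2 ^ 2) / 2"

lemma qSodd_flip: "qSodd k1 (- k2) (- M) (- N1) N2 = qSodd k1 k2 M N1 N2"
proof -
  have "M * ((- k2) ^ 3 + 3 * k1 ^ 2 * - k2) = - (M * (k2 ^ 3 + 3 * k1 ^ 2 * k2))" by (simp add: algebra_simps)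
  then show ?thesis by (simp add: qSodd_def)
qed

lemma qS_split:
  "1/13 * c * t ^ 2 * qS (c ^ 5 * t / 5 + 1/273 * c ^ 2 * t ^ 3) (1/13 * M) (- (1/420) * c ^ 7 + 1/1638 * J)
     = qeven c t M J + 1/13 * c * t ^ 2 * qSodd (c ^ 5 * t / 5) (1/273 * c ^ 2 * t ^ 3) (1/13 * M) (- (1/420) * c ^ 7) (1/1638 * J)"
proof -
  have "qS (k1 + k2) M N = (- (13/6) * k1 * M ^ 3 + 117/4 * M ^ 2 * k1 * k2 - 910/27 * M * (k1 ^ 3 + 3 * k1 * k2 ^ 2)
     + 4 * 819221/31104 * (k1 ^ 3 * k2 + k1 * k2 ^ 3)
     + (-39/8) * (N1 * (k1 ^ 2 + k2 ^ 2) + 2 * N2 * k1 * k2) - N1 * N2) + qSodd k1 k2 M N1 N2"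
    if "N = N1 + N2" for k1 k2 M N N1 N2
    unfolding qS_def qSodd_def that by (simp add: field_simps power_numeral_reduce)
  note split = this[OF refl, of "c ^ 5 * t / 5" "1/273 * c ^ 2 * t ^ 3" "1/13 * M" "- (1/420) * c ^ 7" "1/1638 * J"]
  show ?thesis
    unfolding split distrib_left qeven_def
    by (simp add: algebra_simps power_mult_distrib power_divide flip: power_mult) algebra
qed

text \<open>Of the four parts three have mean zero: the exact derivative \<open>?x\<close>, the part
  \<open>?o\<close> that is odd under the half turn, and the exact derivative \<open>?d\<close>. The
  rest \<open>?p\<close> is positive by \<open>gM_bound\<close> and a positive constant.\<close>

lemma quintic_coefficient:
  "circ (\<lambda>\<theta>. gw \<theta> * (oB 0 \<theta> * (oA 0 \<theta> ^ 3 - oA 0 \<theta> * oq1 0 \<theta>))) > 0"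
proof -
  let ?x = "\<lambda>\<theta>. qexact' (ok 0 \<theta>) (okd 0 \<theta>) (om 0 \<theta>) (1/13 * gM \<theta>) (oN \<theta>)"
  let ?o = "\<lambda>\<theta>. 1/13 * gC \<theta> * gS \<theta> ^ 2 * qSodd (gC \<theta> ^ 5 * gS \<theta> / 5) (1/273 * gC \<theta> ^ 2 * gS \<theta> ^ 3)
     (1/13 * gM \<theta>) (- (1/420) * gC \<theta> ^ 7) (1/1638 * gJ \<theta>)"
  let ?d = "\<lambda>\<theta>. dpoly qlist (gC \<theta>) (gS \<theta>) (gM \<theta>) (gJ \<theta>)"
  let ?p = "\<lambda>\<theta>. 11/93600 * (gS \<theta> ^ 4 * qG (gC \<theta> ^ 6) - gM \<theta> * gC \<theta> ^ 4 * gS \<theta>) + 35700043289/401591964852000000"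
  have eq: "oB 0 \<theta> * (oA 0 \<theta> ^ 3 - oA 0 \<theta> * oq1 0 \<theta>) = ?x \<theta> + (?o \<theta> + (?d \<theta> + ?p \<theta>))" for \<theta>
  proof -
    have q: "oq1 0 \<theta> = oN \<theta> - 169/936 * ok 0 \<theta> ^ 2" by (simp add: oN_def)
    have A: "oA 0 \<theta> = 1/13 * gM \<theta> - 7/3 * ok 0 \<theta>" by (simp add: oA_def kap_def)
    have m: "om 0 \<theta> = 1/13 * gC \<theta> * gS \<theta> ^ 2" by (simp add: om_def kap_def)
    have k: "ok 0 \<theta> = gC \<theta> ^ 5 * gS \<theta> / 5 + 1/273 * gC \<theta> ^ 2 * gS \<theta> ^ 3" by (simp add: ok_def bet_def)
    have "oB 0 \<theta> * (oA 0 \<theta> ^ 3 - oA 0 \<theta> * oq1 0 \<theta>) = ?x \<theta> + om 0 \<theta> * qS (ok 0 \<theta>) (1/13 * gM \<theta>) (oN \<theta>)"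
      unfolding q A oB_def by (rule quintic_decomposition)
    also have "om 0 \<theta> * qS (ok 0 \<theta>) (1/13 * gM \<theta>) (oN \<theta>) = qeven (gC \<theta>) (gS \<theta>) (gM \<theta>) (gJ \<theta>) + ?o \<theta>"
      unfolding m k oN_eq by (rule qS_split)
    also have "qeven (gC \<theta>) (gS \<theta>) (gM \<theta>) (gJ \<theta>) = ?d \<theta> + ?p \<theta>"
      unfolding qeven_eq rpoly_zero[OF gC_gS] by simp
    finally show ?thesis by simp
  qed
  have cx: "continuous_on UNIV (\<lambda>\<theta>. gw \<theta> * ?x \<theta>)" and co: "continuous_on UNIV (\<lambda>\<theta>. gw \<theta> * ?o \<theta>)"
    and cd: "continuous_on UNIV (\<lambda>\<theta>. gw \<theta> * ?d \<theta>)" and cp: "continuous_on UNIV (\<lambda>\<theta>. gw \<theta> * ?p \<theta>)"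
    unfolding qexact'_def qSodd_def qG_def by (intro continuous_intros continuous_on_dpoly; simp)+
  have dM: "((\<lambda>\<theta>. 1/13 * gM \<theta>) has_real_derivative gw \<theta> * om 0 \<theta>) (at \<theta>)" for \<theta>
    by (auto intro!: derivative_eq_intros simp: om_def kap_def)
  have zx: "circ (\<lambda>\<theta>. gw \<theta> * ?x \<theta>) = 0"
    by (rule circ_exact[OF cx DERIV_qexact[OF DERIV_ok dM DERIV_oN]]) (simp add: oN_def)
  have zo: "circ (\<lambda>\<theta>. gw \<theta> * ?o \<theta>) = 0"
  proof (rule circ_antiperiodic[OF co])
    fix \<theta>
    show "gw (\<theta> + pi) * ?o (\<theta> + pi) = - (gw \<theta> * ?o \<theta>)"
      using qSodd_flip[of "gC \<theta> ^ 5 * gS \<theta> / 5" "1/273 * gC \<theta> ^ 2 * gS \<theta> ^ 3" "1/13 * gM \<theta>" "- (1/420) * gC \<theta> ^ 7" "1/1638 * gJ \<theta>"]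
      by simp
  qed
  have pp: "circ (\<lambda>\<theta>. gw \<theta> * ?p \<theta>) > 0"
  proof (rule circ_pos[OF cp])
    fix \<theta>
    have "?p \<theta> > 0" using gM_bound[of \<theta>] by (intro add_nonneg_pos) auto
    then show "gw \<theta> * ?p \<theta> > 0" by (intro mult_pos_pos gw_pos)
  qed
  have "circ (\<lambda>\<theta>. gw \<theta> * (oB 0 \<theta> * (oA 0 \<theta> ^ 3 - oA 0 \<theta> * oq1 0 \<theta>)))
      = circ (\<lambda>\<theta>. gw \<theta> * ?x \<theta> + (gw \<theta> * ?o \<theta> + (gw \<theta> * ?d \<theta> + gw \<theta> * ?p \<theta>)))"
    unfolding eq by (simp only: distrib_left)
  also have "\<dots> = circ (\<lambda>\<theta>. gw \<theta> * ?x \<theta>) + (circ (\<lambda>\<theta>. gw \<theta> * ?o \<theta>) + (circ (\<lambda>\<theta>. gw \<theta> * ?d \<theta>) + circ (\<lambda>\<theta>. gw \<theta> * ?p \<theta>)))"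
    by (simp only: circ_add[OF cx continuous_on_add[OF co continuous_on_add[OF cd cp]]]
        circ_add[OF co continuous_on_add[OF cd cp]] circ_add[OF cd cp])
  finally show ?thesis using zx zo circ_dpoly pp by simp
qed

text \<open>The primitive is monotone. If it had equal values at both ends it would be constant, and
  \<open>g\<close> would vanish at the interior point \<open>x\<close>.\<close>

lemma circ_pos_nonneg:
  assumes g: "continuous_on UNIV g" and nn: "\<And>\<theta>. g \<theta> \<ge> 0" and x: "0 < x" "x < 2 * pi" "g x > 0"
  shows "circ g > 0"
proof -
  have mono: "primitive g a \<le> primitive g b" if "a \<le> b" for a b
  proof (rule DERIV_nonneg_imp_nondecreasing[OF that])
    show "\<exists>y. (primitive g has_real_derivative y) (at z) \<and> 0 \<le> y" for z
      using primitive(2)[OF g, of z] nn[of z] by blast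
  qed
  have "primitive g (2 * pi) \<noteq> 0"
  proof
    assume z: "primitive g (2 * pi) = 0"
    have "\<forall>y. \<bar>x - y\<bar> < min x (2 * pi - x) \<longrightarrow> primitive g x = primitive g y"
    proof (intro allI impI)
      fix y assume "\<bar>x - y\<bar> < min x (2 * pi - x)"
      then have "0 \<le> y" "y \<le> 2 * pi" by auto
      then show "primitive g x = primitive g y"
        using mono[of 0 x] mono[of x "2 * pi"] mono[of 0 y] mono[of y "2 * pi"] x z primitive(1)[OF g] by simp
    qed
    then have "g x = 0"
      using DERIV_local_const[OF primitive(2)[OF g], of "min x (2 * pi - x)" x] x by simp
    then show False using x by simp
  qed
  then show ?thesis using mono[of 0 "2 * pi"] primitive(1)[OF g] by (simp add: circ_def)
qed

lemma circ_C8S6_pos: "circ (\<lambda>\<theta>. gw \<theta> * (gC \<theta> ^ 8 * gS \<theta> ^ 6)) > 0"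
proof (rule circ_pos_nonneg[where x = "pi / 4"])
  have "gC (pi/4) > 0" "gS (pi/4) > 0"
    by (auto simp: gC_def gS_def cos_45 sin_45 intro!: mult_pos_pos zero_less_power)
  then show "gw (pi/4) * (gC (pi/4) ^ 8 * gS (pi/4) ^ 6) > 0" by simp
  show "gw \<theta> * (gC \<theta> ^ 8 * gS \<theta> ^ 6) \<ge> 0" for \<theta>
    by (intro mult_nonneg_nonneg) (simp_all add: less_imp_le)
qed (auto intro!: continuous_intros simp: pi_gt_zero)

section \<open>Construction of the two outer curves and their persistence\<close>

lemma continuous_on_primitive:
  assumes "continuous_on UNIV g" "continuous_on A f"
  shows "continuous_on A (\<lambda>x. primitive g (f x))"
  by (rule continuous_on_compose2[OF _ assms(2)])
    (auto intro!: DERIV_continuous_on[OF has_field_derivative_at_within[OF primitive(2)[OF assms(1)]]])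

text \<open>The curve is \<open>s = 1/t + t q1 + t^2 q2\<close>. The coefficient \<open>q1\<close>
  removes the defect of order 0, and \<open>q2\<close> replaces that of order \<open>t\<close> by
  the multiple \<open>c w\<close> of constant sign with the same mean.\<close>

lemma inner_outer_curve:
  assumes e: "0 < e" "e \<le> 1/20" and \<eta>: "\<eta> > 0"
  shows "\<exists>a. barrier_data (- 1) (fF e 0 0 0 0 0) a \<and> (\<forall>\<theta>. 0 < a \<theta> \<and> a \<theta> < \<eta>)"
proof -
  have wpos: "circ gw > 0" by (rule circ_pos) (auto intro!: continuous_intros)
  \<comment> \<open>This value makes \<open>p2\<close> integrate to zero over a period, so that
    \<open>q2\<close> is periodic. It is negative because \<open>e\<close> is positive.\<close>
  define c where "c = circ (\<lambda>\<theta>. gw \<theta> * (oB e \<theta> * oA e \<theta>)) / circ gw"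
  have c: "c < 0"
  proof -
    have "kap e > 0" using e by (simp add: kap_def)
    then have "e * kap e * circ (\<lambda>\<theta>. gw \<theta> * (gC \<theta> ^ 8 * gS \<theta> ^ 6)) > 0"
      using e circ_C8S6_pos by simp
    then show ?thesis using wpos unfolding c_def cubic_coefficient by (intro divide_neg_pos) auto
  qed
  define p1 where "p1 \<theta> = - (gw \<theta> * oB e \<theta>)" for \<theta>
  define p2 where "p2 \<theta> = oA e \<theta> * p1 \<theta> + c * gw \<theta>" for \<theta>
  define q2 where "q2 = primitive p2"
  note q1 = DERIV_oq1[of e, folded p1_def]
  have cp1: "continuous_on UNIV p1" and cp2: "continuous_on UNIV p2"
    unfolding p1_def[abs_def] p2_def[abs_def] by (intro continuous_intros; simp)+
  have pp [simp]: "p1 (\<theta> + 2 * pi) = p1 \<theta>" "p2 (\<theta> + 2 * pi) = p2 \<theta>" for \<theta>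
    by (simp_all add: p1_def p2_def)
  have q2: "(q2 has_real_derivative p2 \<theta>) (at \<theta>)" for \<theta>
    unfolding q2_def by (rule primitive(2)[OF cp2])
  have cAB: "continuous_on UNIV (\<lambda>\<theta>. gw \<theta> * (oB e \<theta> * oA e \<theta>))"
    and cw: "continuous_on UNIV gw"
    by (auto intro!: continuous_intros)
  have "circ p2 = circ (\<lambda>\<theta>. (- 1) * (gw \<theta> * (oB e \<theta> * oA e \<theta>)) + c * gw \<theta>)"
    by (simp add: p2_def[abs_def] p1_def algebra_simps)
  also have "\<dots> = (- 1) * circ (\<lambda>\<theta>. gw \<theta> * (oB e \<theta> * oA e \<theta>)) + c * circ gw"
    by (simp only: circ_add[OF continuous_on_mult_left[OF cAB] continuous_on_mult_left[OF cw]] circ_cmult[OF cAB] circ_cmult[OF cw])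
  also have "\<dots> = 0" using wpos by (simp add: c_def)
  finally have q2p [simp]: "q2 (\<theta> + 2 * pi) = q2 \<theta>" for \<theta>
    unfolding q2_def by (intro primitive_periodic[OF cp2]) simp
  have cq2 [continuous_intros]: "continuous_on A (\<lambda>x. q2 (f x))" if "continuous_on A f" for A :: "(real \<times> real) set" and f
    unfolding q2_def by (rule continuous_on_primitive[OF cp2 that])
  have cp [continuous_intros]: "continuous_on A (\<lambda>x. p1 (f x))" "continuous_on A (\<lambda>x. p2 (f x))" if "continuous_on A f"
    for A :: "(real \<times> real) set" and f
    unfolding p1_def p2_def using that by (intro continuous_intros; simp)+
  show ?thesis
  proof (rule outer_barrier[where v = "\<lambda>t \<theta>. t * oq1 e \<theta> + t ^ 2 * q2 \<theta>" and v' = "\<lambda>t \<theta>. t * p1 \<theta> + t ^ 2 * p2 \<theta>"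
        and j = 1
        and E = "\<lambda>t \<theta>. c * gw \<theta> + t * (- oA e \<theta> * p2 \<theta> + oq1 e \<theta> * p1 \<theta>) + t ^ 2 * (oq1 e \<theta> * p2 \<theta> + q2 \<theta> * p1 \<theta>)
           + t ^ 3 * (q2 \<theta> * p2 \<theta>)"])
    show "((\<lambda>\<theta>. t * oq1 e \<theta> + t\<^sup>2 * q2 \<theta>) has_real_derivative t * p1 \<theta> + t\<^sup>2 * p2 \<theta>) (at \<theta>)" for t \<theta>
      by (intro DERIV_add DERIV_cmult q1 q2)
    show "(t * p1 \<theta> + t\<^sup>2 * p2 \<theta>) * (1 / t + (t * oq1 e \<theta> + t\<^sup>2 * q2 \<theta>) - oA e \<theta>) + gw \<theta> * oB e \<theta> =
       t ^ 1 * (c * gw \<theta> + t * (- oA e \<theta> * p2 \<theta> + oq1 e \<theta> * p1 \<theta>) + t\<^sup>2 * (oq1 e \<theta> * p2 \<theta> + q2 \<theta> * p1 \<theta>) + t ^ 3 * (q2 \<theta> * p2 \<theta>))"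
      if "t > 0" for t \<theta>
    proof -
      have "gw \<theta> * oB e \<theta> = - p1 \<theta>" and c: "c * gw \<theta> = p2 \<theta> - oA e \<theta> * p1 \<theta>" by (simp_all add: p1_def p2_def)
      then show ?thesis using that unfolding c by (simp add: field_simps power_numeral_reduce)
    qed
    show "(- 1) * (c * gw \<theta> + 0 * (- oA e \<theta> * p2 \<theta> + oq1 e \<theta> * p1 \<theta>) + 0\<^sup>2 * (oq1 e \<theta> * p2 \<theta> + q2 \<theta> * p1 \<theta>) + 0 ^ 3 * (q2 \<theta> * p2 \<theta>)) > 0" for \<theta>
      using c gw_pos[of \<theta>] by (simp add: mult_neg_pos)
    show "continuous_on UNIV (\<lambda>\<theta>. t * p1 \<theta> + t\<^sup>2 * p2 \<theta>)" for t
      by (intro continuous_intros cp1 cp2)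
  qed (use e \<eta> in \<open>auto intro!: continuous_intros\<close>)
qed

text \<open>With vanishing third-order coefficient the same construction goes on for two more orders
  until a defect of constant sign appears at order \<open>t^3\<close>. Each \<open>p\<close> is
  dictated by cancelling one power of \<open>t\<close>, and each \<open>q\<close> is periodic
  because the mean of its \<open>p\<close> is zero.\<close>

lemma outermost_curve:
  assumes \<eta>: "\<eta> > 0"
  shows "\<exists>a. barrier_data 1 (fF 0 0 0 0 0 0) a \<and> (\<forall>\<theta>. 0 < a \<theta> \<and> a \<theta> < \<eta>)"
proof -
  have wpos: "circ gw > 0" by (rule circ_pos) (auto intro!: continuous_intros)
  define p1 where "p1 \<theta> = - (gw \<theta> * oB 0 \<theta>)" for \<theta>
  define p2 where "p2 \<theta> = oA 0 \<theta> * p1 \<theta>" for \<theta>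
  define q2 where "q2 = primitive p2"
  define p3 where "p3 \<theta> = oA 0 \<theta> * p2 \<theta> - oq1 0 \<theta> * p1 \<theta>" for \<theta>
  define q3 where "q3 = primitive p3"
  define r4 where "r4 \<theta> = oA 0 \<theta> * p3 \<theta> - oq1 0 \<theta> * p2 \<theta> - q2 \<theta> * p1 \<theta>" for \<theta>
  define c where "c = - circ r4 / circ gw"
  define p4 where "p4 \<theta> = r4 \<theta> + c * gw \<theta>" for \<theta>
  define q4 where "q4 = primitive p4"
  note q1 = DERIV_oq1[of 0, folded p1_def]
  have cp1: "continuous_on UNIV p1" and cp2: "continuous_on UNIV p2"
    unfolding p1_def[abs_def] p2_def[abs_def] by (intro continuous_intros; simp)+
  then have cp3: "continuous_on UNIV p3"
    unfolding p3_def[abs_def] by (intro continuous_intros; simp)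
  note cq2 = continuous_on_primitive[OF cp2, folded q2_def] and cq3 = continuous_on_primitive[OF cp3, folded q3_def]
  have cr4: "continuous_on UNIV r4"
    unfolding r4_def[abs_def] by (intro continuous_intros cp1 cp2 cp3 cq2; simp)
  then have cp4: "continuous_on UNIV p4"
    unfolding p4_def[abs_def] by (intro continuous_intros; simp)
  note cq4 = continuous_on_primitive[OF cp4, folded q4_def]
  have pp [simp]: "p1 (\<theta> + 2 * pi) = p1 \<theta>" "p2 (\<theta> + 2 * pi) = p2 \<theta>" "p3 (\<theta> + 2 * pi) = p3 \<theta>" for \<theta>
    by (simp_all add: p1_def p2_def p3_def)
  have pm: "p1 (- \<theta>) = - p1 \<theta>" "p2 (- \<theta>) = p2 \<theta>" "p3 (- \<theta>) = - p3 \<theta>" for \<theta>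
    by (simp_all add: p1_def p2_def p3_def)
  have D2: "(q2 has_real_derivative p2 \<theta>) (at \<theta>)" for \<theta> unfolding q2_def by (rule primitive(2)[OF cp2])
  have D3: "(q3 has_real_derivative p3 \<theta>) (at \<theta>)" for \<theta> unfolding q3_def by (rule primitive(2)[OF cp3])
  have D4: "(q4 has_real_derivative p4 \<theta>) (at \<theta>)" for \<theta> unfolding q4_def by (rule primitive(2)[OF cp4])
  have "circ p2 = circ (\<lambda>\<theta>. (- 1) * (gw \<theta> * (oB 0 \<theta> * oA 0 \<theta>)))"
    by (simp add: p2_def[abs_def] p1_def algebra_simps)
  also have "\<dots> = - circ (\<lambda>\<theta>. gw \<theta> * (oB 0 \<theta> * oA 0 \<theta>))"
    by (subst circ_cmult) (auto intro!: continuous_intros)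
  also have "\<dots> = 0" unfolding cubic_coefficient by simp
  finally have q2p [simp]: "q2 (\<theta> + 2 * pi) = q2 \<theta>" for \<theta>
    unfolding q2_def by (intro primitive_periodic[OF cp2]) simp_all
  \<comment> \<open>At this order the mean vanishes by reflection symmetry, so the first obstruction
    can only come from \<open>r4\<close>.\<close>
  have "circ p3 = 0" by (rule circ_odd[OF cp3]) (simp_all add: pm)
  then have q3p [simp]: "q3 (\<theta> + 2 * pi) = q3 \<theta>" for \<theta>
    unfolding q3_def by (intro primitive_periodic[OF cp3]) simp_all
  have p4p [simp]: "p4 (\<theta> + 2 * pi) = p4 \<theta>" for \<theta> by (simp add: p4_def r4_def)
  have cw: "continuous_on UNIV gw" by (auto intro!: continuous_intros)
  have "circ p4 = circ r4 + c * circ gw"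
    unfolding p4_def[abs_def] by (simp only: circ_add[OF cr4 continuous_on_mult_left[OF cw]] circ_cmult[OF cw])
  also have "\<dots> = 0" using wpos by (simp add: c_def)
  finally have q4p [simp]: "q4 (\<theta> + 2 * pi) = q4 \<theta>" for \<theta>
    unfolding q4_def by (intro primitive_periodic[OF cp4]) simp_all
  have c: "c > 0"
  proof -
    let ?x = "\<lambda>\<theta>. oq1 0 \<theta> * p2 \<theta> + p1 \<theta> * q2 \<theta>" and ?y = "\<lambda>\<theta>. gw \<theta> * (oB 0 \<theta> * (oA 0 \<theta> ^ 3 - oA 0 \<theta> * oq1 0 \<theta>))"
    have cx: "continuous_on UNIV ?x" and cy: "continuous_on UNIV ?y"
      by (intro continuous_intros cp1 cp2 cq2; simp)+
    have "circ ?x = 0"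
    proof (rule circ_exact[OF cx, of "\<lambda>\<theta>. oq1 0 \<theta> * q2 \<theta>"])
      show "((\<lambda>\<theta>. oq1 0 \<theta> * q2 \<theta>) has_real_derivative ?x \<theta>) (at \<theta>)" for \<theta>
        using DERIV_mult[OF q1[of \<theta>] D2[of \<theta>]] by (simp add: add.commute mult.commute)
    qed simp
    \<comment> \<open>Unfolding the recursion gives \<open>A^3 p1 - A q1 p1\<close> minus the
      derivative of the periodic function \<open>q1 q2\<close>; the first two terms are minus the
      fifth-order integrand.\<close>
    moreover have "r4 \<theta> = (- 1) * ?y \<theta> + (- 1) * ?x \<theta>" for \<theta>
      by (simp add: r4_def p3_def p2_def p1_def algebra_simps power3_eq_cube)
    then have "circ r4 = circ (\<lambda>\<theta>. (- 1) * ?y \<theta> + (- 1) * ?x \<theta>)" by presburger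
    then have "circ r4 = (- 1) * circ ?y + (- 1) * circ ?x"
      by (simp only: circ_add[OF continuous_on_mult_left[OF cy] continuous_on_mult_left[OF cx]] circ_cmult[OF cx] circ_cmult[OF cy])
    ultimately have "circ r4 < 0" using quintic_coefficient by simp
    then show ?thesis using wpos by (simp add: c_def divide_neg_pos)
  qed
  show ?thesis
  proof (rule outer_barrier[where v = "\<lambda>t \<theta>. t * oq1 0 \<theta> + t ^ 2 * q2 \<theta> + t ^ 3 * q3 \<theta> + t ^ 4 * q4 \<theta>"
        and v' = "\<lambda>t \<theta>. t * p1 \<theta> + t ^ 2 * p2 \<theta> + t ^ 3 * p3 \<theta> + t ^ 4 * p4 \<theta>"
        and j = 3
        and E = "\<lambda>t \<theta>. c * gw \<theta> + t * (- oA 0 \<theta> * p4 \<theta> + oq1 0 \<theta> * p3 \<theta> + q2 \<theta> * p2 \<theta> + q3 \<theta> * p1 \<theta>)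
           + t ^ 2 * (oq1 0 \<theta> * p4 \<theta> + q2 \<theta> * p3 \<theta> + q3 \<theta> * p2 \<theta> + q4 \<theta> * p1 \<theta>)
           + t ^ 3 * (q2 \<theta> * p4 \<theta> + q3 \<theta> * p3 \<theta> + q4 \<theta> * p2 \<theta>) + t ^ 4 * (q3 \<theta> * p4 \<theta> + q4 \<theta> * p3 \<theta>)
           + t ^ 5 * (q4 \<theta> * p4 \<theta>)"])
    show "((\<lambda>\<theta>. t * oq1 0 \<theta> + t ^ 2 * q2 \<theta> + t ^ 3 * q3 \<theta> + t ^ 4 * q4 \<theta>) has_real_derivative
        t * p1 \<theta> + t ^ 2 * p2 \<theta> + t ^ 3 * p3 \<theta> + t ^ 4 * p4 \<theta>) (at \<theta>)" for t \<theta>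
      by (intro DERIV_add DERIV_cmult q1 D2 D3 D4)
    show "(t * p1 \<theta> + t ^ 2 * p2 \<theta> + t ^ 3 * p3 \<theta> + t ^ 4 * p4 \<theta>)
        * (1 / t + (t * oq1 0 \<theta> + t ^ 2 * q2 \<theta> + t ^ 3 * q3 \<theta> + t ^ 4 * q4 \<theta>) - oA 0 \<theta>) + gw \<theta> * oB 0 \<theta> =
       t ^ 3 * (c * gw \<theta> + t * (- oA 0 \<theta> * p4 \<theta> + oq1 0 \<theta> * p3 \<theta> + q2 \<theta> * p2 \<theta> + q3 \<theta> * p1 \<theta>)
           + t ^ 2 * (oq1 0 \<theta> * p4 \<theta> + q2 \<theta> * p3 \<theta> + q3 \<theta> * p2 \<theta> + q4 \<theta> * p1 \<theta>)
           + t ^ 3 * (q2 \<theta> * p4 \<theta> + q3 \<theta> * p3 \<theta> + q4 \<theta> * p2 \<theta>) + t ^ 4 * (q3 \<theta> * p4 \<theta> + q4 \<theta> * p3 \<theta>)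
           + t ^ 5 * (q4 \<theta> * p4 \<theta>))"
      if "t > 0" for t \<theta>
    proof -
      \<comment> \<open>The comparison of powers of \<open>t\<close> is made with free variables;
        \<open>i\<close> stands for \<open>1/t\<close> and the premises are the recursion.\<close>
      have "(t * a + t ^ 2 * b + t ^ 3 * d + t ^ 4 * f) * (i + (t * w + t ^ 2 * x + t ^ 3 * y + t ^ 4 * z) - A) + g =
       t ^ 3 * (h + t * (- A * f + w * d + x * b + y * a)
           + t ^ 2 * (w * f + x * d + y * b + z * a)
           + t ^ 3 * (x * f + y * d + z * b) + t ^ 4 * (y * f + z * d)
           + t ^ 5 * (z * f))"
        if "i * t = 1" "g = - a" "b = A * a" "d = A * b - w * a" "f = A * d - w * b - x * a + h" for i g a b d f w x y z A h
      proof -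
        have i: "i * t ^ 2 = t" "i * t ^ 3 = t ^ 2" "i * t ^ 4 = t ^ 3"
          using that(1) by (simp_all add: power_numeral_reduce flip: mult.assoc)
        have "(t * a + t ^ 2 * b + t ^ 3 * d + t ^ 4 * f) * (i + (t * w + t ^ 2 * x + t ^ 3 * y + t ^ 4 * z) - A) + g
         = (a * (i * t) + b * (i * t ^ 2) + d * (i * t ^ 3) + f * (i * t ^ 4)) + g
            + (t * a + t ^ 2 * b + t ^ 3 * d + t ^ 4 * f) * ((t * w + t ^ 2 * x + t ^ 3 * y + t ^ 4 * z) - A)"
          by (simp add: algebra_simps)
        also have "\<dots> = t * (b - A * a) + t ^ 2 * (d - A * b + w * a) + t ^ 3 * (f - A * d + w * b + x * a)
            + t ^ 4 * (- A * f + w * d + x * b + y * a)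
           + t ^ 5 * (w * f + x * d + y * b + z * a)
           + t ^ 6 * (x * f + y * d + z * b) + t ^ 7 * (y * f + z * d)
           + t ^ 8 * (z * f)" unfolding i that(1,2) by (simp add: algebra_simps power_numeral_reduce)
        also have "\<dots> = t ^ 3 * h + t ^ 4 * (- A * f + w * d + x * b + y * a)
           + t ^ 5 * (w * f + x * d + y * b + z * a)
           + t ^ 6 * (x * f + y * d + z * b) + t ^ 7 * (y * f + z * d)
           + t ^ 8 * (z * f)" using that(3-5) by simp
        finally show ?thesis by (simp add: algebra_simps power_numeral_reduce)
      qed
      from this[of "1 / t" "gw \<theta> * oB 0 \<theta>" "p1 \<theta>" "p2 \<theta>" "oA 0 \<theta>" "p3 \<theta>" "oq1 0 \<theta>" "p4 \<theta>" "q2 \<theta>" "c * gw \<theta>" "q3 \<theta>" "q4 \<theta>"]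
      show ?thesis using that by (simp only: p1_def p2_def p3_def p4_def r4_def) simp
    qed
    show "1 * (c * gw \<theta> + 0 * (- oA 0 \<theta> * p4 \<theta> + oq1 0 \<theta> * p3 \<theta> + q2 \<theta> * p2 \<theta> + q3 \<theta> * p1 \<theta>)
           + 0 ^ 2 * (oq1 0 \<theta> * p4 \<theta> + q2 \<theta> * p3 \<theta> + q3 \<theta> * p2 \<theta> + q4 \<theta> * p1 \<theta>)
           + 0 ^ 3 * (q2 \<theta> * p4 \<theta> + q3 \<theta> * p3 \<theta> + q4 \<theta> * p2 \<theta>) + 0 ^ 4 * (q3 \<theta> * p4 \<theta> + q4 \<theta> * p3 \<theta>)
           + 0 ^ 5 * (q4 \<theta> * p4 \<theta>)) > 0" for \<theta>
      using c gw_pos[of \<theta>] by simp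
    show "continuous_on UNIV (\<lambda>\<theta>. t * p1 \<theta> + t ^ 2 * p2 \<theta> + t ^ 3 * p3 \<theta> + t ^ 4 * p4 \<theta>)" for t
      by (intro continuous_intros cp1 cp2 cp3 cp4)
  qed (use \<eta> in \<open>auto intro!: continuous_intros cq2 cq3 cq4 continuous_on_compose2[OF cp1] continuous_on_compose2[OF cp2]
     continuous_on_compose2[OF cp3] continuous_on_compose2[OF cp4]\<close>)
qed

text \<open>The crossing quantity is jointly continuous in the six parameters and the angle, since
  the denominator is positive on the whole box. Its minimum over one period is positive, hence stays
  positive near the given parameters with the curve itself unchanged.\<close>

lemma barrier_persistence:
  assumes bd: "barrier_data \<sigma> (fF e 0 0 0 0 0) a" and a: "\<And>\<theta>. 0 < a \<theta> \<and> a \<theta> < 1/10" and e: "\<bar>e\<bar> < 1/20"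
  shows "\<exists>\<nu>>0. \<forall>e2 e1 d2 d1 d0 s. \<bar>e2 - e\<bar> < \<nu> \<longrightarrow> \<bar>e1\<bar> < \<nu> \<longrightarrow> \<bar>d2\<bar> < \<nu> \<longrightarrow> \<bar>d1\<bar> < \<nu> \<longrightarrow> \<bar>d0\<bar> < \<nu> \<longrightarrow> \<bar>s\<bar> < \<nu>
     \<longrightarrow> barrier_data \<sigma> (fF e2 e1 d2 d1 d0 s) a"
proof -
  obtain a' where da: "\<And>\<theta>. (a has_real_derivative a' \<theta>) (at \<theta>)" and ca': "continuous_on UNIV a'"
    and per: "\<And>\<theta>. a (\<theta> + 2 * pi) = a \<theta>" "\<And>\<theta>. a' (\<theta> + 2 * pi) = a' \<theta>"
    and F0: "\<And>\<theta>. \<sigma> * (fF e 0 0 0 0 0 \<theta> (a \<theta>) - a' \<theta>) > 0"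
    using bd unfolding barrier_data_def by blast
  define W where "W = {p :: real \<times> real \<times> real \<times> real \<times> real \<times> real.
     case p of (e2, e1, d2, d1, d0, s) \<Rightarrow> small_parameters e2 e1 d2 d1 d0 s}"
  define G where "G q = (case q of ((e2, e1, d2, d1, d0, s), \<theta>) \<Rightarrow> \<sigma> * (fF e2 e1 d2 d1 d0 s \<theta> (a \<theta>) - a' \<theta>))"
    for q :: "(real \<times> real \<times> real \<times> real \<times> real \<times> real) \<times> real"
  have contG: "continuous_on (W \<times> {0..2 * pi}) G"
  proof -
    have ca: "continuous_on UNIV a" using da by (meson DERIV_continuous continuous_at_imp_continuous_on)
    have *: "fden (fst p) (fst (snd p)) (fst (snd (snd p))) (fst (snd (snd (snd p)))) (fst (snd (snd (snd (snd p)))))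
        (snd (snd (snd (snd (snd p))))) \<theta> (a \<theta>) \<noteq> 0" if "p \<in> W" for p \<theta>
      using that fden_pos[of "fst p" "fst (snd p)" "fst (snd (snd p))" "fst (snd (snd (snd p)))"
          "fst (snd (snd (snd (snd p))))" "snd (snd (snd (snd (snd p))))" "a \<theta>" \<theta>] a[of \<theta>]
      by (force simp: W_def split: prod.splits)
    show ?thesis unfolding G_def case_prod_unfold fF_def
      by (intro continuous_intros continuous_on_compose2[OF ca] continuous_on_compose2[OF ca'] ballI)
         (use * in auto)
  qed
  have F0': "G ((e, 0, 0, 0, 0, 0), \<theta>) > 0" for \<theta> using F0 by (simp add: G_def)
  have p0: "(e, 0, 0, 0, 0, 0) \<in> W" using e by (simp add: W_def small_parameters_def)
  have "continuous_on {0..2 * pi} (\<lambda>\<theta>. G ((e, 0, 0, 0, 0, 0), \<theta>))"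
    by (rule continuous_on_compose2[OF contG]) (use p0 in \<open>auto intro!: continuous_intros\<close>)
  then obtain x where x: "x \<in> {0..2 * pi}" "\<And>\<theta>. \<theta> \<in> {0..2 * pi} \<Longrightarrow> G ((e, 0, 0, 0, 0, 0), x) \<le> G ((e, 0, 0, 0, 0, 0), \<theta>)"
    using continuous_attains_inf[of "{0..2 * pi}" "\<lambda>\<theta>. G ((e, 0, 0, 0, 0, 0), \<theta>)"] by (auto simp: less_imp_le)
  obtain X where X: "(e, 0, 0, 0, 0, 0) \<in> X" "open X"
      "\<And>p \<theta>. p \<in> X \<inter> W \<Longrightarrow> \<theta> \<in> {0..2 * pi} \<Longrightarrow> dist (G (p, \<theta>)) (G ((e, 0, 0, 0, 0, 0), \<theta>)) \<le> G ((e, 0, 0, 0, 0, 0), x) / 2"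
    by (rule continuous_on_prod_compactE[OF contG, of "(e, 0, 0, 0, 0, 0)" "G ((e, 0, 0, 0, 0, 0), x) / 2"])
      (use F0'[of x] p0 in auto)
  then obtain r where r: "r > 0" "ball (e, 0, 0, 0, 0, 0) r \<subseteq> X" by (meson openE)
  define \<nu> where "\<nu> = Min {r / 6, 1/20 - \<bar>e\<bar>, 1/20}"
  have \<nu>: "\<nu> > 0" "\<nu> \<le> r / 6" "\<nu> \<le> 1/20 - \<bar>e\<bar>" "\<nu> \<le> 1/20" using r e by (auto simp: \<nu>_def min_def)
  have "barrier_data \<sigma> (fF e2 e1 d2 d1 d0 s) a"
    if small: "\<bar>e2 - e\<bar> < \<nu>" "\<bar>e1\<bar> < \<nu>" "\<bar>d2\<bar> < \<nu>" "\<bar>d1\<bar> < \<nu>" "\<bar>d0\<bar> < \<nu>" "\<bar>s\<bar> < \<nu>" for e2 e1 d2 d1 d0 s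
  proof -
    let ?p = "(e2, e1, d2, d1, d0, s)"
    have "small_parameters e2 e1 d2 d1 d0 s" using small \<nu> by (auto simp: small_parameters_def)
    then have pW: "?p \<in> W" by (simp add: W_def)
    have "norm (?p - (e, 0, 0, 0, 0, 0)) \<le> \<bar>e2 - e\<bar> + (\<bar>e1\<bar> + (\<bar>d2\<bar> + (\<bar>d1\<bar> + (\<bar>d0\<bar> + \<bar>s\<bar>))))"
      unfolding diff_Pair diff_zero real_norm_def[symmetric]
      by (intro order_trans[OF norm_Pair_le] add_left_mono order_refl)
    then have "dist ?p (e, 0, 0, 0, 0, 0) < r" using small \<nu> unfolding dist_norm by linarith
    then have "?p \<in> ball (e, 0, 0, 0, 0, 0) r" by (simp only: mem_ball dist_commute)
    then have pX: "?p \<in> X \<inter> W" using r pW by blast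
    have pos: "\<sigma> * (fF e2 e1 d2 d1 d0 s \<theta> (a \<theta>) - a' \<theta>) > 0" for \<theta>
    proof -
      obtain n :: int where n: "0 \<le> \<theta> + of_int n * (2 * pi)" "\<theta> + of_int n * (2 * pi) < 0 + 2 * pi"
        by (rule periodic_representative[of "2 * pi" 0 \<theta>]) simp
      let ?\<phi> = "\<theta> + of_int n * (2 * pi)"
      have "fF e2 e1 d2 d1 d0 s (z + 2 * pi) (a (z + 2 * pi)) - a' (z + 2 * pi) = fF e2 e1 d2 d1 d0 s z (a z) - a' z" for z
        by (simp add: per fF_def fnum_def fden_def n9_def k9_def)
      then have "fF e2 e1 d2 d1 d0 s ?\<phi> (a ?\<phi>) - a' ?\<phi> = fF e2 e1 d2 d1 d0 s \<theta> (a \<theta>) - a' \<theta>"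
        by (rule periodic_shift_int)
      moreover have \<phi>: "?\<phi> \<in> {0..2 * pi}" using n by auto
      have "G (?p, ?\<phi>) > 0"
        using X(3)[OF pX \<phi>] x(2)[OF \<phi>] F0'[of x] unfolding dist_real_def abs_le_iff by argo
      ultimately show ?thesis by (simp add: G_def)
    qed
    then show ?thesis unfolding barrier_data_def using da ca' per by blast
  qed
  then show ?thesis using \<nu>(1) by blast
qed

section \<open>The inner curves\<close>


lemma gw_nonzero [simp]: "gw \<theta> \<noteq> 0"
  using gw_pos[of \<theta>] by (simp only: less_irrefl not_False_eq_True less_imp_neq[symmetric])

text \<open>The common form in which the persistent outer curves and the inner curves, rebuilt for
  every parameter value, are finally compared.\<close>

definition barrier :: "real \<Rightarrow> (real \<Rightarrow> real \<Rightarrow> real) \<Rightarrow> (real \<Rightarrow> real) \<Rightarrow> bool" where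
  "barrier \<sigma> F a \<longleftrightarrow>
     (\<forall>\<theta>. a (\<theta> + 2 * pi) = a \<theta> \<and> (\<exists>a'. (a has_real_derivative a') (at \<theta>) \<and> \<sigma> * (F \<theta> (a \<theta>) - a') > 0))"

text \<open>The gauge \<open>N\<close>, strictly increasing along rays, marks the region where the
  radial derivative of \<open>G\<close> is positive. There the level set is a graph over the angle,
  and periodicity follows from uniqueness of the solution.\<close>

lemma implicit_curve:
  fixes G Gt Gr N :: "real \<Rightarrow> real \<Rightarrow> real"
  assumes D: "\<And>\<theta> \<rho>. ((\<lambda>p. G (fst p) (snd p)) has_derivative (\<lambda>h. Gt \<theta> \<rho> * fst h + Gr \<theta> \<rho> * snd h)) (at (\<theta>, \<rho>))"
    and N: "continuous_on UNIV (\<lambda>p. N (fst p) (snd p))"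
    and mono: "\<And>\<theta> \<rho> \<rho>'. 0 \<le> \<rho> \<Longrightarrow> \<rho> < \<rho>' \<Longrightarrow> N \<theta> \<rho> < N \<theta> \<rho>'"
    and N0: "\<And>\<theta>. N \<theta> 0 = 0" and unbounded: "\<And>\<theta>. \<exists>\<rho>>0. N \<theta> \<rho> \<ge> c2" and c: "0 < c1" "c1 < c2"
    and per: "\<And>\<theta> \<rho>. G (\<theta> + 2 * pi) \<rho> = G \<theta> \<rho>" "\<And>\<theta> \<rho>. N (\<theta> + 2 * pi) \<rho> = N \<theta> \<rho>"
    and inner: "\<And>\<theta> \<rho>. \<rho> > 0 \<Longrightarrow> N \<theta> \<rho> = c1 \<Longrightarrow> G \<theta> \<rho> < c"
    and outer: "\<And>\<theta> \<rho>. \<rho> > 0 \<Longrightarrow> N \<theta> \<rho> = c2 \<Longrightarrow> c < G \<theta> \<rho>"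
    and pos: "\<And>\<theta> \<rho>. \<rho> > 0 \<Longrightarrow> c1 \<le> N \<theta> \<rho> \<Longrightarrow> N \<theta> \<rho> \<le> c2 \<Longrightarrow> Gr \<theta> \<rho> > 0"
  shows "\<exists>a. \<forall>\<theta>. a \<theta> > 0 \<and> c1 < N \<theta> (a \<theta>) \<and> N \<theta> (a \<theta>) < c2 \<and> a (\<theta> + 2 * pi) = a \<theta> \<and>
     (a has_real_derivative - Gt \<theta> (a \<theta>) / Gr \<theta> (a \<theta>)) (at \<theta>)"
proof -
  have DG: "(G \<theta> has_real_derivative Gr \<theta> \<rho>) (at \<rho>)" for \<theta> \<rho>
  proof -
    have "((\<lambda>\<rho>. (\<theta>, \<rho>)) has_derivative (\<lambda>h. (0, h))) (at \<rho>)" by (auto intro!: derivative_eq_intros)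
    from has_derivative_compose[OF this D[of \<theta> \<rho>]] show ?thesis
      by (simp add: has_field_derivative_def)
  qed
  have increasing: "G \<theta> \<rho> < G \<theta> \<rho>'" if "0 < \<rho>" "\<rho> < \<rho>'" "c1 \<le> N \<theta> \<rho>" "N \<theta> \<rho>' \<le> c2" for \<theta> \<rho> \<rho>'
  proof (rule DERIV_pos_imp_increasing[OF that(2)])
    fix z assume z: "\<rho> \<le> z" "z \<le> \<rho>'"
    have "N \<theta> \<rho> \<le> N \<theta> z" "N \<theta> z \<le> N \<theta> \<rho>'"
      using mono[of \<rho> z \<theta>] mono[of z \<rho>' \<theta>] z that(1) by (cases "z = \<rho>"; cases "z = \<rho>'"; force)+
    then have "Gr \<theta> z > 0" using that z by (intro pos) auto
    then show "\<exists>y. (G \<theta> has_real_derivative y) (at z) \<and> 0 < y" using DG by blast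
  qed
  have ex: "\<exists>\<rho>>0. c1 < N \<theta> \<rho> \<and> N \<theta> \<rho> < c2 \<and> G \<theta> \<rho> = c" for \<theta>
  proof -
    have cN: "continuous_on A (N \<theta>)" for A
      using continuous_on_compose2[OF N, of A "\<lambda>\<rho>. (\<theta>, \<rho>)"] by (simp add: continuous_intros)
    obtain R where R: "R > 0" "N \<theta> R \<ge> c2" using unbounded by blast
    obtain \<rho>2 where r2: "0 \<le> \<rho>2" "\<rho>2 \<le> R" "N \<theta> \<rho>2 = c2"
      using IVT'[of "N \<theta>" 0 c2 R] N0[of \<theta>] R c cN by auto
    obtain \<rho>1 where r1: "0 \<le> \<rho>1" "\<rho>1 \<le> \<rho>2" "N \<theta> \<rho>1 = c1"
      using IVT'[of "N \<theta>" 0 c1 \<rho>2] N0[of \<theta>] r2 c cN by auto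
    have r10: "0 < \<rho>1" using r1 N0[of \<theta>] c by (cases "\<rho>1 = 0") auto
    have G12: "G \<theta> \<rho>1 < c" "c < G \<theta> \<rho>2" using inner[OF r10 r1(3)] outer[of \<rho>2 \<theta>] r2 r1 r10 by auto
    have "continuous_on {\<rho>1..\<rho>2} (G \<theta>)" using DG by (meson DERIV_continuous continuous_at_imp_continuous_on)
    then obtain \<rho> where r: "\<rho>1 \<le> \<rho>" "\<rho> \<le> \<rho>2" "G \<theta> \<rho> = c"
      using IVT'[of "G \<theta>" \<rho>1 c \<rho>2] G12 r1 by auto
    then have "\<rho>1 < \<rho>" "\<rho> < \<rho>2" using G12 by (auto simp: less_le)
    then show ?thesis using mono[of \<rho>1 \<rho> \<theta>] mono[of \<rho> \<rho>2 \<theta>] r r1 r2 r10 by (intro exI[of _ \<rho>]) auto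
  qed
  then obtain a where a: "\<And>\<theta>. a \<theta> > 0" "\<And>\<theta>. c1 < N \<theta> (a \<theta>)" "\<And>\<theta>. N \<theta> (a \<theta>) < c2" "\<And>\<theta>. G \<theta> (a \<theta>) = c"
    by metis
  have uniq: "\<rho> = \<rho>'" if "\<rho> > 0" "\<rho>' > 0" "c1 < N \<theta> \<rho>" "N \<theta> \<rho> < c2" "c1 < N \<theta> \<rho>'" "N \<theta> \<rho>' < c2" "G \<theta> \<rho> = G \<theta> \<rho>'" for \<theta> \<rho> \<rho>'
    using that increasing[of \<rho> \<rho>' \<theta>] increasing[of \<rho>' \<rho> \<theta>] by (cases \<rho> \<rho>' rule: linorder_cases) auto
  define S where "S = {p. 0 < snd p \<and> c1 < N (fst p) (snd p) \<and> N (fst p) (snd p) < c2}"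
  \<comment> \<open>This map straightens the level sets; differentiating its inverse along
    \<open>G = c\<close> is the implicit function theorem.\<close>
  define f where "f p = (fst p, G (fst p) (snd p))" for p
  define g where "g = inv_into S f"
  have "open S"
    unfolding S_def by (intro open_Collect_conj open_Collect_less continuous_intros N)
  have contf: "continuous_on S f"
    unfolding f_def[abs_def]
    by (intro continuous_intros has_derivative_continuous_on[where f' = "\<lambda>p h. Gt (fst p) (snd p) * fst h + Gr (fst p) (snd p) * snd h"])
      (use D in \<open>auto intro: has_derivative_at_withinI\<close>)
  have inj: "inj_on f S"
    by (rule inj_onI) (auto simp: f_def S_def intro: uniq)
  have gf: "g (f p) = p" if "p \<in> S" for p unfolding g_def by (rule inv_into_f_f[OF inj that])
  have aS: "(\<theta>, a \<theta>) \<in> S" for \<theta> using a by (simp add: S_def)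
  have ga: "g (\<theta>, c) = (\<theta>, a \<theta>)" for \<theta> using gf[OF aS[of \<theta>]] a(4)[of \<theta>] by (simp add: f_def)
  have "(a has_real_derivative - Gt \<theta> (a \<theta>) / Gr \<theta> (a \<theta>)) (at \<theta>)" for \<theta>
  proof -
    let ?p = "(\<theta>, a \<theta>)"
    have Gr: "Gr \<theta> (a \<theta>) > 0" using pos[of "a \<theta>" \<theta>] a[of \<theta>] by simp
    have "(f has_derivative (\<lambda>h. (fst h, Gt \<theta> (a \<theta>) * fst h + Gr \<theta> (a \<theta>) * snd h))) (at ?p)"
      unfolding f_def[abs_def] by (intro has_derivative_Pair D has_derivative_fst has_derivative_ident)
    from has_derivative_inverse_strong[OF \<open>open S\<close> aS contf gf this,
        of "\<lambda>k. (fst k, (snd k - Gt \<theta> (a \<theta>) * fst k) / Gr \<theta> (a \<theta>))"]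
    have "(g has_derivative (\<lambda>k. (fst k, (snd k - Gt \<theta> (a \<theta>) * fst k) / Gr \<theta> (a \<theta>)))) (at (\<theta>, c))"
      using Gr a(4)[of \<theta>] by (simp add: f_def fun_eq_iff)
    moreover have "((\<lambda>x. (x, c)) has_derivative (\<lambda>h. (h, 0))) (at \<theta>)" by (auto intro!: derivative_eq_intros)
    ultimately have "((\<lambda>x. g (x, c)) has_derivative (\<lambda>h. (h, (0 - Gt \<theta> (a \<theta>) * h) / Gr \<theta> (a \<theta>)))) (at \<theta>)"
      by (auto dest: has_derivative_compose)
    from has_derivative_snd[OF this] show ?thesis
      unfolding has_field_derivative_def ga snd_conv by (rule has_derivative_eq_rhs) (auto simp: fun_eq_iff)
  qed
  moreover have "a (\<theta> + 2 * pi) = a \<theta>" for \<theta>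
  proof (rule uniq[where \<theta> = \<theta>])
    show "c1 < N \<theta> (a (\<theta> + 2 * pi))" "N \<theta> (a (\<theta> + 2 * pi)) < c2" "G \<theta> (a (\<theta> + 2 * pi)) = G \<theta> (a \<theta>)"
      using a(2)[of "\<theta> + 2 * pi"] a(3)[of "\<theta> + 2 * pi"] a(4)[of "\<theta> + 2 * pi"] a(4)[of \<theta>] by (simp_all only: per)
  qed (use a in auto)
  ultimately show ?thesis using a by blast
qed

section \<open>Polynomial corrections of the energy in the scaled variables\<close>

definition mp :: "(real \<times> nat \<times> nat) list \<Rightarrow> real \<Rightarrow> real \<Rightarrow> real" where
  "mp xs x y = (\<Sum>(c, i, j)\<leftarrow>xs. c * x ^ i * y ^ j)"
definition mpx :: "(real \<times> nat \<times> nat) list \<Rightarrow> real \<Rightarrow> real \<Rightarrow> real" where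
  "mpx xs x y = (\<Sum>(c, i, j)\<leftarrow>xs. c * (real i * x ^ (i - 1)) * y ^ j)"
definition mpy :: "(real \<times> nat \<times> nat) list \<Rightarrow> real \<Rightarrow> real \<Rightarrow> real" where
  "mpy xs x y = (\<Sum>(c, i, j)\<leftarrow>xs. c * x ^ i * (real j * y ^ (j - 1)))"

lemma mp_Cons:
  "mp [] x y = 0" "mp ((c, i, j) # xs) x y = c * x ^ i * y ^ j + mp xs x y"
  "mpx [] x y = 0" "mpx ((c, i, j) # xs) x y = c * (real i * x ^ (i - 1)) * y ^ j + mpx xs x y"
  "mpy [] x y = 0" "mpy ((c, i, j) # xs) x y = c * x ^ i * (real j * y ^ (j - 1)) + mpy xs x y"
  by (simp_all add: mp_def mpx_def mpy_def)

lemma has_derivative_mp: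
  fixes X Y :: "'a::real_normed_vector \<Rightarrow> real"
  assumes "(X has_derivative X') (at z)" "(Y has_derivative Y') (at z)"
  shows "((\<lambda>z. mp xs (X z) (Y z)) has_derivative (\<lambda>h. mpx xs (X z) (Y z) * X' h + mpy xs (X z) (Y z) * Y' h)) (at z)"
proof (induction xs)
  case (Cons m xs)
  obtain c i j where m: "m = (c, i, j)" by (cases m) auto
  show ?case unfolding m mp_Cons
    by (rule derivative_eq_intros assms Cons refl)+ (simp add: fun_eq_iff algebra_simps)
qed (simp add: mp_Cons)

lemma continuous_on_mp [continuous_intros]:
  fixes f g :: "'a::topological_space \<Rightarrow> real"
  assumes "continuous_on A f" "continuous_on A g"
  shows "continuous_on A (\<lambda>z. mp xs (f z) (g z))" "continuous_on A (\<lambda>z. mpx xs (f z) (g z))"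
    "continuous_on A (\<lambda>z. mpy xs (f z) (g z))"
proof -
  have "continuous_on A (\<lambda>z. mp xs (f z) (g z)) \<and> continuous_on A (\<lambda>z. mpx xs (f z) (g z)) \<and> continuous_on A (\<lambda>z. mpy xs (f z) (g z))"
  proof (induction xs)
    case (Cons m xs)
    obtain c i j where m: "m = (c, i, j)" by (cases m) auto
    show ?case unfolding m mp_Cons using Cons assms by (intro conjI continuous_intros) auto
  qed (simp add: mp_Cons)
  then show "continuous_on A (\<lambda>z. mp xs (f z) (g z))" "continuous_on A (\<lambda>z. mpx xs (f z) (g z))"
    "continuous_on A (\<lambda>z. mpy xs (f z) (g z))" by auto
qed

lemma mp_bound:
  assumes "\<bar>x\<bar> \<le> t" "\<bar>y\<bar> \<le> t" "t \<le> 1" "\<And>c i j. (c, i, j) \<in> set xs \<Longrightarrow> n \<le> i + j"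
  shows "\<bar>mp xs x y\<bar> \<le> (\<Sum>m\<leftarrow>xs. \<bar>fst m\<bar>) * t ^ n"
  using assms(4)
proof (induction xs)
  case (Cons m xs)
  obtain c i j where m: "m = (c, i, j)" by (cases m) auto
  have t: "0 \<le> t" using assms(1) by linarith
  have "\<bar>x\<bar> ^ i * \<bar>y\<bar> ^ j \<le> t ^ i * t ^ j" using assms t by (intro mult_mono power_mono) auto
  also have "\<dots> \<le> t ^ n" unfolding power_add[symmetric] using Cons.prems[of c i j] t assms(3) m by (intro power_decreasing) auto
  finally have "\<bar>c\<bar> * (\<bar>x\<bar> ^ i * \<bar>y\<bar> ^ j) \<le> \<bar>c\<bar> * t ^ n" by (rule mult_left_mono) simp
  then have "\<bar>c * x ^ i * y ^ j\<bar> \<le> \<bar>c\<bar> * t ^ n" by (simp add: abs_mult power_abs mult.assoc)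
  moreover have "\<bar>mp xs x y\<bar> \<le> (\<Sum>m\<leftarrow>xs. \<bar>fst m\<bar>) * t ^ n" using Cons by (meson list.set_intros(2))
  ultimately have "\<bar>c * x ^ i * y ^ j + mp xs x y\<bar> \<le> (\<bar>c\<bar> + (\<Sum>m\<leftarrow>xs. \<bar>fst m\<bar>)) * t ^ n"
    unfolding distrib_right by linarith
  then show ?case by (simp add: m mp_Cons)
qed (simp add: mp_Cons)

text \<open>The substitution \<open>x = \<sigma>\<^sup>2 X\<close>, \<open>y = \<sigma>\<^sup>3 Y\<close> turns the system into a perturbation of the Hamiltonian system
  with \<open>H = (X\<^sup>2 + Y\<^sup>2 + X\<^sup>6 + Y\<^sup>4) / 2\<close>; \<open>hV\<close> is a corrected energy and \<open>hq\<close> its scaled derivative along the flow.\<close>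

definition hP :: "real \<Rightarrow> real \<Rightarrow> real \<Rightarrow> real \<Rightarrow> real \<Rightarrow> real \<Rightarrow> real \<Rightarrow> real" where
  "hP e2 e1 d2 d1 d0 X Y = - d0 * X + fA e1 d2 d1 * X * Y ^ 2 - 1/5 * (1 - e1) * X ^ 5 + 1/35 * (5 + 7 * e2) * X ^ 2 * Y ^ 2"
definition hQ :: "real \<Rightarrow> real \<Rightarrow> real \<Rightarrow> real \<Rightarrow> real \<Rightarrow> real \<Rightarrow> real" where
  "hQ e1 d2 d1 d0 X Y = - d0 * Y - fB e1 d2 d1 * X ^ 2 * Y + X ^ 4 * Y + 5/21 * X * Y ^ 3"
definition hV :: "(real \<times> nat \<times> nat) list \<Rightarrow> real \<Rightarrow> real \<Rightarrow> real \<Rightarrow> real" where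
  "hV xs s X Y = (X ^ 2 + Y ^ 2 + X ^ 6 + Y ^ 4) / 2 + s * mp xs X Y"
definition hVx :: "(real \<times> nat \<times> nat) list \<Rightarrow> real \<Rightarrow> real \<Rightarrow> real \<Rightarrow> real" where
  "hVx xs s X Y = X + 3 * X ^ 5 + s * mpx xs X Y"
definition hVy :: "(real \<times> nat \<times> nat) list \<Rightarrow> real \<Rightarrow> real \<Rightarrow> real \<Rightarrow> real" where
  "hVy xs s X Y = Y + 2 * Y ^ 3 + s * mpy xs X Y"
definition hq :: "(real \<times> nat \<times> nat) list \<Rightarrow> real \<Rightarrow> real \<Rightarrow> real \<Rightarrow> real \<Rightarrow> real \<Rightarrow> real \<Rightarrow> real \<Rightarrow> real \<Rightarrow> real" where
  "hq xs e2 e1 d2 d1 d0 s X Y = - (Y + 2 * Y ^ 3) * mpx xs X Y + (X + 3 * X ^ 5) * mpy xs X Y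
     + hP e2 e1 d2 d1 d0 X Y * hVx xs s X Y + hQ e1 d2 d1 d0 X Y * hVy xs s X Y"

text \<open>The unperturbed part preserves its own energy, so the terms without \<open>s\<close>
  cancel and the derivative of the corrected energy has the factor \<open>s\<close>.\<close>

lemma hq_eq:
  "s * hq xs e2 e1 d2 d1 d0 s X Y = (- Y - 2 * Y ^ 3 + s * hP e2 e1 d2 d1 d0 X Y) * hVx xs s X Y
     + (X + 3 * X ^ 5 + s * hQ e1 d2 d1 d0 X Y) * hVy xs s X Y"
  unfolding hq_def hVx_def hVy_def by (simp add: algebra_simps)

text \<open>The powers are \<open>s^2 * s^7\<close> and \<open>s^3 * s^7\<close>: the scaling of the
  coordinates times one common time scale \<open>s^7\<close>.\<close>

lemma pfield_scaled:
  "pfield e2 e1 d2 d1 d0 s (s ^ 2 * X, s ^ 3 * Y) =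
     (s ^ 9 * (- Y - 2 * Y ^ 3 + s * hP e2 e1 d2 d1 d0 X Y), s ^ 10 * (X + 3 * X ^ 5 + s * hQ e1 d2 d1 d0 X Y))"
  unfolding planar_field_def hP_def hQ_def fA_def fB_def
  by (simp add: field_simps power_numeral_reduce)

lemma has_derivative_hV:
  fixes X Y :: "'a::real_normed_vector \<Rightarrow> real"
  assumes "(X has_derivative X') (at z)" "(Y has_derivative Y') (at z)"
  shows "((\<lambda>z. hV xs s (X z) (Y z)) has_derivative (\<lambda>h. hVx xs s (X z) (Y z) * X' h + hVy xs s (X z) (Y z) * Y' h)) (at z)"
proof -
  have "((\<lambda>z. X z ^ 2 + Y z ^ 2 + X z ^ 6 + Y z ^ 4) has_derivative
      (\<lambda>h. 2 * X z * X' h + 2 * Y z * Y' h + 6 * X z ^ 5 * X' h + 4 * Y z ^ 3 * Y' h)) (at z)"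
    by (rule derivative_eq_intros assms refl)+ (simp add: fun_eq_iff mult_ac)
  then have "((\<lambda>z. (1/2) * (X z ^ 2 + Y z ^ 2 + X z ^ 6 + Y z ^ 4) + s * mp xs (X z) (Y z)) has_derivative
      (\<lambda>h. (1/2) * (2 * X z * X' h + 2 * Y z * Y' h + 6 * X z ^ 5 * X' h + 4 * Y z ^ 3 * Y' h)
        + s * (mpx xs (X z) (Y z) * X' h + mpy xs (X z) (Y z) * Y' h))) (at z)"
    by (rule has_derivative_add[OF has_derivative_mult_right has_derivative_mult_right[OF has_derivative_mp[OF assms]]])
  moreover have "(\<lambda>z. hV xs s (X z) (Y z)) = (\<lambda>z. (1/2) * (X z ^ 2 + Y z ^ 2 + X z ^ 6 + Y z ^ 4) + s * mp xs (X z) (Y z))"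
    by (simp add: hV_def)
  ultimately show ?thesis by (simp only:) (erule has_derivative_eq_rhs, simp add: fun_eq_iff hVx_def hVy_def algebra_simps)
qed

text \<open>The squared Euclidean distance from the origin in the scaled coordinates, seen from the
  polar ones. It orders the inner curves.\<close>

definition lN :: "real \<Rightarrow> real \<Rightarrow> real \<Rightarrow> real" where
  "lN s \<theta> \<rho> = (\<rho> ^ 2 * gC \<theta> / s ^ 2) ^ 2 + (\<rho> ^ 3 * gS \<theta> / s ^ 3) ^ 2"

lemma lN_eq: "lN s \<theta> \<rho> = \<rho> ^ 4 * (gC \<theta> / s ^ 2) ^ 2 + \<rho> ^ 6 * (gS \<theta> / s ^ 3) ^ 2"
  by (simp add: lN_def power_divide power_mult_distrib flip: power_mult)

lemma lN_mono:
  assumes "s \<noteq> 0" "0 \<le> \<rho>" "\<rho> < \<rho>'"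
  shows "lN s \<theta> \<rho> < lN s \<theta> \<rho>'"
proof -
  have p: "\<rho> ^ 4 < \<rho>' ^ 4" "\<rho> ^ 6 < \<rho>' ^ 6" using assms by (simp_all add: power_strict_mono)
  have "gC \<theta> \<noteq> 0 \<or> gS \<theta> \<noteq> 0" using gC_gS[of \<theta>] by force
  then show ?thesis
  proof
    assume "gC \<theta> \<noteq> 0"
    then have "\<rho> ^ 4 * (gC \<theta> / s ^ 2) ^ 2 < \<rho>' ^ 4 * (gC \<theta> / s ^ 2) ^ 2" using p assms(1) by (intro mult_strict_right_mono) auto
    moreover have "\<rho> ^ 6 * (gS \<theta> / s ^ 3) ^ 2 \<le> \<rho>' ^ 6 * (gS \<theta> / s ^ 3) ^ 2" using p by (intro mult_right_mono) auto
    ultimately show ?thesis unfolding lN_eq by linarith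
  next
    assume "gS \<theta> \<noteq> 0"
    then have "\<rho> ^ 6 * (gS \<theta> / s ^ 3) ^ 2 < \<rho>' ^ 6 * (gS \<theta> / s ^ 3) ^ 2" using p assms(1) by (intro mult_strict_right_mono) auto
    moreover have "\<rho> ^ 4 * (gC \<theta> / s ^ 2) ^ 2 \<le> \<rho>' ^ 4 * (gC \<theta> / s ^ 2) ^ 2" using p by (intro mult_right_mono) auto
    ultimately show ?thesis unfolding lN_eq by linarith
  qed
qed

text \<open>Because \<open>C^2 + S^2 \<ge> C^6 + S^4 = 1\<close>. Its use is the converse: curves
  inside the scaled unit disc lie at radii below the absolute value of \<open>s\<close>, and so
  below outer curves of fixed size.\<close>

lemma lN_ge_1:
  assumes "s \<noteq> 0" "\<bar>s\<bar> \<le> \<rho>"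
  shows "lN s \<theta> \<rho> \<ge> 1"
proof -
  have "gC \<theta> ^ 6 \<le> gC \<theta> ^ 2" using gC_le[of \<theta>] power_decreasing[of 2 6 "\<bar>gC \<theta>\<bar>"] by simp
  moreover have "gS \<theta> ^ 4 \<le> gS \<theta> ^ 2" using gS_le[of \<theta>] power_decreasing[of 2 4 "\<bar>gS \<theta>\<bar>"] by simp
  ultimately have "1 \<le> gC \<theta> ^ 2 + gS \<theta> ^ 2" using gC_gS[of \<theta>] by linarith
  also have "\<dots> = \<bar>s\<bar> ^ 4 * (gC \<theta> / s ^ 2) ^ 2 + \<bar>s\<bar> ^ 6 * (gS \<theta> / s ^ 3) ^ 2"
    using assms(1) by (simp add: power_divide flip: power_mult)
  also have "\<dots> \<le> lN s \<theta> \<rho>"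
    unfolding lN_eq using assms(2) by (intro add_mono mult_right_mono power_mono) auto
  finally show ?thesis .
qed

lemma lN_less:
  assumes "s \<noteq> 0" "lN s \<theta> \<rho> < 1" shows "\<rho> < \<bar>s\<bar>"
  using lN_ge_1[of s \<rho> \<theta>] assms by linarith

text \<open>The derivative of a function along the flow, computed in Cartesian and in polar
  coordinates. The polar speeds are \<open>n / 6\<close> for the radius and
  \<open>d / (6 w \<rho>)\<close> for the angle, and \<open>s^3\<close> accounts for the different
  scaling of \<open>x\<close> and \<open>y\<close>.\<close>

lemma polar_chain_rule:
  fixes \<rho> w s :: real
  assumes "\<rho> \<noteq> 0" "w \<noteq> 0" "s \<noteq> 0"
  shows "s * (\<rho> / 3 * (c * n - t ^ 3 * d)) * vx + (\<rho> ^ 2 / 2 * (t * n + c ^ 5 * d)) * vy =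
    s ^ 3 * (n * (vx * (2 * \<rho> * c / s ^ 2) + vy * (3 * \<rho> ^ 2 * t / s ^ 3)) / 6
      + d * (vx * (\<rho> ^ 2 * (- 2 * t ^ 3 * w) / s ^ 2) + vy * (\<rho> ^ 3 * (3 * c ^ 5 * w) / s ^ 3)) / (6 * w * \<rho>))"
proof -
  have 1: "s ^ 3 * (n * (vx * (2 * \<rho> * c / s ^ 2) + vy * (3 * \<rho> ^ 2 * t / s ^ 3)) / 6)
     = n * (s * vx * (2 * \<rho> * c) + vy * (3 * \<rho> ^ 2 * t)) / 6"
    using assms by (simp add: field_simps power_numeral_reduce)
  have 2: "s ^ 3 * (d * (vx * (\<rho> ^ 2 * (- 2 * t ^ 3 * w) / s ^ 2) + vy * (\<rho> ^ 3 * (3 * c ^ 5 * w) / s ^ 3)) / (6 * w * \<rho>))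
     = d * (s * vx * (\<rho> * (- 2 * t ^ 3)) + vy * (\<rho> ^ 2 * (3 * c ^ 5))) / 6"
    using assms by (simp add: field_simps power_numeral_reduce)
  show ?thesis unfolding distrib_left[of "s ^ 3"] 1 2 by (simp add: field_simps)
qed

text \<open>The energy is close to half the squared distance, so its level \<open>r^2\<close> runs
  between the circles of radius \<open>r\<close> and \<open>2 r\<close>. The weights 2 and 3 in
  \<open>radial\<close> come from differentiating \<open>X\<close> and \<open>Y\<close> along a
  weighted ray, so the level set is a graph over the angle. A level curve is crossed in the
  direction in which the energy changes.\<close>

lemma level_barrier:
  assumes sp: "small_parameters e2 e1 d2 d1 d0 s" and s: "s \<noteq> 0" "\<bar>s\<bar> \<le> 1/10" and r: "0 < r" "r \<le> 1/2"
    and inner: "\<And>X Y. X ^ 2 + Y ^ 2 = r ^ 2 \<Longrightarrow> hV xs s X Y < r ^ 2"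
    and outer: "\<And>X Y. X ^ 2 + Y ^ 2 = 4 * r ^ 2 \<Longrightarrow> r ^ 2 < hV xs s X Y"
    and radial: "\<And>X Y. r ^ 2 \<le> X ^ 2 + Y ^ 2 \<Longrightarrow> X ^ 2 + Y ^ 2 \<le> 4 * r ^ 2 \<Longrightarrow> 2 * X * hVx xs s X Y + 3 * Y * hVy xs s X Y > 0"
    and q: "\<And>X Y. r ^ 2 \<le> X ^ 2 + Y ^ 2 \<Longrightarrow> X ^ 2 + Y ^ 2 \<le> 4 * r ^ 2 \<Longrightarrow> \<sigma> * hq xs e2 e1 d2 d1 d0 s X Y > 0"
  shows "\<exists>a. barrier \<sigma> (fF e2 e1 d2 d1 d0 s) a \<and> (\<forall>\<theta>. 0 < a \<theta> \<and> a \<theta> < \<bar>s\<bar> \<and> r ^ 2 < lN s \<theta> (a \<theta>) \<and> lN s \<theta> (a \<theta>) < 4 * r ^ 2)"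
proof -
  define X Y where "X \<theta> \<rho> = \<rho> ^ 2 * gC \<theta> / s ^ 2" and "Y \<theta> \<rho> = \<rho> ^ 3 * gS \<theta> / s ^ 3" for \<theta> \<rho>
  define Vx Vy where "Vx \<theta> \<rho> = hVx xs s (X \<theta> \<rho>) (Y \<theta> \<rho>)" and "Vy \<theta> \<rho> = hVy xs s (X \<theta> \<rho>) (Y \<theta> \<rho>)" for \<theta> \<rho>
  define Gt where "Gt \<theta> \<rho> = Vx \<theta> \<rho> * (\<rho> ^ 2 * (- 2 * gS \<theta> ^ 3 * gw \<theta>) / s ^ 2) + Vy \<theta> \<rho> * (\<rho> ^ 3 * (3 * gC \<theta> ^ 5 * gw \<theta>) / s ^ 3)" for \<theta> \<rho>
  define Gr where "Gr \<theta> \<rho> = Vx \<theta> \<rho> * (2 * \<rho> * gC \<theta> / s ^ 2) + Vy \<theta> \<rho> * (3 * \<rho> ^ 2 * gS \<theta> / s ^ 3)" for \<theta> \<rho>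
  have N: "lN s \<theta> \<rho> = X \<theta> \<rho> ^ 2 + Y \<theta> \<rho> ^ 2" for \<theta> \<rho> by (simp add: lN_def X_def Y_def)
  have "\<exists>a. \<forall>\<theta>. a \<theta> > 0 \<and> r ^ 2 < lN s \<theta> (a \<theta>) \<and> lN s \<theta> (a \<theta>) < 4 * r ^ 2 \<and> a (\<theta> + 2 * pi) = a \<theta> \<and>
     (a has_real_derivative - Gt \<theta> (a \<theta>) / Gr \<theta> (a \<theta>)) (at \<theta>)"
  proof (rule implicit_curve[where G = "\<lambda>\<theta> \<rho>. hV xs s (X \<theta> \<rho>) (Y \<theta> \<rho>)" and c = "r ^ 2"])
    fix \<theta> \<rho> :: real
    have gC: "((\<lambda>p. gC (fst p)) has_derivative (\<lambda>h. - 2 * gS \<theta> ^ 3 * gw \<theta> * fst h)) (at (\<theta>, \<rho>))"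
      and gS: "((\<lambda>p. gS (fst p)) has_derivative (\<lambda>h. 3 * gC \<theta> ^ 5 * gw \<theta> * fst h)) (at (\<theta>, \<rho>))"
    proof -
      have fst: "(fst has_derivative fst) (at (\<theta>, \<rho>))" by (rule has_derivative_fst[OF has_derivative_ident])
      show "((\<lambda>p. gC (fst p)) has_derivative (\<lambda>h. - 2 * gS \<theta> ^ 3 * gw \<theta> * fst h)) (at (\<theta>, \<rho>))"
        using has_derivative_compose[OF fst, of gC "(*) (- 2 * gS \<theta> ^ 3 * gw \<theta>)"] DERIV_gC[of \<theta>]
        by (simp add: has_field_derivative_def)
      show "((\<lambda>p. gS (fst p)) has_derivative (\<lambda>h. 3 * gC \<theta> ^ 5 * gw \<theta> * fst h)) (at (\<theta>, \<rho>))"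
        using has_derivative_compose[OF fst, of gS "(*) (3 * gC \<theta> ^ 5 * gw \<theta>)"] DERIV_gS[of \<theta>]
        by (simp add: has_field_derivative_def)
    qed
    have DX: "((\<lambda>p. X (fst p) (snd p)) has_derivative (\<lambda>h. (\<rho> ^ 2 * (- 2 * gS \<theta> ^ 3 * gw \<theta>) / s ^ 2) * fst h + (2 * \<rho> * gC \<theta> / s ^ 2) * snd h)) (at (\<theta>, \<rho>))"
      unfolding X_def by (rule derivative_eq_intros gC refl)+ (use s in \<open>auto simp: fun_eq_iff field_simps\<close>)
    have DY: "((\<lambda>p. Y (fst p) (snd p)) has_derivative (\<lambda>h. (\<rho> ^ 3 * (3 * gC \<theta> ^ 5 * gw \<theta>) / s ^ 3) * fst h + (3 * \<rho> ^ 2 * gS \<theta> / s ^ 3) * snd h)) (at (\<theta>, \<rho>))"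
      unfolding Y_def by (rule derivative_eq_intros gS refl)+ (use s in \<open>auto simp: fun_eq_iff field_simps\<close>)
    show "((\<lambda>p. hV xs s (X (fst p) (snd p)) (Y (fst p) (snd p))) has_derivative (\<lambda>h. Gt \<theta> \<rho> * fst h + Gr \<theta> \<rho> * snd h)) (at (\<theta>, \<rho>))"
      by (rule has_derivative_eq_rhs[OF has_derivative_hV[OF DX DY]])
        (simp add: fun_eq_iff Gt_def Gr_def Vx_def Vy_def algebra_simps)
  next
    show "continuous_on UNIV (\<lambda>p. lN s (fst p) (snd p))"
      unfolding lN_eq by (intro continuous_intros; use s in simp)
    show "\<exists>\<rho>>0. 4 * r ^ 2 \<le> lN s \<theta> \<rho>" for \<theta>
    proof -
      have "4 * r ^ 2 \<le> 1" using r power_mono[of r "1/2" 2] by (simp add: power2_eq_square)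
      then show ?thesis using lN_ge_1[of s "\<bar>s\<bar>" \<theta>] s by (intro exI[of _ "\<bar>s\<bar>"]) auto
    qed
    show "0 < r ^ 2" "r ^ 2 < 4 * r ^ 2" using r by auto
    show "Gr \<theta> \<rho> > 0" if "\<rho> > 0" "r ^ 2 \<le> lN s \<theta> \<rho>" "lN s \<theta> \<rho> \<le> 4 * r ^ 2" for \<theta> \<rho>
    proof -
      have "\<rho> * Gr \<theta> \<rho> = 2 * X \<theta> \<rho> * Vx \<theta> \<rho> + 3 * Y \<theta> \<rho> * Vy \<theta> \<rho>"
        by (simp add: Gr_def X_def Y_def algebra_simps power_numeral_reduce)
      also have "\<dots> > 0" unfolding Vx_def Vy_def using that unfolding N by (intro radial)
      finally show ?thesis using that(1) by (simp add: zero_less_mult_iff)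
    qed
  qed (use s r inner outer lN_mono in \<open>auto simp: N[symmetric] X_def[of "_ + _"] Y_def[of "_ + _"] lN_def X_def Y_def\<close>)
  then obtain a where a: "\<And>\<theta>. a \<theta> > 0" "\<And>\<theta>. r ^ 2 < lN s \<theta> (a \<theta>)" "\<And>\<theta>. lN s \<theta> (a \<theta>) < 4 * r ^ 2"
    "\<And>\<theta>. a (\<theta> + 2 * pi) = a \<theta>" "\<And>\<theta>. (a has_real_derivative - Gt \<theta> (a \<theta>) / Gr \<theta> (a \<theta>)) (at \<theta>)" by blast
  have "4 * r ^ 2 \<le> 1" using r power_mono[of r "1/2" 2] by (simp add: power2_eq_square)
  then have less: "a \<theta> < \<bar>s\<bar>" for \<theta> using lN_less[OF s(1) order.strict_trans2[OF a(3)]] by blast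
  have "\<sigma> * (fF e2 e1 d2 d1 d0 s \<theta> (a \<theta>) - (- Gt \<theta> (a \<theta>) / Gr \<theta> (a \<theta>))) > 0" for \<theta>
  proof -
    let ?\<rho> = "a \<theta>"
    let ?n = "fnum e2 e1 d2 d1 d0 s \<theta> ?\<rho> :: real" and ?d = "fden e2 e1 d2 d1 d0 s \<theta> ?\<rho> :: real"
    have den: "?d > 0" using fden_pos[OF sp a(1)] less[of \<theta>] s by force
    have Gr: "Gr \<theta> ?\<rho> > 0"
    proof -
      have "?\<rho> * Gr \<theta> ?\<rho> = 2 * X \<theta> ?\<rho> * Vx \<theta> ?\<rho> + 3 * Y \<theta> ?\<rho> * Vy \<theta> ?\<rho>"
        by (simp add: Gr_def X_def Y_def algebra_simps power_numeral_reduce)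
      also have "\<dots> > 0" unfolding Vx_def Vy_def using a(2,3)[of \<theta>] unfolding N by (intro radial) auto
      finally show ?thesis using a(1)[of \<theta>] by (simp add: zero_less_mult_iff)
    qed
    have "pt \<theta> ?\<rho> = (s ^ 2 * X \<theta> ?\<rho>, s ^ 3 * Y \<theta> ?\<rho>)" using s by (simp add: pt_def X_def Y_def)
    from pfield_polar[where \<rho> = ?\<rho> and ?e2.0 = e2 and ?e1.0 = e1 and ?d2.0 = d2 and ?d1.0 = d1 and ?d0.0 = d0 and s = s and \<theta> = \<theta>, unfolded this pfield_scaled] a(1)[of \<theta>]
    have f: "s ^ 9 * (- Y \<theta> ?\<rho> - 2 * Y \<theta> ?\<rho> ^ 3 + s * hP e2 e1 d2 d1 d0 (X \<theta> ?\<rho>) (Y \<theta> ?\<rho>)) = ?\<rho> / 3 * (gC \<theta> * ?n - gS \<theta> ^ 3 * ?d)"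
      "s ^ 10 * (X \<theta> ?\<rho> + 3 * X \<theta> ?\<rho> ^ 5 + s * hQ e1 d2 d1 d0 (X \<theta> ?\<rho>) (Y \<theta> ?\<rho>)) = ?\<rho> ^ 2 / 2 * (gS \<theta> * ?n + gC \<theta> ^ 5 * ?d)"
      by auto
    let ?q = "hq xs e2 e1 d2 d1 d0 s (X \<theta> ?\<rho>) (Y \<theta> ?\<rho>)"
    have "s ^ 10 * (s * ?q) = s * (s ^ 9 * (- Y \<theta> ?\<rho> - 2 * Y \<theta> ?\<rho> ^ 3 + s * hP e2 e1 d2 d1 d0 (X \<theta> ?\<rho>) (Y \<theta> ?\<rho>))) * Vx \<theta> ?\<rho>
       + (s ^ 10 * (X \<theta> ?\<rho> + 3 * X \<theta> ?\<rho> ^ 5 + s * hQ e1 d2 d1 d0 (X \<theta> ?\<rho>) (Y \<theta> ?\<rho>))) * Vy \<theta> ?\<rho>"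
      unfolding hq_eq Vx_def Vy_def by (simp add: algebra_simps power_numeral_reduce)
    also have "\<dots> = s * (?\<rho> / 3 * (gC \<theta> * ?n - gS \<theta> ^ 3 * ?d)) * Vx \<theta> ?\<rho> + (?\<rho> ^ 2 / 2 * (gS \<theta> * ?n + gC \<theta> ^ 5 * ?d)) * Vy \<theta> ?\<rho>"
      unfolding f ..
    also have "\<dots> = s ^ 3 * (?n * Gr \<theta> ?\<rho> / 6 + ?d * Gt \<theta> ?\<rho> / (6 * gw \<theta> * ?\<rho>))"
      unfolding Gr_def Gt_def
      by (rule polar_chain_rule) (use s a(1)[of \<theta>] gw_pos[of \<theta>] in \<open>simp_all del: gw_pos\<close>)
    finally have *: "s ^ 10 * (s * ?q) = s ^ 3 * (?n * Gr \<theta> ?\<rho> / 6 + ?d * Gt \<theta> ?\<rho> / (6 * gw \<theta> * ?\<rho>))" .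
    \<comment> \<open>What remains is \<open>s^8 * ?q\<close>. The power is even, so the sign of the
      crossing is the same for positive and negative \<open>s\<close>.\<close>
    have "s ^ 10 * (s * ?q) = s ^ 3 * (s ^ 8 * ?q)" by (simp add: power_numeral_reduce)
    from trans[OF *[symmetric] this] s(1)
    have "?n * Gr \<theta> ?\<rho> / 6 + ?d * Gt \<theta> ?\<rho> / (6 * gw \<theta> * ?\<rho>) = s ^ 8 * ?q"
      unfolding mult_cancel_left power_eq_0_iff by blast
    moreover have "fF e2 e1 d2 d1 d0 s \<theta> ?\<rho> - (- Gt \<theta> ?\<rho> / Gr \<theta> ?\<rho>)
       = 6 * gw \<theta> * ?\<rho> / (?d * Gr \<theta> ?\<rho>) * (?n * Gr \<theta> ?\<rho> / 6 + ?d * Gt \<theta> ?\<rho> / (6 * gw \<theta> * ?\<rho>))"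
      using Gr den a(1)[of \<theta>] gw_pos[of \<theta>] unfolding fF_def by (simp add: field_simps)
    ultimately have "\<sigma> * (fF e2 e1 d2 d1 d0 s \<theta> ?\<rho> - (- Gt \<theta> ?\<rho> / Gr \<theta> ?\<rho>)) = 6 * gw \<theta> * ?\<rho> / (?d * Gr \<theta> ?\<rho>) * (s ^ 8 * (\<sigma> * ?q))"
      by simp
    moreover have "\<sigma> * ?q > 0" using a(2,3)[of \<theta>] unfolding N by (intro q) auto
    ultimately show ?thesis using Gr den a(1)[of \<theta>] gw_pos[of \<theta>] s(1) by (simp add: mult_pos_pos divide_pos_pos)
  qed
  then have "barrier \<sigma> (fF e2 e1 d2 d1 d0 s) a" unfolding barrier_def using a(4,5) by blast
  then show ?thesis using a less by blast
qed

lemma compact_positive_persists: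
  fixes g :: "'a::metric_space \<times> 'b::topological_space \<Rightarrow> real"
  assumes K: "compact K" and g: "continuous_on (UNIV \<times> K) g" and pos: "\<And>k. k \<in> K \<Longrightarrow> g (p, k) > 0"
  shows "\<exists>r>0. \<forall>q. dist q p < r \<longrightarrow> (\<forall>k\<in>K. g (q, k) > 0)"
proof (cases "K = {}")
  case True
  then show ?thesis by (auto intro: exI[of _ 1])
next
  case False
  have "continuous_on K (\<lambda>k. g (p, k))"
    by (rule continuous_on_compose2[OF g]) (auto intro!: continuous_intros)
  then obtain m where m: "m \<in> K" "\<And>k. k \<in> K \<Longrightarrow> g (p, m) \<le> g (p, k)"
    using continuous_attains_inf[OF K False] by blast
  obtain X where X: "p \<in> X" "open X" "\<And>q k. q \<in> X \<inter> UNIV \<Longrightarrow> k \<in> K \<Longrightarrow> dist (g (q, k)) (g (p, k)) \<le> g (p, m) / 2"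
    by (rule continuous_on_prod_compactE[OF g K, of p "g (p, m) / 2"]) (use pos[OF m(1)] in auto)
  obtain r where r: "r > 0" "ball p r \<subseteq> X" using X by (meson openE)
  have "g (q, k) > 0" if "dist q p < r" "k \<in> K" for q k
  proof -
    have "q \<in> X \<inter> UNIV" using r that by (auto simp: dist_commute)
    then show ?thesis using X(3)[of q k] m(2)[OF that(2)] pos[OF m(1)] that(2) unfolding dist_real_def abs_le_iff by force
  qed
  then show ?thesis using r(1) by blast
qed

text \<open>At \<open>s = 0\<close> all conditions of \<open>level_barrier\<close> are strict
  inequalities on compact sets, so they persist for small \<open>s\<close> and for small changes of
  the three \<delta> parameters.\<close>

lemma inner_curve:
  assumes e: "\<bar>e2\<bar> \<le> 1/20" "\<bar>e1\<bar> \<le> 1/20" and d: "\<bar>d2\<bar> < 1/20" "\<bar>d1\<bar> < 1/20" "\<bar>d0\<bar> < 1/20"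
    and r: "0 < r" "r < 1/2"
    and q: "\<And>X Y. r ^ 2 \<le> X ^ 2 + Y ^ 2 \<Longrightarrow> X ^ 2 + Y ^ 2 \<le> 4 * r ^ 2 \<Longrightarrow> \<sigma> * hq xs e2 e1 d2 d1 d0 0 X Y > 0"
  shows "\<exists>\<nu>>0. \<forall>d2' d1' d0' s. \<bar>d2' - d2\<bar> < \<nu> \<longrightarrow> \<bar>d1' - d1\<bar> < \<nu> \<longrightarrow> \<bar>d0' - d0\<bar> < \<nu> \<longrightarrow> s \<noteq> 0 \<longrightarrow> \<bar>s\<bar> < \<nu> \<longrightarrow>
     (\<exists>a. barrier \<sigma> (fF e2 e1 d2' d1' d0' s) a \<and> (\<forall>\<theta>. 0 < a \<theta> \<and> a \<theta> < \<bar>s\<bar> \<and> r ^ 2 < lN s \<theta> (a \<theta>) \<and> lN s \<theta> (a \<theta>) < 4 * r ^ 2))"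
proof -
  define K where "K = {z :: real \<times> real. r ^ 2 \<le> fst z ^ 2 + snd z ^ 2 \<and> fst z ^ 2 + snd z ^ 2 \<le> 4 * r ^ 2}"
  define K1 where "K1 = {z :: real \<times> real. fst z ^ 2 + snd z ^ 2 = r ^ 2}"
  define K2 where "K2 = {z :: real \<times> real. fst z ^ 2 + snd z ^ 2 = 4 * r ^ 2}"
  have bounded: "bounded K"
  proof (rule boundedI)
    fix z :: "real \<times> real" assume "z \<in> K"
    then have "norm z ^ 2 \<le> (2 * r) ^ 2" by (simp add: K_def norm_prod_def power_mult_distrib)
    then show "norm z \<le> 2 * r" by (rule power2_le_imp_le) (use r in simp)
  qed
  have "closed K" "closed K1" "closed K2" unfolding K_def K1_def K2_def
    by (intro closed_Collect_conj closed_Collect_le closed_Collect_eq continuous_intros)+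
  moreover have "K1 \<subseteq> K" "K2 \<subseteq> K" using r by (auto simp: K_def K1_def K2_def)
  ultimately have comp: "compact K" "compact K1" "compact K2"
    using bounded bounded_subset by (auto simp: compact_eq_bounded_closed)
  let ?p = "(d2, d1, d0, 0) :: real \<times> real \<times> real \<times> real"
  have V0: "hV xs 0 X Y = (X ^ 2 + Y ^ 2 + X ^ 6 + Y ^ 4) / 2" for X Y by (simp add: hV_def)
  have cV: "continuous_on A (\<lambda>z :: (real \<times> real \<times> real \<times> real) \<times> real \<times> real. hV xs (snd (snd (snd (fst z)))) (fst (snd z)) (snd (snd z)))"
    "continuous_on A (\<lambda>z :: (real \<times> real \<times> real \<times> real) \<times> real \<times> real. hVx xs (snd (snd (snd (fst z)))) (fst (snd z)) (snd (snd z)))"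
    "continuous_on A (\<lambda>z :: (real \<times> real \<times> real \<times> real) \<times> real \<times> real. hVy xs (snd (snd (snd (fst z)))) (fst (snd z)) (snd (snd z)))" for A
    unfolding hV_def hVx_def hVy_def by (intro continuous_intros; simp)+
  obtain r1 where r1: "r1 > 0" "\<And>q z. dist q ?p < r1 \<Longrightarrow> z \<in> K1 \<Longrightarrow> r ^ 2 - hV xs (snd (snd (snd q))) (fst z) (snd z) > 0"
  proof -
    have "\<exists>\<epsilon>>0. \<forall>q. dist q ?p < \<epsilon> \<longrightarrow> (\<forall>k\<in>K1. (\<lambda>z. r ^ 2 - hV xs (snd (snd (snd (fst z)))) (fst (snd z)) (snd (snd z))) (q, k) > 0)"
    proof (rule compact_positive_persists[OF comp(2)])
      fix z assume "z \<in> K1"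
      then have z: "fst z ^ 2 + snd z ^ 2 = r ^ 2" by (simp add: K1_def)
      have r2: "r ^ 2 < 1" using r power_strict_mono[of r 1 2] by simp
      have "fst z ^ 2 \<le> r ^ 2" "snd z ^ 2 \<le> r ^ 2" using z by (smt (verit) zero_le_power2)+
      then have "(fst z ^ 2) ^ 3 \<le> fst z ^ 2 * r ^ 2" "(snd z ^ 2) ^ 2 \<le> snd z ^ 2 * r ^ 2"
      proof -
        assume *: "fst z ^ 2 \<le> r ^ 2" "snd z ^ 2 \<le> r ^ 2"
        have "fst z ^ 2 * (fst z ^ 2 * fst z ^ 2) \<le> fst z ^ 2 * (r ^ 2 * 1)"
          using * r2 by (intro mult_left_mono mult_mono) auto
        then show "(fst z ^ 2) ^ 3 \<le> fst z ^ 2 * r ^ 2" by (simp add: power3_eq_cube mult.assoc)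
        have "snd z ^ 2 * snd z ^ 2 \<le> snd z ^ 2 * r ^ 2" using * by (intro mult_left_mono) auto
        then show "(snd z ^ 2) ^ 2 \<le> snd z ^ 2 * r ^ 2" by (simp add: power2_eq_square)
      qed
      then have "fst z ^ 6 + snd z ^ 4 \<le> (fst z ^ 2 + snd z ^ 2) * r ^ 2"
        by (simp add: distrib_right flip: power_mult)
      also have "\<dots> < r ^ 2 * 1" unfolding z using r r2 by (intro mult_strict_left_mono) auto
      finally show "(\<lambda>z. r ^ 2 - hV xs (snd (snd (snd (fst z)))) (fst (snd z)) (snd (snd z))) (?p, z) > 0"
        using z by (simp add: V0)
    qed (intro continuous_intros cV)
    then show ?thesis unfolding fst_conv snd_conv using that by blast
  qed
  obtain r2 where r2: "r2 > 0" "\<And>q z. dist q ?p < r2 \<Longrightarrow> z \<in> K2 \<Longrightarrow> hV xs (snd (snd (snd q))) (fst z) (snd z) - r ^ 2 > 0"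
  proof -
    have "\<exists>\<epsilon>>0. \<forall>q. dist q ?p < \<epsilon> \<longrightarrow> (\<forall>k\<in>K2. (\<lambda>z. hV xs (snd (snd (snd (fst z)))) (fst (snd z)) (snd (snd z)) - r ^ 2) (q, k) > 0)"
    proof (rule compact_positive_persists[OF comp(3)])
      fix z assume "z \<in> K2"
      then have z: "fst z ^ 2 + snd z ^ 2 = 4 * r ^ 2" by (simp add: K2_def)
      have "fst z ^ 6 \<ge> 0" "snd z ^ 4 \<ge> 0" "r ^ 2 > 0" using r by simp_all
      moreover have "(A + B + c + d) / 2 - R > 0" if "A + B = 4 * R" "0 \<le> c" "0 \<le> d" "0 < R" for A B c d R :: real
      proof -
        have "2 * R < A + B + c + d" using that by linarith
        then show ?thesis by simp
      qed
      ultimately have "(fst z ^ 2 + snd z ^ 2 + fst z ^ 6 + snd z ^ 4) / 2 - r ^ 2 > 0" using z by blast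
      then show "(\<lambda>z. hV xs (snd (snd (snd (fst z)))) (fst (snd z)) (snd (snd z)) - r ^ 2) (?p, z) > 0"
        by (simp only: V0 fst_conv snd_conv)
    qed (intro continuous_intros cV)
    then show ?thesis unfolding fst_conv snd_conv using that by blast
  qed
  obtain r3 where r3: "r3 > 0" "\<And>q z. dist q ?p < r3 \<Longrightarrow> z \<in> K \<Longrightarrow>
      2 * fst z * hVx xs (snd (snd (snd q))) (fst z) (snd z) + 3 * snd z * hVy xs (snd (snd (snd q))) (fst z) (snd z) > 0"
  proof -
    have "\<exists>\<epsilon>>0. \<forall>q. dist q ?p < \<epsilon> \<longrightarrow> (\<forall>k\<in>K. (\<lambda>z. 2 * fst (snd z) * hVx xs (snd (snd (snd (fst z)))) (fst (snd z)) (snd (snd z))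
        + 3 * snd (snd z) * hVy xs (snd (snd (snd (fst z)))) (fst (snd z)) (snd (snd z))) (q, k) > 0)"
    proof (rule compact_positive_persists[OF comp(1)])
      fix z assume "z \<in> K"
      then have "r ^ 2 \<le> fst z ^ 2 + snd z ^ 2" by (simp add: K_def)
      then have z: "fst z ^ 2 + snd z ^ 2 > 0" using zero_less_power[OF r(1), of 2] by (rule order.strict_trans2[rotated])
      have "2 * fst z * hVx xs 0 (fst z) (snd z) + 3 * snd z * hVy xs 0 (fst z) (snd z)
          = 2 * (fst z ^ 2 + snd z ^ 2) + snd z ^ 2 + 6 * fst z ^ 6 + 6 * snd z ^ 4"
        by (simp add: hVx_def hVy_def algebra_simps power_numeral_reduce)
      also have "\<dots> > 0" using z by (intro add_pos_nonneg) auto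
      finally show "(\<lambda>z. 2 * fst (snd z) * hVx xs (snd (snd (snd (fst z)))) (fst (snd z)) (snd (snd z))
        + 3 * snd (snd z) * hVy xs (snd (snd (snd (fst z)))) (fst (snd z)) (snd (snd z))) (?p, z) > 0" by simp
    qed (intro continuous_intros cV)
    then show ?thesis unfolding fst_conv snd_conv using that by blast
  qed
  obtain r4 where r4: "r4 > 0" "\<And>q z. dist q ?p < r4 \<Longrightarrow> z \<in> K \<Longrightarrow>
      \<sigma> * hq xs e2 e1 (fst q) (fst (snd q)) (fst (snd (snd q))) (snd (snd (snd q))) (fst z) (snd z) > 0"
  proof -
    have "\<exists>\<epsilon>>0. \<forall>p. dist p ?p < \<epsilon> \<longrightarrow> (\<forall>k\<in>K. (\<lambda>z. \<sigma> * hq xs e2 e1 (fst (fst z)) (fst (snd (fst z))) (fst (snd (snd (fst z))))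
        (snd (snd (snd (fst z)))) (fst (snd z)) (snd (snd z))) (p, k) > 0)"
    proof (rule compact_positive_persists[OF comp(1)])
      show "continuous_on (UNIV \<times> K) (\<lambda>z. \<sigma> * hq xs e2 e1 (fst (fst z)) (fst (snd (fst z))) (fst (snd (snd (fst z))))
        (snd (snd (snd (fst z)))) (fst (snd z)) (snd (snd z)))"
        unfolding hq_def hP_def hQ_def fA_def fB_def by (intro continuous_intros cV; simp)
    qed (use q in \<open>auto simp: K_def\<close>)
    then show ?thesis unfolding fst_conv snd_conv using that by blast
  qed
  define \<nu> where "\<nu> = Min {r1 / 4, r2 / 4, r3 / 4, r4 / 4, 1/20 - \<bar>d2\<bar>, 1/20 - \<bar>d1\<bar>, 1/20 - \<bar>d0\<bar>, 1/10}"
  have \<nu>: "\<nu> > 0" "4 * \<nu> \<le> r1" "4 * \<nu> \<le> r2" "4 * \<nu> \<le> r3" "4 * \<nu> \<le> r4" "\<nu> \<le> 1/20 - \<bar>d2\<bar>" "\<nu> \<le> 1/20 - \<bar>d1\<bar>"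
    "\<nu> \<le> 1/20 - \<bar>d0\<bar>" "\<nu> \<le> 1/10"
  proof -
    have "finite {r1 / 4, r2 / 4, r3 / 4, r4 / 4, 1/20 - \<bar>d2\<bar>, 1/20 - \<bar>d1\<bar>, 1/20 - \<bar>d0\<bar>, 1/10}" by simp
    note le = Min_le[OF this, folded \<nu>_def]
    show "\<nu> > 0" unfolding \<nu>_def by (subst Min_gr_iff) (use r1(1) r2(1) r3(1) r4(1) d in auto)
    show "4 * \<nu> \<le> r1" "4 * \<nu> \<le> r2" "4 * \<nu> \<le> r3" "4 * \<nu> \<le> r4" "\<nu> \<le> 1/20 - \<bar>d2\<bar>" "\<nu> \<le> 1/20 - \<bar>d1\<bar>"
      "\<nu> \<le> 1/20 - \<bar>d0\<bar>" "\<nu> \<le> 1/10"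
      using le[of "r1 / 4"] le[of "r2 / 4"] le[of "r3 / 4"] le[of "r4 / 4"] le[of "1/20 - \<bar>d2\<bar>"] le[of "1/20 - \<bar>d1\<bar>"]
        le[of "1/20 - \<bar>d0\<bar>"] le[of "1/10"] by simp_all
  qed
  have "\<exists>a. barrier \<sigma> (fF e2 e1 d2' d1' d0' s) a \<and> (\<forall>\<theta>. 0 < a \<theta> \<and> a \<theta> < \<bar>s\<bar> \<and> r ^ 2 < lN s \<theta> (a \<theta>) \<and> lN s \<theta> (a \<theta>) < 4 * r ^ 2)"
    if small: "\<bar>d2' - d2\<bar> < \<nu>" "\<bar>d1' - d1\<bar> < \<nu>" "\<bar>d0' - d0\<bar> < \<nu>" "s \<noteq> 0" "\<bar>s\<bar> < \<nu>" for d2' d1' d0' s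
  proof (rule level_barrier)
    have "\<bar>x'\<bar> \<le> 1/20" if "\<bar>x' - x\<bar> < \<nu>" "\<nu> \<le> 1/20 - \<bar>x\<bar>" for x x' :: real
      using that abs_triangle_ineq[of "x' - x" x] by simp
    from this[OF small(1) \<nu>(6)] this[OF small(2) \<nu>(7)] this[OF small(3) \<nu>(8)]
    show "small_parameters e2 e1 d2' d1' d0' s" using e small(5) \<nu>(9) by (simp add: small_parameters_def)
    have "norm ((d2', d1', d0', s) - ?p) \<le> \<bar>d2' - d2\<bar> + (\<bar>d1' - d1\<bar> + (\<bar>d0' - d0\<bar> + \<bar>s\<bar>))"
      unfolding diff_Pair diff_zero real_norm_def[symmetric]
      by (intro order_trans[OF norm_Pair_le] add_left_mono order_refl)
    then have dist: "dist (d2', d1', d0', s) ?p < 4 * \<nu>" using small unfolding dist_norm by linarith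
    show "hV xs s X Y < r ^ 2" if "X ^ 2 + Y ^ 2 = r ^ 2" for X Y
      using r1(2)[OF order.strict_trans2[OF dist \<nu>(2)], of "(X, Y)"] that by (simp add: K1_def)
    show "r ^ 2 < hV xs s X Y" if "X ^ 2 + Y ^ 2 = 4 * r ^ 2" for X Y
      using r2(2)[OF order.strict_trans2[OF dist \<nu>(3)], of "(X, Y)"] that by (simp add: K2_def)
    show "2 * X * hVx xs s X Y + 3 * Y * hVy xs s X Y > 0" if "r ^ 2 \<le> X ^ 2 + Y ^ 2" "X ^ 2 + Y ^ 2 \<le> 4 * r ^ 2" for X Y
      using r3(2)[OF order.strict_trans2[OF dist \<nu>(4)], of "(X, Y)"] that by (simp add: K_def)
    show "\<sigma> * hq xs e2 e1 d2' d1' d0' s X Y > 0" if "r ^ 2 \<le> X ^ 2 + Y ^ 2" "X ^ 2 + Y ^ 2 \<le> 4 * r ^ 2" for X Y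
      using r4(2)[OF order.strict_trans2[OF dist \<nu>(5)], of "(X, Y)"] that by (simp add: K_def)
  qed (use small \<nu> r in auto)
  then show ?thesis using \<nu>(1) by blast
qed

text \<open>In the ring the leading term is at least of size \<open>t^(2k)\<close>, while the
  remainder is at most a constant times \<open>t^(2k+1)\<close>. Small radii therefore decide the
  sign.\<close>

lemma leading_term_positive:
  assumes hq: "\<And>X Y. hq xs e2 e1 d2 d1 d0 0 X Y = c * (X ^ 2 + Y ^ 2) ^ k + mp rs X Y"
    and deg: "\<forall>(c, i, j)\<in>set rs. 2 * k + 1 \<le> i + j" and c: "\<sigma> * c > 0" and \<sigma>: "\<bar>\<sigma>\<bar> = 1"
  shows "\<exists>r0>0. \<forall>r X Y. 0 < r \<longrightarrow> r < r0 \<longrightarrow> r ^ 2 \<le> X ^ 2 + Y ^ 2 \<longrightarrow> X ^ 2 + Y ^ 2 \<le> 4 * r ^ 2 \<longrightarrow> \<sigma> * hq xs e2 e1 d2 d1 d0 0 X Y > 0"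
proof -
  define M where "M = (\<Sum>m\<leftarrow>rs. \<bar>fst m\<bar>)"
  have M: "M \<ge> 0" unfolding M_def by (induction rs) auto
  define r0 where "r0 = min (1/2) (\<sigma> * c / (2 * (M + 1)))"
  have r0: "r0 > 0" using c M by (auto simp: r0_def)
  have "\<sigma> * hq xs e2 e1 d2 d1 d0 0 X Y > 0" if r: "0 < r" "r < r0" and XY: "r ^ 2 \<le> X ^ 2 + Y ^ 2" "X ^ 2 + Y ^ 2 \<le> 4 * r ^ 2" for r X Y
  proof -
    define t where "t = sqrt (X ^ 2 + Y ^ 2)"
    have t2: "X ^ 2 + Y ^ 2 = t ^ 2" by (simp add: t_def)
    have "0 < X ^ 2 + Y ^ 2" using XY(1) zero_less_power[OF r(1), of 2] by linarith
    then have t0: "t > 0" by (simp add: t_def)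
    have "t ^ 2 \<le> (2 * r) ^ 2" using XY(2) unfolding t2 power_mult_distrib by simp
    then have t: "t \<le> 2 * r" by (rule power2_le_imp_le) (use r in simp)
    have t1: "t \<le> 1" using t r unfolding r0_def by linarith
    have "\<bar>X\<bar> \<le> t" "\<bar>Y\<bar> \<le> t" by (simp_all add: t_def real_le_rsqrt)
    then have "\<bar>mp rs X Y\<bar> \<le> M * t ^ (2 * k + 1)" unfolding M_def using deg by (intro mp_bound t1) auto
    then have "\<bar>\<sigma> * mp rs X Y\<bar> \<le> t ^ (2 * k) * (M * t)" using \<sigma> by (simp add: abs_mult algebra_simps)
    moreover have "M * t < \<sigma> * c"
    proof -
      have "M * t \<le> (M + 1) * (2 * r)" using M t t0 by (intro mult_mono) auto
      also have "\<dots> < (M + 1) * (2 * (\<sigma> * c / (2 * (M + 1))))" using M r by (intro mult_strict_left_mono) (auto simp: r0_def)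
      also have "\<dots> = \<sigma> * c" using M by (simp add: field_simps)
      finally show ?thesis .
    qed
    then have "t ^ (2 * k) * (M * t) < t ^ (2 * k) * (\<sigma> * c)" using t0 by (intro mult_strict_left_mono) auto
    moreover have "\<sigma> * hq xs e2 e1 d2 d1 d0 0 X Y = t ^ (2 * k) * (\<sigma> * c) + \<sigma> * mp rs X Y"
      unfolding hq t2 by (simp add: algebra_simps flip: power_mult)
    ultimately show ?thesis by linarith
  qed
  then show ?thesis using r0 by blast
qed

text \<open>The bounds on \<open>lN\<close> separate the inner curves from each other, the bound by
  the absolute value of \<open>s\<close> separates them from the outer ones.\<close>

definition level_between :: "real \<Rightarrow> real \<Rightarrow> real \<Rightarrow> (real \<Rightarrow> real) \<Rightarrow> bool" where
  "level_between r R s a \<longleftrightarrow> (\<forall>\<theta>. 0 < a \<theta> \<and> a \<theta> < \<bar>s\<bar> \<and> r ^ 2 < lN s \<theta> (a \<theta>) \<and> lN s \<theta> (a \<theta>) < R ^ 2)"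

text \<open>Here \<open>R\<close> is the inner radius of the next larger curve; choosing
  \<open>2 * r \<le> R\<close> keeps the whole ring of the new curve inside it.\<close>

lemma inner_curve_of_leading_term:
  assumes hq: "\<And>X Y. hq xs e2 e1 d2 d1 d0 0 X Y = c * (X ^ 2 + Y ^ 2) ^ k + mp rs X Y"
    and deg: "\<forall>(c, i, j)\<in>set rs. 2 * k + 1 \<le> i + j" and c: "\<sigma> * c > 0" and \<sigma>: "\<bar>\<sigma>\<bar> = 1"
    and e: "\<bar>e2\<bar> \<le> 1/20" "\<bar>e1\<bar> \<le> 1/20" and d: "\<bar>d2\<bar> < 1/20" "\<bar>d1\<bar> < 1/20" "\<bar>d0\<bar> < 1/20"
    and R: "R > 0"
  shows "\<exists>r>0. \<exists>\<nu>>0. \<forall>d2' d1' d0' s. \<bar>d2' - d2\<bar> < \<nu> \<longrightarrow> \<bar>d1' - d1\<bar> < \<nu> \<longrightarrow> \<bar>d0' - d0\<bar> < \<nu> \<longrightarrow> s \<noteq> 0 \<longrightarrow> \<bar>s\<bar> < \<nu> \<longrightarrow>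
     (\<exists>a. barrier \<sigma> (fF e2 e1 d2' d1' d0' s) a \<and> level_between r R s a)"
proof -
  obtain r0 where r0: "r0 > 0" "\<And>r X Y. 0 < r \<Longrightarrow> r < r0 \<Longrightarrow> r ^ 2 \<le> X ^ 2 + Y ^ 2 \<Longrightarrow> X ^ 2 + Y ^ 2 \<le> 4 * r ^ 2
      \<Longrightarrow> \<sigma> * hq xs e2 e1 d2 d1 d0 0 X Y > 0"
    using leading_term_positive[OF hq deg c \<sigma>] by blast
  define r where "r = min (r0 / 2) (min (1/4) (R / 2))"
  have r: "0 < r" "r < r0" "r < 1/2" "2 * r \<le> R" using r0(1) R by (auto simp: r_def min_def)
  have R2: "4 * r ^ 2 \<le> R ^ 2" using power_mono[OF r(4), of 2] r by (simp add: power_mult_distrib)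
  have level: "level_between r R s a"
    if "\<forall>\<theta>. 0 < a \<theta> \<and> a \<theta> < \<bar>s\<bar> \<and> r ^ 2 < lN s \<theta> (a \<theta>) \<and> lN s \<theta> (a \<theta>) < 4 * r ^ 2" for s a
    unfolding level_between_def using that order.strict_trans2[OF _ R2] by blast
  have "\<exists>\<nu>>0. \<forall>d2' d1' d0' s. \<bar>d2' - d2\<bar> < \<nu> \<longrightarrow> \<bar>d1' - d1\<bar> < \<nu> \<longrightarrow> \<bar>d0' - d0\<bar> < \<nu> \<longrightarrow> s \<noteq> 0 \<longrightarrow> \<bar>s\<bar> < \<nu> \<longrightarrow>
     (\<exists>a. barrier \<sigma> (fF e2 e1 d2' d1' d0' s) a \<and> (\<forall>\<theta>. 0 < a \<theta> \<and> a \<theta> < \<bar>s\<bar> \<and> r ^ 2 < lN s \<theta> (a \<theta>) \<and> lN s \<theta> (a \<theta>) < 4 * r ^ 2))"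
    by (rule inner_curve[OF e d r(1,3)]) (rule r0(2)[OF r(1,2)])
  then obtain \<nu> where "\<nu> > 0" and \<nu>: "\<forall>d2' d1' d0' s. \<bar>d2' - d2\<bar> < \<nu> \<longrightarrow> \<bar>d1' - d1\<bar> < \<nu> \<longrightarrow> \<bar>d0' - d0\<bar> < \<nu> \<longrightarrow> s \<noteq> 0 \<longrightarrow> \<bar>s\<bar> < \<nu> \<longrightarrow>
     (\<exists>a. barrier \<sigma> (fF e2 e1 d2' d1' d0' s) a \<and> (\<forall>\<theta>. 0 < a \<theta> \<and> a \<theta> < \<bar>s\<bar> \<and> r ^ 2 < lN s \<theta> (a \<theta>) \<and> lN s \<theta> (a \<theta>) < 4 * r ^ 2))"
    by (elim exE conjE)
  show ?thesis
  proof (rule exI[of _ r], rule conjI[OF r(1)], rule exI[of _ \<nu>], rule conjI[OF \<open>\<nu> > 0\<close>], intro allI impI)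
    fix d2' d1' d0' s
    assume "\<bar>d2' - d2\<bar> < \<nu>" "\<bar>d1' - d1\<bar> < \<nu>" "\<bar>d0' - d0\<bar> < \<nu>" "s \<noteq> 0" "\<bar>s\<bar> < \<nu>"
    then obtain a where "barrier \<sigma> (fF e2 e1 d2' d1' d0' s) a"
      "\<forall>\<theta>. 0 < a \<theta> \<and> a \<theta> < \<bar>s\<bar> \<and> r ^ 2 < lN s \<theta> (a \<theta>) \<and> lN s \<theta> (a \<theta>) < 4 * r ^ 2"
      using \<nu> by blast
    then show "\<exists>a. barrier \<sigma> (fF e2 e1 d2' d1' d0' s) a \<and> level_between r R s a" using level by blast
  qed
qed

text \<open>The first list in each of the following lemmas is the first-order correction of the energy, found degree by degree by
  averaging: it removes all terms of the derivative except the radial leading one.\<close>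

lemma leading_term_first:
  "hq [] e2 e1 d2 d1 d0 0 X Y = - d0 * (X ^ 2 + Y ^ 2) ^ 1 + mp
     [((-2) * d0, 0, 4), (4 * d1, 2, 2), (5/21, 1, 4), (1/7 + 1/5 * e2, 3, 2), (4 * d1 + (-8) * d2 + (-1) * e1, 2, 4), (1, 4, 2), ((-1/5) + (-3) * d0 + 1/5 * e1, 6, 0), (10/21, 1, 6), (2, 4, 4), (6 * d1 + 12 * d2 + 3/2 * e1, 6, 2), (3/7 + 3/5 * e2, 7, 2), ((-3/5) + 3/5 * e1, 10, 0)] X Y"
  by (simp add: hq_def mp_Cons hP_def hQ_def hVx_def hVy_def fA_def fB_def field_simps power_numeral_reduce)

lemma leading_term_second:
  "hq [((-1/2) * d1, 1, 3), (1/2 * d1, 3, 1)] e2 e1 d2 d1 0 0 X Y = d1 / 2 * (X ^ 2 + Y ^ 2) ^ 2 + mp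
     [(5/21, 1, 4), (1/7 + 1/5 * e2, 3, 2), (1 * d1, 0, 6), (1 * d1 + (-8) * d2 + (-1) * e1, 2, 4), (1, 4, 2), ((-1/5) + 1/5 * e1, 6, 0), (10/21, 1, 6), (2, 4, 4), (3/2 * d1 + 12 * d2 + 3/2 * e1, 6, 2), (3/2 * d1, 8, 0), (3/7 + 3/5 * e2, 7, 2), ((-3/5) + 3/5 * e1, 10, 0)] X Y"
  by (simp add: hq_def mp_Cons hP_def hQ_def hVx_def hVy_def fA_def fB_def field_simps power_numeral_reduce)

lemma leading_term_third:
  "hq [((-1/15) + (-2/75) * e2, 0, 5), ((-1/21) + (-1/15) * e2, 2, 3), (1/2 * d2, 1, 5), ((-4/3) * d2 + (-1/3) * e1, 3, 3), (1/5 + (-1/2) * d2 + (-1/5) * e1, 5, 1)] e2 e1 d2 0 0 0 X Y = - (d2 / 2) * (X ^ 2 + Y ^ 2) ^ 3 + mp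
     [(2/3 + 4/15 * e2, 1, 6), ((-1) * d2, 0, 8), (8 * d2 + 2 * e1, 2, 6), (5 * d2 + 2 * e1, 4, 4), (12 * d2 + 3/2 * e1, 6, 2), ((-1) + (-2/5) * e2, 5, 4), (15/2 * d2, 6, 4), ((-12) * d2 + (-3) * e1, 8, 2), ((-3/2) * d2, 10, 0)] X Y"
  by (simp add: hq_def mp_Cons hP_def hQ_def hVx_def hVy_def fA_def fB_def field_simps power_numeral_reduce)

lemma leading_term_fourth:
  "hq [((-1/15) + (-2/75) * e2, 0, 5), ((-1/21) + (-1/15) * e2, 2, 3), ((-1/3) * e1, 3, 3), (1/5 + (-1/5) * e1, 5, 1), ((-2/21) + (-4/105) * e2, 0, 7), ((-47/256) * e1, 1, 7), ((-5/768) * e1, 3, 5), (133/768 * e1, 5, 3), (47/256 * e1, 7, 1)] e2 e1 0 0 0 0 X Y = 47/256 * e1 * (X ^ 2 + Y ^ 2) ^ 4 + mp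
     [((-1) + (-2/5) * e2, 5, 4), (47/128 * e1, 0, 10), (5/128 * e1, 2, 8), ((-665/384) * e1, 4, 6), ((-329/128) * e1, 6, 4), ((-3) * e1, 8, 2), ((-2) + (-4/5) * e2, 5, 6), ((-987/256) * e1, 6, 6), ((-25/256) * e1, 8, 4), (399/256 * e1, 10, 2), (141/256 * e1, 12, 0)] X Y"
  by (simp add: hq_def mp_Cons hP_def hQ_def hVx_def hVy_def fA_def fB_def field_simps power_numeral_reduce)

section \<open>Nested annuli\<close>


lemma pt_representation_unique:
  assumes "pt \<theta> \<rho> = pt \<phi> \<rho>'" "\<rho> > 0" "\<rho>' > 0" and per: "\<And>\<theta>. a (\<theta> + 2 * pi) = a \<theta>"
  shows "\<rho> = \<rho>'" "a \<theta> = a \<phi>"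
proof -
  show "\<rho> = \<rho>'" using pt_eq(1)[OF assms(1-3)] .
  obtain n :: int where "\<theta> = \<phi> + 2 * pi * n" using pt_eq(2)[OF assms(1-3)] by blast
  then show "a \<theta> = a \<phi>" using periodic_shift_int[where \<phi> = a and T = "2 * pi" and t = \<phi> and n = n, OF per] by (simp add: mult.commute)
qed

lemma disjoint_annuli:
  assumes "\<And>\<theta>. 0 < a \<theta>" "\<And>\<theta>. 0 < c \<theta>" "\<And>\<theta>. b \<theta> \<le> c \<theta>" and per: "\<And>\<theta>. c (\<theta> + 2 * pi) = c \<theta>"
  shows "annulus a b \<inter> annulus c d = {}"
proof -
  have False if pa: "p \<in> annulus a b" and pc: "p \<in> annulus c d" for p
  proof -
    obtain \<theta> \<rho> where p: "p = pt \<theta> \<rho>" "a \<theta> < \<rho>" "\<rho> < b \<theta>"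
      using pa unfolding annulus_def by blast
    obtain \<phi> \<rho>' where q: "p = pt \<phi> \<rho>'" "c \<phi> < \<rho>'"
      using pc unfolding annulus_def by blast
    have pos: "\<rho> > 0" "\<rho>' > 0" using assms(1)[of \<theta>] assms(2)[of \<phi>] p q by linarith+
    have "\<rho> = \<rho>'" "c \<theta> = c \<phi>" using pt_representation_unique[OF trans[OF p(1)[symmetric] q(1)] pos, of c] per by blast+
    then show False using p q assms(3)[of \<theta>] by linarith
  qed
  then show ?thesis by blast
qed

lemma barrier_lower_upper: "barrier 1 F a = lower_barrier F a" "barrier (- 1) F a = upper_barrier F a"
  unfolding barrier_def lower_barrier_def upper_barrier_def by simp_all

text \<open>The alternating signs make every gap between neighbouring curves attracting or repelling
  according to the parity of \<open>i\<close>. The annuli are disjoint, so the cycles found in them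
  are distinct.\<close>

lemma nested_limit_cycles:
  fixes a :: "nat \<Rightarrow> real \<Rightarrow> real"
  assumes sp: "small_parameters e2 e1 d2 d1 d0 s"
    and pos: "\<And>\<theta>. 0 < a 0 \<theta>" and less: "\<And>i \<theta>. i < n \<Longrightarrow> a i \<theta> < a (Suc i) \<theta>" and small: "\<And>\<theta>. a n \<theta> < 1/10"
    and barriers: "\<And>i. i \<le> n \<Longrightarrow> barrier ((- 1) ^ Suc i) (fF e2 e1 d2 d1 d0 s) (a i)"
  shows "\<exists>C. card C = n \<and> (\<forall>\<Gamma>\<in>C. limit_cycle (pfield e2 e1 d2 d1 d0 s) \<Gamma> \<and> (\<forall>p\<in>\<Gamma>. \<exists>\<theta> \<rho>. p = pt \<theta> \<rho> \<and> 0 < \<rho> \<and> \<rho> < a n \<theta>))"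
proof -
  have le: "a i \<theta> \<le> a j \<theta>" if "i \<le> j" "j \<le> n" for i j \<theta>
    using that
  proof (induction j)
    case (Suc j)
    then show ?case using less[of j \<theta>] by (cases "i = Suc j") auto
  qed simp
  have apos: "0 < a i \<theta>" if "i \<le> n" for i \<theta> using pos[of \<theta>] le[of 0 i \<theta>] that by simp
  have per: "a i (\<theta> + 2 * pi) = a i \<theta>" if "i \<le> n" for i \<theta> using barriers[OF that] by (simp add: barrier_def)
  have "\<exists>\<Gamma>. limit_cycle (pfield e2 e1 d2 d1 d0 s) \<Gamma> \<and> \<Gamma> \<subseteq> annulus (a i) (a (Suc i))" if i: "i < n" for i
  proof (rule limit_cycle_between[OF sp])
    show "0 < a i \<theta> \<and> a i \<theta> < a (Suc i) \<theta> \<and> a (Suc i) \<theta> < 1/10" for \<theta>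
      using i apos[of i \<theta>] less[of i \<theta>] le[of "Suc i" n \<theta>] small[of \<theta>] by auto
    show "lower_barrier (fF e2 e1 d2 d1 d0 s) (a i) \<and> upper_barrier (fF e2 e1 d2 d1 d0 s) (a (Suc i)) \<or>
       upper_barrier (fF e2 e1 d2 d1 d0 s) (a i) \<and> lower_barrier (fF e2 e1 d2 d1 d0 s) (a (Suc i))"
      using barriers[of i] barriers[of "Suc i"] i
      by (cases "even i") (simp_all add: barrier_lower_upper)
  qed
  then obtain \<Gamma> where \<Gamma>: "\<And>i. i < n \<Longrightarrow> limit_cycle (pfield e2 e1 d2 d1 d0 s) (\<Gamma> i)"
    "\<And>i. i < n \<Longrightarrow> \<Gamma> i \<subseteq> annulus (a i) (a (Suc i))" by metis
  have ne: "\<Gamma> i \<noteq> {}" if "i < n" for i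
    using \<Gamma>(1)[OF that] by (auto simp: limit_cycle_def periodic_orbit_def)
  have disj: "\<Gamma> i \<inter> \<Gamma> j = {}" if "i < j" "j < n" for i j
  proof -
    have "annulus (a i) (a (Suc i)) \<inter> annulus (a j) (a (Suc j)) = {}"
      by (rule disjoint_annuli) (use that apos per le in auto)
    then show ?thesis using \<Gamma>(2)[of i] \<Gamma>(2)[of j] that by auto
  qed
  have "inj_on \<Gamma> {..<n}"
  proof (rule linorder_inj_onI')
    fix i j assume "i \<in> {..<n}" "j \<in> {..<n}" "i < j"
    then show "\<Gamma> i \<noteq> \<Gamma> j" using disj[of i j] ne[of j] by auto
  qed
  then have "card (\<Gamma> ` {..<n}) = n" by (simp add: card_image)
  moreover have "\<exists>\<theta> \<rho>. p = pt \<theta> \<rho> \<and> 0 < \<rho> \<and> \<rho> < a n \<theta>" if i: "i < n" and p: "p \<in> \<Gamma> i" for i p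
  proof -
    obtain \<theta> \<rho> where "p = pt \<theta> \<rho>" "a i \<theta> < \<rho>" "\<rho> < a (Suc i) \<theta>"
      using \<Gamma>(2)[OF i] p unfolding annulus_def by blast
    then show ?thesis using apos[of i \<theta>] le[of "Suc i" n \<theta>] i by (intro exI[of _ \<theta>] exI[of _ \<rho>]) auto
  qed
  ultimately show ?thesis using \<Gamma>(1) by (intro exI[of _ "\<Gamma> ` {..<n}"]) blast
qed

section \<open>Choosing the curves and the parameters in turn\<close>

lemma barrier_data_lower_bound:
  assumes "barrier_data \<sigma> F a" "\<And>\<theta>. a \<theta> > 0"
  obtains m where "m > 0" "\<And>\<theta>. m \<le> a \<theta>"
proof -
  have da: "\<And>\<theta>. \<exists>a'. (a has_real_derivative a') (at \<theta>)" and per: "\<And>\<theta>. a (\<theta> + 2 * pi) = a \<theta>"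
    using assms(1) unfolding barrier_data_def by blast+
  have "continuous_on {0..2 * pi} a" using da by (meson DERIV_continuous continuous_at_imp_continuous_on)
  from continuous_attains_inf[OF compact_Icc _ this]
  obtain x where x: "\<forall>\<theta>\<in>{0..2 * pi}. a x \<le> a \<theta>" by fastforce
  have "a x \<le> a \<theta>" for \<theta>
  proof -
    obtain n :: int where n: "0 \<le> \<theta> + of_int n * (2 * pi)" "\<theta> + of_int n * (2 * pi) < 0 + 2 * pi"
      by (rule periodic_representative[of "2 * pi" 0 \<theta>]) simp
    have "a (\<theta> + of_int n * (2 * pi)) = a \<theta>" by (rule periodic_shift_int[of a "2 * pi", OF per])
    then show ?thesis using bspec[OF x, of "\<theta> + of_int n * (2 * pi)"] n by simp
  qed
  then show ?thesis using that assms(2) by blast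
qed

lemma barrier_data_barrier: "barrier_data \<sigma> F a \<Longrightarrow> barrier \<sigma> F a"
  unfolding barrier_data_def barrier_def by blast

lemma level_between_less:
  assumes a: "level_between r R s a" and b: "level_between r' R' s b" and "R \<le> r'" "0 < R" "s \<noteq> 0"
  shows "a \<theta> < b \<theta>"
proof (rule ccontr)
  assume "\<not> a \<theta> < b \<theta>"
  then have "lN s \<theta> (b \<theta>) \<le> lN s \<theta> (a \<theta>)"
    using lN_mono[OF assms(5), of "b \<theta>" "a \<theta>" \<theta>] b unfolding level_between_def
    by (metis less_eq_real_def not_less_iff_gr_or_eq)
  moreover have "lN s \<theta> (a \<theta>) < R ^ 2" "r' ^ 2 < lN s \<theta> (b \<theta>)" using a b unfolding level_between_def by blast+
  moreover have "R ^ 2 \<le> r' ^ 2" using assms(3,4) by (intro power_mono) auto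
  ultimately show False by linarith
qed

lemma eventually_at_right_0: "(\<nu>::real) > 0 \<Longrightarrow> (\<And>x. 0 < x \<Longrightarrow> x < \<nu> \<Longrightarrow> P x) \<Longrightarrow> eventually P (at_right 0)"
  by (auto simp: eventually_at_right_field)

lemma eventually_at_0: "(\<nu>::real) > 0 \<Longrightarrow> (\<And>x. x \<noteq> 0 \<Longrightarrow> \<bar>x\<bar> < \<nu> \<Longrightarrow> P x) \<Longrightarrow> eventually P (at 0)"
  by (auto simp: eventually_at dist_real_def)

text \<open>In this lemma and the next three the expansion is taken with all parameters below the
  decisive one equal to zero. They are readmitted, up to the size \<nu>, through the persistence of
  the curve.\<close>

lemma first_curve:
  assumes "\<bar>e2\<bar> \<le> 1/20" "\<bar>e1\<bar> \<le> 1/20" "\<bar>d2\<bar> < 1/20" "\<bar>d1\<bar> < 1/20" "0 < d0" "d0 < 1/20" "R > 0"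
  shows "\<exists>r>0. \<exists>\<nu>>0. \<forall>s. s \<noteq> 0 \<longrightarrow> \<bar>s\<bar> < \<nu> \<longrightarrow> (\<exists>a. barrier (- 1) (fF e2 e1 d2 d1 d0 s) a \<and> level_between r R s a)"
proof -
  have "\<exists>r>0. \<exists>\<nu>>0. \<forall>d2' d1' d0' s. \<bar>d2' - d2\<bar> < \<nu> \<longrightarrow> \<bar>d1' - d1\<bar> < \<nu> \<longrightarrow> \<bar>d0' - d0\<bar> < \<nu> \<longrightarrow> s \<noteq> 0 \<longrightarrow> \<bar>s\<bar> < \<nu> \<longrightarrow>
     (\<exists>a. barrier (- 1) (fF e2 e1 d2' d1' d0' s) a \<and> level_between r R s a)"
    by (rule inner_curve_of_leading_term[OF leading_term_first]) (use assms in auto)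
  then show ?thesis by (metis abs_zero diff_self)
qed

lemma second_curve:
  assumes "\<bar>e2\<bar> \<le> 1/20" "\<bar>e1\<bar> \<le> 1/20" "\<bar>d2\<bar> < 1/20" "0 < d1" "d1 < 1/20" "R > 0"
  shows "\<exists>r>0. \<exists>\<nu>>0. \<forall>d0 s. \<bar>d0\<bar> < \<nu> \<longrightarrow> s \<noteq> 0 \<longrightarrow> \<bar>s\<bar> < \<nu> \<longrightarrow> (\<exists>a. barrier 1 (fF e2 e1 d2 d1 d0 s) a \<and> level_between r R s a)"
proof -
  have "\<exists>r>0. \<exists>\<nu>>0. \<forall>d2' d1' d0' s. \<bar>d2' - d2\<bar> < \<nu> \<longrightarrow> \<bar>d1' - d1\<bar> < \<nu> \<longrightarrow> \<bar>d0' - 0\<bar> < \<nu> \<longrightarrow> s \<noteq> 0 \<longrightarrow> \<bar>s\<bar> < \<nu> \<longrightarrow>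
     (\<exists>a. barrier 1 (fF e2 e1 d2' d1' d0' s) a \<and> level_between r R s a)"
    by (rule inner_curve_of_leading_term[OF leading_term_second]) (use assms in auto)
  then show ?thesis by (metis abs_zero diff_self diff_zero)
qed

lemma third_curve:
  assumes "\<bar>e2\<bar> \<le> 1/20" "\<bar>e1\<bar> \<le> 1/20" "0 < d2" "d2 < 1/20" "R > 0"
  shows "\<exists>r>0. \<exists>\<nu>>0. \<forall>d1 d0 s. \<bar>d1\<bar> < \<nu> \<longrightarrow> \<bar>d0\<bar> < \<nu> \<longrightarrow> s \<noteq> 0 \<longrightarrow> \<bar>s\<bar> < \<nu> \<longrightarrow>
     (\<exists>a. barrier (- 1) (fF e2 e1 d2 d1 d0 s) a \<and> level_between r R s a)"
proof -
  have "\<exists>r>0. \<exists>\<nu>>0. \<forall>d2' d1' d0' s. \<bar>d2' - d2\<bar> < \<nu> \<longrightarrow> \<bar>d1' - 0\<bar> < \<nu> \<longrightarrow> \<bar>d0' - 0\<bar> < \<nu> \<longrightarrow> s \<noteq> 0 \<longrightarrow> \<bar>s\<bar> < \<nu> \<longrightarrow>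
     (\<exists>a. barrier (- 1) (fF e2 e1 d2' d1' d0' s) a \<and> level_between r R s a)"
    by (rule inner_curve_of_leading_term[OF leading_term_third]) (use assms in auto)
  then show ?thesis by (metis abs_zero diff_self diff_zero)
qed

lemma fourth_curve:
  assumes "\<bar>e2\<bar> \<le> 1/20" "0 < e1" "e1 \<le> 1/20" "R > 0"
  shows "\<exists>r>0. \<exists>\<nu>>0. \<forall>d2 d1 d0 s. \<bar>d2\<bar> < \<nu> \<longrightarrow> \<bar>d1\<bar> < \<nu> \<longrightarrow> \<bar>d0\<bar> < \<nu> \<longrightarrow> s \<noteq> 0 \<longrightarrow> \<bar>s\<bar> < \<nu> \<longrightarrow>
     (\<exists>a. barrier 1 (fF e2 e1 d2 d1 d0 s) a \<and> level_between r R s a)"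
proof -
  have "\<exists>r>0. \<exists>\<nu>>0. \<forall>d2' d1' d0' s. \<bar>d2' - 0\<bar> < \<nu> \<longrightarrow> \<bar>d1' - 0\<bar> < \<nu> \<longrightarrow> \<bar>d0' - 0\<bar> < \<nu> \<longrightarrow> s \<noteq> 0 \<longrightarrow> \<bar>s\<bar> < \<nu> \<longrightarrow>
     (\<exists>a. barrier 1 (fF e2 e1 d2' d1' d0' s) a \<and> level_between r R s a)"
    by (rule inner_curve_of_leading_term[OF leading_term_fourth]) (use assms in auto)
  then show ?thesis by simp
qed

text \<open>Three kinds of comparison order the six curves: \<open>lN\<close> for the first four,
  the absolute value of \<open>s\<close> between the fourth and the fifth, and a direct inequality
  for the last two.\<close>

lemma five_cycles:
  assumes sp: "small_parameters e2 e1 d2 d1 d0 s"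
    and 1: "barrier (- 1) (fF e2 e1 d2 d1 d0 s) a1" "level_between r1 r2 s a1"
    and 2: "barrier 1 (fF e2 e1 d2 d1 d0 s) a2" "level_between r2 r3 s a2"
    and 3: "barrier (- 1) (fF e2 e1 d2 d1 d0 s) a3" "level_between r3 r4 s a3"
    and 4: "barrier 1 (fF e2 e1 d2 d1 d0 s) a4" "level_between r4 r5 s a4"
    and 5: "barrier (- 1) (fF e2 e1 d2 d1 d0 s) a5" "\<And>\<theta>. \<bar>s\<bar> \<le> a5 \<theta>" "\<And>\<theta>. a5 \<theta> < a6 \<theta>"
    and 6: "barrier 1 (fF e2 e1 d2 d1 d0 s) a6" "\<And>\<theta>. a6 \<theta> < \<eta>" "\<eta> \<le> 1/10"
    and r: "0 < r2" "0 < r3" "0 < r4" "s \<noteq> 0" and U: "\<And>\<theta> \<rho>. 0 < \<rho> \<Longrightarrow> \<rho> < \<eta> \<Longrightarrow> pt \<theta> \<rho> \<in> U"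
  shows "\<exists>C. card C = 5 \<and> (\<forall>\<Gamma>\<in>C. \<Gamma> \<subseteq> U \<and> limit_cycle (pfield e2 e1 d2 d1 d0 s) \<Gamma>)"
proof -
  let ?a = "\<lambda>i. [a1, a2, a3, a4, a5, a6] ! i"
  have i5: "i = 0 \<or> i = 1 \<or> i = 2 \<or> i = 3 \<or> i = 4" if "i < 5" for i :: nat
    using that by linarith
  have "\<exists>C. card C = 5 \<and> (\<forall>\<Gamma>\<in>C. limit_cycle (pfield e2 e1 d2 d1 d0 s) \<Gamma> \<and> (\<forall>p\<in>\<Gamma>. \<exists>\<theta> \<rho>. p = pt \<theta> \<rho> \<and> 0 < \<rho> \<and> \<rho> < ?a 5 \<theta>))"
  proof (rule nested_limit_cycles[OF sp])
    show "0 < ?a 0 \<theta>" for \<theta> using 1(2) by (simp add: level_between_def)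
    show "?a i \<theta> < ?a (Suc i) \<theta>" if "i < 5" for i \<theta>
    proof -
      have "a1 \<theta> < a2 \<theta>" "a2 \<theta> < a3 \<theta>" "a3 \<theta> < a4 \<theta>"
        by (rule level_between_less[OF 1(2) 2(2)] level_between_less[OF 2(2) 3(2)] level_between_less[OF 3(2) 4(2)];
            use r in simp)+
      moreover have "a4 \<theta> < \<bar>s\<bar>" using 4(2) by (simp add: level_between_def)
      ultimately show ?thesis using 5(2,3)[of \<theta>] i5[OF that] by (elim disjE) simp_all
    qed
    show "?a 5 \<theta> < 1/10" for \<theta> using 6(2)[of \<theta>] 6(3) by simp
    show "barrier ((- 1) ^ Suc i) (fF e2 e1 d2 d1 d0 s) (?a i)" if "i \<le> 5" for i
    proof (cases "i = 5")
      case False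
      then have "i < 5" using that by simp
      from i5[OF this] 1(1) 2(1) 3(1) 4(1) 5(1) show ?thesis by (elim disjE) simp_all
    qed (use 6(1) in simp)
  qed
  then obtain C where C: "card C = 5" "\<And>\<Gamma>. \<Gamma> \<in> C \<Longrightarrow> limit_cycle (pfield e2 e1 d2 d1 d0 s) \<Gamma>"
    "\<And>\<Gamma> p. \<Gamma> \<in> C \<Longrightarrow> p \<in> \<Gamma> \<Longrightarrow> \<exists>\<theta> \<rho>. p = pt \<theta> \<rho> \<and> 0 < \<rho> \<and> \<rho> < ?a 5 \<theta>" by blast
  have "\<Gamma> \<subseteq> U" if G: "\<Gamma> \<in> C" for \<Gamma>
  proof
    fix p assume "p \<in> \<Gamma>"
    from C(3)[OF G this] obtain \<theta> \<rho> where "p = pt \<theta> \<rho>" "0 < \<rho>" "\<rho> < a6 \<theta>" by auto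
    then show "p \<in> U" using U[of \<rho> \<theta>] 6(2)[of \<theta>] by simp
  qed
  then show ?thesis using C(1,2) by blast
qed

theorem theorem4p5:
  fixes U :: "(real \<times> real) set"
  assumes "open U" and "(0, 0) \<in> U"
  shows "\<forall>\<^sub>F \<epsilon>2 in at_right (0::real). \<forall>\<^sub>F \<epsilon>1 in at_right (0::real).
         \<forall>\<^sub>F \<delta>2 in at_right (0::real). \<forall>\<^sub>F \<delta>1 in at_right (0::real).
         \<forall>\<^sub>F \<delta>0 in at_right (0::real). \<forall>\<^sub>F \<sigma> in at (0::real).
           (\<exists>C. card C = 5 \<and>
              (\<forall>\<Gamma>\<in>C. \<Gamma> \<subseteq> U \<and>
                 limit_cycle
                   (planar_field (- (1/5) * (1 - \<epsilon>1)) (1/35 * (5 + 7 * \<epsilon>2)) 1 (5/21)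
                      \<delta>0 \<delta>1 \<delta>2 \<sigma>) \<Gamma>))"
proof -
  obtain e where e: "e > 0" "ball (0, 0) e \<subseteq> U" using assms by (meson openE)
  \<comment> \<open>A point of radius \<rho> below 1 has norm at most \<open>2 * \<rho>\<close>, so
    radii below \<open>e / 2\<close> stay inside the ball contained in \<open>U\<close>.\<close>
  define \<eta> where "\<eta> = min (1/10) (e / 2)"
  have \<eta>: "\<eta> > 0" "\<eta> \<le> 1/10" "\<eta> \<le> e / 2" using e(1) by (auto simp: \<eta>_def)
  have U: "pt \<theta> \<rho> \<in> U" if "0 < \<rho>" "\<rho> < \<eta>" for \<theta> \<rho>
  proof -
    have "\<rho> ^ 2 * \<bar>gC \<theta>\<bar> \<le> \<rho> * 1" "\<rho> ^ 3 * \<bar>gS \<theta>\<bar> \<le> \<rho> * 1"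
      using that \<eta> power_decreasing[of 1 2 \<rho>] power_decreasing[of 1 3 \<rho>] gC_le gS_le by (intro mult_mono; simp)+
    then have "norm (\<rho> ^ 2 * gC \<theta>) + norm (\<rho> ^ 3 * gS \<theta>) \<le> 2 * \<rho>" using that by (simp add: abs_mult)
    then have "norm (pt \<theta> \<rho>) \<le> 2 * \<rho>" unfolding pt_def by (rule order_trans[OF norm_Pair_le])
    then have "pt \<theta> \<rho> \<in> ball 0 e" using that \<eta> by simp
    then show ?thesis using e(2) by (auto simp: zero_prod_def)
  qed
  \<comment> \<open>The outermost curve depends on \<open>U\<close> alone and is fixed before any
    parameter.\<close>
  obtain a6 where a6: "barrier_data 1 (fF 0 0 0 0 0 0) a6" "\<And>\<theta>. 0 < a6 \<theta> \<and> a6 \<theta> < \<eta>"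
    using outermost_curve[OF \<eta>(1)] by blast
  obtain m6 where m6: "m6 > 0" "\<And>\<theta>. m6 \<le> a6 \<theta>" using barrier_data_lower_bound[OF a6(1)] a6(2) by blast
  have "0 < a6 \<theta> \<and> a6 \<theta> < 1/10" for \<theta> using a6(2)[of \<theta>] \<eta>(2) by simp
  from barrier_persistence[OF a6(1) this] obtain \<nu>6 where \<nu>6: "\<nu>6 > 0"
    "\<And>e2 e1 d2 d1 d0 s. \<bar>e2\<bar> < \<nu>6 \<Longrightarrow> \<bar>e1\<bar> < \<nu>6 \<Longrightarrow> \<bar>d2\<bar> < \<nu>6 \<Longrightarrow> \<bar>d1\<bar> < \<nu>6 \<Longrightarrow> \<bar>d0\<bar> < \<nu>6 \<Longrightarrow> \<bar>s\<bar> < \<nu>6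
       \<Longrightarrow> barrier_data 1 (fF e2 e1 d2 d1 d0 s) a6" by auto
  show ?thesis
  proof (rule eventually_at_right_0[of "min \<nu>6 (1/20)"])
    fix e2 :: real assume e2: "0 < e2" "e2 < min \<nu>6 (1/20)"
    have e2le: "\<bar>e2\<bar> \<le> 1/20" "e2 \<le> 1/20" "\<bar>e2\<bar> < 1/20" using e2 by auto
    \<comment> \<open>It is placed below the minimum of \<open>a6\<close>, which makes the two outer
      curves disjoint.\<close>
    obtain a5 where a5: "barrier_data (- 1) (fF e2 0 0 0 0 0) a5" "\<And>\<theta>. 0 < a5 \<theta> \<and> a5 \<theta> < m6"
      using inner_outer_curve[OF e2(1) e2le(2) m6(1)] by blast
    obtain m5 where m5: "m5 > 0" "\<And>\<theta>. m5 \<le> a5 \<theta>" using barrier_data_lower_bound[OF a5(1)] a5(2) by blast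
    have a56: "a5 \<theta> < a6 \<theta>" for \<theta> using a5(2)[of \<theta>] m6(2)[of \<theta>] by simp
    have "0 < a5 \<theta> \<and> a5 \<theta> < 1/10" for \<theta> using a5(2)[of \<theta>] a56[of \<theta>] a6(2)[of \<theta>] \<eta>(2) by simp
    from barrier_persistence[OF a5(1) this e2le(3)] obtain \<nu>5 where \<nu>5: "\<nu>5 > 0"
      "\<And>e1 d2 d1 d0 s. \<bar>e1\<bar> < \<nu>5 \<Longrightarrow> \<bar>d2\<bar> < \<nu>5 \<Longrightarrow> \<bar>d1\<bar> < \<nu>5 \<Longrightarrow> \<bar>d0\<bar> < \<nu>5 \<Longrightarrow> \<bar>s\<bar> < \<nu>5
         \<Longrightarrow> barrier_data (- 1) (fF e2 e1 d2 d1 d0 s) a5" by (metis abs_zero diff_self)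
    \<comment> \<open>The entries \<nu>5 and \<nu>6 keep the two outer curves crossed in the right
      direction, and \<open>m5\<close> keeps \<open>s\<close> so small that the inner curves stay
      below \<open>a5\<close>.\<close>
    define \<mu> where "\<mu> = min (min \<nu>5 \<nu>6) (min m5 (1/20))"
    have \<mu>: "\<mu> > 0" "\<mu> \<le> \<nu>5" "\<mu> \<le> \<nu>6" "\<mu> \<le> m5" "\<mu> \<le> 1/20" using \<nu>5 \<nu>6 m5 by (auto simp: \<mu>_def)
    show "\<forall>\<^sub>F \<epsilon>1 in at_right 0. \<forall>\<^sub>F \<delta>2 in at_right 0. \<forall>\<^sub>F \<delta>1 in at_right 0. \<forall>\<^sub>F \<delta>0 in at_right 0. \<forall>\<^sub>F \<sigma> in at 0.
      \<exists>C. card C = 5 \<and> (\<forall>\<Gamma>\<in>C. \<Gamma> \<subseteq> U \<and> limit_cycle (pfield e2 \<epsilon>1 \<delta>2 \<delta>1 \<delta>0 \<sigma>) \<Gamma>)"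
    proof (rule eventually_at_right_0[OF \<mu>(1)])
      fix e1 assume e1: "0 < e1" "e1 < \<mu>"
      have e1le: "\<bar>e1\<bar> \<le> 1/20" "e1 \<le> 1/20" using e1 \<mu> by auto
      \<comment> \<open>The inner curves are chosen from the outside inwards, starting with the
        scaled unit disc; each radius found bounds the next curve.\<close>
      obtain r4 \<nu>4 where r4: "r4 > 0" and \<nu>4: "\<nu>4 > 0" and a4: "\<And>d2 d1 d0 s. \<bar>d2\<bar> < \<nu>4 \<Longrightarrow> \<bar>d1\<bar> < \<nu>4 \<Longrightarrow> \<bar>d0\<bar> < \<nu>4 \<Longrightarrow>
          s \<noteq> 0 \<Longrightarrow> \<bar>s\<bar> < \<nu>4 \<Longrightarrow> \<exists>a. barrier 1 (fF e2 e1 d2 d1 d0 s) a \<and> level_between r4 1 s a"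
        using fourth_curve[OF e2le(1) e1(1) e1le(2), of 1] by auto
      show "\<forall>\<^sub>F \<delta>2 in at_right 0. \<forall>\<^sub>F \<delta>1 in at_right 0. \<forall>\<^sub>F \<delta>0 in at_right 0. \<forall>\<^sub>F \<sigma> in at 0.
        \<exists>C. card C = 5 \<and> (\<forall>\<Gamma>\<in>C. \<Gamma> \<subseteq> U \<and> limit_cycle (pfield e2 e1 \<delta>2 \<delta>1 \<delta>0 \<sigma>) \<Gamma>)"
      proof (rule eventually_at_right_0[of "min \<mu> \<nu>4"])
        fix d2 assume d2: "0 < d2" "d2 < min \<mu> \<nu>4"
        have d2le: "d2 < 1/20" "\<bar>d2\<bar> < 1/20" using d2 \<mu> by auto
        obtain r3 \<nu>3 where r3: "r3 > 0" and \<nu>3: "\<nu>3 > 0" and a3: "\<And>d1 d0 s. \<bar>d1\<bar> < \<nu>3 \<Longrightarrow> \<bar>d0\<bar> < \<nu>3 \<Longrightarrow>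
            s \<noteq> 0 \<Longrightarrow> \<bar>s\<bar> < \<nu>3 \<Longrightarrow> \<exists>a. barrier (- 1) (fF e2 e1 d2 d1 d0 s) a \<and> level_between r3 r4 s a"
          using third_curve[OF e2le(1) e1le(1) d2(1) d2le(1) r4] by auto
        show "\<forall>\<^sub>F \<delta>1 in at_right 0. \<forall>\<^sub>F \<delta>0 in at_right 0. \<forall>\<^sub>F \<sigma> in at 0.
          \<exists>C. card C = 5 \<and> (\<forall>\<Gamma>\<in>C. \<Gamma> \<subseteq> U \<and> limit_cycle (pfield e2 e1 d2 \<delta>1 \<delta>0 \<sigma>) \<Gamma>)"
        proof (rule eventually_at_right_0[of "min (min \<mu> \<nu>4) \<nu>3"])
          fix d1 assume d1: "0 < d1" "d1 < min (min \<mu> \<nu>4) \<nu>3"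
          have d1le: "d1 < 1/20" "\<bar>d1\<bar> < 1/20" using d1 \<mu> by auto
          obtain r2 \<nu>2 where r2: "r2 > 0" and \<nu>2: "\<nu>2 > 0" and a2: "\<And>d0 s. \<bar>d0\<bar> < \<nu>2 \<Longrightarrow>
              s \<noteq> 0 \<Longrightarrow> \<bar>s\<bar> < \<nu>2 \<Longrightarrow> \<exists>a. barrier 1 (fF e2 e1 d2 d1 d0 s) a \<and> level_between r2 r3 s a"
            using second_curve[OF e2le(1) e1le(1) d2le(2) d1(1) d1le(1) r3] by auto
          show "\<forall>\<^sub>F \<delta>0 in at_right 0. \<forall>\<^sub>F \<sigma> in at 0.
            \<exists>C. card C = 5 \<and> (\<forall>\<Gamma>\<in>C. \<Gamma> \<subseteq> U \<and> limit_cycle (pfield e2 e1 d2 d1 \<delta>0 \<sigma>) \<Gamma>)"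
          proof (rule eventually_at_right_0[of "min (min \<mu> \<nu>4) (min \<nu>3 \<nu>2)"])
            fix d0 assume d0: "0 < d0" "d0 < min (min \<mu> \<nu>4) (min \<nu>3 \<nu>2)"
            have d0le: "d0 < 1/20" using d0 \<mu> by auto
            obtain r1 \<nu>1 where \<nu>1: "\<nu>1 > 0" and a1: "\<And>s. s \<noteq> 0 \<Longrightarrow> \<bar>s\<bar> < \<nu>1 \<Longrightarrow>
                \<exists>a. barrier (- 1) (fF e2 e1 d2 d1 d0 s) a \<and> level_between r1 r2 s a"
              using first_curve[OF e2le(1) e1le(1) d2le(2) d1le(2) d0(1) d0le r2] by auto
            show "\<forall>\<^sub>F \<sigma> in at 0. \<exists>C. card C = 5 \<and> (\<forall>\<Gamma>\<in>C. \<Gamma> \<subseteq> U \<and> limit_cycle (pfield e2 e1 d2 d1 d0 \<sigma>) \<Gamma>)"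
            proof (rule eventually_at_0[of "min (min \<mu> \<nu>4) (min \<nu>3 (min \<nu>2 \<nu>1))"])
              fix s :: real assume s: "s \<noteq> 0" "\<bar>s\<bar> < min (min \<mu> \<nu>4) (min \<nu>3 (min \<nu>2 \<nu>1))"
              have sb: "\<bar>s\<bar> < \<mu>" "\<bar>s\<bar> < \<nu>1" "\<bar>s\<bar> < \<nu>2" "\<bar>s\<bar> < \<nu>3" "\<bar>s\<bar> < \<nu>4" using s by simp_all
              have d0b: "\<bar>d0\<bar> < \<mu>" "\<bar>d0\<bar> < \<nu>2" "\<bar>d0\<bar> < \<nu>3" "\<bar>d0\<bar> < \<nu>4" using d0 by simp_all
              have d1b: "\<bar>d1\<bar> < \<mu>" "\<bar>d1\<bar> < \<nu>3" "\<bar>d1\<bar> < \<nu>4" using d1 by simp_all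
              have d2b: "\<bar>d2\<bar> < \<mu>" "\<bar>d2\<bar> < \<nu>4" using d2 by simp_all
              have eb: "\<bar>e1\<bar> < \<mu>" "\<bar>e2\<bar> < \<nu>6" using e1 e2 by simp_all
              obtain b1 where b1: "barrier (- 1) (fF e2 e1 d2 d1 d0 s) b1" "level_between r1 r2 s b1"
                using a1[OF s(1) sb(2)] by blast
              obtain b2 where b2: "barrier 1 (fF e2 e1 d2 d1 d0 s) b2" "level_between r2 r3 s b2"
                using a2[OF d0b(2) s(1) sb(3)] by blast
              obtain b3 where b3: "barrier (- 1) (fF e2 e1 d2 d1 d0 s) b3" "level_between r3 r4 s b3"
                using a3[OF d1b(2) d0b(3) s(1) sb(4)] by blast
              obtain b4 where b4: "barrier 1 (fF e2 e1 d2 d1 d0 s) b4" "level_between r4 1 s b4"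
                using a4[OF d2b(2) d1b(3) d0b(4) s(1) sb(5)] by blast
              note \<mu>5 = order.strict_trans2[OF _ \<mu>(2)] and \<mu>6 = order.strict_trans2[OF _ \<mu>(3)]
              have b5: "barrier (- 1) (fF e2 e1 d2 d1 d0 s) a5"
                by (intro barrier_data_barrier \<nu>5(2) \<mu>5 eb d2b d1b d0b sb)
              have b6: "barrier 1 (fF e2 e1 d2 d1 d0 s) a6"
                by (intro barrier_data_barrier \<nu>6(2) \<mu>6 eb d2b d1b d0b sb)
              have sp: "small_parameters e2 e1 d2 d1 d0 s"
                using e2le(1) e1le(1) d2le(2) d1le(2) d0(1) d0le sb(1) \<mu>(5) by (simp add: small_parameters_def)
              have s5: "\<bar>s\<bar> \<le> a5 \<theta>" for \<theta> using sb(1) \<mu>(4) m5(2)[of \<theta>] by linarith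
              have a6\<eta>: "a6 \<theta> < \<eta>" for \<theta> using a6(2) by blast
              show "\<exists>C. card C = 5 \<and> (\<forall>\<Gamma>\<in>C. \<Gamma> \<subseteq> U \<and> limit_cycle (pfield e2 e1 d2 d1 d0 s) \<Gamma>)"
                by (rule five_cycles[OF sp b1 b2 b3 b4 b5 s5 a56 b6 a6\<eta> \<eta>(2) r2 r3 r4 s(1) U])
            qed (use \<mu> \<nu>4 \<nu>3 \<nu>2 \<nu>1 in auto)
          qed (use \<mu> \<nu>4 \<nu>3 \<nu>2 in auto)
        qed (use \<mu> \<nu>4 \<nu>3 in auto)
      qed (use \<mu> \<nu>4 in auto)
    qed
  qed (use \<nu>6 in auto)
qed

end
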